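(* Let $h>0$ and let $q$ be a positive rational number. Then a stationary periodic Brownian motion on the interval $[0,qh]$ is finitarily isomorphic to a stationary periodic Brownian motion on $[0,h]$; moreover, the isomorphism also has a finitary inverse. That is, there is an isomorphism $\phi$ between the measure-preserving flows associated with these two processes such that both $\phi$ and $\phi^{-1}$ are finitary.
   Context: **Periodic Brownian motion.** Let $W=(W_s)_{s\in\mathbb{R}}$ be a (two-sided) Brownian motion with variance parameter $\sigma^2=1$, where $W_0$ is a real-valued random variable. For $L>0$, the periodic Brownian motion on $[0,L]$ is $Z_t:=W_t \bmod L$, where the points $0$ and $L$ are identified (so continuity of paths of $Z$ is understood with respect to this identification); stationary means that its law is invariant under time translations. **Associated flow.** Let $C(\mathbb{R},I)$ be the space of continuous functions from $\mathbb{R}$ to the interval $I=[0,L]$ (with endpoints identified), and let $T=(T_t)_{t\in\mathbb{R}}$ be the group of translations of $\mathbb{R}$, acting by $T_t(f)=f\circ T_{-t}$. The flow associated with a stationary periodic Brownian motion $Z$ on $I$ is $(C(\mathbb{R},I),\mathbb{P}(Z\in\cdot),T)$. **Factors and isomorphisms.** For measure-preserving flows $(K,\kappa,T)$ and $(K',\kappa',T')$, a (measurable) map $\phi:K\to K'$ is a factor if, on a set of full measure, $\phi\circ T_s=T'_s\circ\phi$ for all $s\in\mathbb{R}$, and $\kappa'=\kappa\circ\phi^{-1}$. If $\phi$ is injective (on a set of full measure), then $\phi^{-1}$ is a factor from $(K',\kappa',T')$ to $(K,\kappa,T)$ and $\phi$ is called an isomorphism. **Finitary.** A factor $\phi$ between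 two such path-space flows is finitary if there is a measurable function $w$ on the source space with values in $\mathbb{N}\cup\{\infty\}$, finite almost surely, such that $\phi(f)|_{(0,1)}=\phi(f')|_{(0,1)}$ whenever $f$ and $f'$ agree on $(-w(f),w(f))$ (i.e. have the same restriction to this interval). *)

theory Defs
  imports "HOL-Probability.Probability" "HOL-Library.Real_Mod"
begin

section \<open>Two-sided Brownian motion\<close>

text \<open>
  Variance parameter \<open>1\<close>, arbitrary initial law: \<open>W 0\<close> is a random variable
  independent of the process of increments. All sample paths are continuous.
\<close>

locale two_sided_brownian_motion = prob_space M for M :: "'a measure" +
  fixes W :: "real \<Rightarrow> 'a \<Rightarrow> real"
  assumes random_variable_W: "\<And>t. random_variable borel (W t)"
    and continuous_paths: "\<And>\<omega>. \<omega> \<in> space M \<Longrightarrow> continuous_on UNIV (\<lambda>t. W t \<omega>)"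
    and gaussian_increments: "\<And>s t. s < t \<Longrightarrow>
      distributed M lborel (\<lambda>\<omega>. W t \<omega> - W s \<omega>) (normal_density 0 (sqrt (t - s)))"
    and independent_increments: "\<And>(u :: nat \<Rightarrow> real) n. strict_mono u \<Longrightarrow>
      indep_vars (\<lambda>_. borel) (\<lambda>i \<omega>. W (u (Suc i)) \<omega> - W (u i) \<omega>) {..<n}"
    and independent_start: "indep_set
      (sets (vimage_algebra (space M) (W 0) borel))
      (sets (vimage_algebra (space M) (\<lambda>\<omega> t. W t \<omega> - W 0 \<omega>) (\<Pi>\<^sub>M t\<in>UNIV. borel)))"


section \<open>The interval with identified endpoints and its path space\<close>

text \<open>
  Points of \<open>[0, L]\<close> with \<open>0\<close> and \<open>L\<close> identified are represented by
  \<open>{0..<L}\<close>, so that \<open>\<lambda>x. x rmod L\<close> is the gluing map on \<open>{0..L}\<close>. The topology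
  is the quotient topology for this map.
\<close>

definition glued_interval :: "real \<Rightarrow> real topology" where
  "glued_interval L =
     topology (\<lambda>U. U \<subseteq> {0..<L} \<and> openin (top_of_set {0..L}) {x \<in> {0..L}. x rmod L \<in> U})"

lemma openin_glued_interval:
  "openin (glued_interval L) U \<longleftrightarrow>
     U \<subseteq> {0..<L} \<and> openin (top_of_set {0..L}) {x \<in> {0..L}. x rmod L \<in> U}"
proof -
  let ?P = "\<lambda>U. {x \<in> {0..L}. x rmod L \<in> U}"
  have "istopology (\<lambda>U. U \<subseteq> {0..<L} \<and> openin (top_of_set {0..L}) (?P U))"
    unfolding istopology_def
  proof (intro conjI allI impI)
    fix S T
    assume "S \<subseteq> {0..<L} \<and> openin (top_of_set {0..L}) (?P S)"
      and "T \<subseteq> {0..<L} \<and> openin (top_of_set {0..L}) (?P T)"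
    moreover have "?P (S \<inter> T) = ?P S \<inter> ?P T" by auto
    ultimately show "S \<inter> T \<subseteq> {0..<L}" "openin (top_of_set {0..L}) (?P (S \<inter> T))"
      by (auto simp del: Int_iff intro: openin_Int)
  next
    fix \<K>
    assume *: "\<forall>K\<in>\<K>. K \<subseteq> {0..<L} \<and> openin (top_of_set {0..L}) (?P K)"
    then show "\<Union>\<K> \<subseteq> {0..<L}" by auto
    have "?P (\<Union>\<K>) = (\<Union>K\<in>\<K>. ?P K)" by auto
    with * show "openin (top_of_set {0..L}) (?P (\<Union>\<K>))" by auto
  qed
  then show ?thesis by (simp add: glued_interval_def topology_inverse')
qed

lemma topspace_glued_interval:
  assumes "L > 0"
  shows "topspace (glued_interval L) = {0..<L}"
proof -
  have "{x \<in> {0..L}. x rmod L \<in> {0..<L}} = {0..L}"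
    using assms by (auto simp: rmod_less rmod_nonneg)
  then have "openin (glued_interval L) {0..<L}"
    by (simp add: openin_glued_interval)
  then show ?thesis
    by (metis openin_glued_interval openin_subset openin_topspace subset_antisym)
qed

definition circle_paths :: "real \<Rightarrow> (real \<Rightarrow> real) set" where
  "circle_paths L = {f. continuous_map euclideanreal (glued_interval L) f}"

text \<open>
  The \<open>\<sigma>\<close>-algebra on paths is generated by the evaluation maps; it is the Borel
  \<open>\<sigma>\<close>-algebra of uniform convergence on compact sets. Only the space and the measurable
  sets of \<open>path_algebra\<close> matter.
\<close>

definition path_algebra :: "real \<Rightarrow> (real \<Rightarrow> real) measure" where
  "path_algebra L = restrict_space (\<Pi>\<^sub>M t\<in>UNIV. borel) (circle_paths L)"

lemma space_path_algebra: "space (path_algebra L) = circle_paths L"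
  by (simp add: path_algebra_def space_restrict_space space_PiM)

lemma continuous_map_rmod:
  assumes "L > 0"
  shows "continuous_map euclideanreal (glued_interval L) (\<lambda>x. x rmod L)"
  unfolding continuous_map_def
proof (intro conjI allI impI)
  show "(\<lambda>x. x rmod L) \<in> topspace euclideanreal \<rightarrow> topspace (glued_interval L)"
    using assms by (auto simp: topspace_glued_interval rmod_less rmod_nonneg)
  fix U assume "openin (glued_interval L) U"
  then obtain V where V: "open V" "{x \<in> {0..L}. x rmod L \<in> U} = {0..L} \<inter> V"
    by (auto simp: openin_glued_interval openin_open)
  have shift: "(x + of_int k * L) rmod L = x rmod L" for x k
    using assms by (simp add: rmod_def add_divide_distrib algebra_simps)
  have memV: "y \<in> V \<longleftrightarrow> y rmod L \<in> U" if "0 \<le> y" "y \<le> L" for y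
  proof -
    have "y \<in> {x \<in> {0..L}. x rmod L \<in> U} \<longleftrightarrow> y \<in> {0..L} \<inter> V"
      by (simp only: V(2))
    with that show ?thesis by simp
  qed
  have "\<exists>e>0. \<forall>y. dist y x < e \<longrightarrow> y rmod L \<in> U" if x: "x rmod L \<in> U" for x
  proof -
    define r where "r = x rmod L"
    define k where "k = \<lfloor>x / L\<rfloor>"
    have xr: "x = r + of_int k * L"
      using assms by (simp add: r_def k_def rmod_def)
    have r: "0 \<le> r" "r < L" "r rmod L \<in> U"
      using assms x by (auto simp: r_def rmod_less rmod_nonneg)
    have "r \<in> V" using memV r by auto
    then obtain e1 where e1: "e1 > 0" "\<And>y. dist y r < e1 \<Longrightarrow> y \<in> V"
      using V(1) by (auto simp: open_dist)
    have "\<exists>e>0. \<forall>z. \<bar>z - r\<bar> < e \<longrightarrow> z rmod L \<in> U"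
    proof (cases "r = 0")
      case False
      show ?thesis
      proof (intro exI[of _ "min e1 (min r (L - r))"] conjI allI impI)
        show "0 < min e1 (min r (L - r))" using e1 r False by auto
        fix z assume "\<bar>z - r\<bar> < min e1 (min r (L - r))"
        then have "z \<in> V" "0 \<le> z" "z \<le> L" using e1(2)[of z] by (auto simp: dist_real_def)
        then show "z rmod L \<in> U" using memV by auto
      qed
    next
      case True
      have "L \<in> V" using memV[of L] r True assms by auto
      then obtain e2 where e2: "e2 > 0" "\<And>y. dist y L < e2 \<Longrightarrow> y \<in> V"
        using V(1) by (auto simp: open_dist)
      show ?thesis
      proof (intro exI[of _ "min L (min e1 e2)"] conjI allI impI)
        show "0 < min L (min e1 e2)" using e1 e2 assms by auto
        fix z assume z: "\<bar>z - r\<bar> < min L (min e1 e2)"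
        show "z rmod L \<in> U"
        proof (cases "z \<ge> 0")
          case True
          then have "z \<in> V" "z \<le> L" using z \<open>r = 0\<close> e1(2)[of z] by (auto simp: dist_real_def)
          then show ?thesis using memV[of z] True by simp
        next
          case False
          then have "z + L \<in> V" "0 \<le> z + L" "z + L \<le> L"
            using z \<open>r = 0\<close> e2(2)[of "z + L"] by (auto simp: dist_real_def)
          then have "(z + L) rmod L \<in> U" using memV by auto
          then show ?thesis using shift[of z 1] by simp
        qed
      qed
    qed
    then obtain e where e: "e > 0" "\<And>z. \<bar>z - r\<bar> < e \<Longrightarrow> z rmod L \<in> U" by auto
    have "y rmod L \<in> U" if "dist y x < e" for y
      using e(2)[of "y - of_int k * L"] shift[of "y - of_int k * L" k] that
      by (auto simp: xr dist_real_def algebra_simps)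
    with e(1) show ?thesis by auto
  qed
  then show "openin euclideanreal {x \<in> topspace euclideanreal. x rmod L \<in> U}"
    by (auto simp: open_dist)
qed

corollary rmod_in_circle_paths:
  assumes "L > 0" "continuous_on UNIV g"
  shows "(\<lambda>t. g t rmod L) \<in> circle_paths L"
  using continuous_map_compose[of euclideanreal euclideanreal g] assms continuous_map_rmod
  by (fastforce simp: circle_paths_def o_def)


section \<open>Stationary periodic Brownian motion and its flow\<close>

definition periodic_brownian_motion :: "'a measure \<Rightarrow> real \<Rightarrow> (real \<Rightarrow> 'a \<Rightarrow> real) \<Rightarrow> bool" where
  "periodic_brownian_motion M L Z \<longleftrightarrow> L > 0 \<and>
     (\<exists>W. two_sided_brownian_motion M W \<and> (\<forall>t. \<forall>\<omega>\<in>space M. Z t \<omega> = W t \<omega> rmod L))"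

definition path_law :: "'a measure \<Rightarrow> real \<Rightarrow> (real \<Rightarrow> 'a \<Rightarrow> real) \<Rightarrow> (real \<Rightarrow> real) measure" where
  "path_law M L Z = distr M (path_algebra L) (\<lambda>\<omega> t. Z t \<omega>)"

definition translate :: "real \<Rightarrow> (real \<Rightarrow> real) \<Rightarrow> (real \<Rightarrow> real)" where
  "translate s f = (\<lambda>t. f (t - s))"

definition stationary :: "'a measure \<Rightarrow> real \<Rightarrow> (real \<Rightarrow> 'a \<Rightarrow> real) \<Rightarrow> bool" where
  "stationary M L Z \<longleftrightarrow>
     (\<forall>s. distr (path_law M L Z) (path_algebra L) (translate s) = path_law M L Z)"

text \<open>\<open>distr\<close> is the null measure for non-measurable maps; this does not occur here.\<close>

lemma measurable_periodic_brownian_motion: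
  assumes "periodic_brownian_motion M L Z"
  shows "(\<lambda>\<omega> t. Z t \<omega>) \<in> M \<rightarrow>\<^sub>M path_algebra L"
proof -
  from assms obtain W where "L > 0" and W: "two_sided_brownian_motion M W"
    and Z: "\<And>t \<omega>. \<omega> \<in> space M \<Longrightarrow> Z t \<omega> = W t \<omega> rmod L"
    by (auto simp: periodic_brownian_motion_def)
  interpret two_sided_brownian_motion M W by (fact W)
  have [measurable]: "W t \<in> borel_measurable M" for t
    by (rule random_variable_W)
  have "(\<lambda>\<omega> t. W t \<omega> rmod L) \<in> M \<rightarrow>\<^sub>M path_algebra L"
    unfolding path_algebra_def
  proof (rule measurable_restrict_space2)
    show "(\<lambda>\<omega> t. W t \<omega> rmod L) \<in> space M \<rightarrow> circle_paths L"
      using rmod_in_circle_paths[OF \<open>L > 0\<close> continuous_paths] by auto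
    show "(\<lambda>\<omega> t. W t \<omega> rmod L) \<in> M \<rightarrow>\<^sub>M (\<Pi>\<^sub>M t\<in>UNIV. borel)"
      by (rule measurable_PiM_single') (auto simp: rmod_def space_PiM)
  qed
  then show ?thesis
    by (subst measurable_cong[where g = "\<lambda>\<omega> t. W t \<omega> rmod L"]) (auto simp: Z)
qed

lemma measurable_translate: "translate s \<in> path_algebra L \<rightarrow>\<^sub>M path_algebra L"
proof -
  have "translate s f \<in> circle_paths L" if "f \<in> circle_paths L" for f
  proof -
    have "continuous_map euclideanreal euclideanreal (\<lambda>t. t - s)"
      by (auto intro!: continuous_intros)
    from continuous_map_compose[OF this] that show ?thesis
      by (auto simp: circle_paths_def translate_def o_def)
  qed
  moreover have "translate s \<in> path_algebra L \<rightarrow>\<^sub>M (\<Pi>\<^sub>M t\<in>UNIV. borel)"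
    unfolding path_algebra_def translate_def
    by (rule measurable_restrict_space1, rule measurable_PiM_single') (auto simp: space_PiM)
  ultimately show ?thesis
    unfolding path_algebra_def
    by (intro measurable_restrict_space2) (auto simp: space_restrict_space space_PiM)
qed


section \<open>Factors, isomorphisms, finitary factors\<close>

definition flow_factor ::
  "'k measure \<Rightarrow> (real \<Rightarrow> 'k \<Rightarrow> 'k) \<Rightarrow> 'l measure \<Rightarrow> (real \<Rightarrow> 'l \<Rightarrow> 'l) \<Rightarrow> ('k \<Rightarrow> 'l) \<Rightarrow> bool" where
  "flow_factor \<kappa> T \<kappa>' T' \<phi> \<longleftrightarrow>
     \<phi> \<in> \<kappa> \<rightarrow>\<^sub>M \<kappa>' \<and>
     (AE x in \<kappa>. \<forall>s. \<phi> (T s x) = T' s (\<phi> x)) \<and>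
     distr \<kappa> \<kappa>' \<phi> = \<kappa>'"

definition flow_isomorphism ::
  "'k measure \<Rightarrow> (real \<Rightarrow> 'k \<Rightarrow> 'k) \<Rightarrow> 'l measure \<Rightarrow> (real \<Rightarrow> 'l \<Rightarrow> 'l) \<Rightarrow> ('k \<Rightarrow> 'l) \<Rightarrow> bool" where
  "flow_isomorphism \<kappa> T \<kappa>' T' \<phi> \<longleftrightarrow>
     flow_factor \<kappa> T \<kappa>' T' \<phi> \<and> (\<exists>X\<in>sets \<kappa>. (AE x in \<kappa>. x \<in> X) \<and> inj_on \<phi> X)"

text \<open>
  The inverse of an isomorphism is only defined up to null sets; \<open>\<psi>\<close> below is a version of it
  defined everywhere.
\<close>

definition ae_inverse :: "'k measure \<Rightarrow> 'l measure \<Rightarrow> ('k \<Rightarrow> 'l) \<Rightarrow> ('l \<Rightarrow> 'k) \<Rightarrow> bool" where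
  "ae_inverse \<kappa> \<kappa>' \<phi> \<psi> \<longleftrightarrow> (AE x in \<kappa>. \<psi> (\<phi> x) = x) \<and> (AE y in \<kappa>'. \<phi> (\<psi> y) = y)"

definition finitary_factor ::
  "(real \<Rightarrow> real) measure \<Rightarrow> (real \<Rightarrow> real) measure \<Rightarrow> ((real \<Rightarrow> real) \<Rightarrow> (real \<Rightarrow> real)) \<Rightarrow> bool" where
  "finitary_factor \<kappa> \<kappa>' \<phi> \<longleftrightarrow>
     flow_factor \<kappa> translate \<kappa>' translate \<phi> \<and>
     (\<exists>w :: (real \<Rightarrow> real) \<Rightarrow> enat.
        w \<in> \<kappa> \<rightarrow>\<^sub>M count_space UNIV \<and>
        (AE f in \<kappa>. w f \<noteq> \<infinity>) \<and>
        (\<forall>f\<in>space \<kappa>. \<forall>f'\<in>space \<kappa>.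
           (\<forall>t. ereal \<bar>t\<bar> < ereal_of_enat (w f) \<longrightarrow> f t = f' t) \<longrightarrow>
           (\<forall>t\<in>{0<..<1}. \<phi> f t = \<phi> f' t)))"

end

theory Submission
  imports Defs
begin

text \<open>
  Write the two lengths as \<open>2 a H\<close> and \<open>2 b H\<close> with natural numbers \<open>a\<close>, \<open>b\<close>. It suffices
  to identify the flow on a circle of length \<open>2 m H\<close> with the flow on the circle of length
  \<open>2 H\<close>, finitarily in both directions, and to pass from \<open>a\<close> to \<open>b\<close> through the short
  circle.

  Measure positions on the long circle in units of \<open>H\<close>, and call the times at which the
  path is at an integer vertex times. Between vertex times the path makes excursions from
  the last vertex; those that end at a different vertex are crossings, and they form the
  steps of a nearest neighbour walk \<open>p\<close> on the integers modulo \<open>2 m\<close>. The map \<open>fold_path\<close>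
  takes the path modulo \<open>2 H\<close> and reverses (\<open>x\<close> becomes \<open>- x\<close>) every crossing that starts
  at a vertex in the upper half \<open>{m, \<dots>, 2 m - 1}\<close>. All vertices are fixed points of
  this reflection of the short circle, so the result is continuous.

  Reversing a single excursion preserves the law of Brownian motion on the short circle by
  the reflection principle (\<open>preserves_flip_excursion\<close>), and whether an excursion is
  reversed depends only on its starting vertex and on whether it crosses, which the
  reversal itself does not affect. Treating the excursions met by a finite grid one at a
  time, from the last to the first, and passing to the limit gives \<open>law_fold_path\<close>: the
  folded path is again a stationary Brownian motion.

  Let \<open>y\<close> be the image of \<open>p\<close> under the identification of \<open>r\<close> with \<open>2 m - 1 - r\<close>. With the
  reversed steps, \<open>y\<close> is a walk on \<open>{0, \<dots>, m - 1}\<close> that follows the steps of the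
  folded path but stays put when it would leave this range. Clamped walks of this kind
  forget where they started: once the driving walk has covered a range of \<open>m\<close>, all of them
  agree. So the past of the folded path determines \<open>y\<close> (\<open>coupled_level\<close>), the parity of
  the vertex then distinguishes the two preimages of \<open>y\<close>, and the signs can be restored
  (\<open>decode_coupled\<close>). This is the map \<open>unfold_path\<close>. Its law and the identity in the other
  order follow from the law of the folded path.

  To fold on the unit interval one needs the vertex times next to it, which suffices
  because the path on the circle determines the vertices modulo \<open>2 m\<close>. To unfold one needs
  moreover a stretch of the past of range \<open>m\<close>. Both are found within an almost surely
  finite distance, since Brownian motion has unbounded oscillation at both ends of time
  (\<open>AE_wild\<close>). A composition is again finitary because only finitely many unit intervals
  of the intermediate path are needed (\<open>window_code_comp\<close>).

  All this takes place under the law of a loop with uniform start. A stationary periodic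
  Brownian motion has this law (\<open>stationary_path_law\<close>) whatever the law of \<open>W 0\<close> on the
  line is: Gaussian smoothing makes the law of the position almost translation invariant,
  and stationarity makes it invariant.
\<close>

section \<open>The circle and its continuous paths\<close>

text \<open>
  Parametrises the circle of length \<open>L\<close> inside the complex plane. The glued interval
  carries a quotient topology on representatives; composing with this homeomorphism turns
  continuity of circle paths into ordinary continuity.
\<close>

definition circ :: "real \<Rightarrow> real \<Rightarrow> complex" where
  "circ L x = cis (2 * pi * x / L)"

lemma circ_eq_iff:
  assumes "L > 0"
  shows "circ L x = circ L y \<longleftrightarrow> [x = y] (rmod L)"
proof -
  have "[2 * pi * x / L = 2 * pi * y / L] (rmod (2 * pi)) \<longleftrightarrow> [x = y] (rmod L)"
  proof
    assume "[2 * pi * x / L = 2 * pi * y / L] (rmod (2 * pi))"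
    then obtain n :: int where "2 * pi * y / L = 2 * pi * x / L + of_int n * (2 * pi)"
      by (auto simp: rcong_altdef)
    then have "2 * pi * y = 2 * pi * (x + of_int n * L)"
      using assms by (simp add: field_simps)
    then have "y = x + of_int n * L"
      by (simp only: mult_cancel_left) simp
    then show "[x = y] (rmod L)"
      unfolding rcong_altdef by blast
  next
    assume "[x = y] (rmod L)"
    then obtain n :: int where "y = x + of_int n * L"
      by (auto simp: rcong_altdef)
    then have "2 * pi * y / L = 2 * pi * x / L + of_int n * (2 * pi)"
      using assms by (simp add: field_simps)
    then show "[2 * pi * x / L = 2 * pi * y / L] (rmod (2 * pi))"
      unfolding rcong_altdef by blast
  qed
  then show ?thesis
    by (simp add: circ_def cis_eq_iff)
qed

lemma circ_rmod [simp]: "L > 0 \<Longrightarrow> circ L (x rmod L) = circ L x"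
  by (simp add: circ_eq_iff)

lemma circ_add: "circ L (x + y) = circ L x * circ L y"
  by (simp add: circ_def cis_mult add_divide_distrib distrib_left)

lemma circ_minus: "circ L (- x) = cnj (circ L x)"
  by (simp add: circ_def cis_cnj)

lemma norm_circ [simp]: "norm (circ L x) = 1"
  by (simp add: circ_def)

lemma continuous_on_circ [continuous_intros]:
  "continuous_on S f \<Longrightarrow> continuous_on S (\<lambda>t. circ L (f t))"
  unfolding circ_def cis_conv_exp divide_inverse by (intro continuous_intros)

lemma isCont_circ: "isCont (circ L) x"
  using continuous_on_circ[OF continuous_on_id, of UNIV L]
  by (simp add: continuous_on_eq_continuous_at)

lemma borel_measurable_circ [measurable]: "circ L \<in> borel_measurable borel"
  by (intro borel_measurable_continuous_onI continuous_on_circ continuous_on_id)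

lemma rmod_mem_iff: "L > 0 \<Longrightarrow> x = y rmod L \<longleftrightarrow> 0 \<le> x \<and> x < L \<and> [x = y] (rmod L)"
  by (auto simp: rcong_def rmod_nonneg rmod_less)

lemma rmod_cong_eq: "[x = y] (rmod L) \<Longrightarrow> x rmod L = y rmod L"
  by (simp add: rcong_def)

lemma borel_measurable_rmod [measurable]: "(\<lambda>x. x rmod L) \<in> borel_measurable borel"
  unfolding rmod_def by measurable

text \<open>
  By the definition of the quotient topology, only continuity on the unglued interval and
  equal values at its two endpoints matter.
\<close>

lemma circ_continuous_map_glued:
  assumes "L > 0"
  shows "continuous_map (glued_interval L) euclidean (circ L)"
  unfolding continuous_map_def
proof (intro conjI allI impI)
  fix V :: "complex set" assume "openin euclidean V"
  then have V: "open V" by simp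
  let ?U = "{x \<in> {0..<L}. circ L x \<in> V}"
  have "{x \<in> {0..L}. x rmod L \<in> ?U} = {0..L} \<inter> circ L -` V"
    using assms by (auto simp: rmod_less rmod_nonneg)
  moreover have "open (circ L -` V)"
    using V continuous_on_circ[OF continuous_on_id] by (metis open_vimage)
  ultimately have "openin (glued_interval L) ?U"
    by (auto simp: openin_glued_interval)
  then show "openin (glued_interval L) {x \<in> topspace (glued_interval L). circ L x \<in> V}"
    using assms by (simp add: topspace_glued_interval)
qed simp

lemma circle_path_imp:
  assumes "L > 0" "f \<in> circle_paths L"
  shows "0 \<le> f t" "f t < L" "continuous_on UNIV (\<lambda>t. circ L (f t))"
proof -
  have f: "continuous_map euclideanreal (glued_interval L) f"
    using assms by (simp add: circle_paths_def)
  then have "f t \<in> topspace (glued_interval L)"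
    by (auto simp: continuous_map_def)
  then show "0 \<le> f t" "f t < L"
    using assms by (auto simp: topspace_glued_interval)
  show "continuous_on UNIV (\<lambda>t. circ L (f t))"
    using continuous_map_compose[OF f circ_continuous_map_glued[OF assms(1)]]
    by (simp add: o_def)
qed

text \<open>
  Paths on the circle are handled through their lifts to the line, which exist because a
  nowhere vanishing continuous function on the line has a continuous logarithm.
\<close>

lemma circle_path_liftable:
  fixes f :: "real \<Rightarrow> real"
  assumes "L > 0" "\<And>t. 0 \<le> f t" "\<And>t. f t < L" "continuous_on UNIV (\<lambda>t. circ L (f t))"
  obtains g where "continuous_on UNIV g" "g 0 = f 0" "\<And>t. f t = g t rmod L"
proof -
  have "contractible (UNIV :: real set)"
    by (simp add: convex_imp_contractible)
  then obtain h where h: "continuous_on UNIV h" "\<And>t. circ L (f t) = exp (h t)"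
    using continuous_logarithm_on_contractible[of UNIV "\<lambda>t. circ L (f t)"] assms(4)
    by (auto simp: circ_def)
  define g0 where "g0 t = Im (h t) * L / (2 * pi)" for t
  have "Re (h t) = 0" for t
    using arg_cong[OF h(2)[of t], of norm] by simp
  then have "exp (h t) = circ L (g0 t)" for t
    using assms(1) by (simp add: circ_def g0_def exp_eq_polar)
  then have *: "[f t = g0 t] (rmod L)" for t
    using h(2)[of t] assms(1) by (simp add: circ_eq_iff)
  obtain n :: int where n: "g0 0 = f 0 + of_int n * L"
    using *[of 0] by (auto simp: rcong_altdef)
  define g where "g t = g0 t - of_int n * L" for t
  have "[f t = g t] (rmod L)" for t
    using rcong_diff[OF *[of t], of "0" "of_int n * L"]
    by (simp add: g_def rcong_mult_of_int_0_left_left)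
  then have "f t = g t rmod L" for t
    using assms by (simp add: rmod_mem_iff)
  moreover have "continuous_on UNIV g"
    unfolding g_def g0_def using h(1) by (intro continuous_intros) auto
  moreover have "g 0 = f 0"
    by (simp add: g_def n)
  ultimately show ?thesis
    using that by blast
qed

lemma circle_paths_iff:
  assumes "L > 0"
  shows "f \<in> circle_paths L \<longleftrightarrow>
    (\<forall>t. 0 \<le> f t \<and> f t < L) \<and> continuous_on UNIV (\<lambda>t. circ L (f t))"
proof
  assume "f \<in> circle_paths L"
  then show "(\<forall>t. 0 \<le> f t \<and> f t < L) \<and> continuous_on UNIV (\<lambda>t. circ L (f t))"
    using circle_path_imp[OF assms] by blast
next
  assume "(\<forall>t. 0 \<le> f t \<and> f t < L) \<and> continuous_on UNIV (\<lambda>t. circ L (f t))"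
  then obtain g where g: "continuous_on UNIV g" "\<And>t. f t = g t rmod L"
    using circle_path_liftable[OF assms, of f] by blast
  from g(2) have "f = (\<lambda>t. g t rmod L)" by (simp add: fun_eq_iff)
  then show "f \<in> circle_paths L"
    using rmod_in_circle_paths[OF assms g(1)] by (simp only:)
qed

text \<open>
  The difference of two lifts is continuous and takes values in a discrete set. The
  interval is arbitrary because lifts are also compared on bounded windows of time, where
  two paths happen to agree.
\<close>

lemma lifts_differ_by_constant:
  fixes g h :: "real \<Rightarrow> real"
  assumes L: "L > 0" and S: "connected S" and g: "continuous_on S g" and h: "continuous_on S h"
    and *: "\<And>t. t \<in> S \<Longrightarrow> [g t = h t] (rmod L)"
  shows "\<exists>n::int. \<forall>t\<in>S. g t = h t + of_int n * L"
proof -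
  define d where "d t = (g t - h t) / L" for t
  have d: "d t \<in> \<int>" if "t \<in> S" for t
  proof -
    from *[OF that] obtain n :: int where "h t = g t + of_int n * L"
      by (auto simp: rcong_altdef)
    then have "d t = of_int (- n)"
      using L by (simp add: d_def)
    then show ?thesis by (metis Ints_of_int)
  qed
  have "continuous_on S d"
    unfolding d_def using g h L by (intro continuous_intros) auto
  then have "d constant_on S"
  proof (rule continuous_discrete_range_constant[OF S])
    fix t assume t: "t \<in> S"
    show "\<exists>e>0. \<forall>y. y \<in> S \<and> d y \<noteq> d t \<longrightarrow> e \<le> norm (d y - d t)"
    proof (intro exI[of _ 1] conjI allI impI)
      fix y assume "y \<in> S \<and> d y \<noteq> d t"
      moreover from this have "d y - d t \<in> \<int>" using d t by auto
      ultimately show "1 \<le> norm (d y - d t)"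
        using Ints_nonzero_abs_ge1[of "d y - d t"] by simp
    qed simp
  qed
  then have c: "d x = d y" if "x \<in> S" "y \<in> S" for x y
    using that unfolding constant_on_def by metis
  show ?thesis
  proof (cases "S = {}")
    case True
    then show ?thesis by blast
  next
    case False
    then obtain s where s: "s \<in> S" by blast
    then obtain n :: int where n: "d s = of_int n" using d by (blast elim: Ints_cases)
    have "g t = h t + of_int n * L" if "t \<in> S" for t
    proof -
      have "(g t - h t) / L = of_int n" using c[OF that s] n by (simp only: d_def)
      then show ?thesis using L by (simp add: field_simps)
    qed
    then show ?thesis by blast
  qed
qed

text \<open>
  The lift is normalised by its value at time \<open>0\<close>. It therefore does not commute with
  translations, but only up to a multiple of \<open>L\<close>; every quantity derived from it below is
  invariant under such shifts.
\<close>

definition lift :: "real \<Rightarrow> (real \<Rightarrow> real) \<Rightarrow> real \<Rightarrow> real" where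
  "lift L f = (SOME g. continuous_on UNIV g \<and> g 0 = f 0 \<and> (\<forall>t. f t = g t rmod L))"

lemma
  assumes "L > 0" "f \<in> circle_paths L"
  shows continuous_lift: "continuous_on UNIV (lift L f)"
    and lift_0: "lift L f 0 = f 0"
    and lift_rmod: "lift L f t rmod L = f t"
proof -
  have "\<exists>g. continuous_on UNIV g \<and> g 0 = f 0 \<and> (\<forall>t. f t = g t rmod L)"
    using circle_path_liftable[OF assms(1) circle_path_imp[OF assms]] by blast
  note * = someI_ex[OF this, folded lift_def]
  show "continuous_on UNIV (lift L f)" "lift L f 0 = f 0"
    using * by blast+
  show "lift L f t rmod L = f t"
    using * by (intro sym[of "f t"]) blast
qed

lemma lift_unique:
  assumes "L > 0" "continuous_on UNIV g" "\<And>t. f t = g t rmod L" "g 0 = f 0"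
  shows "lift L f = g"
proof -
  have f: "f \<in> circle_paths L"
  proof -
    from assms(3) have "f = (\<lambda>t. g t rmod L)" by (simp add: fun_eq_iff)
    then show ?thesis
      using rmod_in_circle_paths[OF assms(1,2)] by (simp only:)
  qed
  have "[lift L f t = g t] (rmod L)" for t
    using lift_rmod[OF assms(1) f] assms(3) by (simp add: rcong_def)
  from lifts_differ_by_constant[OF assms(1) connected_UNIV continuous_lift[OF assms(1) f] assms(2) this]
  obtain n :: int where n: "\<And>t. lift L f t = g t + of_int n * L"
    by blast
  then have "of_int n * L = 0"
    using lift_0[OF assms(1) f] assms(4) n[of 0] by simp
  then show ?thesis
    using n by (auto simp: fun_eq_iff)
qed

lemma lift_rmod_path:
  assumes "L > 0" "continuous_on UNIV g"
  obtains n :: int where "\<And>t. lift L (\<lambda>t. g t rmod L) t = g t + of_int n * L"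
proof -
  let ?f = "\<lambda>t. g t rmod L"
  have f: "?f \<in> circle_paths L"
    using rmod_in_circle_paths[OF assms] .
  have "[lift L ?f t = g t] (rmod L)" for t
    using lift_rmod[OF assms(1) f] by (simp add: rcong_def)
  from lifts_differ_by_constant[OF assms(1) connected_UNIV continuous_lift[OF assms(1) f] assms(2) this]
  show ?thesis using that by blast
qed

lemma eq_on_Rats_imp_eq:
  assumes "L > 0" "f \<in> circle_paths L" "f' \<in> circle_paths L" "\<And>q. q \<in> \<rat> \<Longrightarrow> f q = f' q"
  shows "f = f'"
proof
  fix t
  have cl: "closed {t. circ L (f t) = circ L (f' t)}"
    using circle_path_imp(3) assms(1-3) by (intro closed_Collect_eq) auto
  have "closure \<rat> \<subseteq> {t. circ L (f t) = circ L (f' t)}"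
    using assms(4) by (intro closure_minimal[OF _ cl]) auto
  then have "circ L (f t) = circ L (f' t)"
    by (auto simp: Rats_closure_real)
  then have "[f t = f' t] (rmod L)"
    using assms(1) by (simp add: circ_eq_iff)
  then show "f t = f' t"
    using circle_path_imp(1,2)[OF assms(1,2), of t] circle_path_imp(1,2)[OF assms(1,3), of t]
    by (simp add: rcong_def)
qed

section \<open>Measurability on path space\<close>

lemma measurable_path_eval: "(\<lambda>f. f t) \<in> borel_measurable (path_algebra L)"
  unfolding path_algebra_def by (intro measurable_restrict_space1 measurable_component_singleton) simp

lemma measurable_path_algebraI:
  assumes "\<And>x. x \<in> space N \<Longrightarrow> F x \<in> circle_paths L"
    and "\<And>t. (\<lambda>x. F x t) \<in> borel_measurable N"
  shows "F \<in> N \<rightarrow>\<^sub>M path_algebra L"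
  unfolding path_algebra_def
proof (rule measurable_restrict_space2)
  show "F \<in> space N \<rightarrow> circle_paths L" using assms(1) by auto
  show "F \<in> N \<rightarrow>\<^sub>M (\<Pi>\<^sub>M t\<in>UNIV. borel)"
    using assms(2) by (intro measurable_PiM_single') (auto simp: space_PiM)
qed

lemma measurable_path_apply:
  assumes "F \<in> N \<rightarrow>\<^sub>M path_algebra L"
  shows "(\<lambda>x. F x t) \<in> borel_measurable N"
  using measurable_compose[OF assms measurable_path_eval] .

lemma measurable_path_space:
  assumes "F \<in> N \<rightarrow>\<^sub>M path_algebra L" "x \<in> space N"
  shows "F x \<in> circle_paths L"
  using measurable_space[OF assms] by (simp add: space_path_algebra)

lemma sets_path_eq:
  assumes "L > 0" "F \<in> N \<rightarrow>\<^sub>M path_algebra L" "G \<in> N \<rightarrow>\<^sub>M path_algebra L"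
  shows "{x \<in> space N. F x = G x} \<in> sets N"
proof -
  have [measurable]: "(\<lambda>x. F x t) \<in> borel_measurable N" "(\<lambda>x. G x t) \<in> borel_measurable N" for t
    using measurable_path_apply assms by auto
  have "{x \<in> space N. F x = G x} = {x \<in> space N. \<forall>q\<in>\<rat>. F x q = G x q}"
  proof (intro Collect_cong conj_cong refl)
    fix x assume "x \<in> space N"
    then show "F x = G x \<longleftrightarrow> (\<forall>q\<in>\<rat>. F x q = G x q)"
      using eq_on_Rats_imp_eq[OF assms(1) measurable_path_space[OF assms(2)]
        measurable_path_space[OF assms(3)], of x x] by metis
  qed
  also have "\<dots> \<in> sets N"
    using countable_rat by measurable
  finally show ?thesis .
qed

text \<open>
  Cylinder sets are closed under intersection and generate the path algebra.
\<close>

lemma path_measure_eqI: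
  assumes "sets \<mu> = sets (path_algebra L)" "sets \<nu> = sets (path_algebra L)" "finite_measure \<mu>"
    and eq: "\<And>(A :: real \<Rightarrow> real set) J. finite J \<Longrightarrow> (\<And>i. A i \<in> sets borel) \<Longrightarrow>
      emeasure \<mu> {f \<in> circle_paths L. \<forall>j\<in>J. f j \<in> A j} =
      emeasure \<nu> {f \<in> circle_paths L. \<forall>j\<in>J. f j \<in> A j}"
  shows "\<mu> = \<nu>"
proof -
  let ?P = "\<Pi>\<^sub>M t\<in>(UNIV :: real set). (borel :: real measure)"
  have sp: "space \<mu> = circle_paths L" "space \<nu> = circle_paths L"
    using sets_eq_imp_space_eq[OF assms(1)] sets_eq_imp_space_eq[OF assms(2)]
    by (auto simp: space_path_algebra)
  have id: "id \<in> path_algebra L \<rightarrow>\<^sub>M ?P"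
    unfolding path_algebra_def by (intro measurable_restrict_space1 measurable_ident)
  have [measurable]: "id \<in> \<mu> \<rightarrow>\<^sub>M ?P" "id \<in> \<nu> \<rightarrow>\<^sub>M ?P"
    using id measurable_cong_sets[OF assms(1) refl] measurable_cong_sets[OF assms(2) refl] by auto
  interpret finite_measure \<mu> by fact
  have "distr \<mu> ?P id = distr \<nu> ?P id"
  proof (rule measure_eqI_PiM_infinite)
    show "finite_measure (distr \<mu> ?P id)"
      by (rule finite_measure_distr) simp
    fix A :: "real \<Rightarrow> real set" and J :: "real set"
    assume J: "finite J" "J \<subseteq> UNIV" "\<And>i. i \<in> J \<Longrightarrow> A i \<in> sets borel"
    define A' where "A' i = (if i \<in> J then A i else UNIV)" for i
    let ?X = "prod_emb UNIV (\<lambda>_. borel) J (Pi\<^sub>E J A)"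
    have X: "?X \<in> sets ?P"
      using J by (intro sets_PiM_I) auto
    have "?X \<inter> circle_paths L = {f \<in> circle_paths L. \<forall>j\<in>J. f j \<in> A' j}"
      by (auto simp: prod_emb_def space_PiM A'_def PiE_iff)
    moreover have "emeasure \<mu> {f \<in> circle_paths L. \<forall>j\<in>J. f j \<in> A' j} =
        emeasure \<nu> {f \<in> circle_paths L. \<forall>j\<in>J. f j \<in> A' j}"
      using J by (intro eq) (auto simp: A'_def)
    ultimately show "emeasure (distr \<mu> ?P id) ?X = emeasure (distr \<nu> ?P id) ?X"
      using X by (simp add: emeasure_distr sp)
  qed auto
  then have eqd: "emeasure (distr \<mu> ?P id) X = emeasure (distr \<nu> ?P id) X" for X
    by simp
  show ?thesis
  proof (rule measure_eqI)
    fix X assume "X \<in> sets \<mu>"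
    then obtain Y where Y: "Y \<in> sets ?P" "X = Y \<inter> circle_paths L"
      unfolding assms(1) path_algebra_def by (auto simp: sets_restrict_space)
    then show "emeasure \<mu> X = emeasure \<nu> X"
      using eqd[of Y] by (simp add: emeasure_distr sp)
  qed (simp add: assms)
qed

text \<open>
  The winding of a path is the limit of sums of its small increments, each taken to lie in
  \<open>[- L / 2, L / 2]\<close>; this makes the lift measurable.
\<close>

lemma borel_measurable_lift:
  assumes L: "L > 0"
  shows "(\<lambda>f. lift L f t) \<in> borel_measurable (path_algebra L)"
proof -
  define wrap where "wrap x = x - L * of_int \<lfloor>x / L + 1 / 2\<rfloor>" for x
  have [measurable]: "wrap \<in> borel_measurable borel"
    unfolding wrap_def by measurable
  have wrap: "wrap y = x" if xy: "[x = y] (rmod L)" "\<bar>x\<bar> < L / 2" for x y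
  proof -
    obtain n :: int where n: "y = x + of_int n * L" using xy(1) by (auto simp: rcong_altdef)
    have "\<lfloor>y / L + 1 / 2\<rfloor> = n"
      using xy(2) L by (intro floor_unique) (auto simp: n field_simps)
    then show ?thesis by (simp add: wrap_def n)
  qed
  define S where "S n f = f 0 + (\<Sum>k<n. wrap (f (t * (k + 1) / n) - f (t * k / n)))" for n :: nat and f
  have [measurable]: "S n \<in> borel_measurable (path_algebra L)" for n
    unfolding S_def using measurable_path_eval[measurable] by measurable
  show ?thesis
  proof (rule borel_measurable_LIMSEQ_real)
    fix f assume "f \<in> space (path_algebra L)"
    then have f: "f \<in> circle_paths L" by (simp add: space_path_algebra)
    let ?g = "lift L f"
    have "uniformly_continuous_on {- \<bar>t\<bar>..\<bar>t\<bar>} ?g"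
      using continuous_lift[OF L f]
      by (intro compact_uniformly_continuous) (auto intro: continuous_on_subset)
    then obtain d where d: "d > 0"
      "\<And>x y. x \<in> {- \<bar>t\<bar>..\<bar>t\<bar>} \<Longrightarrow> y \<in> {- \<bar>t\<bar>..\<bar>t\<bar>} \<Longrightarrow> \<bar>x - y\<bar> < d \<Longrightarrow> \<bar>?g x - ?g y\<bar> < L / 2"
      using L unfolding uniformly_continuous_on_def dist_real_def by (metis half_gt_zero)
    obtain N :: nat where N: "\<bar>t\<bar> / d < N"
      using reals_Archimedean2 by blast
    have "S n f = ?g t" if "n > N" for n
    proof -
      have n: "n > 0" "\<bar>t\<bar> / d < n" using that N by auto
      have *: "wrap (f (t * (k + 1) / n) - f (t * k / n)) = ?g (t * (k + 1) / n) - ?g (t * k / n)"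
        if k: "k < n" for k :: nat
      proof (rule wrap)
        show "[?g (t * (k + 1) / n) - ?g (t * k / n) = f (t * (k + 1) / n) - f (t * k / n)] (rmod L)"
          by (intro rcong_diff) (simp_all add: rcong_def flip: lift_rmod[OF L f])
        have i: "t * x / n \<in> {- \<bar>t\<bar>..\<bar>t\<bar>}" if "0 \<le> x" "x \<le> n" for x
        proof -
          have "\<bar>t * x / n\<bar> = \<bar>t\<bar> * (x / n)" using that by (simp add: abs_mult)
          also have "\<dots> \<le> \<bar>t\<bar> * 1" using that n by (intro mult_left_mono) (auto simp: field_simps)
          finally show ?thesis by (simp only: atLeastAtMost_iff) linarith
        qed
        have "\<bar>t * (k + 1) / n - t * k / n\<bar> = \<bar>t\<bar> / n"
          using n by (simp add: field_simps flip: diff_divide_distrib)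
        also have "\<dots> < d" using n d(1) by (simp add: field_simps)
        finally show "\<bar>?g (t * (k + 1) / n) - ?g (t * k / n)\<bar> < L / 2"
          using k by (intro d(2) i) auto
      qed
      have "(\<Sum>k<n. wrap (f (t * (k + 1) / n) - f (t * k / n)))
          = (\<Sum>k<n. ?g (t * Suc k / n) - ?g (t * k / n))"
        by (intro sum.cong refl) (use * in \<open>simp add: add.commute\<close>)
      also have "\<dots> = ?g t - ?g 0"
        using n by (subst sum_lessThan_telescope) simp
      finally show ?thesis by (simp add: S_def lift_0[OF L f])
    qed
    then show "(\<lambda>n. S n f) \<longlonglongrightarrow> ?g t"
      by (intro tendsto_eventually) (auto simp: eventually_sequentially intro!: exI[of _ "Suc N"])
  qed simp
qed

section \<open>Lattice crossings of a continuous function\<close>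

text \<open>
  \<open>before g t a b\<close> compares the last visits up to time \<open>t\<close>: the one to \<open>a\<close> came after the
  one to \<open>b\<close>. Expressing everything through such comparisons keeps the crossing data local
  and measurable.
\<close>

definition before :: "(real \<Rightarrow> real) \<Rightarrow> real \<Rightarrow> real \<Rightarrow> real \<Rightarrow> bool" where
  "before g t a b \<longleftrightarrow> (\<exists>v\<le>t. g v = a \<and> (\<forall>w\<in>{v..t}. g w \<noteq> b))"

definition after :: "(real \<Rightarrow> real) \<Rightarrow> real \<Rightarrow> real \<Rightarrow> real \<Rightarrow> bool" where
  "after g t a b \<longleftrightarrow> (\<exists>v\<ge>t. g v = a \<and> (\<forall>w\<in>{t..v}. g w \<noteq> b))"

text \<open>
  The last integer visited up to time \<open>t\<close>. A continuous path reaches a non-integer value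
  from one of the two neighbouring integers. A path that never visited an integer gets the
  value \<open>\<lfloor>g t\<rfloor> + 1\<close>, an arbitrary choice.
\<close>

definition vtx :: "(real \<Rightarrow> real) \<Rightarrow> real \<Rightarrow> int" where
  "vtx g t = (if before g t (of_int \<lfloor>g t\<rfloor>) (of_int (\<lfloor>g t\<rfloor> + 1)) then \<lfloor>g t\<rfloor> else \<lfloor>g t\<rfloor> + 1)"

text \<open>
  The current excursion from the vertex \<open>vtx g t\<close> will end at another integer, so it is a
  step of the walk on the integers and not a return. This looks into the future, but only
  up to the next vertex time.
\<close>

definition crs :: "(real \<Rightarrow> real) \<Rightarrow> real \<Rightarrow> bool" where
  "crs g t \<longleftrightarrow> (if vtx g t = \<lfloor>g t\<rfloor> then after g t (of_int (\<lfloor>g t\<rfloor> + 1)) (of_int \<lfloor>g t\<rfloor>)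
     else after g t (of_int \<lfloor>g t\<rfloor>) (of_int (\<lfloor>g t\<rfloor> + 1)))"

lemma before_cong:
  assumes "s \<le> t" "\<And>w. s < w \<Longrightarrow> w \<le> t \<Longrightarrow> g w \<noteq> a \<and> g w \<noteq> b"
  shows "before g t a b \<longleftrightarrow> before g s a b"
proof
  assume "before g t a b"
  then obtain v where v: "v \<le> t" "g v = a" "\<forall>w\<in>{v..t}. g w \<noteq> b"
    by (auto simp: before_def)
  then have "v \<le> s" using assms(2)[of v] by force
  then show "before g s a b"
    using v assms(1) by (auto simp: before_def intro!: exI[of _ v])
next
  assume "before g s a b"
  then obtain v where v: "v \<le> s" "g v = a" "\<forall>w\<in>{v..s}. g w \<noteq> b"
    by (auto simp: before_def)
  then have "\<forall>w\<in>{v..t}. g w \<noteq> b" using assms(2) by (metis atLeastAtMost_iff not_le)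
  then show "before g t a b"
    using v assms(1) by (auto simp: before_def intro!: exI[of _ v])
qed

lemma after_eq_before: "after g t a b \<longleftrightarrow> before (\<lambda>x. g (- x)) (- t) a b"
proof
  assume "after g t a b"
  then obtain v where v: "v \<ge> t" "g v = a" "\<forall>w\<in>{t..v}. g w \<noteq> b"
    by (auto simp: after_def)
  then show "before (\<lambda>x. g (- x)) (- t) a b"
    unfolding before_def by (intro exI[of _ "- v"]) auto
next
  assume "before (\<lambda>x. g (- x)) (- t) a b"
  then obtain v where v: "v \<le> - t" "g (- v) = a" "\<forall>w\<in>{v..- t}. g (- w) \<noteq> b"
    by (auto simp: before_def)
  have "g w \<noteq> b" if "w \<in> {t..- v}" for w
    using v(3)[rule_format, of "- w"] that by auto
  then show "after g t a b"
    using v unfolding after_def by (intro exI[of _ "- v"]) auto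
qed

lemma after_cong:
  assumes "s \<le> t" "\<And>w. s \<le> w \<Longrightarrow> w < t \<Longrightarrow> g w \<noteq> a \<and> g w \<noteq> b"
  shows "after g s a b \<longleftrightarrow> after g t a b"
  unfolding after_eq_before
  by (rule before_cong) (use assms in auto)

lemma cont_sub: "continuous_on UNIV g \<Longrightarrow> continuous_on S g"
  using continuous_on_subset by blast

lemma IVT_up:
  fixes g :: "real \<Rightarrow> real"
  assumes "continuous_on UNIV g" "s \<le> t" "g s \<le> c" "c \<le> g t"
  shows "\<exists>w. s \<le> w \<and> w \<le> t \<and> g w = c"
  using IVT'[OF assms(3,4,2) cont_sub[OF assms(1)]] by blast

lemma IVT_down:
  fixes g :: "real \<Rightarrow> real"
  assumes "continuous_on UNIV g" "s \<le> t" "g t \<le> c" "c \<le> g s"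
  shows "\<exists>w. s \<le> w \<and> w \<le> t \<and> g w = c"
  using IVT2'[OF assms(3,4,2) cont_sub[OF assms(1)]] by blast

lemma floor_const_between_ints:
  fixes g :: "real \<Rightarrow> real"
  assumes g: "continuous_on UNIV g" and st: "s \<le> t" and w: "\<And>w. s \<le> w \<Longrightarrow> w \<le> t \<Longrightarrow> g w \<notin> \<int>"
  shows "\<lfloor>g s\<rfloor> = \<lfloor>g t\<rfloor>"
proof (rule ccontr)
  assume "\<lfloor>g s\<rfloor> \<noteq> \<lfloor>g t\<rfloor>"
  then consider "g s \<le> \<lfloor>g t\<rfloor>" "\<lfloor>g t\<rfloor> \<le> g t" | "g t \<le> \<lfloor>g s\<rfloor>" "\<lfloor>g s\<rfloor> \<le> g s"
    by linarith
  then show False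
    using IVT_up[OF g st, of "\<lfloor>g t\<rfloor>"] IVT_down[OF g st, of "\<lfloor>g s\<rfloor>"] w
    by cases (metis Ints_of_int)+
qed

text \<open>
  Along an excursion no comparison of last or next visits to neighbouring integers can
  change.
\<close>

lemma excursion_const:
  fixes g :: "real \<Rightarrow> real"
  assumes g: "continuous_on UNIV g" and st: "s \<le> t" and w: "\<And>w. s \<le> w \<Longrightarrow> w \<le> t \<Longrightarrow> g w \<notin> \<int>"
  shows "vtx g s = vtx g t" "crs g s = crs g t"
proof -
  note fl = floor_const_between_ints[OF g st w]
  have ne: "g w \<noteq> of_int n" if "s \<le> w" "w \<le> t" for w n
    using w[OF that] by (metis Ints_of_int)
  have "before g t (of_int a) (of_int b) = before g s (of_int a) (of_int b)" for a b
    by (rule before_cong[OF st]) (use ne in auto)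
  then show v: "vtx g s = vtx g t"
    by (simp only: vtx_def fl)
  have "after g s (of_int a) (of_int b) = after g t (of_int a) (of_int b)" for a b
    by (rule after_cong[OF st]) (use ne in auto)
  then show "crs g s = crs g t"
    by (simp only: crs_def fl v)
qed

lemma vtx_int: "g t = of_int k \<Longrightarrow> vtx g t = k"
  unfolding vtx_def before_def by auto

lemma not_crs_int: "g t \<in> \<int> \<Longrightarrow> \<not> crs g t"
  unfolding crs_def after_def by (auto simp: vtx_int elim!: Ints_cases)

lemma abs_less_imp_floor: "\<bar>(x::real) - of_int k\<bar> < 1 \<Longrightarrow> \<lfloor>x\<rfloor> = k \<or> \<lfloor>x\<rfloor> = k - 1"
  by linarith

text \<open>
  Near a vertex time the neighbouring integers have not been reached since.
\<close>

lemma vtx_near_int: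
  fixes g :: "real \<Rightarrow> real"
  assumes "g x = of_int k" "x \<le> b" and near: "\<And>w. x \<le> w \<Longrightarrow> w \<le> b \<Longrightarrow> \<bar>g w - k\<bar> < 1"
  shows "vtx g b = k"
proof -
  consider "\<lfloor>g b\<rfloor> = k" | "\<lfloor>g b\<rfloor> = k - 1"
    using near[of b] assms(2) abs_less_imp_floor by blast
  then show ?thesis
  proof cases
    case 1
    have "g w \<noteq> of_int (k + 1)" if "w \<in> {x..b}" for w
      using near[of w] that by auto
    then have "before g b k (of_int (k + 1))"
      unfolding before_def using assms by blast
    then show ?thesis by (simp add: vtx_def 1)
  next
    case 2
    have "\<not> before g b (of_int (k - 1)) k"
    proof
      assume "before g b (of_int (k - 1)) k"
      then obtain v where v: "v \<le> b" "g v = of_int (k - 1)" "\<forall>w\<in>{v..b}. g w \<noteq> k"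
        by (auto simp: before_def)
      show False
      proof (cases "v \<le> x")
        case True then show False using v assms by auto
      next
        case False then show False using near[of v] v by auto
      qed
    qed
    then show ?thesis by (simp add: vtx_def 2)
  qed
qed

lemma closed_int_times:
  fixes g :: "real \<Rightarrow> real"
  assumes "continuous_on UNIV g" shows "closed {u. g u \<in> \<int>}"
  using continuous_closed_preimage[OF assms closed_UNIV closed_Ints] by (simp add: vimage_def)

lemma first_int:
  fixes g :: "real \<Rightarrow> real"
  assumes g: "continuous_on UNIV g" and "a \<le> x" "g x \<in> \<int>"
  shows "\<exists>b\<ge>a. b \<le> x \<and> g b \<in> \<int> \<and> (\<forall>w. a \<le> w \<longrightarrow> w < b \<longrightarrow> g w \<notin> \<int>)"
proof -
  let ?S = "{a..x} \<inter> {u. g u \<in> \<int>}"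
  have "compact ?S" using closed_int_times[OF g] by (intro compact_Int_closed) auto
  moreover have "?S \<noteq> {}" using assms by auto
  ultimately obtain b where "b \<in> ?S" "\<And>u. u \<in> ?S \<Longrightarrow> b \<le> u"
    using compact_attains_inf[of ?S] by blast
  then show ?thesis by (intro exI[of _ b]) force
qed

lemma last_int:
  fixes g :: "real \<Rightarrow> real"
  assumes g: "continuous_on UNIV g" and "x \<le> t" "g x \<in> \<int>"
  shows "\<exists>b\<ge>x. b \<le> t \<and> g b \<in> \<int> \<and> (\<forall>w. b < w \<longrightarrow> w \<le> t \<longrightarrow> g w \<notin> \<int>)"
proof -
  let ?S = "{x..t} \<inter> {u. g u \<in> \<int>}"
  have "compact ?S" using closed_int_times[OF g] by (intro compact_Int_closed) auto
  moreover have "?S \<noteq> {}" using assms by auto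
  ultimately obtain b where b: "b \<in> ?S" "\<And>u. u \<in> ?S \<Longrightarrow> u \<le> b"
    using compact_attains_sup[of ?S] by blast
  have "g w \<notin> \<int>" if "b < w" "w \<le> t" for w
    using b(2)[of w] b(1) that by auto
  with b(1) show ?thesis by (intro exI[of _ b]) auto
qed

lemma near_until_next_int:
  fixes g :: "real \<Rightarrow> real"
  assumes g: "continuous_on UNIV g" and k: "g b = of_int k"
    and ni: "\<And>w. b < w \<Longrightarrow> w \<le> t \<Longrightarrow> g w \<notin> \<int>" and u: "b \<le> u" "u \<le> t"
  shows "\<bar>g u - k\<bar> < 1"
proof (rule ccontr)
  assume *: "\<not> \<bar>g u - k\<bar> < 1"
  have c: "continuous_on UNIV (\<lambda>w. \<bar>g w - k\<bar>)" using g by (intro continuous_intros)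
  from * obtain w where w: "b \<le> w" "w \<le> u" "\<bar>g w - k\<bar> = 1"
    using IVT_up[OF c u(1), of 1] k by auto
  then have "g w = of_int (k + 1) \<or> g w = of_int (k - 1)" by (auto simp: abs_if split: if_splits)
  then have "g w \<in> \<int>" by (metis Ints_of_int)
  moreover have "b < w" using w k by (cases "b = w") auto
  ultimately show False using ni[of w] w u by auto
qed

lemma vtx_after_last_int:
  fixes g :: "real \<Rightarrow> real"
  assumes "continuous_on UNIV g" "b \<le> t" "g b = of_int k"
    "\<And>w. b < w \<Longrightarrow> w \<le> t \<Longrightarrow> g w \<notin> \<int>"
  shows "vtx g t = k"
  using near_until_next_int[OF assms(1,3,4)] by (intro vtx_near_int[where x = b]) (use assms in auto)

lemma vtx_floor: "vtx g t = \<lfloor>g t\<rfloor> \<or> vtx g t = \<lfloor>g t\<rfloor> + 1"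
  by (simp add: vtx_def)

text \<open>
  The next integer is the vertex itself or a neighbour, by the intermediate value theorem,
  and crossing means that it is a neighbour.
\<close>

lemma next_int_vtx:
  fixes g :: "real \<Rightarrow> real"
  assumes g: "continuous_on UNIV g" and ab: "a \<le> b" and k: "g b = of_int k"
    and ni: "\<And>w. a \<le> w \<Longrightarrow> w < b \<Longrightarrow> g w \<notin> \<int>"
  shows "\<bar>vtx g a - k\<bar> \<le> 1" "crs g a \<longleftrightarrow> vtx g a \<noteq> k"
proof -
  have "\<bar>vtx g a - k\<bar> \<le> 1 \<and> (crs g a \<longleftrightarrow> vtx g a \<noteq> k)"
  proof (cases "a = b")
    case True
    then show ?thesis using k vtx_int[of g a k] not_crs_int[of g a] by auto
  next
    case False
    then have ab: "a < b" using ab by simp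
    let ?j = "\<lfloor>g a\<rfloor>"
    have aj: "?j < g a" "g a < ?j + 1"
    proof -
      have "g a \<noteq> ?j" using ni[of a] ab by (metis Ints_of_int order_refl)
      then show "?j < g a" "g a < ?j + 1" by linarith+
    qed
    have near: "\<bar>g u - k\<bar> < 1" if "a \<le> u" "u \<le> b" for u
    proof -
      have "\<bar>(\<lambda>x. g (- x)) (- u) - k\<bar> < 1"
        by (rule near_until_next_int[where b = "- b" and t = "- a"])
          (use g k ni that in \<open>auto intro!: continuous_on_compose2[OF g] continuous_intros\<close>)
      then show ?thesis by simp
    qed
    have kj: "k = ?j \<or> k = ?j + 1"
      using near[of a] ab aj by linarith
    have ne: "g w \<noteq> of_int n" if "a \<le> w" "w \<le> b" "n \<noteq> k" for w n
      using ni[of w] that k by (cases "w = b") auto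
    have A: "after g a (of_int (?j + 1)) (of_int ?j) \<longleftrightarrow> k = ?j + 1"
    proof
      assume "after g a (of_int (?j + 1)) (of_int ?j)"
      then obtain v where v: "a \<le> v" "g v = of_int (?j + 1)" "\<forall>w\<in>{a..v}. g w \<noteq> ?j"
        by (auto simp: after_def)
      then have "b \<le> v" using ni[of v] by (metis Ints_of_int not_le)
      then have "k \<noteq> ?j" using v(3) ab k by auto
      then show "k = ?j + 1" using kj by auto
    next
      assume "k = ?j + 1"
      then show "after g a (of_int (?j + 1)) (of_int ?j)"
        using ab k ne by (auto simp: after_def intro!: exI[of _ b])
    qed
    have B: "after g a (of_int ?j) (of_int (?j + 1)) \<longleftrightarrow> k = ?j"
    proof
      assume "after g a (of_int ?j) (of_int (?j + 1))"
      then obtain v where v: "a \<le> v" "g v = of_int ?j" "\<forall>w\<in>{a..v}. g w \<noteq> of_int (?j + 1)"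
        by (auto simp: after_def)
      then have "b \<le> v" using ni[of v] by (metis Ints_of_int not_le)
      then have "k \<noteq> ?j + 1" using v(3) ab k by auto
      then show "k = ?j" using kj by auto
    next
      assume "k = ?j"
      then show "after g a (of_int ?j) (of_int (?j + 1))"
        using ab k ne[of _ "?j + 1"] by (auto simp: after_def intro!: exI[of _ b])
    qed
    show ?thesis
      using kj vtx_floor[of g a] A B by (auto simp: crs_def)
  qed
  then show "\<bar>vtx g a - k\<bar> \<le> 1" "crs g a \<longleftrightarrow> vtx g a \<noteq> k" by auto
qed

lemma crs_imp_next_int:
  assumes "crs g a" obtains x where "a \<le> x" "g x \<in> \<int>"
  using assms by (auto simp: crs_def after_def split: if_splits)

lemma near_int_neighbourhood:
  fixes g :: "real \<Rightarrow> real"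
  assumes "continuous_on UNIV g" "e > 0"
  shows "\<exists>d>0. \<forall>w. \<bar>w - x\<bar> < d \<longrightarrow> \<bar>g w - g x\<bar> < e"
  using assms unfolding continuous_on_iff dist_real_def by blast

lemma nonint_neighbourhood:
  fixes g :: "real \<Rightarrow> real"
  assumes g: "continuous_on UNIV g" and x: "g x \<notin> \<int>"
  shows "\<exists>d>0. \<forall>w. \<bar>w - x\<bar> < d \<longrightarrow> g w \<notin> \<int>"
proof -
  have "open (- {u. g u \<in> \<int>})" using closed_int_times[OF g] by (simp add: open_Compl)
  then show ?thesis using x by (auto simp: open_dist dist_real_def)
qed

lemma near_const:
  fixes g :: "real \<Rightarrow> real"
  assumes g: "continuous_on UNIV g" and x: "g x \<notin> \<int>"
  shows "\<exists>d>0. \<forall>w. \<bar>w - x\<bar> < d \<longrightarrow>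
    g w \<notin> \<int> \<and> vtx g w = vtx g x \<and> crs g w = crs g x"
proof -
  obtain d where d: "d > 0" "\<And>w. \<bar>w - x\<bar> < d \<Longrightarrow> g w \<notin> \<int>"
    using nonint_neighbourhood[OF g x] by blast
  have "vtx g w = vtx g x \<and> crs g w = crs g x" if "\<bar>w - x\<bar> < d" for w
  proof (cases "w \<le> x")
    case True
    then show ?thesis using excursion_const[OF g True] d that by auto
  next
    case False
    then have "x \<le> w" by simp
    then show ?thesis using excursion_const[OF g \<open>x \<le> w\<close>] d that by auto
  qed
  then show ?thesis using d by blast
qed

section \<open>Invariance under shifts of time and space\<close>

lemma before_time_shift: "before (\<lambda>t. g (t - s)) t a b = before g (t - s) a b"
proof
  assume "before (\<lambda>t. g (t - s)) t a b"
  then obtain v where v: "v \<le> t" "g (v - s) = a" "\<forall>w\<in>{v..t}. g (w - s) \<noteq> b"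
    by (auto simp: before_def)
  have "g w \<noteq> b" if "w \<in> {v - s..t - s}" for w
    using v(3)[rule_format, of "w + s"] that by auto
  then show "before g (t - s) a b"
    unfolding before_def using v by (intro exI[of _ "v - s"]) auto
next
  assume "before g (t - s) a b"
  then obtain v where v: "v \<le> t - s" "g v = a" "\<forall>w\<in>{v..t - s}. g w \<noteq> b"
    by (auto simp: before_def)
  then show "before (\<lambda>t. g (t - s)) t a b"
    unfolding before_def by (intro exI[of _ "v + s"]) auto
qed

lemma after_time_shift: "after (\<lambda>t. g (t - s)) t a b = after g (t - s) a b"
  using before_time_shift[of "\<lambda>x. g (- x)" "- s" "- t" a b]
  by (simp add: after_eq_before algebra_simps)

lemma vtx_time_shift: "vtx (\<lambda>t. g (t - s)) t = vtx g (t - s)"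
  by (simp add: vtx_def before_time_shift)

lemma crs_time_shift: "crs (\<lambda>t. g (t - s)) t = crs g (t - s)"
  by (simp add: crs_def after_time_shift vtx_time_shift)

lemma before_space_shift: "before (\<lambda>t. g t + c) t (a + c) (b + c) = before g t a b"
  by (simp add: before_def)

lemma after_space_shift: "after (\<lambda>t. g t + c) t (a + c) (b + c) = after g t a b"
  by (simp add: after_def)

lemma vtx_space_shift: "vtx (\<lambda>t. g t + of_int n) t = vtx g t + n"
  using before_space_shift[of g "of_int n" t "of_int \<lfloor>g t\<rfloor>" "of_int (\<lfloor>g t\<rfloor> + 1)"]
  by (simp add: vtx_def add_ac)

lemma crs_space_shift: "crs (\<lambda>t. g t + of_int n) t = crs g t"
  using after_space_shift[of g "of_int n" t "of_int \<lfloor>g t\<rfloor>" "of_int (\<lfloor>g t\<rfloor> + 1)"]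
    after_space_shift[of g "of_int n" t "of_int (\<lfloor>g t\<rfloor> + 1)" "of_int \<lfloor>g t\<rfloor>"]
  unfolding crs_def vtx_space_shift by (simp add: add_ac)

section \<open>The two codings\<close>

text \<open>
  Steps that start in the upper half \<open>{m..<2 * m}\<close> of the vertices modulo \<open>2 * m\<close> are
  reversed.
\<close>

definition flipped :: "nat \<Rightarrow> (real \<Rightarrow> real) \<Rightarrow> real \<Rightarrow> bool" where
  "flipped m g t \<longleftrightarrow> crs g t \<and> int m \<le> vtx g t mod (2 * int m)"

text \<open>
  The level in \<open>{0..<m}\<close> of the clamped walk driven by the steps of \<open>g\<close>: it goes up and
  down with \<open>g\<close> but does not leave \<open>{0..<m}\<close>. Clamping amounts to pushing along a frame of
  \<open>m\<close> consecutive integers that contains the current vertex \<open>k\<close>; the level is the height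
  of \<open>k\<close> above the bottom of the frame. At a visit to \<open>k - \<theta>\<close> the bottom is at or
  below this point, and only a visit to \<open>k - \<theta> + m\<close> pushes it above. So the more
  recent of these two visits tells whether the level is at least \<open>\<theta>\<close>, and counting
  such \<open>\<theta>\<close> gives the level without a choice of initial value.
\<close>

definition level :: "nat \<Rightarrow> (real \<Rightarrow> real) \<Rightarrow> real \<Rightarrow> int" where
  "level m g t = int (card {\<theta> \<in> {1..<int m}.
     before g t (of_int (vtx g t - \<theta>)) (of_int (vtx g t - \<theta> + int m))})"

text \<open>
  A level comes from two vertices modulo \<open>2 * m\<close>, namely \<open>y\<close> and \<open>2 * m - 1 - y\<close>, which
  have different parity. Reversing steps does not change parities, so the parity of the
  vertex \<open>k\<close> of the folded path decides.
\<close>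

definition unfold_level :: "nat \<Rightarrow> int \<Rightarrow> int \<Rightarrow> int" where
  "unfold_level m y k = (if even (y - k) then y else 2 * int m - 1 - y)"

text \<open>
  Folding the \<open>2 * m\<close> vertices of the long circle in half identifies \<open>m - 1\<close> with \<open>m\<close> and
  \<open>2 * m - 1\<close> with \<open>0\<close>. These two edges are where the walk turns from one half to the
  other, so the folded walk stays put there: it is a clamped walk.
\<close>

definition fold_vertex :: "nat \<Rightarrow> int \<Rightarrow> int" where
  "fold_vertex m p = (let r = p mod (2 * int m) in if r < int m then r else 2 * int m - 1 - r)"

definition place :: "nat \<Rightarrow> (real \<Rightarrow> real) \<Rightarrow> real \<Rightarrow> int" where
  "place m g t = unfold_level m (level m g t) (vtx g t)"

text \<open>
  Position on the long circle in units of \<open>H\<close>: the vertex recovered from the level, plus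
  the excursion with its original sign.
\<close>

definition decode :: "nat \<Rightarrow> (real \<Rightarrow> real) \<Rightarrow> real \<Rightarrow> real" where
  "decode m g t = of_int (place m g t) +
     (if crs g t \<and> int m \<le> place m g t then - 1 else 1) * (g t - of_int (vtx g t))"

subsection \<open>The clamped walk\<close>

lemma level_bounds: "0 \<le> level m g t" "m > 0 \<Longrightarrow> level m g t < int m"
proof -
  have "card {\<theta> \<in> {1..<int m}. before g t (of_int (vtx g t - \<theta>)) (of_int (vtx g t - \<theta> + int m))}
      \<le> card {1..<int m}"
    by (intro card_mono) auto
  then show "0 \<le> level m g t" "m > 0 \<Longrightarrow> level m g t < int m"
    by (auto simp: level_def)
qed

lemma card_initial_segment:
  assumes y: "0 \<le> y" "y < int m" and T: "\<And>\<theta>. 1 \<le> \<theta> \<Longrightarrow> \<theta> < int m \<Longrightarrow> T \<theta> \<longleftrightarrow> \<theta> \<le> y"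
  shows "int (card {\<theta> \<in> {1..<int m}. T \<theta>}) = y"
proof -
  have "{\<theta> \<in> {1..<int m}. T \<theta>} = {1..y}"
    using assms by auto
  then show ?thesis using y by simp
qed

lemma level_eqI:
  assumes "0 \<le> y" "y < int m"
    and "\<And>\<theta>. 1 \<le> \<theta> \<Longrightarrow> \<theta> < int m \<Longrightarrow>
      before g t (of_int (vtx g t - \<theta>)) (of_int (vtx g t - \<theta> + int m)) \<longleftrightarrow> \<theta> \<le> y"
  shows "level m g t = y"
  unfolding level_def by (rule card_initial_segment) (use assms in auto)

lemma downward_closed_int:
  fixes T :: "int \<Rightarrow> bool"
  assumes down: "\<And>\<theta>. 1 \<le> \<theta> \<Longrightarrow> \<theta> + 1 < int m \<Longrightarrow> T (\<theta> + 1) \<Longrightarrow> T \<theta>"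
  shows "\<exists>y\<ge>0. (\<forall>\<theta>. 1 \<le> \<theta> \<longrightarrow> \<theta> < int m \<longrightarrow> (T \<theta> \<longleftrightarrow> \<theta> \<le> y)) \<and> (m > 0 \<longrightarrow> y < int m)"
proof -
  define S where "S = {\<theta> \<in> {1..<int m}. T \<theta>}"
  have fin: "finite S" unfolding S_def by (rule finite_subset[of _ "{1..<int m}"]) auto
  define y where "y = Max (insert 0 S)"
  have y0: "0 \<le> y" unfolding y_def using fin by (intro Max_ge) auto
  have yS: "y \<in> insert 0 S" unfolding y_def using fin by (intro Max_in) auto
  have T_low: "T \<theta>" if "1 \<le> \<theta>" "\<theta> \<le> y" for \<theta>
  proof -
    have "T y" "y < int m" using yS that by (auto simp: S_def)
    have "T (y - int n)" if "1 \<le> y - int n" for n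
      using that
    proof (induction n)
      case 0 then show ?case using \<open>T y\<close> by simp
    next
      case (Suc n)
      then show ?case using down[of "y - int (Suc n)"] \<open>y < int m\<close> by simp
    qed
    from this[of "nat (y - \<theta>)"] that show ?thesis by simp
  qed
  have "T \<theta> \<longleftrightarrow> \<theta> \<le> y" if "1 \<le> \<theta>" "\<theta> < int m" for \<theta>
  proof
    assume "T \<theta>"
    then show "\<theta> \<le> y" unfolding y_def using that fin by (intro Max_ge) (auto simp: S_def)
  qed (use that T_low in auto)
  moreover have "m > 0 \<Longrightarrow> y < int m" using yS by (auto simp: S_def)
  ultimately show ?thesis using y0 by (intro exI[of _ y]) simp
qed

lemma vtx_near: "\<bar>g t - vtx g t\<bar> \<le> 1"
  using vtx_floor[of g t] by linarith

lemma stays_below: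
  fixes g :: "real \<Rightarrow> real"
  assumes g: "continuous_on UNIV g" and v: "g v < b" "\<forall>w\<in>{v..t}. g w \<noteq> b" and w: "v \<le> w" "w \<le> t"
  shows "g w < b"
proof (rule ccontr)
  assume "\<not> g w < b"
  then have "g v \<le> b" "b \<le> g w" using v(1) by auto
  then obtain u where "v \<le> u" "u \<le> w" "g u = b"
    using IVT_up[OF g w(1)] by blast
  then show False using v(2) w by auto
qed

lemma stays_above:
  fixes g :: "real \<Rightarrow> real"
  assumes g: "continuous_on UNIV g" and v: "g v > b" "\<forall>w\<in>{v..t}. g w \<noteq> b" and w: "v \<le> w" "w \<le> t"
  shows "g w > b"
proof (rule ccontr)
  assume "\<not> g w > b"
  then have "g w \<le> b" "b \<le> g v" using v(1) by auto
  then obtain u where "v \<le> u" "u \<le> w" "g u = b"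
    using IVT_down[OF g w(1)] by blast
  then show False using v(2) w by auto
qed

text \<open>
  The comparisons counted by the level are monotone in \<open>\<theta>\<close>: by the intermediate
  value theorem a path on its way from \<open>k - \<theta>\<close> to \<open>k\<close> passes all integers in
  between. So the count is also the threshold.
\<close>

lemma level_iff:
  fixes g :: "real \<Rightarrow> real"
  assumes g: "continuous_on UNIV g" and \<theta>: "1 \<le> \<theta>" "\<theta> < int m"
  shows "before g t (of_int (vtx g t - \<theta>)) (of_int (vtx g t - \<theta> + int m)) \<longleftrightarrow> \<theta> \<le> level m g t"
proof -
  let ?k = "vtx g t"
  define T where "T \<theta> = before g t (of_int (?k - \<theta>)) (of_int (?k - \<theta> + int m))" for \<theta>
  have "T \<theta>" if \<theta>: "1 \<le> \<theta>" "\<theta> + 1 < int m" and T: "T (\<theta> + 1)" for \<theta>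
  proof -
    from T obtain v where v: "v \<le> t" "g v = of_int (?k - (\<theta> + 1))"
      "\<forall>w\<in>{v..t}. g w \<noteq> of_int (?k - (\<theta> + 1) + int m)"
      by (auto simp: T_def before_def)
    have "g v \<le> of_int (?k - \<theta>)" "of_int (?k - \<theta>) \<le> g t"
      using vtx_near[of g t] \<theta> v(2) by auto
    then obtain u where u: "v \<le> u" "u \<le> t" "g u = of_int (?k - \<theta>)"
      using IVT_up[OF g v(1)] by blast
    have "g w < of_int (?k - (\<theta> + 1) + int m)" if "w \<in> {u..t}" for w
      by (rule stays_below[OF g _ v(3)]) (use v(2) \<theta> u that in auto)
    then have "\<forall>w\<in>{u..t}. g w \<noteq> of_int (?k - \<theta> + int m)"
      by force
    then show ?thesis using u by (auto simp: T_def before_def)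
  qed
  from downward_closed_int[of m T, OF this]
  obtain y where y: "0 \<le> y" "\<And>\<theta>. 1 \<le> \<theta> \<Longrightarrow> \<theta> < int m \<Longrightarrow> T \<theta> \<longleftrightarrow> \<theta> \<le> y" "m > 0 \<Longrightarrow> y < int m"
    by auto
  then have "level m g t = y"
    using \<theta> by (intro level_eqI) (auto simp: T_def)
  then show ?thesis using y(2)[OF \<theta>] by (simp add: T_def)
qed

text \<open>
  Visits to the current vertex itself enter none of the comparisons.
\<close>

lemma level_const:
  fixes g :: "real \<Rightarrow> real"
  assumes "a \<le> b" "vtx g a = vtx g b"
    and av: "\<And>w n. a < w \<Longrightarrow> w \<le> b \<Longrightarrow> n \<noteq> vtx g b \<Longrightarrow> g w \<noteq> of_int n"
  shows "level m g a = level m g b"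
proof -
  have "before g b (of_int (vtx g b - \<theta>)) (of_int (vtx g b - \<theta> + int m)) \<longleftrightarrow>
      before g a (of_int (vtx g b - \<theta>)) (of_int (vtx g b - \<theta> + int m))"
    if "\<theta> \<in> {1..<int m}" for \<theta>
  proof (rule before_cong[OF assms(1)])
    fix w assume "a < w" "w \<le> b"
    then show "g w \<noteq> of_int (vtx g b - \<theta>) \<and> g w \<noteq> of_int (vtx g b - \<theta> + int m)"
      using av[of w "vtx g b - \<theta>"] av[of w "vtx g b - \<theta> + int m"] that by simp
  qed
  then have "{\<theta> \<in> {1..<int m}. before g a (of_int (vtx g a - \<theta>)) (of_int (vtx g a - \<theta> + int m))}
    = {\<theta> \<in> {1..<int m}. before g b (of_int (vtx g b - \<theta>)) (of_int (vtx g b - \<theta> + int m))}"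
    unfolding assms(2) by blast
  then show ?thesis by (simp only: level_def)
qed

lemma level_step:
  fixes g :: "real \<Rightarrow> real"
  assumes g: "continuous_on UNIV g" and m: "m > 0" and ax: "a \<le> x" and k: "g x = of_int k"
    and near: "\<And>w. a \<le> w \<Longrightarrow> w \<le> x \<Longrightarrow> \<bar>g w - k\<bar> < 1"
  shows "vtx g a = k - 1 \<Longrightarrow> level m g x = min (level m g a + 1) (int m - 1)"
    and "vtx g a = k + 1 \<Longrightarrow> level m g x = max (level m g a - 1) 0"
proof -
  have vx: "vtx g x = k" using k by (rule vtx_int)
  have av: "g w \<noteq> of_int n" if "a \<le> w" "w \<le> x" "n \<noteq> k" for w n
    using near[OF that(1,2)] that(3) by auto
  have shift: "before g x (of_int i) (of_int j) \<longleftrightarrow> before g a (of_int i) (of_int j)"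
    if "i \<noteq> k" "j \<noteq> k" for i j
    by (rule before_cong[OF ax]) (use av that in auto)
  note lb = level_bounds(1)[of m g a] level_bounds(2)[OF m, of g a]
  {
    assume va: "vtx g a = k - 1"
    have fl: "\<lfloor>g a\<rfloor> = k - 1"
      using near[of a] ax vtx_floor[of g a] va by linarith
    have bf: "before g a (of_int (k - 1)) (of_int k)"
      using va by (simp add: vtx_def fl split: if_splits)
    show "level m g x = min (level m g a + 1) (int m - 1)"
    proof (rule level_eqI)
      fix \<theta> assume \<theta>: "1 \<le> \<theta>" "\<theta> < int m"
      show "before g x (of_int (vtx g x - \<theta>)) (of_int (vtx g x - \<theta> + int m)) \<longleftrightarrow>
          \<theta> \<le> min (level m g a + 1) (int m - 1)"
      proof (cases "\<theta> = 1")
        case True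
        from bf obtain v where v: "v \<le> a" "g v = of_int (k - 1)" "\<forall>w\<in>{v..a}. g w \<noteq> of_int k"
          by (auto simp: before_def)
        have "g w \<noteq> of_int (k - 1 + int m)" if "w \<in> {v..x}" for w
        proof (cases "w \<le> a")
          case True
          have "g w < of_int k"
            by (rule stays_below[OF g _ v(3)]) (use v(2) that True in auto)
          then show ?thesis using m by auto
        next
          case False
          then show ?thesis using near[of w] that \<theta> True by auto
        qed
        then have "before g x (of_int (k - 1)) (of_int (k - 1 + int m))"
          using v ax by (auto simp: before_def intro!: exI[of _ v])
        then show ?thesis using True \<theta> lb by (simp add: vx)
      next
        case False
        then have "1 \<le> \<theta> - 1" "\<theta> - 1 < int m" using \<theta> by auto
        from level_iff[OF g this, of a]
        have "before g a (of_int (k - \<theta>)) (of_int (k - \<theta> + int m)) \<longleftrightarrow> \<theta> - 1 \<le> level m g a"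
          by (simp add: va algebra_simps)
        then show ?thesis
          using shift[of "k - \<theta>" "k - \<theta> + int m"] \<theta> by (auto simp: vx)
      qed
    qed (use lb m in auto)
  }
  {
    assume va: "vtx g a = k + 1"
    have fl: "\<lfloor>g a\<rfloor> = k"
      using near[of a] ax vtx_floor[of g a] va by linarith
    have nb: "\<not> before g a (of_int k) (of_int (k + 1))"
      using va by (simp add: vtx_def fl split: if_splits)
    show "level m g x = max (level m g a - 1) 0"
    proof (rule level_eqI)
      fix \<theta> assume \<theta>: "1 \<le> \<theta>" "\<theta> < int m"
      show "before g x (of_int (vtx g x - \<theta>)) (of_int (vtx g x - \<theta> + int m)) \<longleftrightarrow>
          \<theta> \<le> max (level m g a - 1) 0"
      proof (cases "\<theta> = int m - 1")
        case True
        have "\<not> before g a (of_int (k - \<theta>)) (of_int (k - \<theta> + int m))"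
        proof
          assume "before g a (of_int (k - \<theta>)) (of_int (k - \<theta> + int m))"
          then obtain v where v: "v \<le> a" "g v = of_int (k - \<theta>)" "\<forall>w\<in>{v..a}. g w \<noteq> of_int (k + 1)"
            using True by (auto simp: before_def)
          have "g v \<le> of_int k" "of_int k \<le> g a" using v(2) \<theta> fl by auto
          then obtain u where u: "v \<le> u" "u \<le> a" "g u = of_int k"
            using IVT_up[OF g v(1)] by blast
          then have "before g a (of_int k) (of_int (k + 1))"
            using v(3) by (auto simp: before_def intro!: exI[of _ u])
          with nb show False ..
        qed
        then show ?thesis
          using shift[of "k - \<theta>" "k - \<theta> + int m"] \<theta> True lb by (auto simp: vx)
      next
        case False
        then have "1 \<le> \<theta> + 1" "\<theta> + 1 < int m" using \<theta> by auto
        from level_iff[OF g this, of a]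
        have "before g a (of_int (k - \<theta>)) (of_int (k - \<theta> + int m)) \<longleftrightarrow> \<theta> + 1 \<le> level m g a"
          by (simp add: va algebra_simps)
        then show ?thesis
          using shift[of "k - \<theta>" "k - \<theta> + int m"] \<theta> by (auto simp: vx)
      qed
    qed (use lb m in auto)
  }
qed

text \<open>
  A step of the folded walk, decoded: the original step, with its sign restored in the
  upper half. At the ends of the range the level stays put while the parity changes, which
  moves the vertex to the other half.
\<close>

lemma unfold_level_step:
  assumes "0 \<le> y" "y < int m" "s = 1 \<or> s = - 1"
    and y': "y' = (if s = 1 then min (y + 1) (int m - 1) else max (y - 1) 0)"
  shows "unfold_level m y' (k + s) mod (2 * int m) =
      (unfold_level m y k + (if unfold_level m y k < int m then s else - s)) mod (2 * int m)"
proof -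
  consider "y' = y + s" | "y' = y" "s = 1" "y = int m - 1" | "y' = y" "s = - 1" "y = 0"
  proof -
    have "y' = y + s \<or> (y' = y \<and> s = 1 \<and> y = int m - 1) \<or> (y' = y \<and> s = - 1 \<and> y = 0)"
      using assms by (auto simp: min_def max_def split: if_splits)
    then show ?thesis using that by blast
  qed
  then show ?thesis
  proof cases
    case 1
    then have "even (y' - (k + s)) \<longleftrightarrow> even (y - k)" by simp
    then have "unfold_level m y' (k + s) =
        unfold_level m y k + (if unfold_level m y k < int m then s else - s)"
      using 1 assms(1,2) by (simp add: unfold_level_def)
    then show ?thesis by simp
  next
    case 2
    then have "even (y' - (k + s)) \<longleftrightarrow> odd (y - k)" by simp
    then have "unfold_level m y' (k + s) =
        unfold_level m y k + (if unfold_level m y k < int m then s else - s)"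
      using 2 assms(1,2) by (simp add: unfold_level_def)
    then show ?thesis by simp
  next
    case 3
    then have *: "even (y' - (k + s)) \<longleftrightarrow> odd (y - k)" by simp
    show ?thesis
    proof (cases "even (y - k)")
      case True
      with * 3 assms(1,2) have "unfold_level m y' (k + s) =
        unfold_level m y k + (if unfold_level m y k < int m then s else - s) + 2 * int m"
        by (simp add: unfold_level_def)
      then show ?thesis by simp
    next
      case False
      with * 3 assms(1,2) have "unfold_level m y' (k + s) + 2 * int m =
        unfold_level m y k + (if unfold_level m y k < int m then s else - s)"
        by (simp add: unfold_level_def)
      then show ?thesis by (metis mod_add_self2)
    qed
  qed
qed

lemma fold_vertex_bounds:
  assumes "m > 0" shows "0 \<le> fold_vertex m p" "fold_vertex m p < int m"
proof -
  define r where "r = p mod (2 * int m)"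
  have "0 \<le> r" "r < 2 * int m" using assms by (simp_all add: r_def)
  then show "0 \<le> fold_vertex m p" "fold_vertex m p < int m"
    unfolding fold_vertex_def Let_def r_def[symmetric] by simp_all
qed

lemma unfold_fold:
  assumes "m > 0" "even (k - p)"
  shows "unfold_level m (fold_vertex m p) k = p mod (2 * int m)"
proof -
  define r where "r = p mod (2 * int m)"
  have "p = r + p div (2 * int m) * (2 * int m)"
    unfolding r_def by (rule mod_div_mult_eq[symmetric])
  then have "even r \<longleftrightarrow> even p" by (metis dvd_triv_left even_add even_mult_iff)
  then show ?thesis using assms(2) unfolding unfold_level_def fold_vertex_def Let_def r_def[symmetric]
    by simp
qed

text \<open>
  The steps reversed in the upper half are exactly those that drive the folded position as
  a clamped walk.
\<close>

lemma fold_vertex_step: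
  assumes m: "m > 0" and s: "s = 1 \<or> s = - 1"
    and s': "s' = (if p mod (2 * int m) < int m then s else - s)"
  shows "fold_vertex m (p + s) =
    (if s' = 1 then min (fold_vertex m p + 1) (int m - 1) else max (fold_vertex m p - 1) 0)"
proof -
  define n where "n = 2 * int m"
  define r where "r = p mod n"
  have n: "n > 0" using m by (simp add: n_def)
  have r: "0 \<le> r" "r < n" using n by (auto simp: r_def)
  have "(p + s) mod n = (r + s) mod n" unfolding r_def by (rule mod_add_left_eq[symmetric])
  also have "\<dots> = (if r + s = n then 0 else if r + s = - 1 then n - 1 else r + s)"
  proof -
    consider "r + s = n" | "r + s = - 1" | "0 \<le> r + s" "r + s < n" using r s by linarith
    then show ?thesis
    proof cases
      case 1
      then show ?thesis by simp
    next
      case 2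
      then have "(r + s) mod n = n - 1" using n by (simp only: zmod_minus1)
      then show ?thesis using 2 n by simp
    next
      case 3
      then have "(r + s) mod n = r + s" by (intro mod_pos_pos_trivial)
      then show ?thesis using 3 by simp
    qed
  qed
  finally have q: "(p + s) mod n = (if r + s = n then 0 else if r + s = - 1 then n - 1 else r + s)" .
  define x where "x = (p + s) mod n"
  have e: "fold_vertex m (p + s) = (if x < int m then x else n - 1 - x)"
    "fold_vertex m p = (if r < int m then r else n - 1 - r)" "s' = (if r < int m then s else - s)"
    by (simp_all add: fold_vertex_def Let_def n_def r_def s' x_def)
  have x: "x = (if r + s = n then 0 else if r + s = - 1 then n - 1 else r + s)"
    using q by (simp only: x_def)
  have m': "int m \<ge> 1" using m by simp
  from s show ?thesis
  proof
    assume s1: "s = 1"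
    show ?thesis
      unfolding e using r m' x by (cases "r < int m") (auto simp: s1 n_def split: if_splits)
  next
    assume s1: "s = - 1"
    show ?thesis
      unfolding e using r m' x by (cases "r < int m") (auto simp: s1 n_def split: if_splits)
  qed
qed

lemma mod_eq_imp_ex: 
  fixes a b c :: int
  assumes "a mod c = b mod c" obtains n where "a = b + n * c"
  using assms by (metis add.commute mod_eqE mult.commute)

text \<open>
  Close to a vertex time the decoded path can move only by one excursion from one vertex.
  The multiples of \<open>2 * m\<close> account for turns around the long circle.
\<close>

lemma decode_local:
  fixes g :: "real \<Rightarrow> real"
  assumes g: "continuous_on UNIV g" and m: "m > 0"
  shows "\<exists>d>0. \<forall>t. \<bar>t - x\<bar> < d \<longrightarrow>
    (\<exists>n::int. \<bar>decode m g t - decode m g x - real_of_int n * (2 * real m)\<bar> \<le> \<bar>g t - g x\<bar>)"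
proof (cases "g x \<in> \<int>")
  case False
  obtain d where d: "d > 0" "\<And>w. \<bar>w - x\<bar> < d \<Longrightarrow> g w \<notin> \<int>"
    "\<And>w. \<bar>w - x\<bar> < d \<Longrightarrow> vtx g w = vtx g x" "\<And>w. \<bar>w - x\<bar> < d \<Longrightarrow> crs g w = crs g x"
    using near_const[OF g False] by blast
  have lev: "level m g t = level m g x" if t: "\<bar>t - x\<bar> < d" for t
  proof (cases "t \<le> x")
    case True
    show ?thesis
    proof (rule level_const[OF True d(3)[OF t]])
      fix w and n :: int assume "t < w" "w \<le> x"
      then have "g w \<notin> \<int>" using t by (intro d(2)) auto
      then show "g w \<noteq> of_int n" using Ints_of_int[of n] by auto
    qed
  next
    case False
    then have le: "x \<le> t" by simp
    have "level m g x = level m g t"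
    proof (rule level_const[OF le])
      fix w and n :: int assume "x < w" "w \<le> t"
      then have "g w \<notin> \<int>" using t by (intro d(2)) auto
      then show "g w \<noteq> of_int n" using Ints_of_int[of n] by auto
    qed (use d(3)[OF t] in simp)
    then show ?thesis by simp
  qed
  have "decode m g t - decode m g x = g t - g x \<or> decode m g t - decode m g x = - (g t - g x)"
    if t: "\<bar>t - x\<bar> < d" for t
    by (simp add: decode_def place_def d(3,4)[OF t] lev[OF t] algebra_simps)
  then have *: "\<bar>decode m g t - decode m g x\<bar> \<le> \<bar>g t - g x\<bar>" if t: "\<bar>t - x\<bar> < d" for t
    using t by fastforce
  show ?thesis
    by (rule exI[of _ d], intro conjI allI impI exI[of _ "0 :: int"]) (use d(1) * in auto)
next
  case True
  then obtain k where k: "g x = of_int k" by (auto elim: Ints_cases)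
  obtain d where d: "d > 0" "\<And>w. \<bar>w - x\<bar> < d \<Longrightarrow> \<bar>g w - k\<bar> < 1"
    using near_int_neighbourhood[OF g zero_less_one, of x] k by auto
  have vx: "vtx g x = k" using k by (rule vtx_int)
  have dx: "decode m g x = place m g x"
    using not_crs_int[of g x] k by (simp add: decode_def vx)
  have ne: "g w \<noteq> of_int n" if "\<bar>w - x\<bar> < d" "n \<noteq> k" for w n
    using d(2)[OF that(1)] that(2) by auto
  have same: "\<exists>n::int. \<bar>decode m g t - decode m g x - real_of_int n * (2 * real m)\<bar> \<le> \<bar>g t - g x\<bar>"
    if "level m g t = level m g x" "vtx g t = k" for t
  proof -
    have "place m g t = place m g x" using that vx by (simp add: place_def)
    then have "\<bar>decode m g t - decode m g x\<bar> \<le> \<bar>g t - g x\<bar>"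
      using that k by (auto simp: decode_def[of m g t] dx)
    then show ?thesis by (intro exI[of _ "0 :: int"]) simp
  qed
  have "\<exists>n::int. \<bar>decode m g t - decode m g x - real_of_int n * (2 * real m)\<bar> \<le> \<bar>g t - g x\<bar>"
    if t: "\<bar>t - x\<bar> < d" for t
  proof (cases "x \<le> t")
    case True
    have v: "vtx g t = k"
      by (rule vtx_near_int[where x = x]) (use k d(2) t True in auto)
    have "level m g x = level m g t"
      by (rule level_const[OF True]) (use v vx ne t in auto)
    then show ?thesis using same v by simp
  next
    case False
    then have tx: "t \<le> x" by simp
    have near: "\<bar>g w - k\<bar> < 1" if "t \<le> w" "w \<le> x" for w
      using d(2)[of w] that t by auto
    obtain c where c: "t \<le> c" "c \<le> x" "g c \<in> \<int>" "\<And>w. t \<le> w \<Longrightarrow> w < c \<Longrightarrow> g w \<notin> \<int>"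
      using first_int[OF g tx] k by auto
    have gc: "g c = of_int k"
      using c(3) near[OF c(1,2)] by (auto elim!: Ints_cases)
    note nv = next_int_vtx[OF g c(1) gc c(4)]
    show ?thesis
    proof (cases "vtx g t = k")
      case True
      have "level m g t = level m g x"
        by (rule level_const[OF tx]) (use True vx ne t in auto)
      then show ?thesis using same True by simp
    next
      case neq: False
      define s where "s = k - vtx g t"
      have s: "s = 1 \<or> s = - 1" using neq nv(1) by (auto simp: s_def)
      have crs: "crs g t" using nv(2) neq by simp
      let ?P = "place m g t"
      let ?e = "(if int m \<le> ?P then - 1 else 1) :: int"
      have "level m g x = (if s = 1 then min (level m g t + 1) (int m - 1) else max (level m g t - 1) 0)"
        using level_step[OF g m tx k near] s by (auto simp: s_def)
      from unfold_level_step[OF level_bounds(1) level_bounds(2)[OF m] s this, of "vtx g t"]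
      have "place m g x mod (2 * int m) = (?P + ?e * s) mod (2 * int m)"
        by (auto simp: place_def vx s_def not_le split: if_splits)
      then obtain n where "place m g x = ?P + ?e * s + n * (2 * int m)"
        by (rule mod_eq_imp_ex)
      then have "real_of_int (place m g x) = of_int (?P + ?e * s + n * (2 * int m))"
        by simp
      then have "decode m g t - decode m g x - real_of_int (- n) * (2 * real m) = of_int ?e * (g t - k)"
        using crs by (auto simp: dx decode_def[of m g t] s_def algebra_simps)
      then show ?thesis
        by (intro exI[of _ "- n"]) (auto simp: k abs_mult)
    qed
  qed
  then show ?thesis using d(1) by blast
qed

section \<open>Decoding inverts the flips\<close>

text \<open>
  \<open>g\<close> is a lift of a path on the long circle and \<open>g'\<close> a lift of its folded image, in units
  of \<open>H\<close>. The lifts are only related modulo \<open>2\<close> because the two paths wind differently.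
\<close>

definition coupled :: "nat \<Rightarrow> (real \<Rightarrow> real) \<Rightarrow> (real \<Rightarrow> real) \<Rightarrow> bool" where
  "coupled m g g' \<longleftrightarrow> continuous_on UNIV g \<and> continuous_on UNIV g' \<and>
     (\<forall>t. \<exists>n::int. g' t = (if flipped m g t then - g t else g t) + 2 * of_int n)"

lemma coupled_int:
  assumes "coupled m g g'" shows "g' t \<in> \<int> \<longleftrightarrow> g t \<in> \<int>"
proof -
  obtain n :: int where n: "g' t = (if flipped m g t then - g t else g t) + 2 * of_int n"
    using assms unfolding coupled_def by blast
  have *: "x + 2 * of_int n \<in> \<int> \<longleftrightarrow> x \<in> \<int>" for x :: real
    using Ints_add[of x "2 * of_int n"] Ints_diff[of "x + 2 * of_int n" "2 * of_int n"] by auto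
  show ?thesis
    using n * by (auto split: if_splits)
qed

lemma coupled_parity:
  assumes "coupled m g g'" "g t \<in> \<int>" shows "\<exists>n::int. g' t = g t + 2 * of_int n"
proof -
  have "\<not> flipped m g t" using not_crs_int[of g t] assms(2) by (simp add: flipped_def)
  moreover obtain n :: int where "g' t = (if flipped m g t then - g t else g t) + 2 * of_int n"
    using assms(1) unfolding coupled_def by blast
  ultimately show ?thesis by auto
qed

text \<open>
  On a stretch with one sign the two lifts move in parallel or in opposite directions; at
  vertices the sign does not matter, as \<open>k\<close> and \<open>- k\<close> agree modulo \<open>2\<close>.
\<close>

lemma coupled_move:
  assumes c: "coupled m g g'" and bc: "b \<le> c"
    and F: "\<And>w. b \<le> w \<Longrightarrow> w \<le> c \<Longrightarrow> g w \<in> \<int> \<or> (flipped m g w \<longleftrightarrow> F)"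
  shows "g' c - g' b = (if F then - 1 else 1) * (g c - g b)"
proof -
  define \<sigma> :: real where "\<sigma> = (if F then - 1 else 1)"
  define D where "D w = (g' w - \<sigma> * g w) / 2" for w
  have D: "D w \<in> \<int>" if "b \<le> w" "w \<le> c" for w
  proof (cases "g w \<in> \<int>")
    case True
    obtain n :: int where n: "g' w = g w + 2 * of_int n" using coupled_parity[OF c True] by blast
    from True obtain k where k: "g w = of_int k" by (auto elim: Ints_cases)
    have "D w = of_int (if F then k + n else n)"
      by (simp add: D_def n \<sigma>_def k)
    then show ?thesis by (metis Ints_of_int)
  next
    case False
    then have "flipped m g w \<longleftrightarrow> F" using F that by auto
    moreover obtain n :: int where n: "g' w = (if flipped m g w then - g w else g w) + 2 * of_int n"
      using c unfolding coupled_def by blast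
    ultimately have "D w = of_int n" by (simp add: D_def \<sigma>_def)
    then show ?thesis by simp
  qed
  have "D constant_on {b..c}"
  proof (rule continuous_discrete_range_constant)
    show "continuous_on {b..c} D"
      using c unfolding D_def coupled_def by (auto intro!: continuous_intros intro: cont_sub)
    fix x assume x: "x \<in> {b..c}"
    show "\<exists>e>0. \<forall>y. y \<in> {b..c} \<and> D y \<noteq> D x \<longrightarrow> e \<le> norm (D y - D x)"
    proof (intro exI[of _ 1] conjI allI impI)
      fix y assume "y \<in> {b..c} \<and> D y \<noteq> D x"
      then show "1 \<le> norm (D y - D x)"
        using Ints_nonzero_abs_ge1[of "D y - D x"] D[of x] D[of y] x by simp
    qed simp
  qed simp
  then have "D b = D c" using bc by (auto simp: constant_on_def)
  then have "g' b - \<sigma> * g b = g' c - \<sigma> * g c" by (simp add: D_def)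
  then show ?thesis unfolding \<sigma>_def[symmetric] by (simp add: algebra_simps)
qed

lemma flipped_excursion_const:
  fixes g :: "real \<Rightarrow> real"
  assumes g: "continuous_on UNIV g" and st: "s \<le> t" and w: "\<And>w. s \<le> w \<Longrightarrow> w \<le> t \<Longrightarrow> g w \<notin> \<int>"
  shows "flipped m g s = flipped m g t"
  using excursion_const[OF assms] by (simp add: flipped_def)

lemma coupled_vtx:
  assumes c: "coupled m g g'" and x: "x \<le> t" "g x \<in> \<int>"
  shows "g' t - vtx g' t = (if flipped m g t then - 1 else 1) * (g t - vtx g t)"
    and "even (vtx g' t - vtx g t)"
    and "\<exists>b. x \<le> b \<and> b \<le> t \<and> g' b = vtx g' t"
proof -
  have g: "continuous_on UNIV g" and g': "continuous_on UNIV g'" using c by (auto simp: coupled_def)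
  obtain b where b: "x \<le> b" "b \<le> t" "g b \<in> \<int>" "\<And>w. b < w \<Longrightarrow> w \<le> t \<Longrightarrow> g w \<notin> \<int>"
    using last_int[OF g x] by blast
  obtain k where k: "g b = of_int k" using b(3) by (auto elim: Ints_cases)
  obtain n :: int where n: "g' b = g b + 2 * of_int n" using coupled_parity[OF c b(3)] by blast
  then have k': "g' b = of_int (k + 2 * n)" by (simp add: k)
  have v: "vtx g t = k" using vtx_after_last_int[OF g b(2) k b(4)] .
  have v': "vtx g' t = k + 2 * n"
    by (rule vtx_after_last_int[OF g' b(2) k']) (use b(4) coupled_int[OF c] in auto)
  have "g' t - g' b = (if flipped m g t then - 1 else 1) * (g t - g b)"
  proof (rule coupled_move[OF c b(2)])
    fix w assume w: "b \<le> w" "w \<le> t"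
    show "g w \<in> \<int> \<or> (flipped m g w \<longleftrightarrow> flipped m g t)"
    proof (cases "w = b")
      case False
      then show ?thesis using flipped_excursion_const[OF g w(2)] b(4) w by auto
    qed (use b in simp)
  qed
  then show "g' t - vtx g' t = (if flipped m g t then - 1 else 1) * (g t - vtx g t)"
    by (simp only: v v' k k')
  show "even (vtx g' t - vtx g t)" by (simp add: v v')
  show "\<exists>b. x \<le> b \<and> b \<le> t \<and> g' b = vtx g' t" using b k' v' by auto
qed

lemma coupled_next:
  assumes c: "coupled m g g'" and ab: "a \<le> b" "g b = of_int k"
    and ni: "\<And>w. a \<le> w \<Longrightarrow> w < b \<Longrightarrow> g w \<notin> \<int>" and x: "x \<le> a" "g x \<in> \<int>"
  shows "g' b - vtx g' a = (if flipped m g a then - 1 else 1) * (k - vtx g a)"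
proof -
  have g: "continuous_on UNIV g" using c by (auto simp: coupled_def)
  have "g' b - g' a = (if flipped m g a then - 1 else 1) * (g b - g a)"
  proof (rule coupled_move[OF c ab(1)])
    fix w assume w: "a \<le> w" "w \<le> b"
    show "g w \<in> \<int> \<or> (flipped m g w \<longleftrightarrow> flipped m g a)"
    proof (cases "w = b")
      case False
      then show ?thesis using flipped_excursion_const[OF g w(1)] ni w by auto
    qed (use ab in simp)
  qed
  with coupled_vtx(1)[OF c x] ab(2) show ?thesis by (auto split: if_splits)
qed

lemma coupled_crs:
  assumes c: "coupled m g g'" and x: "x \<le> t" "g x \<in> \<int>"
  shows "crs g' t = crs g t"
proof (cases "\<exists>u\<ge>t. g u \<in> \<int>")
  case False
  then show ?thesis using crs_imp_next_int[of g t] crs_imp_next_int[of g' t] coupled_int[OF c] by blast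
next
  case True
  have g: "continuous_on UNIV g" and g': "continuous_on UNIV g'" using c by (auto simp: coupled_def)
  from True obtain u where "t \<le> u" "g u \<in> \<int>" by auto
  then obtain b where b: "t \<le> b" "b \<le> u" "g b \<in> \<int>" "\<And>w. t \<le> w \<Longrightarrow> w < b \<Longrightarrow> g w \<notin> \<int>"
    using first_int[OF g] by blast
  obtain k where k: "g b = of_int k" using b(3) by (auto elim: Ints_cases)
  have "g' b \<in> \<int>" using coupled_int[OF c, of b] b(3) by simp
  then obtain k' where k': "g' b = of_int k'" by (auto elim: Ints_cases)
  have "crs g t \<longleftrightarrow> vtx g t \<noteq> k" using next_int_vtx(2)[OF g b(1) k b(4)] .
  moreover have "crs g' t \<longleftrightarrow> vtx g' t \<noteq> k'"
    by (rule next_int_vtx(2)[OF g' b(1) k']) (use b(4) coupled_int[OF c] in auto)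
  moreover have "of_int k' - of_int (vtx g' t) = (if flipped m g t then - 1 else 1) * (of_int k - of_int (vtx g t) :: real)"
    using coupled_next[OF c b(1) k b(4) x] k' by simp
  ultimately show ?thesis by (auto split: if_splits)
qed

text \<open>
  Short intervals contain at most one step of the walk, and the coupled walk makes the
  same step up to sign.
\<close>

lemma coupled_step:
  assumes c: "coupled m g g'" and past: "\<And>T. \<exists>x\<le>T. g x \<in> \<int>"
  shows "\<exists>d>0. \<forall>a b. a \<le> x \<longrightarrow> x \<le> b \<longrightarrow> b - a < d \<longrightarrow>
    \<bar>vtx g b - vtx g a\<bar> \<le> 1 \<and> vtx g' b - vtx g' a =
      (if vtx g a mod (2 * int m) < int m then 1 else - 1) * (vtx g b - vtx g a)"
proof (cases "g x \<in> \<int>")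
  case False
  have g: "continuous_on UNIV g" and g': "continuous_on UNIV g'" using c by (auto simp: coupled_def)
  obtain d where d: "d > 0" "\<And>w. \<bar>w - x\<bar> < d \<Longrightarrow> vtx g w = vtx g x"
    using near_const[OF g False] by blast
  obtain d' where d': "d' > 0" "\<And>w. \<bar>w - x\<bar> < d' \<Longrightarrow> vtx g' w = vtx g' x"
    using near_const[OF g'] False coupled_int[OF c] by blast
  show ?thesis
  proof (intro exI[of _ "min d d'"] conjI[of "0 < min d d'"] allI impI)
    fix a b assume ab: "a \<le> x" "x \<le> b" "b - a < min d d'"
    have "vtx g a = vtx g x" "vtx g b = vtx g x" "vtx g' a = vtx g' x" "vtx g' b = vtx g' x"
      using d(2)[of a] d(2)[of b] d'(2)[of a] d'(2)[of b] ab by auto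
    then show "\<bar>vtx g b - vtx g a\<bar> \<le> 1 \<and> vtx g' b - vtx g' a =
      (if vtx g a mod (2 * int m) < int m then 1 else - 1) * (vtx g b - vtx g a)" by simp
  qed (use d d' in simp)
next
  case True
  have g: "continuous_on UNIV g" and g': "continuous_on UNIV g'" using c by (auto simp: coupled_def)
  obtain k where k: "g x = of_int k" using True by (auto elim: Ints_cases)
  have "g' x \<in> \<int>" using coupled_int[OF c, of x] True by simp
  then obtain k' where k': "g' x = of_int k'" by (auto elim: Ints_cases)
  obtain d where d: "d > 0" "\<And>w. \<bar>w - x\<bar> < d \<Longrightarrow> \<bar>g w - k\<bar> < 1"
    using near_int_neighbourhood[OF g zero_less_one, of x] k by auto
  obtain d' where d': "d' > 0" "\<And>w. \<bar>w - x\<bar> < d' \<Longrightarrow> \<bar>g' w - k'\<bar> < 1"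
    using near_int_neighbourhood[OF g' zero_less_one, of x] k' by auto
  show ?thesis
  proof (intro exI[of _ "min d d'"] conjI[of "0 < min d d'"] allI impI)
    fix a b assume ab: "a \<le> x" "x \<le> b" "b - a < min d d'"
    have vb: "vtx g b = k" by (rule vtx_near_int[where x = x]) (use k d(2) ab in auto)
    have vb': "vtx g' b = k'" by (rule vtx_near_int[where x = x]) (use k' d'(2) ab in auto)
    obtain e where e: "a \<le> e" "e \<le> x" "g e \<in> \<int>" "\<And>w. a \<le> w \<Longrightarrow> w < e \<Longrightarrow> g w \<notin> \<int>"
      using first_int[OF g ab(1) True] by blast
    have ge: "g e = of_int k"
      using e(3) d(2)[of e] e ab by (auto elim!: Ints_cases)
    have "g' e \<in> \<int>" using e(3) coupled_int[OF c] by simp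
    then have ge': "g' e = of_int k'"
      using d'(2)[of e] e ab by (auto elim!: Ints_cases)
    note nv = next_int_vtx[OF g e(1) ge e(4)]
    obtain x0 where x0: "x0 \<le> a" "g x0 \<in> \<int>" using past by blast
    have "of_int k' - of_int (vtx g' a) = (if flipped m g a then - 1 else 1) * (of_int k - of_int (vtx g a) :: real)"
      using coupled_next[OF c e(1) ge e(4) x0] ge' by simp
    then have "real_of_int (k' - vtx g' a) = of_int ((if flipped m g a then - 1 else 1) * (k - vtx g a))"
      by simp
    then have *: "k' - vtx g' a = (if flipped m g a then - 1 else 1) * (k - vtx g a)"
      by (simp only: of_int_eq_iff)
    show "\<bar>vtx g b - vtx g a\<bar> \<le> 1 \<and> vtx g' b - vtx g' a =
      (if vtx g a mod (2 * int m) < int m then 1 else - 1) * (vtx g b - vtx g a)"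
      using nv * by (auto simp: vb vb' flipped_def)
  qed (use d d' in simp)
qed

text \<open>
  Induction along an interval: an invariant survives the passage of a vertex because it survives
  one step of the walk.
\<close>

lemma coupled_invariant:
  fixes Inv :: "int \<Rightarrow> int \<Rightarrow> bool"
  assumes c: "coupled m g g'" and past: "\<And>T. \<exists>x\<le>T. g x \<in> \<int>" and vt: "v \<le> t"
    and init: "Inv (vtx g v) (vtx g' v)"
    and step: "\<And>a b s. v \<le> a \<Longrightarrow> a \<le> b \<Longrightarrow> b \<le> t \<Longrightarrow> Inv (vtx g a) (vtx g' a) \<Longrightarrow> s = 1 \<or> s = - 1 \<Longrightarrow>
      vtx g b = vtx g a + s \<Longrightarrow>
      vtx g' b = vtx g' a + (if vtx g a mod (2 * int m) < int m then s else - s) \<Longrightarrow>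
      Inv (vtx g b) (vtx g' b)"
  shows "Inv (vtx g t) (vtx g' t)"
proof -
  let ?I = "\<lambda>u. Inv (vtx g u) (vtx g' u)"
  define P where "P a b \<longleftrightarrow> (v \<le> a \<and> b \<le> t \<longrightarrow> ?I a \<longrightarrow> ?I b)" for a b
  have "P v t"
  proof (rule Bolzano[OF vt])
    fix a b c assume "P a b" "P b c" "a \<le> b" "b \<le> c"
    then show "P a c" by (auto simp: P_def)
  next
    fix x
    obtain d where d: "d > 0" "\<And>a b. a \<le> x \<Longrightarrow> x \<le> b \<Longrightarrow> b - a < d \<Longrightarrow>
      \<bar>vtx g b - vtx g a\<bar> \<le> 1 \<and> vtx g' b - vtx g' a =
      (if vtx g a mod (2 * int m) < int m then 1 else - 1) * (vtx g b - vtx g a)"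
      using coupled_step[OF c past] by blast
    show "\<exists>d>0. \<forall>a b. a \<le> x \<and> x \<le> b \<and> b - a < d \<longrightarrow> P a b"
      unfolding P_def
    proof (intro exI[of _ d] conjI allI impI)
      fix a b assume ab: "a \<le> x \<and> x \<le> b \<and> b - a < d" and r: "v \<le> a \<and> b \<le> t" and I: "?I a"
      note D = d(2)[of a b]
      define s where "s = vtx g b - vtx g a"
      have s: "\<bar>s\<bar> \<le> 1" "vtx g' b = vtx g' a + (if vtx g a mod (2 * int m) < int m then 1 else - 1) * s"
        using D ab by (auto simp: s_def)
      show "?I b"
      proof (cases "s = 0")
        case True
        then show ?thesis using s I by (simp add: s_def)
      next
        case False
        then have s1: "s = 1 \<or> s = - 1" using s(1) by auto
        show ?thesis
          by (rule step[of a b s, OF _ _ _ I s1]) (use r ab s in \<open>auto simp: s_def\<close>)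
      qed
    qed (use d in simp)
  qed
  then show ?thesis using init by (simp add: P_def)
qed

lemma vtx_near_strict: "\<bar>g t - vtx g t\<bar> < 1"
proof (cases "g t \<in> \<int>")
  case True
  then show ?thesis by (auto elim!: Ints_cases simp: vtx_int)
next
  case False
  then have "g t \<noteq> \<lfloor>g t\<rfloor>" by (metis Ints_of_int)
  then show ?thesis using vtx_floor[of g t] by linarith
qed

text \<open>
  The last time at which the path was not strictly between \<open>a\<close> and \<open>b\<close>.
\<close>

lemma last_exit:
  fixes g :: "real \<Rightarrow> real"
  assumes g: "continuous_on UNIV g" and t: "a < g t" "g t < b" and w: "w \<le> t" "g w \<le> a \<or> b \<le> g w"
  obtains u where "w \<le> u" "u \<le> t" "(g u = a \<and> (\<forall>x\<in>{u..t}. g x \<noteq> b)) \<or> (g u = b \<and> (\<forall>x\<in>{u..t}. g x \<noteq> a))"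
proof -
  let ?S = "{w..t} \<inter> {u. g u = a \<or> g u = b}"
  have "closed {u. g u = a \<or> g u = b}"
    using g by (intro closed_Collect_disj closed_Collect_eq) auto
  then have "compact ?S" by (intro compact_Int_closed) auto
  moreover have "?S \<noteq> {}"
    using w(2)
  proof
    assume "g w \<le> a"
    then obtain u where "w \<le> u" "u \<le> t" "g u = a" 
      using IVT_up[OF g w(1)] t(1) by (blast intro: less_imp_le)
    then show ?thesis by auto
  next
    assume "b \<le> g w"
    then obtain u where "w \<le> u" "u \<le> t" "g u = b" 
      using IVT_down[OF g w(1)] t(2) by (blast intro: less_imp_le)
    then show ?thesis by auto
  qed
  ultimately obtain u where u: "u \<in> ?S" "\<And>x. x \<in> ?S \<Longrightarrow> x \<le> u"
    using compact_attains_sup[of ?S] by blast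
  have *: "g x \<noteq> a \<and> g x \<noteq> b" if "u < x" "x \<le> t" for x
    using u(2)[of x] u(1) that by auto
  have "(g u = a \<and> (\<forall>x\<in>{u..t}. g x \<noteq> b)) \<or> (g u = b \<and> (\<forall>x\<in>{u..t}. g x \<noteq> a))"
  proof -
    have "g x \<noteq> a" if "g u = b" "x \<in> {u..t}" for x using *[of x] that t by (cases "x = u") auto
    moreover have "g x \<noteq> b" if "g u = a" "x \<in> {u..t}" for x using *[of x] that t by (cases "x = u") auto
    ultimately show ?thesis using u(1) by blast
  qed
  with u(1) show ?thesis by (intro that[of u]) auto
qed

text \<open>
  A path whose range is at least \<open>m\<close> cannot have stayed strictly between two points at
  distance \<open>m\<close>, so one of the two was hit, and one of them last.
\<close>

lemma wide_past_exit:
  fixes g :: "real \<Rightarrow> real"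
  assumes g: "continuous_on UNIV g" and uv: "u \<le> t" "v \<le> t" "real m \<le> g u - g v"
    and \<theta>: "1 \<le> \<theta>" "\<theta> < int m"
  shows "\<exists>w\<ge>min u v. w \<le> t \<and>
    ((g w = of_int (vtx g t - \<theta>) \<and> (\<forall>x\<in>{w..t}. g x \<noteq> of_int (vtx g t - \<theta> + int m))) \<or>
     (g w = of_int (vtx g t - \<theta> + int m) \<and> (\<forall>x\<in>{w..t}. g x \<noteq> of_int (vtx g t - \<theta>))))"
proof -
  let ?a = "real_of_int (vtx g t - \<theta>)" and ?b = "real_of_int (vtx g t - \<theta> + int m)"
  have t: "?a < g t" "g t < ?b" using vtx_near_strict[of g t] \<theta> by auto
  have "(g u \<le> ?a \<or> ?b \<le> g u) \<or> (g v \<le> ?a \<or> ?b \<le> g v)" using uv(3) by auto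
  then obtain w where w: "min u v \<le> w" "w \<le> t" "g w \<le> ?a \<or> ?b \<le> g w"
    using uv(1,2) by (metis min.cobounded1 min.cobounded2)
  show ?thesis
    by (rule last_exit[OF g t w(2,3)]) (use w(1) in \<open>meson order_trans\<close>)
qed

text \<open>
  At a visit to \<open>l\<close>, the frame of every clamped walk with the given steps has its bottom
  at or below \<open>l\<close>; at a visit to \<open>l + m\<close> it has its bottom above \<open>l\<close>; and between such
  visits the side cannot change. A past of range \<open>m\<close> contains one of these visits for each
  relevant \<open>l\<close>. It therefore determines the level of every such walk, wherever it started,
  and the folded position of the original walk is one of them.
\<close>

lemma coupled_level:
  assumes c: "coupled m g g'" and past: "\<And>T. \<exists>x\<le>T. g x \<in> \<int>" and m: "m > 0"
    and wide: "u \<le> t" "v \<le> t" "real m \<le> g' u - g' v"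
  shows "level m g' t = fold_vertex m (vtx g t)"
proof (rule level_eqI[OF fold_vertex_bounds[OF m]])
  have g': "continuous_on UNIV g'" using c by (auto simp: coupled_def)
  fix \<theta> assume \<theta>: "1 \<le> \<theta>" "\<theta> < int m"
  define l where "l = vtx g' t - \<theta>"
  note fb = fold_vertex_bounds[OF m]
  note step = fold_vertex_step[OF m]
  have vertex_visited: "\<exists>b. w \<le> b \<and> b \<le> a \<and> g' b = of_int (vtx g' a)" if "w \<le> a" "g' w \<in> \<int>" for w a
    using coupled_vtx(3)[OF c that(1)] that(2) coupled_int[OF c] by auto
  have below: "\<theta> \<le> fold_vertex m (vtx g t)"
    if w: "w \<le> t" "g' w = of_int l" "\<forall>x\<in>{w..t}. g' x \<noteq> of_int (l + int m)" for w
  proof -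
    have lt: "vtx g' a < l + int m" if a: "w \<le> a" "a \<le> t" for a
    proof -
      obtain b where b: "w \<le> b" "b \<le> a" "g' b = of_int (vtx g' a)"
        using vertex_visited[OF a(1)] w(2) by auto
      have "g' b < of_int (l + int m)"
        by (rule stays_below[OF g' _ w(3)]) (use w b a m in auto)
      then show ?thesis using b(3) by linarith
    qed
    have "vtx g' t - l \<le> fold_vertex m (vtx g t)"
    proof (rule coupled_invariant[OF c past w(1), where Inv = "\<lambda>p k. k - l \<le> fold_vertex m p"])
      show "vtx g' w - l \<le> fold_vertex m (vtx g w)"
        using vtx_int[of g' w] w(2) fb by simp
      fix a b s
      assume "w \<le> a" "a \<le> b" "b \<le> t" "vtx g' a - l \<le> fold_vertex m (vtx g a)"
        "s = 1 \<or> s = - 1" "vtx g b = vtx g a + s"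
        "vtx g' b = vtx g' a + (if vtx g a mod (2 * int m) < int m then s else - s)"
      then show "vtx g' b - l \<le> fold_vertex m (vtx g b)"
        using lt[of b] step[OF \<open>s = 1 \<or> s = - 1\<close> refl, of "vtx g a"] fb[of "vtx g b"]
        by (auto simp: min_def max_def split: if_splits)
    qed
    then show ?thesis by (simp add: l_def)
  qed
  have above: "fold_vertex m (vtx g t) < \<theta>"
    if w: "w \<le> t" "g' w = of_int (l + int m)" "\<forall>x\<in>{w..t}. g' x \<noteq> of_int l" for w
  proof -
    have lt: "l < vtx g' a" if a: "w \<le> a" "a \<le> t" for a
    proof -
      obtain b where b: "w \<le> b" "b \<le> a" "g' b = of_int (vtx g' a)"
        using vertex_visited[OF a(1)] w(2) by auto
      have "g' b > of_int l"
        by (rule stays_above[OF g' _ w(3)]) (use w b a m in auto)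
      then show ?thesis using b(3) by linarith
    qed
    have "fold_vertex m (vtx g t) < vtx g' t - l"
    proof (rule coupled_invariant[OF c past w(1), where Inv = "\<lambda>p k. fold_vertex m p < k - l"])
      show "fold_vertex m (vtx g w) < vtx g' w - l"
        using vtx_int[of g' w, OF w(2)] fb[of "vtx g w"] by simp
      fix a b s
      assume "w \<le> a" "a \<le> b" "b \<le> t" "fold_vertex m (vtx g a) < vtx g' a - l"
        "s = 1 \<or> s = - 1" "vtx g b = vtx g a + s"
        "vtx g' b = vtx g' a + (if vtx g a mod (2 * int m) < int m then s else - s)"
      then show "fold_vertex m (vtx g b) < vtx g' b - l"
        using lt[of b] step[OF \<open>s = 1 \<or> s = - 1\<close> refl, of "vtx g a"] fb[of "vtx g b"]
        by (auto simp: min_def max_def split: if_splits)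
    qed
    then show ?thesis by (simp add: l_def)
  qed
  obtain w where w: "w \<le> t"
    "(g' w = of_int l \<and> (\<forall>x\<in>{w..t}. g' x \<noteq> of_int (l + int m))) \<or>
     (g' w = of_int (l + int m) \<and> (\<forall>x\<in>{w..t}. g' x \<noteq> of_int l))"
    using wide_past_exit[OF g' wide \<theta>] unfolding l_def by blast
  show "before g' t (of_int (vtx g' t - \<theta>)) (of_int (vtx g' t - \<theta> + int m)) \<longleftrightarrow>
      \<theta> \<le> fold_vertex m (vtx g t)"
    unfolding l_def[symmetric]
  proof
    assume "before g' t (of_int l) (of_int (l + int m))"
    then show "\<theta> \<le> fold_vertex m (vtx g t)" using below by (auto simp: before_def)
  next
    assume "\<theta> \<le> fold_vertex m (vtx g t)"
    then show "before g' t (of_int l) (of_int (l + int m))"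
      using w above[of w] by (auto simp: before_def)
  qed
qed

text \<open>
  The level gives the vertex modulo \<open>2 * m\<close>, and the excursion keeps its absolute value
  and its kind, so that the flip can be undone.
\<close>

lemma decode_coupled:
  assumes c: "coupled m g g'" and past: "\<And>T. \<exists>x\<le>T. g x \<in> \<int>" and m: "m > 0"
    and wide: "u \<le> t" "v \<le> t" "real m \<le> g' u - g' v"
  obtains n :: int where "decode m g' t = g t + real_of_int n * (2 * real m)"
proof -
  obtain x where x: "x \<le> t" "g x \<in> \<int>" using past by blast
  have P: "place m g' t = vtx g t mod (2 * int m)"
    unfolding place_def coupled_level[OF assms]
    by (rule unfold_fold[OF m coupled_vtx(2)[OF c x]])
  have "vtx g t mod (2 * int m) = vtx g t - (vtx g t div (2 * int m)) * (2 * int m)"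
    by (simp add: minus_div_mult_eq_mod)
  then have "real_of_int (vtx g t mod (2 * int m)) = vtx g t - (vtx g t div (2 * int m)) * (2 * int m)"
    by (simp only:)
  moreover have "(crs g' t \<and> int m \<le> place m g' t) = flipped m g t"
    using coupled_crs[OF c x] P by (simp add: flipped_def)
  ultimately have "decode m g' t = g t + real_of_int (- (vtx g t div (2 * int m))) * (2 * real m)"
    using coupled_vtx(1)[OF c x] by (simp add: decode_def P)
  then show ?thesis using that by blast
qed

section \<open>Measurability of the crossing data\<close>

definition continuous_process :: "'a measure \<Rightarrow> ('a \<Rightarrow> real \<Rightarrow> real) \<Rightarrow> bool" where
  "continuous_process N g \<longleftrightarrow>
     (\<forall>x\<in>space N. continuous_on UNIV (g x)) \<and> (\<forall>t. (\<lambda>x. g x t) \<in> borel_measurable N)"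

lemma hits_iff_rational:
  fixes g :: "real \<Rightarrow> real"
  assumes g: "continuous_on UNIV g" and st: "s \<le> t"
  shows "(\<exists>v\<in>{s..t}. g v = a) \<longleftrightarrow>
    (\<forall>n::nat. \<exists>q\<in>(\<rat> \<union> {s, t}) \<inter> {s..t}. \<bar>g q - a\<bar> < 1 / Suc n)"
proof
  assume "\<exists>v\<in>{s..t}. g v = a"
  then obtain v where v: "s \<le> v" "v \<le> t" "g v = a" by auto
  show "\<forall>n::nat. \<exists>q\<in>(\<rat> \<union> {s, t}) \<inter> {s..t}. \<bar>g q - a\<bar> < 1 / Suc n"
  proof
    fix n :: nat
    show "\<exists>q\<in>(\<rat> \<union> {s, t}) \<inter> {s..t}. \<bar>g q - a\<bar> < 1 / Suc n"
    proof (cases "v = s \<or> v = t")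
      case True
      then show ?thesis using v st by (intro bexI[of _ v]) auto
    next
      case False
      obtain d where d: "d > 0" "\<And>w. \<bar>w - v\<bar> < d \<Longrightarrow> \<bar>g w - g v\<bar> < 1 / Suc n"
        using near_int_neighbourhood[OF g, of "1 / Suc n" v] by auto
      obtain q where q: "q \<in> \<rat>" "v < q" "q < min t (v + d)"
        using Rats_dense_in_real[of v "min t (v + d)"] False v d(1) by auto
      then show ?thesis using d(2)[of q] v by (intro bexI[of _ q]) auto
    qed
  qed
next
  assume *: "\<forall>n::nat. \<exists>q\<in>(\<rat> \<union> {s, t}) \<inter> {s..t}. \<bar>g q - a\<bar> < 1 / Suc n"
  have "continuous_on {s..t} (\<lambda>v. \<bar>g v - a\<bar>)"
    using cont_sub[OF g] by (intro continuous_intros)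
  then obtain v where v: "v \<in> {s..t}" "\<And>w. w \<in> {s..t} \<Longrightarrow> \<bar>g v - a\<bar> \<le> \<bar>g w - a\<bar>"
    using continuous_attains_inf[of "{s..t}" "\<lambda>v. \<bar>g v - a\<bar>"] st by auto
  have "g v = a"
  proof (rule ccontr)
    assume "g v \<noteq> a"
    then obtain n :: nat where "1 / Suc n < \<bar>g v - a\<bar>"
      using nat_approx_posE[of "\<bar>g v - a\<bar>"] by auto
    moreover from * obtain q where "q \<in> {s..t}" "\<bar>g q - a\<bar> < 1 / Suc n" by blast
    ultimately show False using v(2)[of q] by linarith
  qed
  with v(1) show "\<exists>v\<in>{s..t}. g v = a" by blast
qed

text \<open>
  By compactness a value is attained on an interval if it is approximated at rational
  times.
\<close>

lemma measurable_hits: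
  assumes g: "continuous_process N g" and st: "s \<le> t"
  shows "Measurable.pred N (\<lambda>x. \<exists>v\<in>{s..t}. g x v = a)"
proof -
  have [measurable]: "(\<lambda>x. g x t) \<in> borel_measurable N" for t
    using g by (simp add: continuous_process_def)
  have "countable ((\<rat> \<union> {s, t}) \<inter> {s..t})"
    by (intro countable_Int1 countable_Un countable_rat) auto
  then have "Measurable.pred N (\<lambda>x. \<forall>n::nat. \<exists>q\<in>(\<rat> \<union> {s, t}) \<inter> {s..t}. \<bar>g x q - a\<bar> < 1 / Suc n)"
    by measurable
  then show ?thesis
    by (subst measurable_cong[OF hits_iff_rational[OF _ st]])
      (use g in \<open>auto simp: continuous_process_def\<close>)
qed

lemma before_iff_rational:
  fixes g :: "real \<Rightarrow> real"
  assumes g: "continuous_on UNIV g"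
  shows "before g t a b \<longleftrightarrow> (\<exists>s\<in>\<rat> \<inter> {..t}. (\<exists>v\<in>{s..t}. g v = a) \<and> \<not> (\<exists>v\<in>{s..t}. g v = b))"
proof
  assume "before g t a b"
  then obtain v where v: "v \<le> t" "g v = a" "\<forall>w\<in>{v..t}. g w \<noteq> b"
    by (auto simp: before_def)
  then have "\<bar>a - b\<bar> > 0" by auto
  then obtain d where d: "d > 0" "\<And>w. \<bar>w - v\<bar> < d \<Longrightarrow> \<bar>g w - g v\<bar> < \<bar>a - b\<bar>"
    using near_int_neighbourhood[OF g, of "\<bar>a - b\<bar>" v] by auto
  obtain s where s: "s \<in> \<rat>" "v - d < s" "s < v"
    using Rats_dense_in_real[of "v - d" v] d(1) by auto
  have "g w \<noteq> b" if "w \<in> {s..t}" for w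
    using d(2)[of w] v s that by (cases "w < v") auto
  then show "\<exists>s\<in>\<rat> \<inter> {..t}. (\<exists>v\<in>{s..t}. g v = a) \<and> \<not> (\<exists>v\<in>{s..t}. g v = b)"
    using s v by (intro bexI[of _ s]) (auto intro!: bexI[of _ v])
next
  assume "\<exists>s\<in>\<rat> \<inter> {..t}. (\<exists>v\<in>{s..t}. g v = a) \<and> \<not> (\<exists>v\<in>{s..t}. g v = b)"
  then show "before g t a b" by (fastforce simp: before_def)
qed

lemma measurable_before_const:
  assumes g: "continuous_process N g"
  shows "Measurable.pred N (\<lambda>x. before (g x) t a b)"
proof -
  have [measurable]: "Measurable.pred N (\<lambda>x. \<exists>v\<in>{s..t}. g x v = a)" if "s \<in> \<rat> \<inter> {..t}" for s a
    using measurable_hits[OF g] that by auto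
  have "countable (\<rat> \<inter> {..t})" by (intro countable_Int1 countable_rat)
  then have "Measurable.pred N (\<lambda>x. \<exists>s\<in>\<rat> \<inter> {..t}. (\<exists>v\<in>{s..t}. g x v = a) \<and> \<not> (\<exists>v\<in>{s..t}. g x v = b))"
    by measurable
  then show ?thesis
    by (subst measurable_cong[OF before_iff_rational]) (use g in \<open>auto simp: continuous_process_def\<close>)
qed

lemma measurable_before:
  assumes g: "continuous_process N g"
    and A: "A \<in> N \<rightarrow>\<^sub>M count_space UNIV" and B: "B \<in> N \<rightarrow>\<^sub>M count_space UNIV"
  shows "Measurable.pred N (\<lambda>x. before (g x) t (of_int (A x :: int)) (of_int (B x :: int)))"
proof (rule measurable_compose_countable[OF _ A])
  fix a
  show "Measurable.pred N (\<lambda>x. before (g x) t (of_int a) (of_int (B x)))"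
    by (rule measurable_compose_countable[OF _ B]) (rule measurable_before_const[OF g])
qed

lemma continuous_process_reverse:
  assumes "continuous_process N g" shows "continuous_process N (\<lambda>x t. g x (- t))"
  unfolding continuous_process_def
proof (intro conjI ballI allI)
  fix x assume "x \<in> space N"
  then have "continuous_on UNIV (g x)" using assms by (simp add: continuous_process_def)
  then show "continuous_on UNIV (\<lambda>t. g x (- t))"
    by (rule continuous_on_compose2[where t = UNIV]) (auto intro: continuous_intros)
qed (use assms in \<open>simp add: continuous_process_def\<close>)

lemma measurable_after:
  assumes g: "continuous_process N g"
    and "A \<in> N \<rightarrow>\<^sub>M count_space UNIV" "B \<in> N \<rightarrow>\<^sub>M count_space UNIV"
  shows "Measurable.pred N (\<lambda>x. after (g x) t (of_int (A x :: int)) (of_int (B x :: int)))"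
  unfolding after_eq_before using measurable_before[OF continuous_process_reverse[OF g] assms(2,3)] .

lemma measurable_discrete:
  assumes "f \<in> N \<rightarrow>\<^sub>M count_space UNIV"
  shows "(\<lambda>x. h (f x)) \<in> N \<rightarrow>\<^sub>M count_space UNIV"
  by (rule measurable_compose[OF assms]) simp

lemma measurable_discrete2:
  fixes f :: "'a \<Rightarrow> 'b :: countable"
  assumes "f \<in> N \<rightarrow>\<^sub>M count_space UNIV" "f' \<in> N \<rightarrow>\<^sub>M count_space UNIV"
  shows "(\<lambda>x. h (f x) (f' x)) \<in> N \<rightarrow>\<^sub>M count_space UNIV"
  by (rule measurable_compose_countable[OF measurable_discrete[OF assms(2)] assms(1)])

context
  fixes N :: "'a measure" and g :: "'a \<Rightarrow> real \<Rightarrow> real"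
  assumes g: "continuous_process N g"
begin

lemma measurable_process_floor: "(\<lambda>x. \<lfloor>g x t\<rfloor>) \<in> N \<rightarrow>\<^sub>M count_space UNIV"
proof -
  have [measurable]: "(\<lambda>x. g x t) \<in> borel_measurable N"
    using g by (simp add: continuous_process_def)
  show ?thesis by measurable
qed

lemma measurable_vtx: "(\<lambda>x. vtx (g x) t) \<in> N \<rightarrow>\<^sub>M count_space UNIV"
proof -
  note fl = measurable_process_floor[of t]
  note bf = measurable_before[OF g fl measurable_discrete[OF fl, of "\<lambda>k. k + 1"], of t]
  show ?thesis
    unfolding vtx_def
    by (rule measurable_discrete2[OF bf fl, of "\<lambda>b k. if b then k else k + 1"])
qed

lemma measurable_crs: "Measurable.pred N (\<lambda>x. crs (g x) t)"
proof -
  note fl = measurable_process_floor[of t]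
  note fl1 = measurable_discrete[OF fl, of "\<lambda>k. k + 1"]
  note v = measurable_discrete2[OF measurable_vtx[of t] fl, of "(=)"]
  have "Measurable.pred N (\<lambda>x. (\<lambda>b (c, d). if b then c else d) (vtx (g x) t = \<lfloor>g x t\<rfloor>)
      (after (g x) t (of_int (\<lfloor>g x t\<rfloor> + 1)) (of_int \<lfloor>g x t\<rfloor>),
       after (g x) t (of_int \<lfloor>g x t\<rfloor>) (of_int (\<lfloor>g x t\<rfloor> + 1))))"
    by (rule measurable_discrete2[OF v], rule measurable_discrete2[of _ _ _ Pair])
      (rule measurable_after[OF g fl1 fl] measurable_after[OF g fl fl1])+
  then show ?thesis
    unfolding crs_def by (simp only: prod.case)
qed

lemma measurable_flipped: "Measurable.pred N (\<lambda>x. flipped m (g x) t)"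
  unfolding flipped_def
  by (rule measurable_discrete2[OF measurable_crs[of t] measurable_vtx[of t],
    of "\<lambda>b k. b \<and> int m \<le> k mod (2 * int m)"])

lemma measurable_level: "(\<lambda>x. level m (g x) t) \<in> N \<rightarrow>\<^sub>M count_space UNIV"
proof -
  let ?P = "\<lambda>\<theta> x. before (g x) t (of_int (vtx (g x) t - \<theta>)) (of_int (vtx (g x) t - \<theta> + int m))"
  have P: "Measurable.pred N (?P \<theta>)" for \<theta>
    by (rule measurable_before[OF g])
      (rule measurable_discrete[OF measurable_vtx[of t], of "\<lambda>k. k - \<theta>"]
        measurable_discrete[OF measurable_vtx[of t], of "\<lambda>k. k - \<theta> + int m"])+
  have "(\<lambda>x. \<Sum>\<theta>\<in>S. if ?P \<theta> x then 1 else 0 :: int) \<in> N \<rightarrow>\<^sub>M count_space UNIV" if "finite S" for S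
    using that
  proof (induction S)
    case (insert \<theta> S)
    have "(\<lambda>x. (if ?P \<theta> x then 1 else 0) + (\<Sum>\<theta>\<in>S. if ?P \<theta> x then 1 else 0 :: int)) \<in> N \<rightarrow>\<^sub>M count_space UNIV"
      by (rule measurable_discrete2[OF P[of \<theta>] insert.IH, of "\<lambda>b k. (if b then 1 else 0) + k"])
    then show ?case using insert.hyps by simp
  qed simp
  moreover have "level m (g x) t = (\<Sum>\<theta>\<in>{1..<int m}. if ?P \<theta> x then 1 else 0)" for x
    unfolding level_def by (subst sum.If_cases) (auto simp: Int_def)
  ultimately show ?thesis by (simp only: finite_atLeastLessThan_int)
qed

lemma measurable_decode: "(\<lambda>x. decode m (g x) t) \<in> borel_measurable N"
proof -
  have [measurable]: "(\<lambda>x. g x t) \<in> borel_measurable N"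
    using g by (simp add: continuous_process_def)
  have p: "(\<lambda>x. place m (g x) t) \<in> N \<rightarrow>\<^sub>M count_space UNIV"
    unfolding place_def by (rule measurable_discrete2[OF measurable_level measurable_vtx])
  have b: "Measurable.pred N (\<lambda>x. crs (g x) t \<and> int m \<le> place m (g x) t)"
    by (rule measurable_discrete2[OF measurable_crs p, of "\<lambda>b k. b \<and> int m \<le> k"])
  have [measurable]: "(\<lambda>x. real_of_int (place m (g x) t)) \<in> borel_measurable N"
    "(\<lambda>x. real_of_int (vtx (g x) t)) \<in> borel_measurable N"
    "(\<lambda>x. if crs (g x) t \<and> int m \<le> place m (g x) t then - 1 else 1 :: real) \<in> borel_measurable N"
    by (rule measurable_compose[OF p], simp, rule measurable_compose[OF measurable_vtx], simp,
      rule measurable_compose[OF b, of "\<lambda>b. if b then - 1 else 1"], simp)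
  show ?thesis unfolding decode_def by measurable
qed

end

section \<open>The codings as maps of path spaces\<close>

definition unit_lift :: "real \<Rightarrow> nat \<Rightarrow> (real \<Rightarrow> real) \<Rightarrow> real \<Rightarrow> real" where
  "unit_lift H m f t = lift (2 * real m * H) f t / H"

definition flip_path :: "real \<Rightarrow> (real \<Rightarrow> bool) \<Rightarrow> (real \<Rightarrow> real) \<Rightarrow> real \<Rightarrow> real" where
  "flip_path H S f t = (if S t then - f t else f t) rmod (2 * H)"

definition fold_path :: "real \<Rightarrow> nat \<Rightarrow> (real \<Rightarrow> real) \<Rightarrow> real \<Rightarrow> real" where
  "fold_path H m f = flip_path H (flipped m (unit_lift H m f)) f"

definition unfold_path :: "real \<Rightarrow> nat \<Rightarrow> (real \<Rightarrow> real) \<Rightarrow> real \<Rightarrow> real" where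
  "unfold_path H m f t = (H * decode m (unit_lift H 1 f) t) rmod (2 * real m * H)"

lemma rmod_rmod_multiple:
  assumes "H > 0" "m > 0"
  shows "(x rmod (2 * real m * H)) rmod (2 * H) = x rmod (2 * H)"
proof -
  obtain n :: int where "x rmod (2 * real m * H) = x + of_int n * (2 * real m * H)"
    by (metis rcong_altdef rcong_def rmod_rmod)
  then have "x rmod (2 * real m * H) = x + of_int (n * int m) * (2 * H)"
    by (simp add: algebra_simps)
  then have "[x = x rmod (2 * real m * H)] (rmod (2 * H))"
    unfolding rcong_altdef by blast
  then show ?thesis by (simp add: rcong_def)
qed

context
  fixes H :: real and m :: nat
  assumes H: "H > 0" and m: "m > 0"
begin

private lemma L: "2 * real m * H > 0" using H m by simp

lemma continuous_unit_lift: "f \<in> circle_paths (2 * real m * H) \<Longrightarrow> continuous_on UNIV (unit_lift H m f)"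
  unfolding unit_lift_def using continuous_lift[OF L] H by (intro continuous_intros) auto

lemma unit_lift_rmod: "f \<in> circle_paths (2 * real m * H) \<Longrightarrow> (H * unit_lift H m f t) rmod (2 * real m * H) = f t"
  using lift_rmod[OF L] H by (simp add: unit_lift_def)

lemma continuous_process_unit_lift:
  "continuous_process (path_algebra (2 * real m * H)) (unit_lift H m)"
  unfolding continuous_process_def
proof (intro conjI ballI allI)
  fix f assume "f \<in> space (path_algebra (2 * real m * H))"
  then show "continuous_on UNIV (unit_lift H m f)"
    by (simp add: space_path_algebra continuous_unit_lift)
next
  fix t
  show "(\<lambda>f. unit_lift H m f t) \<in> borel_measurable (path_algebra (2 * real m * H))"
    unfolding unit_lift_def using borel_measurable_lift[OF L] by measurable
qed

lemma unit_lift_shift: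
  assumes g: "continuous_on UNIV g" and f: "\<And>t. f t = (H * g t) rmod (2 * real m * H)"
  obtains n :: int where "\<And>t. unit_lift H m f t = g t + of_int (n * (2 * int m))"
proof -
  have c: "continuous_on UNIV (\<lambda>t. H * g t)" using g by (intro continuous_intros)
  have f': "f = (\<lambda>t. (H * g t) rmod (2 * real m * H))" using f by blast
  obtain n :: int where "\<And>t. lift (2 * real m * H) f t = H * g t + of_int n * (2 * real m * H)"
    unfolding f' by (rule lift_rmod_path[OF L c]) blast
  then have "unit_lift H m f t = g t + of_int (n * (2 * int m))" for t
    using H by (simp add: unit_lift_def field_simps)
  then show ?thesis using that by blast
qed

lemma flipped_unit_lift:
  assumes "continuous_on UNIV g" "\<And>t. f t = (H * g t) rmod (2 * real m * H)"
  shows "flipped m (unit_lift H m f) t = flipped m g t"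
proof -
  obtain n :: int where "\<And>t. unit_lift H m f t = g t + of_int (n * (2 * int m))"
    using unit_lift_shift[OF assms] by blast
  then have "unit_lift H m f = (\<lambda>t. g t + of_int (n * (2 * int m)))" by auto
  then show ?thesis
    by (simp only: flipped_def vtx_space_shift crs_space_shift) simp
qed

end

lemma flip_path_cong:
  assumes "[f t = y] (rmod (2 * H))"
  shows "flip_path H S f t = (if S t then - y else y) rmod (2 * H)"
  using assms rcong_uminus[OF assms] by (auto simp: flip_path_def rcong_def)

text \<open>
  The lattice points are the fixed points of the reflection, so signs may be chosen freely on the
  excursions without breaking continuity.
\<close>

lemma flip_path_in_circle_paths:
  assumes H: "H > 0" and g: "continuous_on UNIV g" and f: "\<And>t. [f t = H * g t] (rmod (2 * H))"
    and S: "\<And>x. g x \<notin> \<int> \<Longrightarrow> \<exists>d>0. \<forall>w. \<bar>w - x\<bar> < d \<longrightarrow> S w = S x"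
  shows "flip_path H S f \<in> circle_paths (2 * H)"
proof -
  let ?F = "flip_path H S f"
  let ?c = "\<lambda>t. circ (2 * H) (H * g t)"
  have F: "circ (2 * H) (?F t) = (if S t then cnj (?c t) else ?c t)" for t
    using H flip_path_cong[of f t, OF f] by (simp add: circ_minus)
  have c: "continuous_on UNIV ?c" using g by (intro continuous_intros)
  have "isCont (\<lambda>t. circ (2 * H) (?F t)) x" for x
  proof (cases "g x \<in> \<int>")
    case False
    then obtain d where d: "d > 0" "\<And>w. \<bar>w - x\<bar> < d \<Longrightarrow> S w = S x" using S by blast
    have ev: "eventually (\<lambda>w. S w = S x) (nhds x)"
      unfolding eventually_nhds_metric dist_real_def using d by blast
    have "isCont (\<lambda>t. if S x then cnj (?c t) else ?c t) x"
      using c by (cases "S x") (auto simp: continuous_on_eq_continuous_at intro!: continuous_intros)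
    moreover have "eventually (\<lambda>w. circ (2 * H) (?F w) = (if S x then cnj (?c w) else ?c w)) (nhds x)"
      using ev by eventually_elim (simp add: F)
    ultimately show ?thesis
      using isCont_cong by fastforce
  next
    case True
    then obtain k where k: "g x = of_int k" by (auto elim: Ints_cases)
    have "[- (H * of_int k) = H * of_int k] (rmod (2 * H))"
      unfolding rcong_altdef by (intro exI[of _ k]) (simp add: algebra_simps)
    then have cnj: "cnj (?c x) = ?c x"
      using circ_eq_iff[of "2 * H"] H by (simp add: k flip: circ_minus)
    have "(\<lambda>t. circ (2 * H) (?F t)) \<midarrow>x\<rightarrow> circ (2 * H) (?F x)"
    proof (rule Lim_transform_bound[of _ "\<lambda>t. ?c t - ?c x", THEN LIM_zero_cancel])
      have "norm (cnj z - w) = norm (z - w)" if "cnj w = w" for z w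
      proof -
        have "cnj z - w = cnj (z - w)" using that by simp
        then show ?thesis by (simp only: complex_mod_cnj)
      qed
      then show "\<forall>\<^sub>F t in at x. norm (circ (2 * H) (?F t) - circ (2 * H) (?F x)) \<le> norm (?c t - ?c x)"
        using cnj by (intro always_eventually allI) (auto simp: F)
      show "(\<lambda>t. ?c t - ?c x) \<midarrow>x\<rightarrow> 0"
        using c by (simp add: continuous_on_eq_continuous_at isCont_def LIM_zero)
    qed
    then show ?thesis by (simp add: isCont_def)
  qed
  then have "continuous_on UNIV (\<lambda>t. circ (2 * H) (?F t))"
    by (simp add: continuous_on_eq_continuous_at)
  moreover have "0 \<le> ?F t \<and> ?F t < 2 * H" for t
    unfolding flip_path_def using H by (auto intro!: rmod_nonneg rmod_less)
  ultimately show ?thesis using H by (simp add: circle_paths_iff)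
qed

lemma continuous_circleI:
  fixes G g :: "real \<Rightarrow> real"
  assumes H: "H > 0" and L: "L > 0" and g: "continuous_on UNIV g"
    and *: "\<And>x. \<exists>d>0. \<forall>t. \<bar>t - x\<bar> < d \<longrightarrow>
      (\<exists>n::int. \<bar>G t - G x - of_int n * (L / H)\<bar> \<le> \<bar>g t - g x\<bar>)"
  shows "(\<lambda>t. (H * G t) rmod L) \<in> circle_paths L"
proof -
  have "isCont (\<lambda>t. circ L (H * G t)) x" for x
    unfolding isCont_def tendsto_iff
  proof (intro allI impI)
    fix e :: real assume e: "e > 0"
    have "continuous_on UNIV (circ L)" by (intro continuous_on_circ continuous_on_id)
    from continuous_on_iff[THEN iffD1, OF this, rule_format, OF UNIV_I e, of 0]
    obtain d1 where d1: "d1 > 0" "\<And>y. \<bar>y\<bar> < d1 \<Longrightarrow> dist (circ L y) (circ L 0) < e"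
      by (auto simp: dist_real_def)
    obtain d2 where d2: "d2 > 0" "\<And>w. \<bar>w - x\<bar> < d2 \<Longrightarrow> \<bar>g w - g x\<bar> < d1 / H"
      using near_int_neighbourhood[OF g, of "d1 / H" x] d1 H by auto
    obtain d3 where d3: "d3 > 0" "\<And>t. \<bar>t - x\<bar> < d3 \<Longrightarrow>
      (\<exists>n::int. \<bar>G t - G x - of_int n * (L / H)\<bar> \<le> \<bar>g t - g x\<bar>)" using * by blast
    have "dist (circ L (H * G t)) (circ L (H * G x)) < e" if t: "\<bar>t - x\<bar> < min d2 d3" for t
    proof -
      obtain n :: int where n: "\<bar>G t - G x - of_int n * (L / H)\<bar> \<le> \<bar>g t - g x\<bar>" using d3(2) t by auto
      define y where "y = H * (G t - G x - of_int n * (L / H))"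
      have "\<bar>y\<bar> = H * \<bar>G t - G x - of_int n * (L / H)\<bar>" using H by (simp add: y_def abs_mult)
      also have "\<dots> < H * (d1 / H)" using n d2(2)[of t] t H by (intro mult_strict_left_mono) auto
      finally have y: "\<bar>y\<bar> < d1" using H by simp
      have "H * G t = (H * G x + y) + of_int n * L" using H by (simp add: y_def algebra_simps)
      then have "[H * G x + y = H * G t] (rmod L)" unfolding rcong_altdef by blast
      then have "circ L (H * G t) = circ L (H * G x) * circ L y"
        using L by (simp flip: circ_add circ_eq_iff)
      then have "circ L (H * G t) - circ L (H * G x) = circ L (H * G x) * (circ L y - circ L 0)"
        by (simp add: circ_def algebra_simps)
      then have "dist (circ L (H * G t)) (circ L (H * G x)) = dist (circ L y) (circ L 0)"
        by (simp add: dist_norm norm_mult)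
      then show ?thesis using d1(2)[OF y] by simp
    qed
    then show "\<forall>\<^sub>F t in at x. dist (circ L (H * G t)) (circ L (H * G x)) < e"
      unfolding eventually_at using d2(1) d3(1)
      by (intro exI[of _ "min d2 d3"]) (auto simp: dist_real_def)
  qed
  then show ?thesis
    using L by (auto simp: circle_paths_iff rmod_nonneg rmod_less continuous_on_eq_continuous_at)
qed

section \<open>Wiener processes and the uniform law on the circle\<close>

text \<open>
  A Brownian motion started from \<open>0\<close>, with increments taken over finite grids that contain
  time \<open>0\<close>. Keeping only such grids makes it easy to see that reflections at time \<open>0\<close> give
  processes of the same kind.
\<close>

definition wiener :: "'a measure \<Rightarrow> (real \<Rightarrow> 'a \<Rightarrow> real) \<Rightarrow> bool" where
  "wiener M V \<longleftrightarrow> prob_space M \<and> (\<forall>t. V t \<in> borel_measurable M) \<and>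
     (\<forall>\<omega>. V 0 \<omega> = 0) \<and> (\<forall>\<omega>\<in>space M. continuous_on UNIV (\<lambda>t. V t \<omega>)) \<and>
     (\<forall>(u :: nat \<Rightarrow> real) n. strict_mono u \<longrightarrow> 0 \<in> u ` {..n} \<longrightarrow>
        prob_space.indep_vars M (\<lambda>_. borel) (\<lambda>i \<omega>. V (u (Suc i)) \<omega> - V (u i) \<omega>) {..<n} \<and>
        (\<forall>i<n. distributed M lborel (\<lambda>\<omega>. V (u (Suc i)) \<omega> - V (u i) \<omega>)
           (normal_density 0 (sqrt (u (Suc i) - u i)))))"

lemma wienerD:
  assumes "wiener M V"
  shows "prob_space M" "\<And>t. V t \<in> borel_measurable M" "\<And>\<omega>. V 0 \<omega> = 0"
    "\<And>\<omega>. \<omega> \<in> space M \<Longrightarrow> continuous_on UNIV (\<lambda>t. V t \<omega>)"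
    "\<And>(u :: nat \<Rightarrow> real) n. strict_mono u \<Longrightarrow> 0 \<in> u ` {..n} \<Longrightarrow>
        prob_space.indep_vars M (\<lambda>_. borel) (\<lambda>i \<omega>. V (u (Suc i)) \<omega> - V (u i) \<omega>) {..<n}"
    "\<And>(u :: nat \<Rightarrow> real) n i. strict_mono u \<Longrightarrow> 0 \<in> u ` {..n} \<Longrightarrow> i < n \<Longrightarrow>
        distributed M lborel (\<lambda>\<omega>. V (u (Suc i)) \<omega> - V (u i) \<omega>)
           (normal_density 0 (sqrt (u (Suc i) - u i)))"
  using assms unfolding wiener_def by blast+

lemma finite_subset_strict_mono_image:
  fixes J :: "real set"
  assumes J: "finite J"
  obtains u :: "nat \<Rightarrow> real" and n where "strict_mono u" "J \<subseteq> u ` {..n}" "n > 0"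
proof -
  define K where "K = insert (1 + Max (insert 0 J)) (insert 0 J)"
  have K: "finite K" "J \<subseteq> K" using J by (auto simp: K_def)
  have "Max (insert 0 J) \<ge> 0" using J by simp
  then have "card {0, 1 + Max (insert 0 J)} = 2" by simp
  moreover have "card {0, 1 + Max (insert 0 J)} \<le> card K"
    using K by (intro card_mono) (auto simp: K_def)
  ultimately have "card K \<ge> 2" by simp
  then obtain n where n: "card K = Suc n" "n > 0" by (cases "card K") auto
  define xs where "xs = sorted_list_of_set K"
  have xs: "sorted_wrt (<) xs" "set xs = K" "length xs = Suc n"
    using K n by (auto simp: xs_def strict_sorted_list_of_set)
  define u where "u i = (if i \<le> n then xs ! i else xs ! n + real (i - n))" for i
  have "u i < u (Suc i)" for i
  proof -
    consider "Suc i \<le> n" | "i = n" | "i > n" by linarith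
    then show ?thesis
    proof cases
      case 1
      then show ?thesis using sorted_wrt_nth_less[OF xs(1), of i "Suc i"] xs(3) by (simp add: u_def)
    qed (auto simp: u_def)
  qed
  then have "strict_mono u" by (simp add: strict_mono_Suc_iff)
  moreover have "J \<subseteq> u ` {..n}"
  proof
    fix x assume "x \<in> J"
    then obtain i where "i < length xs" "xs ! i = x" using K(2) xs(2) by (metis in_set_conv_nth subsetD)
    then show "x \<in> u ` {..n}" using xs(3) by (intro image_eqI[of _ _ i]) (auto simp: u_def)
  qed
  ultimately show ?thesis using that n(2) by blast
qed

lemma wiener_increment_vector:
  assumes "wiener M V" "strict_mono u" "0 \<in> u ` {..n}" "n > 0"
  shows "distr M (\<Pi>\<^sub>M i\<in>{..<n}. borel) (\<lambda>\<omega>. \<lambda>i\<in>{..<n}. V (u (Suc i)) \<omega> - V (u i) \<omega>) =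
    (\<Pi>\<^sub>M i\<in>{..<n}. density lborel (normal_density 0 (sqrt (u (Suc i) - u i))))"
proof -
  interpret prob_space M using wienerD(1)[OF assms(1)] .
  note [measurable] = wienerD(2)[OF assms(1)]
  have "distr M (\<Pi>\<^sub>M i\<in>{..<n}. borel) (\<lambda>\<omega>. \<lambda>i\<in>{..<n}. V (u (Suc i)) \<omega> - V (u i) \<omega>) =
    (\<Pi>\<^sub>M i\<in>{..<n}. distr M borel (\<lambda>\<omega>. V (u (Suc i)) \<omega> - V (u i) \<omega>))"
    using wienerD(5)[OF assms(1-3)] assms(4)
    by (subst (asm) indep_vars_iff_distr_eq_PiM) auto
  also have "\<dots> = (\<Pi>\<^sub>M i\<in>{..<n}. density lborel (normal_density 0 (sqrt (u (Suc i) - u i))))"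
  proof (rule PiM_cong[OF refl])
    fix i assume "i \<in> {..<n}"
    then have "distributed M lborel (\<lambda>\<omega>. V (u (Suc i)) \<omega> - V (u i) \<omega>)
           (normal_density 0 (sqrt (u (Suc i) - u i)))"
      using wienerD(6)[OF assms(1-3)] by simp
    from distributed_distr_eq_density[OF this]
    show "distr M borel (\<lambda>\<omega>. V (u (Suc i)) \<omega> - V (u i) \<omega>) =
        density lborel (normal_density 0 (sqrt (u (Suc i) - u i)))"
      by (simp cong: distr_cong)
  qed
  finally show ?thesis .
qed

text \<open>
  The values of the process at finitely many times are fixed linear functions of its increments
  along a grid through \<open>0\<close>; this is why a Wiener process has only one law.
\<close>

lemma wiener_value_from_increments:
  fixes v :: "nat \<Rightarrow> real"
  assumes "v k = 0" "k \<le> n" "j \<le> n"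
  shows "v j = (\<Sum>i\<in>{k..<j}. v (Suc i) - v i) - (\<Sum>i\<in>{j..<k}. v (Suc i) - v i)"
  using assms by (cases "k \<le> j") (auto simp: sum_Suc_diff' not_le)

lemma wiener_cylinder_unique:
  fixes A :: "real \<Rightarrow> real set"
  assumes V: "wiener M V" "wiener M' V'" and J: "finite J" and A: "\<And>j. A j \<in> sets borel"
  shows "emeasure M {\<omega> \<in> space M. \<forall>j\<in>J. V j \<omega> \<in> A j} = emeasure M' {\<omega> \<in> space M'. \<forall>j\<in>J. V' j \<omega> \<in> A j}"
proof -
  obtain u :: "nat \<Rightarrow> real" and n where u: "strict_mono u" "insert 0 J \<subseteq> u ` {..n}" "n > 0"
    using finite_subset_strict_mono_image[of "insert 0 J"] J by auto
  then have 0: "0 \<in> u ` {..n}" by auto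
  then obtain k where k: "u k = 0" "k \<le> n" by auto
  let ?P = "\<Pi>\<^sub>M i\<in>{..<n}. (borel :: real measure)"
  define I where "I = {j \<in> {..n}. u j \<in> J}"
  define F where "F j d = (\<Sum>i\<in>{k..<j}. d i) - (\<Sum>i\<in>{j..<k}. d i)" for j and d :: "nat \<Rightarrow> real"
  define S where "S = {d \<in> space ?P. \<forall>j\<in>I. F j d \<in> A (u j)}"
  have [measurable]: "F j \<in> borel_measurable ?P" if "j \<in> I" for j
    unfolding F_def using that k(2)
    by (intro borel_measurable_diff borel_measurable_sum measurable_component_singleton) (auto simp: I_def)
  have finI: "finite I" by (simp add: I_def)
  have S: "S \<in> sets ?P"
    unfolding S_def using finI A by measurable
  have *: "emeasure N {\<omega> \<in> space N. \<forall>j\<in>J. X j \<omega> \<in> A j} =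
      emeasure (\<Pi>\<^sub>M i\<in>{..<n}. density lborel (normal_density 0 (sqrt (u (Suc i) - u i)))) S"
    if X: "wiener N X" for N :: "'c measure" and X
  proof -
    let ?D = "\<lambda>\<omega>. \<lambda>i\<in>{..<n}. X (u (Suc i)) \<omega> - X (u i) \<omega>"
    note [measurable] = wienerD(2)[OF X]
    have D: "?D \<in> N \<rightarrow>\<^sub>M ?P" by measurable
    have val: "X (u j) \<omega> = F j (?D \<omega>)" if "\<omega> \<in> space N" "j \<in> I" for j \<omega>
    proof -
      have "X (u j) \<omega> = (\<Sum>i\<in>{k..<j}. X (u (Suc i)) \<omega> - X (u i) \<omega>) - (\<Sum>i\<in>{j..<k}. X (u (Suc i)) \<omega> - X (u i) \<omega>)"
        by (rule wiener_value_from_increments[of "\<lambda>i. X (u i) \<omega>" k n j])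
          (use wienerD(3)[OF X] that k in \<open>auto simp: I_def\<close>)
      also have "\<dots> = F j (?D \<omega>)"
        unfolding F_def using that(2) k(2)
        by (intro arg_cong2[of _ _ _ _ "(-)"] sum.cong) (auto simp: I_def)
      finally show ?thesis .
    qed
    have "(\<forall>j\<in>J. X j \<omega> \<in> A j) \<longleftrightarrow> (\<forall>j\<in>I. X (u j) \<omega> \<in> A (u j))" for \<omega>
      using u(2) by (auto simp: I_def)
    then have "{\<omega> \<in> space N. \<forall>j\<in>J. X j \<omega> \<in> A j} = ?D -` S \<inter> space N"
      using val measurable_space[OF D] by (auto simp: S_def)
    then have "emeasure N {\<omega> \<in> space N. \<forall>j\<in>J. X j \<omega> \<in> A j} = emeasure (distr N ?P ?D) S"
      using S D by (simp add: emeasure_distr)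
    then show ?thesis
      by (simp add: wiener_increment_vector[OF X u(1) 0 u(3)])
  qed
  show ?thesis using *[OF V(1)] *[OF V(2)] by simp
qed

lemma normal_distributed_uminus:
  assumes "prob_space M" "distributed M lborel X (normal_density 0 \<sigma>)" "\<sigma> > 0"
  shows "distributed M lborel (\<lambda>\<omega>. - X \<omega>) (normal_density 0 \<sigma>)"
proof -
  interpret prob_space M by fact
  show ?thesis
    using normal_density_affine[OF assms(2,3), of "-1" 0] by simp
qed

lemma wiener_of_brownian_motion:
  assumes "two_sided_brownian_motion M W"
  shows "wiener M (\<lambda>t \<omega>. W (t + s) \<omega> - W s \<omega>)"
proof -
  interpret two_sided_brownian_motion M W by fact
  note [measurable] = random_variable_W
  show ?thesis
    unfolding wiener_def
  proof (intro conjI allI ballI impI)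
    fix \<omega> assume "\<omega> \<in> space M"
    then have "continuous_on UNIV (\<lambda>t. W t \<omega>)" by (rule continuous_paths)
    then have "continuous_on UNIV (\<lambda>t. W (t + s) \<omega>)"
      by (rule continuous_on_compose2) (auto intro!: continuous_intros)
    then show "continuous_on UNIV (\<lambda>t. W (t + s) \<omega> - W s \<omega>)"
      by (intro continuous_intros)
  next
    fix u :: "nat \<Rightarrow> real" and n assume u: "strict_mono u"
    then have u': "strict_mono (\<lambda>i. u i + s)" by (simp add: strict_mono_def)
    show "indep_vars (\<lambda>_. borel) (\<lambda>i \<omega>. W (u (Suc i) + s) \<omega> - W s \<omega> - (W (u i + s) \<omega> - W s \<omega>)) {..<n}"
      using independent_increments[OF u', of n] by simp
    fix i
    show "distributed M lborel (\<lambda>\<omega>. W (u (Suc i) + s) \<omega> - W s \<omega> - (W (u i + s) \<omega> - W s \<omega>))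
        (normal_density 0 (sqrt (u (Suc i) - u i)))"
      using gaussian_increments[of "u i + s" "u (Suc i) + s"] u by (simp add: strict_mono_Suc_iff)
  qed (auto simp: prob_space_axioms)
qed

text \<open>
  The two halves of the process before and after time \<open>0\<close> may be reflected independently,
  since no grid interval contains \<open>0\<close> in its interior.
\<close>

lemma wiener_signed:
  assumes V: "wiener M V" and ab: "a = 1 \<or> a = - 1" "b = 1 \<or> b = - 1"
  shows "wiener M (\<lambda>t \<omega>. (if t \<ge> 0 then a else b) * V t \<omega>)"
proof -
  let ?V = "\<lambda>t \<omega>. (if t \<ge> 0 then a else b) * V t \<omega>"
  interpret prob_space M using wienerD(1)[OF V] .
  note [measurable] = wienerD(2)[OF V]
  have key: "?V (u (Suc i)) \<omega> - ?V (u i) \<omega> =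
      (if u i \<ge> 0 then a else b) * (V (u (Suc i)) \<omega> - V (u i) \<omega>)"
    if u: "strict_mono u" "0 \<in> u ` {..n}" for u :: "nat \<Rightarrow> real" and n i \<omega>
  proof -
    obtain k where k: "u k = 0" "k \<le> n" using u(2) by auto
    show ?thesis
    proof (cases "i < k")
      case True
      then have "u i < u k" "u (Suc i) \<le> u k"
        using strict_mono_less[OF u(1), of i k] strict_mono_less_eq[OF u(1), of "Suc i" k] by auto
      then show ?thesis using wienerD(3)[OF V] k
        by (cases "u (Suc i) = 0") (auto simp: algebra_simps)
    next
      case False
      then have "u k \<le> u i" "u k \<le> u (Suc i)"
        using strict_mono_less_eq[OF u(1), of k i] strict_mono_less_eq[OF u(1), of k "Suc i"] by auto
      then show ?thesis using k by (simp add: algebra_simps)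
    qed
  qed
  show ?thesis
    unfolding wiener_def
  proof (intro conjI allI ballI impI)
    fix \<omega> assume \<omega>: "\<omega> \<in> space M"
    note c = wienerD(4)[OF V \<omega>]
    have "continuous_on ({0..} \<union> {..0}) (\<lambda>t. if 0 \<le> t then a * V t \<omega> else b * V t \<omega>)"
      using wienerD(3)[OF V]
      by (intro continuous_on_If continuous_intros continuous_on_subset[OF c]) auto
    moreover have "{0..} \<union> {..0} = (UNIV :: real set)" by auto
    ultimately show "continuous_on UNIV (\<lambda>t. ?V t \<omega>)"
      by (simp add: if_distrib[of "\<lambda>c. c * _"] cong: if_cong)
  next
    fix u :: "nat \<Rightarrow> real" and n assume u: "strict_mono u" "0 \<in> u ` {..n}"
    let ?s = "\<lambda>i x. (if u i \<ge> 0 then a else b) * x"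
    have "indep_vars (\<lambda>_. borel) (\<lambda>i. ?s i \<circ> (\<lambda>\<omega>. V (u (Suc i)) \<omega> - V (u i) \<omega>)) {..<n}"
      by (rule indep_vars_compose[OF wienerD(5)[OF V u]]) measurable
    then show "indep_vars (\<lambda>_. borel) (\<lambda>i \<omega>. ?V (u (Suc i)) \<omega> - ?V (u i) \<omega>) {..<n}"
      by (simp only: key[OF u] o_def)
    fix i assume i: "i < n"
    have d: "distributed M lborel (\<lambda>\<omega>. V (u (Suc i)) \<omega> - V (u i) \<omega>) (normal_density 0 (sqrt (u (Suc i) - u i)))"
      by (rule wienerD(6)[OF V u i])
    have pos: "sqrt (u (Suc i) - u i) > 0" using u(1) by (simp add: strict_mono_Suc_iff)
    have "distributed M lborel (\<lambda>\<omega>. ?s i (V (u (Suc i)) \<omega> - V (u i) \<omega>)) (normal_density 0 (sqrt (u (Suc i) - u i)))"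
      using d normal_distributed_uminus[OF prob_space_axioms d pos] ab by (auto simp: if_distrib)
    then show "distributed M lborel (\<lambda>\<omega>. ?V (u (Suc i)) \<omega> - ?V (u i) \<omega>) (normal_density 0 (sqrt (u (Suc i) - u i)))"
      by (simp only: key[OF u])
  qed (auto simp: prob_space_axioms wienerD(3)[OF V])
qed

definition unif :: "real \<Rightarrow> real measure" where
  "unif L = uniform_measure lborel {0..<L}"

text \<open>
  The law of a Brownian motion on the circle started at an independent uniform point. It
  is the law of every stationary periodic Brownian motion, and having this explicit form
  avoids any reference to the initial law of \<open>W\<close>.
\<close>

definition unif_law :: "real \<Rightarrow> 'a measure \<Rightarrow> (real \<Rightarrow> 'a \<Rightarrow> real) \<Rightarrow> (real \<Rightarrow> real) measure" where
  "unif_law L M V = distr (unif L \<Otimes>\<^sub>M M) (path_algebra L) (\<lambda>(x, \<omega>) t. (x + V t \<omega>) rmod L)"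

lemma sets_unif [simp, measurable_cong]: "sets (unif L) = sets borel"
  by (simp add: unif_def)

lemma space_unif [simp]: "space (unif L) = UNIV"
  by (simp add: unif_def)

lemma prob_space_unif: "L > 0 \<Longrightarrow> prob_space (unif L)"
  unfolding unif_def by (rule prob_space_uniform_measure) auto

lemma emeasure_unif: "L > 0 \<Longrightarrow> G \<in> sets borel \<Longrightarrow> emeasure (unif L) G = emeasure lborel ({0..<L} \<inter> G) / ennreal L"
  unfolding unif_def by (simp add: emeasure_uniform_measure)

lemma periodic_shift_int:
  fixes P :: "real \<Rightarrow> bool"
  assumes "\<And>x. P (x + L) \<longleftrightarrow> P x"
  shows "P (x + of_int n * L) \<longleftrightarrow> P x"
proof -
  have *: "P (y + of_nat k * L) \<longleftrightarrow> P y" for k y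
  proof (induction k)
    case (Suc k)
    have "P (y + of_nat (Suc k) * L) \<longleftrightarrow> P ((y + of_nat k * L) + L)" by (simp add: algebra_simps)
    then show ?case using assms Suc by simp
  qed simp
  show ?thesis
  proof (cases "n \<ge> 0")
    case True
    then show ?thesis using *[of x "nat n"] by simp
  next
    case False
    then show ?thesis using *[of "x + of_int n * L" "nat (- n)"] by simp
  qed
qed

lemma emeasure_lborel_shift:
  assumes "X \<in> sets borel" shows "emeasure lborel {x. x + c \<in> X} = emeasure lborel (X :: real set)"
proof -
  have "emeasure lborel X = emeasure (distr lborel borel ((+) c)) X" by (simp add: lborel_distr_plus)
  also have "\<dots> = emeasure lborel {x. x + c \<in> X}"
    using assms by (subst emeasure_distr) (auto simp: vimage_def add.commute)
  finally show ?thesis by simp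
qed

lemma emeasure_lborel_reflect:
  assumes "X \<in> sets borel" shows "emeasure lborel {x. - x \<in> X} = emeasure lborel (X :: real set)"
proof -
  have "emeasure lborel X = emeasure (distr lborel borel uminus) X" by (simp add: lborel_distr_uminus)
  also have "\<dots> = emeasure lborel {x. - x \<in> X}"
    using assms by (subst emeasure_distr) (auto simp: vimage_def)
  finally show ?thesis by simp
qed

lemma emeasure_period_interval:
  assumes L: "L > 0" and G: "G \<in> sets borel" and per: "\<And>x::real. x + L \<in> G \<longleftrightarrow> x \<in> G"
  shows "emeasure lborel ({c..<c + L} \<inter> G) = emeasure lborel ({0..<L} \<inter> G)"
proof -
  define n where "n = \<lfloor>c / L\<rfloor>"
  define r where "r = c - of_int n * L"
  have "of_int n \<le> c / L" "c / L < of_int n + 1" by (simp_all add: n_def)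
  then have r: "0 \<le> r" "r < L" using L by (auto simp: r_def field_simps)
  have c: "c = r + of_int n * L" by (simp add: r_def)
  have per': "x + of_int k * L \<in> G \<longleftrightarrow> x \<in> G" for k x
    using periodic_shift_int[of "\<lambda>x. x \<in> G" L x k] per by simp
  have "{x. x + of_int n * L \<in> {c..<c + L} \<inter> G} = {r..<r + L} \<inter> G"
    using per' by (auto simp: c)
  then have "emeasure lborel ({c..<c + L} \<inter> G) = emeasure lborel ({r..<r + L} \<inter> G)"
    using emeasure_lborel_shift[of "{c..<c + L} \<inter> G" "of_int n * L"] G by simp
  also have "{r..<r + L} \<inter> G = ({r..<L} \<inter> G) \<union> ({L..<r + L} \<inter> G)" using r by auto
  also have "emeasure lborel \<dots> = emeasure lborel ({r..<L} \<inter> G) + emeasure lborel ({L..<r + L} \<inter> G)"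
    using G by (intro plus_emeasure[symmetric]) auto
  also have "emeasure lborel ({L..<r + L} \<inter> G) = emeasure lborel {x. x + L \<in> {L..<r + L} \<inter> G}"
    using emeasure_lborel_shift[of "{L..<r + L} \<inter> G" L] G by simp
  also have "{x. x + L \<in> {L..<r + L} \<inter> G} = {0..<r} \<inter> G" using per by auto
  also have "emeasure lborel ({r..<L} \<inter> G) + emeasure lborel ({0..<r} \<inter> G) =
      emeasure lborel (({r..<L} \<inter> G) \<union> ({0..<r} \<inter> G))"
    using G by (intro plus_emeasure) auto
  also have "({r..<L} \<inter> G) \<union> ({0..<r} \<inter> G) = {0..<L} \<inter> G" using r by auto
  finally show ?thesis .
qed

lemma unif_rotate:
  assumes L: "L > 0" and G: "G \<in> sets borel" and per: "\<And>x::real. x + L \<in> G \<longleftrightarrow> x \<in> G"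
  shows "emeasure (unif L) {x. x + c \<in> G} = emeasure (unif L) G"
proof -
  have [measurable]: "{x. x + c \<in> G} \<in> sets borel" using G by measurable
  have "{0..<L} \<inter> {x. x + c \<in> G} = {x. x + c \<in> {c..<c + L} \<inter> G}" by auto
  also have "emeasure lborel \<dots> = emeasure lborel ({c..<c + L} \<inter> G)"
    using G by (intro emeasure_lborel_shift) auto
  also have "\<dots> = emeasure lborel ({0..<L} \<inter> G)" by (rule emeasure_period_interval[OF L G per])
  finally show ?thesis using L G by (simp add: emeasure_unif)
qed

lemma unif_reflect:
  assumes L: "L > 0" and G: "G \<in> sets borel" and per: "\<And>x::real. x + L \<in> G \<longleftrightarrow> x \<in> G"
  shows "emeasure (unif L) {x. - x \<in> G} = emeasure (unif L) G"
proof -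
  have [measurable]: "{x. - x \<in> G} \<in> sets borel" using G by measurable
  have "{0..<L} \<inter> {x. - x \<in> G} = {x. - x \<in> {- L<..0} \<inter> G}" by auto
  also have "emeasure lborel \<dots> = emeasure lborel ({- L<..0} \<inter> G)"
    using G by (intro emeasure_lborel_reflect) auto
  also have "\<dots> = emeasure lborel ({- L..<- L + L} \<inter> G)"
  proof (rule emeasure_eq_AE)
    have "AE x in lborel. x \<noteq> - L \<and> x \<noteq> (0 :: real)"
      by (intro AE_conjI AE_lborel_singleton)
    then show "AE x in lborel. x \<in> {- L<..0} \<inter> G \<longleftrightarrow> x \<in> {- L..<- L + L} \<inter> G"
      by eventually_elim auto
  qed (use G in auto)
  also have "\<dots> = emeasure lborel ({0..<L} \<inter> G)" by (rule emeasure_period_interval[OF L G per])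
  finally show ?thesis using L G by (simp add: emeasure_unif)
qed

lemma rmod_periodic: "L > 0 \<Longrightarrow> (x + L) rmod L = x rmod L"
  using rmod_add[of x L L] by simp

context
  fixes L :: real and M :: "'a measure" and V :: "real \<Rightarrow> 'a \<Rightarrow> real"
  assumes L: "L > 0" and V: "wiener M V"
begin

interpretation M: prob_space M using wienerD(1)[OF V] .
interpretation U: prob_space "unif L" using prob_space_unif[OF L] .
interpretation UM: pair_prob_space "unif L" M ..

lemma measurable_loop: "(\<lambda>(x, \<omega>) t. (x + V t \<omega>) rmod L) \<in> unif L \<Otimes>\<^sub>M M \<rightarrow>\<^sub>M path_algebra L"
proof (rule measurable_path_algebraI)
  note [measurable] = wienerD(2)[OF V]
  fix p assume "p \<in> space (unif L \<Otimes>\<^sub>M M)"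
  then have "snd p \<in> space M" by (auto simp: space_pair_measure)
  then have "continuous_on UNIV (\<lambda>t. fst p + V t (snd p))"
    using wienerD(4)[OF V] by (intro continuous_intros)
  from rmod_in_circle_paths[OF L this]
  show "(case p of (x, \<omega>) \<Rightarrow> \<lambda>t. (x + V t \<omega>) rmod L) \<in> circle_paths L"
    by (simp add: case_prod_beta)
next
  note [measurable] = wienerD(2)[OF V]
  fix t
  show "(\<lambda>p. (case p of (x, \<omega>) \<Rightarrow> \<lambda>t. (x + V t \<omega>) rmod L) t) \<in> borel_measurable (unif L \<Otimes>\<^sub>M M)"
    by (simp add: case_prod_beta) measurable
qed

lemma prob_space_unif_law: "prob_space (unif_law L M V)"
  unfolding unif_law_def by (rule UM.prob_space_distr[OF measurable_loop])

lemma emeasure_unif_law: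
  assumes "X \<in> sets (path_algebra L)"
  shows "emeasure (unif_law L M V) X =
      (\<integral>\<^sup>+x. emeasure M {\<omega> \<in> space M. (\<lambda>t. (x + V t \<omega>) rmod L) \<in> X} \<partial>unif L)"
    and "emeasure (unif_law L M V) X =
      (\<integral>\<^sup>+\<omega>. emeasure (unif L) {x. (\<lambda>t. (x + V t \<omega>) rmod L) \<in> X} \<partial>M)"
proof -
  let ?Y = "(\<lambda>(x, \<omega>) t. (x + V t \<omega>) rmod L) -` X \<inter> space (unif L \<Otimes>\<^sub>M M)"
  have Y: "?Y \<in> sets (unif L \<Otimes>\<^sub>M M)" using measurable_loop assms by (rule measurable_sets)
  have e: "emeasure (unif_law L M V) X = emeasure (unif L \<Otimes>\<^sub>M M) ?Y"
    unfolding unif_law_def using measurable_loop assms by (rule emeasure_distr)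
  show "emeasure (unif_law L M V) X =
      (\<integral>\<^sup>+x. emeasure M {\<omega> \<in> space M. (\<lambda>t. (x + V t \<omega>) rmod L) \<in> X} \<partial>unif L)"
    unfolding e M.emeasure_pair_measure_alt[OF Y]
    by (intro nn_integral_cong arg_cong[of _ _ "emeasure M"]) (auto simp: space_pair_measure)
  show "emeasure (unif_law L M V) X =
      (\<integral>\<^sup>+\<omega>. emeasure (unif L) {x. (\<lambda>t. (x + V t \<omega>) rmod L) \<in> X} \<partial>M)"
    unfolding e UM.emeasure_pair_measure_alt2[OF Y]
    by (intro nn_integral_cong arg_cong[of _ _ "emeasure (unif L)"]) (auto simp: space_pair_measure)
qed

lemma sets_cylinder:
  assumes "finite J" "\<And>j. A j \<in> sets borel"
  shows "{f \<in> circle_paths L. \<forall>j\<in>J. f j \<in> A j} \<in> sets (path_algebra L)"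
proof -
  have "{f \<in> space (path_algebra L). \<forall>j\<in>J. f j \<in> A j} \<in> sets (path_algebra L)"
    using assms measurable_path_eval[measurable] by measurable
  then show ?thesis by (simp add: space_path_algebra)
qed

lemma unif_law_cylinder:
  assumes J: "finite J" and A: "\<And>j. A j \<in> sets borel"
  shows "emeasure (unif_law L M V) {f \<in> circle_paths L. \<forall>j\<in>J. f j \<in> A j} =
      (\<integral>\<^sup>+x. emeasure M {\<omega> \<in> space M. \<forall>j\<in>J. (x + V j \<omega>) rmod L \<in> A j} \<partial>unif L)"
    and "emeasure (unif_law L M V) {f \<in> circle_paths L. \<forall>j\<in>J. f j \<in> A j} =
      (\<integral>\<^sup>+\<omega>. emeasure (unif L) {x. \<forall>j\<in>J. (x + V j \<omega>) rmod L \<in> A j} \<partial>M)"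
proof -
  have c: "(\<lambda>t. (x + V t \<omega>) rmod L) \<in> circle_paths L" if "\<omega> \<in> space M" for x \<omega>
    using rmod_in_circle_paths[OF L, of "\<lambda>t. x + V t \<omega>"] wienerD(4)[OF V that]
    by (simp add: continuous_on_add)
  show "emeasure (unif_law L M V) {f \<in> circle_paths L. \<forall>j\<in>J. f j \<in> A j} =
      (\<integral>\<^sup>+x. emeasure M {\<omega> \<in> space M. \<forall>j\<in>J. (x + V j \<omega>) rmod L \<in> A j} \<partial>unif L)"
    unfolding emeasure_unif_law(1)[OF sets_cylinder[OF assms]]
    by (intro nn_integral_cong arg_cong[of _ _ "emeasure M"]) (auto simp: c)
  show "emeasure (unif_law L M V) {f \<in> circle_paths L. \<forall>j\<in>J. f j \<in> A j} =
      (\<integral>\<^sup>+\<omega>. emeasure (unif L) {x. \<forall>j\<in>J. (x + V j \<omega>) rmod L \<in> A j} \<partial>M)"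
    unfolding emeasure_unif_law(2)[OF sets_cylinder[OF assms]]
    by (intro nn_integral_cong arg_cong[of _ _ "emeasure (unif L)"]) (auto simp: c)
qed

end

lemma sets_unif_law [simp]: "sets (unif_law L M V) = sets (path_algebra L)"
  by (simp add: unif_law_def)

lemma unif_law_unique:
  assumes L: "L > 0" and V: "wiener M V" "wiener M' V'"
  shows "unif_law L M V = unif_law L M' V'"
proof (rule path_measure_eqI[where L = L])
  show "finite_measure (unif_law L M V)"
    using prob_space_unif_law[OF L V(1)] by (rule prob_space.finite_measure)
  fix A :: "real \<Rightarrow> real set" and J :: "real set"
  assume J: "finite J" and A: "\<And>i. A i \<in> sets borel"
  have "emeasure M {\<omega> \<in> space M. \<forall>j\<in>J. (x + V j \<omega>) rmod L \<in> A j} =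
      emeasure M' {\<omega> \<in> space M'. \<forall>j\<in>J. (x + V' j \<omega>) rmod L \<in> A j}" for x
  proof -
    have "{y. (x + y) rmod L \<in> A j} \<in> sets borel" for j using A by measurable
    from wiener_cylinder_unique[OF V J this] show ?thesis by simp
  qed
  then show "emeasure (unif_law L M V) {f \<in> circle_paths L. \<forall>j\<in>J. f j \<in> A j} =
      emeasure (unif_law L M' V') {f \<in> circle_paths L. \<forall>j\<in>J. f j \<in> A j}"
    by (simp add: unif_law_cylinder(1)[OF L V(1) J A] unif_law_cylinder(1)[OF L V(2) J A])
qed simp_all

text \<open>
  A transformation of loops preserves the law if, for each fixed path, it only rotates the
  uniform starting point and replaces the driving process by another Wiener process.
\<close>

lemma distr_path_eq_unif_lawI:
  assumes L: "L > 0" and V: "wiener M V" and T: "T \<in> path_algebra L \<rightarrow>\<^sub>M path_algebra L"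
    and eq: "\<And>\<omega> (A :: real \<Rightarrow> real set) J. \<omega> \<in> space M \<Longrightarrow> finite J \<Longrightarrow> (\<And>j. A j \<in> sets borel) \<Longrightarrow>
      emeasure (unif L) {x. \<forall>j\<in>J. T (\<lambda>t. (x + V t \<omega>) rmod L) j \<in> A j} =
      emeasure (unif L) {x. \<forall>j\<in>J. (x + V' j \<omega>) rmod L \<in> A j}"
    and W: "wiener M V'"
  shows "distr (unif_law L M V) (path_algebra L) T = unif_law L M V"
proof (rule path_measure_eqI[where L = L])
  have T': "T \<in> unif_law L M V \<rightarrow>\<^sub>M path_algebra L"
    using T by (simp cong: measurable_cong_sets)
  interpret prob_space "unif_law L M V" using prob_space_unif_law[OF L V] .
  show "finite_measure (distr (unif_law L M V) (path_algebra L) T)"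
    by (rule finite_measure_distr[OF T'])
  fix A :: "real \<Rightarrow> real set" and J :: "real set"
  assume J: "finite J" and A: "\<And>i. A i \<in> sets borel"
  let ?X = "{f \<in> circle_paths L. \<forall>j\<in>J. f j \<in> A j}"
  have X: "?X \<in> sets (path_algebra L)" using sets_cylinder[OF L V J A] .
  have TX: "T -` ?X \<inter> circle_paths L \<in> sets (path_algebra L)"
    using measurable_sets[OF T X] by (simp add: space_path_algebra)
  have c: "(\<lambda>t. (x + V t \<omega>) rmod L) \<in> circle_paths L" if "\<omega> \<in> space M" for x \<omega>
    using rmod_in_circle_paths[OF L, of "\<lambda>t. x + V t \<omega>"] wienerD(4)[OF V that]
    by (simp add: continuous_on_add)
  have Tc: "T f \<in> circle_paths L" if "f \<in> circle_paths L" for f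
    using measurable_space[OF T] that by (simp add: space_path_algebra)
  have "space (unif_law L M V) = circle_paths L"
    by (simp add: unif_law_def space_path_algebra)
  then have "emeasure (distr (unif_law L M V) (path_algebra L) T) ?X =
      emeasure (unif_law L M V) (T -` ?X \<inter> circle_paths L)"
    using X T' by (simp add: emeasure_distr)
  also have "\<dots> = (\<integral>\<^sup>+\<omega>. emeasure (unif L) {x. \<forall>j\<in>J. (x + V' j \<omega>) rmod L \<in> A j} \<partial>M)"
    unfolding emeasure_unif_law(2)[OF L V TX]
  proof (rule nn_integral_cong)
    fix \<omega> assume \<omega>: "\<omega> \<in> space M"
    have "{x. (\<lambda>t. (x + V t \<omega>) rmod L) \<in> T -` ?X \<inter> circle_paths L} =
      {x. \<forall>j\<in>J. T (\<lambda>t. (x + V t \<omega>) rmod L) j \<in> A j}"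
      using c[OF \<omega>] Tc by auto
    then show "emeasure (unif L) {x. (\<lambda>t. (x + V t \<omega>) rmod L) \<in> T -` ?X \<inter> circle_paths L} =
        emeasure (unif L) {x. \<forall>j\<in>J. (x + V' j \<omega>) rmod L \<in> A j}"
      using eq[OF \<omega> J A] by simp
  qed
  also have "\<dots> = emeasure (unif_law L M V') ?X" by (rule unif_law_cylinder(2)[OF L W J A, symmetric])
  also have "\<dots> = emeasure (unif_law L M V) ?X" by (simp add: unif_law_unique[OF L W V])
  finally show "emeasure (distr (unif_law L M V) (path_algebra L) T) ?X = emeasure (unif_law L M V) ?X" .
qed simp_all

section \<open>Symmetries of the uniform law\<close>

definition negate :: "real \<Rightarrow> (real \<Rightarrow> real) \<Rightarrow> real \<Rightarrow> real" where
  "negate L f t = (- f t) rmod L"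

text \<open>
  Reflection at the position at time \<open>0\<close>, applied to the times \<open>t\<close> with \<open>e * t > 0\<close>.
\<close>

definition reflect_side :: "real \<Rightarrow> real \<Rightarrow> (real \<Rightarrow> real) \<Rightarrow> real \<Rightarrow> real" where
  "reflect_side L e f t = (if e * t \<le> 0 then f t else 2 * f 0 - f t) rmod L"

lemma negate_loop: "negate L (\<lambda>t. g t rmod L) = (\<lambda>t. (- g t) rmod L)"
  unfolding negate_def by (intro ext rmod_cong_eq) (simp add: rcong_uminus_left_iff)

lemma reflect_side_loop:
  "reflect_side L e (\<lambda>t. g t rmod L) = (\<lambda>t. (if e * t \<le> 0 then g t else 2 * g 0 - g t) rmod L)"
proof
  fix t
  have "[g 0 rmod L + g 0 rmod L - g t rmod L = g 0 + g 0 - g t] (rmod L)"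
    by (intro rcong_diff rcong_add) simp_all
  then show "reflect_side L e (\<lambda>t. g t rmod L) t = (if e * t \<le> 0 then g t else 2 * g 0 - g t) rmod L"
    by (simp add: reflect_side_def rcong_def)
qed

lemma measurable_negate: "L > 0 \<Longrightarrow> negate L \<in> path_algebra L \<rightarrow>\<^sub>M path_algebra L"
proof (rule measurable_path_algebraI)
  fix f assume L: "L > 0" and "f \<in> space (path_algebra L)"
  then have f: "f \<in> circle_paths L" by (simp add: space_path_algebra)
  then have "f = (\<lambda>t. lift L f t rmod L)" using lift_rmod[OF L] by auto
  then have "negate L f = (\<lambda>t. (- lift L f t) rmod L)" using negate_loop by metis
  moreover have "continuous_on UNIV (\<lambda>t. - lift L f t)"
    using continuous_lift[OF L f] by (intro continuous_intros)
  ultimately show "negate L f \<in> circle_paths L" using rmod_in_circle_paths[OF L] by simp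
qed (use measurable_path_eval[measurable] in \<open>simp add: negate_def\<close>)

lemma measurable_reflect_side:
  assumes L: "L > 0" and e: "e = 1 \<or> e = - 1"
  shows "reflect_side L e \<in> path_algebra L \<rightarrow>\<^sub>M path_algebra L"
proof (rule measurable_path_algebraI)
  fix f assume "f \<in> space (path_algebra L)"
  then have f: "f \<in> circle_paths L" by (simp add: space_path_algebra)
  let ?g = "lift L f"
  have c: "continuous_on S ?g" for S using continuous_lift[OF L f] continuous_on_subset by blast
  have "f = (\<lambda>t. ?g t rmod L)" using lift_rmod[OF L f] by auto
  then have r: "reflect_side L e f = (\<lambda>t. (if e * t \<le> 0 then ?g t else 2 * ?g 0 - ?g t) rmod L)"
    using reflect_side_loop by metis
  have "continuous_on ({t. e * t \<le> 0} \<union> {t. e * t \<ge> 0}) (\<lambda>t. if e * t \<le> 0 then ?g t else 2 * ?g 0 - ?g t)"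
  proof (rule continuous_on_If)
    show "closed {t. e * t \<le> 0}" "closed {t. e * t \<ge> 0}"
      by (auto intro!: closed_Collect_le continuous_intros)
    fix t assume "t \<in> {t. e * t \<ge> 0}" "e * t \<le> 0"
    then have "t = 0" using e by auto
    then show "?g t = 2 * ?g 0 - ?g t" by simp
  qed (auto intro!: continuous_intros c)
  moreover have "{t. e * t \<le> 0} \<union> {t. e * t \<ge> 0} = UNIV" by auto
  ultimately have "continuous_on UNIV (\<lambda>t. if e * t \<le> 0 then ?g t else 2 * ?g 0 - ?g t)" by simp
  then show "reflect_side L e f \<in> circle_paths L"
    unfolding r by (rule rmod_in_circle_paths[OF L])
qed (use measurable_path_eval[measurable] in \<open>simp add: reflect_side_def\<close>)

lemma sets_loop_constraint:
  fixes v :: "real \<Rightarrow> real"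
  assumes "finite J" "\<And>j. A j \<in> sets borel"
  shows "{x. \<forall>j\<in>J. (x + v j) rmod L \<in> A j} \<in> sets borel"
  using assms by measurable

lemma loop_constraint_periodic:
  assumes "L > 0"
  shows "x + L \<in> {x. \<forall>j\<in>J. (x + v j) rmod L \<in> A j} \<longleftrightarrow> x \<in> {x. \<forall>j\<in>J. (x + v j) rmod L \<in> A j}"
  using rmod_periodic[OF assms, of "x + v _"] by (simp add: algebra_simps)

lemma unif_law_translate:
  assumes L: "L > 0" and W: "two_sided_brownian_motion M W"
  defines "V \<equiv> \<lambda>t \<omega>. W t \<omega> - W 0 \<omega>"
  shows "distr (unif_law L M V) (path_algebra L) (translate s) = unif_law L M V"
proof (rule distr_path_eq_unif_lawI[OF L])
  let ?V' = "\<lambda>t \<omega>. W (t + - s) \<omega> - W (- s) \<omega>"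
  show V: "wiener M V" using wiener_of_brownian_motion[OF W, of 0] by (simp add: V_def)
  show "wiener M ?V'" by (rule wiener_of_brownian_motion[OF W])
  fix \<omega> and A :: "real \<Rightarrow> real set" and J :: "real set"
  assume J: "finite J" and A: "\<And>j. A j \<in> sets borel"
  let ?G = "{x. \<forall>j\<in>J. (x + ?V' j \<omega>) rmod L \<in> A j}"
  have "emeasure (unif L) {x. x + V (- s) \<omega> \<in> ?G} = emeasure (unif L) ?G"
    by (rule unif_rotate[OF L sets_loop_constraint[OF J A] loop_constraint_periodic[OF L]])
  moreover have "{x. x + V (- s) \<omega> \<in> ?G} = {x. \<forall>j\<in>J. translate s (\<lambda>t. (x + V t \<omega>) rmod L) j \<in> A j}"
    by (auto simp: translate_def V_def algebra_simps)
  ultimately show "emeasure (unif L) {x. \<forall>j\<in>J. translate s (\<lambda>t. (x + V t \<omega>) rmod L) j \<in> A j} = emeasure (unif L) ?G"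
    by simp
qed (rule measurable_translate)

lemma unif_law_negate:
  assumes L: "L > 0" and V: "wiener M V"
  shows "distr (unif_law L M V) (path_algebra L) (negate L) = unif_law L M V"
proof (rule distr_path_eq_unif_lawI[OF L V measurable_negate[OF L]])
  let ?V' = "\<lambda>t \<omega>. (if t \<ge> 0 then - 1 else - 1) * V t \<omega>"
  show "wiener M ?V'" by (rule wiener_signed[OF V]) auto
  fix \<omega> and A :: "real \<Rightarrow> real set" and J :: "real set"
  assume J: "finite J" and A: "\<And>j. A j \<in> sets borel"
  let ?G = "{x. \<forall>j\<in>J. (x + ?V' j \<omega>) rmod L \<in> A j}"
  have "emeasure (unif L) {x. - x \<in> ?G} = emeasure (unif L) ?G"
    by (rule unif_reflect[OF L sets_loop_constraint[OF J A] loop_constraint_periodic[OF L]])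
  moreover have "{x. - x \<in> ?G} = {x. \<forall>j\<in>J. negate L (\<lambda>t. (x + V t \<omega>) rmod L) j \<in> A j}"
    unfolding negate_loop by (auto simp: algebra_simps)
  ultimately show "emeasure (unif L) {x. \<forall>j\<in>J. negate L (\<lambda>t. (x + V t \<omega>) rmod L) j \<in> A j} = emeasure (unif L) ?G"
    by simp
qed

lemma unif_law_reflect_side:
  assumes L: "L > 0" and V: "wiener M V" and e: "e = 1 \<or> e = - 1"
  shows "distr (unif_law L M V) (path_algebra L) (reflect_side L e) = unif_law L M V"
proof (rule distr_path_eq_unif_lawI[OF L V measurable_reflect_side[OF L e]])
  let ?V' = "\<lambda>t \<omega>. (if t \<ge> 0 then - e else e) * V t \<omega>"
  show "wiener M ?V'" by (rule wiener_signed[OF V]) (use e in auto)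
  fix \<omega> and A :: "real \<Rightarrow> real set" and J :: "real set"
  have "reflect_side L e (\<lambda>t. (x + V t \<omega>) rmod L) j = (x + ?V' j \<omega>) rmod L" for x j
  proof -
    have "(if e * j \<le> 0 then x + V j \<omega> else 2 * (x + V 0 \<omega>) - (x + V j \<omega>)) = x + ?V' j \<omega>"
      using e wienerD(3)[OF V, of \<omega>] by (cases "j = 0") auto
    then show ?thesis unfolding reflect_side_loop by simp
  qed
  then show "emeasure (unif L) {x. \<forall>j\<in>J. reflect_side L e (\<lambda>t. (x + V t \<omega>) rmod L) j \<in> A j} =
      emeasure (unif L) {x. \<forall>j\<in>J. (x + ?V' j \<omega>) rmod L \<in> A j}"
    by simp
qed

section \<open>A stationary periodic Brownian motion starts uniformly\<close>

lemma std_normal_shift_L1: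
  "(\<lambda>n. \<integral>\<^sup>+v. norm (std_normal_density (v - z / real n) - std_normal_density v) \<partial>lborel) \<longlonglongrightarrow> 0"
proof (rule Scheffe_lemma1)
  show i: "integrable lborel std_normal_density" by simp
  have eq: "std_normal_density (v - z / real n) = normal_density (z / real n) 1 v" for n v
    by (simp add: normal_density_def)
  show "integrable lborel (\<lambda>v. std_normal_density (v - z / real n))" for n
    unfolding eq by simp
  have one: "(\<integral>\<^sup>+v. norm (normal_density a 1 v) \<partial>lborel) = 1" for a
    by (simp add: nn_integral_eq_integral)
  have "std_normal_density (v - z / real n) = normal_density (z / real n) 1 v" for n v
    by (simp add: eq)
  then show "limsup (\<lambda>n. \<integral>\<^sup>+v. norm (std_normal_density (v - z / real n)) \<partial>lborel)
      \<le> (\<integral>\<^sup>+v. norm (std_normal_density v) \<partial>lborel)"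
    using one by (simp add: Limsup_const)
  show "AE v in lborel. (\<lambda>n. std_normal_density (v - z / real n)) \<longlonglongrightarrow> std_normal_density v"
  proof (rule AE_I2)
    fix v :: real
    have "(\<lambda>n. v - z / real n) \<longlonglongrightarrow> v - 0"
      by (intro tendsto_intros lim_const_over_n)
    then have *: "(\<lambda>n. v - z / real n) \<longlonglongrightarrow> v" by simp
    have "isCont std_normal_density v"
      unfolding normal_density_def by (intro continuous_intros) auto
    from isCont_tendsto_compose[OF this *]
    show "(\<lambda>n. std_normal_density (v - z / real n)) \<longlonglongrightarrow> std_normal_density v" .
  qed
qed

lemma normal_shift_L1:
  assumes "n > 0"
  shows "(\<integral>\<^sup>+y. norm (normal_density 0 (real n) (y - z) - normal_density 0 (real n) y) \<partial>lborel) =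
    (\<integral>\<^sup>+v. norm (std_normal_density (v - z / real n) - std_normal_density v) \<partial>lborel)"
proof -
  have sc: "normal_density 0 (real n) (real n * v - c) = std_normal_density (v - c / real n) / real n" for v c
  proof -
    have "real n * v - c = real n * (v - c / real n)" using assms by (simp add: field_simps)
    then have "(real n * v - c)\<^sup>2 / (2 * (real n)\<^sup>2) = (v - c / real n)\<^sup>2 / 2"
      using assms by (simp add: power_mult_distrib)
    then show ?thesis using assms by (simp add: normal_density_def real_sqrt_mult)
  qed
  have "(\<integral>\<^sup>+y. norm (normal_density 0 (real n) (y - z) - normal_density 0 (real n) y) \<partial>lborel) =
    ennreal \<bar>real n\<bar> * (\<integral>\<^sup>+v. norm (normal_density 0 (real n) ((0 + real n * v) - z) - normal_density 0 (real n) (0 + real n * v)) \<partial>lborel)"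
    using assms by (intro nn_integral_real_affine) auto
  also have "\<dots> = (\<integral>\<^sup>+v. ennreal (real n) * norm (std_normal_density (v - z / real n) / real n - std_normal_density v / real n) \<partial>lborel)"
    using sc[of _ z] sc[of _ 0] by (subst nn_integral_cmult[symmetric]) auto
  also have "\<dots> = (\<integral>\<^sup>+v. norm (std_normal_density (v - z / real n) - std_normal_density v) \<partial>lborel)"
  proof (rule nn_integral_cong)
    fix v
    have "norm (std_normal_density (v - z / real n) / real n - std_normal_density v / real n) =
        norm (std_normal_density (v - z / real n) - std_normal_density v) / real n"
      by (simp flip: diff_divide_distrib)
    then show "ennreal (real n) * norm (std_normal_density (v - z / real n) / real n - std_normal_density v / real n) =
        norm (std_normal_density (v - z / real n) - std_normal_density v)"
      using assms by (simp flip: ennreal_mult)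
  qed
  finally show ?thesis .
qed

context two_sided_brownian_motion
begin

lemma normal_increment_shift:
  assumes n: "n > 0" and A: "A \<in> sets borel"
  shows "emeasure M {\<omega> \<in> space M. W ((real n)\<^sup>2) \<omega> - W 0 \<omega> \<in> A} \<le>
    emeasure M {\<omega> \<in> space M. z + (W ((real n)\<^sup>2) \<omega> - W 0 \<omega>) \<in> A} +
    (\<integral>\<^sup>+v. norm (std_normal_density (v - z / real n) - std_normal_density v) \<partial>lborel)"
proof -
  let ?X = "\<lambda>\<omega>. W ((real n)\<^sup>2) \<omega> - W 0 \<omega>"
  let ?d = "normal_density 0 (real n)"
  have X: "distributed M lborel ?X ?d"
    using gaussian_increments[of 0 "(real n)\<^sup>2"] n by simp
  have em: "emeasure M {\<omega> \<in> space M. ?X \<omega> \<in> A} = (\<integral>\<^sup>+y. ennreal (?d y) * indicator A y \<partial>lborel)"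
    if "A \<in> sets borel" for A
  proof -
    have "{\<omega> \<in> space M. ?X \<omega> \<in> A} = ?X -` A \<inter> space M" by auto
    then show ?thesis using distributed_emeasure[OF X, of A] that by simp
  qed
  have A': "{y. z + y \<in> A} \<in> sets borel" using A by measurable
  have "emeasure M {\<omega> \<in> space M. z + ?X \<omega> \<in> A} = (\<integral>\<^sup>+y. ennreal (?d y) * indicator {y. z + y \<in> A} y \<partial>lborel)"
    using em[OF A'] by simp
  also have "\<dots> = ennreal \<bar>1\<bar> * (\<integral>\<^sup>+y. ennreal (?d (- z + 1 * y)) * indicator {y. z + y \<in> A} (- z + 1 * y) \<partial>lborel)"
    using A' by (intro nn_integral_real_affine) auto
  also have "\<dots> = (\<integral>\<^sup>+y. ennreal (?d (y - z)) * indicator A y \<partial>lborel)"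
    by (simp add: indicator_def)
  finally have e2: "emeasure M {\<omega> \<in> space M. z + ?X \<omega> \<in> A} = (\<integral>\<^sup>+y. ennreal (?d (y - z)) * indicator A y \<partial>lborel)" .
  have "emeasure M {\<omega> \<in> space M. ?X \<omega> \<in> A} = (\<integral>\<^sup>+y. ennreal (?d y) * indicator A y \<partial>lborel)"
    by (rule em[OF A])
  also have "\<dots> \<le> (\<integral>\<^sup>+y. ennreal (?d (y - z)) * indicator A y + ennreal (norm (?d (y - z) - ?d y)) \<partial>lborel)"
  proof (rule nn_integral_mono)
    fix y
    have "ennreal (?d y) \<le> ennreal (?d (y - z) + norm (?d (y - z) - ?d y))"
      by (intro ennreal_leI) auto
    also have "\<dots> = ennreal (?d (y - z)) + ennreal (norm (?d (y - z) - ?d y))"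
      by (intro ennreal_plus) auto
    finally have "ennreal (?d y) \<le> ennreal (?d (y - z)) + ennreal (norm (?d (y - z) - ?d y))" .
    then show "ennreal (?d y) * indicator A y \<le> ennreal (?d (y - z)) * indicator A y + ennreal (norm (?d (y - z) - ?d y))"
      by (auto simp: indicator_def)
  qed
  also have "\<dots> = (\<integral>\<^sup>+y. ennreal (?d (y - z)) * indicator A y \<partial>lborel) + (\<integral>\<^sup>+y. ennreal (norm (?d (y - z) - ?d y)) \<partial>lborel)"
    using A by (intro nn_integral_add) auto
  finally show ?thesis unfolding e2 normal_shift_L1[OF n] .
qed

text \<open>
  Independence of the start is given for generated \<open>\<sigma>\<close>-algebras; the product form
  is what Fubini needs.
\<close>

lemma start_indep_increments:
  "distr M (borel \<Otimes>\<^sub>M (\<Pi>\<^sub>M t\<in>UNIV. borel)) (\<lambda>\<omega>. (W 0 \<omega>, \<lambda>t. W t \<omega> - W 0 \<omega>)) =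
    distr M borel (W 0) \<Otimes>\<^sub>M distr M (\<Pi>\<^sub>M t\<in>UNIV. borel) (\<lambda>\<omega> t. W t \<omega> - W 0 \<omega>)"
proof -
  note [measurable] = random_variable_W
  have B: "(\<lambda>\<omega> t. W t \<omega> - W 0 \<omega>) \<in> M \<rightarrow>\<^sub>M (\<Pi>\<^sub>M t\<in>UNIV. borel)"
    by (rule measurable_PiM_single') (auto simp: space_PiM)
  let ?P = "\<Pi>\<^sub>M t\<in>(UNIV :: real set). (borel :: real measure)"
  have WB: "(\<lambda>\<omega>. (W 0 \<omega>, \<lambda>t. W t \<omega> - W 0 \<omega>)) \<in> M \<rightarrow>\<^sub>M borel \<Otimes>\<^sub>M ?P"
    using B by (intro measurable_Pair) auto
  interpret D: prob_space "distr M borel (W 0)" by (rule prob_space_distr) simp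
  interpret E: prob_space "distr M ?P (\<lambda>\<omega> t. W t \<omega> - W 0 \<omega>)" by (rule prob_space_distr[OF B])
  show ?thesis
  proof (rule pair_measure_eqI[symmetric])
    fix X Y assume X: "X \<in> sets (distr M borel (W 0))" and Y: "Y \<in> sets (distr M ?P (\<lambda>\<omega> t. W t \<omega> - W 0 \<omega>))"
    let ?X = "W 0 -` X \<inter> space M" and ?Y = "(\<lambda>\<omega> t. W t \<omega> - W 0 \<omega>) -` Y \<inter> space M"
    have "?X \<in> sets (vimage_algebra (space M) (W 0) borel)"
      "?Y \<in> sets (vimage_algebra (space M) (\<lambda>\<omega> t. W t \<omega> - W 0 \<omega>) ?P)"
      using X Y by (auto intro!: in_vimage_algebra)
    then have "prob (?X \<inter> ?Y) = prob ?X * prob ?Y"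
      by (rule indep_setD[OF independent_start])
    then have "emeasure M (?X \<inter> ?Y) = emeasure M ?X * emeasure M ?Y"
      by (simp add: emeasure_eq_measure ennreal_mult)
    moreover have "(\<lambda>\<omega>. (W 0 \<omega>, \<lambda>t. W t \<omega> - W 0 \<omega>)) -` (X \<times> Y) \<inter> space M = ?X \<inter> ?Y" by auto
    ultimately show "emeasure (distr M borel (W 0)) X * emeasure (distr M ?P (\<lambda>\<omega> t. W t \<omega> - W 0 \<omega>)) Y =
        emeasure (distr M (borel \<Otimes>\<^sub>M ?P) (\<lambda>\<omega>. (W 0 \<omega>, \<lambda>t. W t \<omega> - W 0 \<omega>))) (X \<times> Y)"
      using X Y B WB by (simp add: emeasure_distr)
  qed (unfold_locales, simp cong: sets_pair_measure_cong)
qed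

lemma start_fubini:
  assumes X: "X \<in> sets (borel \<Otimes>\<^sub>M (\<Pi>\<^sub>M t\<in>UNIV. borel))"
  shows "emeasure M {\<omega> \<in> space M. (W 0 \<omega>, \<lambda>t. W t \<omega> - W 0 \<omega>) \<in> X} =
    (\<integral>\<^sup>+x. emeasure M {\<omega> \<in> space M. (x, \<lambda>t. W t \<omega> - W 0 \<omega>) \<in> X} \<partial>distr M borel (W 0))"
proof -
  note [measurable] = random_variable_W
  let ?P = "\<Pi>\<^sub>M t\<in>(UNIV :: real set). (borel :: real measure)"
  have B: "(\<lambda>\<omega> t. W t \<omega> - W 0 \<omega>) \<in> M \<rightarrow>\<^sub>M ?P"
    by (rule measurable_PiM_single') (auto simp: space_PiM)
  have WB: "(\<lambda>\<omega>. (W 0 \<omega>, \<lambda>t. W t \<omega> - W 0 \<omega>)) \<in> M \<rightarrow>\<^sub>M borel \<Otimes>\<^sub>M ?P"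
    using B by (intro measurable_Pair) auto
  interpret D: prob_space "distr M ?P (\<lambda>\<omega> t. W t \<omega> - W 0 \<omega>)" by (rule prob_space_distr[OF B])
  have "{\<omega> \<in> space M. (W 0 \<omega>, \<lambda>t. W t \<omega> - W 0 \<omega>) \<in> X} = (\<lambda>\<omega>. (W 0 \<omega>, \<lambda>t. W t \<omega> - W 0 \<omega>)) -` X \<inter> space M"
    by auto
  then have "emeasure M {\<omega> \<in> space M. (W 0 \<omega>, \<lambda>t. W t \<omega> - W 0 \<omega>) \<in> X} =
      emeasure (distr M (borel \<Otimes>\<^sub>M ?P) (\<lambda>\<omega>. (W 0 \<omega>, \<lambda>t. W t \<omega> - W 0 \<omega>))) X"
    using WB X by (simp add: emeasure_distr)
  also have "\<dots> = (\<integral>\<^sup>+x. emeasure (distr M ?P (\<lambda>\<omega> t. W t \<omega> - W 0 \<omega>)) (Pair x -` X) \<partial>distr M borel (W 0))"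
    unfolding start_indep_increments using X by (intro D.emeasure_pair_measure_alt) simp
  also have "\<dots> = (\<integral>\<^sup>+x. emeasure M {\<omega> \<in> space M. (x, \<lambda>t. W t \<omega> - W 0 \<omega>) \<in> X} \<partial>distr M borel (W 0))"
  proof (rule nn_integral_cong)
    fix x
    have "Pair x -` X \<in> sets ?P" using X by (rule sets_Pair1)
    then show "emeasure (distr M ?P (\<lambda>\<omega> t. W t \<omega> - W 0 \<omega>)) (Pair x -` X) =
        emeasure M {\<omega> \<in> space M. (x, \<lambda>t. W t \<omega> - W 0 \<omega>) \<in> X}"
      using B by (subst emeasure_distr) (auto intro!: arg_cong[of _ _ "emeasure M"])
  qed
  finally show ?thesis .
qed

text \<open>
  Convolution with a wide Gaussian makes a law nearly translation invariant. A stationary law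
  does not change under this convolution, so it is translation invariant, hence uniform.
\<close>

lemma stationary_start_uniform:
  assumes L: "L > 0"
    and stat: "\<And>t G. G \<in> sets borel \<Longrightarrow> (\<And>x. x + L \<in> G \<longleftrightarrow> x \<in> G) \<Longrightarrow>
      emeasure M {\<omega> \<in> space M. W t \<omega> \<in> G} = emeasure M {\<omega> \<in> space M. W 0 \<omega> \<in> G}"
    and G: "G \<in> sets borel" and per: "\<And>x. x + L \<in> G \<longleftrightarrow> x \<in> G"
  shows "emeasure M {\<omega> \<in> space M. W 0 \<omega> \<in> G} = emeasure (unif L) G"
proof -
  note [measurable] = random_variable_W
  let ?P = "\<Pi>\<^sub>M t\<in>(UNIV :: real set). (borel :: real measure)"
  have le: "emeasure M {\<omega> \<in> space M. W 0 \<omega> \<in> G} \<le> emeasure M {\<omega> \<in> space M. W 0 \<omega> + z \<in> G}"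
    if G: "G \<in> sets borel" and per: "\<And>x. x + L \<in> G \<longleftrightarrow> x \<in> G" for G z
  proof -
    let ?e = "\<lambda>n. \<integral>\<^sup>+v. norm (std_normal_density (v - z / real n) - std_normal_density v) \<partial>lborel"
    have Gz: "{x. x + z \<in> G} \<in> sets borel" using G by measurable
    have perz: "x + L \<in> {x. x + z \<in> G} \<longleftrightarrow> x \<in> {x. x + z \<in> G}" for x
      using per[of "x + z"] by (simp add: algebra_simps)
    have "emeasure M {\<omega> \<in> space M. W 0 \<omega> \<in> G} \<le> emeasure M {\<omega> \<in> space M. W 0 \<omega> + z \<in> G} + ?e n" if n: "n > 0" for n
    proof -
      let ?t = "(real n)\<^sup>2"
      let ?X1 = "{p. fst p + snd p ?t \<in> G} :: (real \<times> (real \<Rightarrow> real)) set"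
      let ?X2 = "{p. fst p + snd p ?t + z \<in> G} :: (real \<times> (real \<Rightarrow> real)) set"
      have X: "{p \<in> space (borel \<Otimes>\<^sub>M ?P). fst p + snd p ?t \<in> G} \<in> sets (borel \<Otimes>\<^sub>M ?P)"
        "{p \<in> space (borel \<Otimes>\<^sub>M ?P). fst p + snd p ?t + z \<in> G} \<in> sets (borel \<Otimes>\<^sub>M ?P)"
        using G by measurable
      have sp: "space (borel \<Otimes>\<^sub>M ?P) = UNIV" by (auto simp: space_pair_measure space_PiM)
      have X1: "?X1 \<in> sets (borel \<Otimes>\<^sub>M ?P)" and X2: "?X2 \<in> sets (borel \<Otimes>\<^sub>M ?P)"
        using X unfolding sp by simp_all
      have "emeasure M {\<omega> \<in> space M. W 0 \<omega> \<in> G} = emeasure M {\<omega> \<in> space M. W ?t \<omega> \<in> G}"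
        by (rule stat[OF G per, symmetric])
      also have "\<dots> = (\<integral>\<^sup>+x. emeasure M {\<omega> \<in> space M. x + (W ?t \<omega> - W 0 \<omega>) \<in> G} \<partial>distr M borel (W 0))"
        using start_fubini[OF X1] by simp
      also have "\<dots> \<le> (\<integral>\<^sup>+x. emeasure M {\<omega> \<in> space M. x + (W ?t \<omega> - W 0 \<omega>) + z \<in> G} + ?e n \<partial>distr M borel (W 0))"
      proof (rule nn_integral_mono)
        fix x
        have "{y. x + y \<in> G} \<in> sets borel" using G by measurable
        from normal_increment_shift[OF n this, of z]
        show "emeasure M {\<omega> \<in> space M. x + (W ?t \<omega> - W 0 \<omega>) \<in> G} \<le>
            emeasure M {\<omega> \<in> space M. x + (W ?t \<omega> - W 0 \<omega>) + z \<in> G} + ?e n"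
          by (simp add: algebra_simps)
      qed
      also have "\<dots> = (\<integral>\<^sup>+x. emeasure M {\<omega> \<in> space M. x + (W ?t \<omega> - W 0 \<omega>) + z \<in> G} \<partial>distr M borel (W 0)) + ?e n"
      proof -
        interpret D: prob_space "distr M borel (W 0)" by (rule prob_space_distr) simp
        have B: "(\<lambda>\<omega> t. W t \<omega> - W 0 \<omega>) \<in> M \<rightarrow>\<^sub>M ?P"
          by (rule measurable_PiM_single') (auto simp: space_PiM)
        interpret E: prob_space "distr M ?P (\<lambda>\<omega> t. W t \<omega> - W 0 \<omega>)" by (rule prob_space_distr[OF B])
        have "emeasure (distr M ?P (\<lambda>\<omega> t. W t \<omega> - W 0 \<omega>)) (Pair x -` ?X2) =
            emeasure M {\<omega> \<in> space M. x + (W ?t \<omega> - W 0 \<omega>) + z \<in> G}" for x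
          using B sets_Pair1[OF X2, of x] by (subst emeasure_distr) (auto intro!: arg_cong[of _ _ "emeasure M"])
        moreover have "(\<lambda>x. emeasure (distr M ?P (\<lambda>\<omega> t. W t \<omega> - W 0 \<omega>)) (Pair x -` ?X2)) \<in> borel_measurable borel"
          using X2 by (intro E.measurable_emeasure_Pair) simp
        ultimately have "(\<lambda>x. emeasure M {\<omega> \<in> space M. x + (W ?t \<omega> - W 0 \<omega>) + z \<in> G}) \<in> borel_measurable borel"
          by simp
        then show ?thesis by (subst nn_integral_add) (auto simp: D.emeasure_space_1[simplified])
      qed
      also have "(\<integral>\<^sup>+x. emeasure M {\<omega> \<in> space M. x + (W ?t \<omega> - W 0 \<omega>) + z \<in> G} \<partial>distr M borel (W 0)) =
          emeasure M {\<omega> \<in> space M. W ?t \<omega> + z \<in> G}"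
        using start_fubini[OF X2] by simp
      also have "\<dots> = emeasure M {\<omega> \<in> space M. W 0 \<omega> + z \<in> G}"
        using stat[OF Gz perz, of ?t] by simp
      finally show ?thesis .
    qed
    then have "\<forall>n\<ge>1. emeasure M {\<omega> \<in> space M. W 0 \<omega> \<in> G} \<le> emeasure M {\<omega> \<in> space M. W 0 \<omega> + z \<in> G} + ?e n"
      by simp
    moreover have "(\<lambda>n. emeasure M {\<omega> \<in> space M. W 0 \<omega> + z \<in> G} + ?e n) \<longlonglongrightarrow> emeasure M {\<omega> \<in> space M. W 0 \<omega> + z \<in> G} + 0"
      by (intro tendsto_add tendsto_const std_normal_shift_L1)
    ultimately show ?thesis
      using LIMSEQ_le_const by (metis (no_types, lifting) add.right_neutral)
  qed
  have inv: "emeasure M {\<omega> \<in> space M. z + W 0 \<omega> \<in> G} = emeasure M {\<omega> \<in> space M. W 0 \<omega> \<in> G}" for z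
  proof (rule antisym)
    have "{x. x + z \<in> G} \<in> sets borel" using G by measurable
    moreover have "x + L \<in> {x. x + z \<in> G} \<longleftrightarrow> x \<in> {x. x + z \<in> G}" for x
      using per[of "x + z"] by (simp add: algebra_simps)
    ultimately show "emeasure M {\<omega> \<in> space M. z + W 0 \<omega> \<in> G} \<le> emeasure M {\<omega> \<in> space M. W 0 \<omega> \<in> G}"
      using le[of "{x. x + z \<in> G}" "- z"] by (simp add: add.commute)
    show "emeasure M {\<omega> \<in> space M. W 0 \<omega> \<in> G} \<le> emeasure M {\<omega> \<in> space M. z + W 0 \<omega> \<in> G}"
      using le[OF G per, of z] by (simp add: add.commute)
  qed
  interpret U: prob_space "unif L" using prob_space_unif[OF L] .
  interpret UM: pair_prob_space "unif L" M ..
  let ?Y = "{p \<in> space (unif L \<Otimes>\<^sub>M M). fst p + W 0 (snd p) \<in> G}"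
  have Y: "?Y \<in> sets (unif L \<Otimes>\<^sub>M M)" using G by measurable
  have "emeasure M {\<omega> \<in> space M. W 0 \<omega> \<in> G} = (\<integral>\<^sup>+z. emeasure M {\<omega> \<in> space M. z + W 0 \<omega> \<in> G} \<partial>unif L)"
    unfolding inv by (simp add: U.emeasure_space_1[simplified])
  also have "\<dots> = emeasure (unif L \<Otimes>\<^sub>M M) ?Y"
    unfolding emeasure_pair_measure_alt[OF Y]
    by (intro nn_integral_cong arg_cong[of _ _ "emeasure M"]) (auto simp: space_pair_measure)
  also have "\<dots> = (\<integral>\<^sup>+\<omega>. emeasure (unif L) {x. x + W 0 \<omega> \<in> G} \<partial>M)"
    unfolding UM.emeasure_pair_measure_alt2[OF Y]
    by (intro nn_integral_cong arg_cong[of _ _ "emeasure (unif L)"]) (auto simp: space_pair_measure)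
  also have "\<dots> = emeasure (unif L) G"
    using unif_rotate[OF L G per] by (simp add: emeasure_space_1)
  finally show ?thesis .
qed

end

context two_sided_brownian_motion
begin

lemma measurable_start_section:
  assumes X: "X \<in> sets (borel \<Otimes>\<^sub>M (\<Pi>\<^sub>M t\<in>UNIV. borel))"
  shows "(\<lambda>x. emeasure M {\<omega> \<in> space M. (x, \<lambda>t. W t \<omega> - W 0 \<omega>) \<in> X}) \<in> borel_measurable borel"
proof -
  note [measurable] = random_variable_W
  let ?P = "\<Pi>\<^sub>M t\<in>(UNIV :: real set). (borel :: real measure)"
  have B: "(\<lambda>\<omega> t. W t \<omega> - W 0 \<omega>) \<in> M \<rightarrow>\<^sub>M ?P"
    by (rule measurable_PiM_single') (auto simp: space_PiM)
  interpret E: prob_space "distr M ?P (\<lambda>\<omega> t. W t \<omega> - W 0 \<omega>)" by (rule prob_space_distr[OF B])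
  have "emeasure (distr M ?P (\<lambda>\<omega> t. W t \<omega> - W 0 \<omega>)) (Pair x -` X) =
      emeasure M {\<omega> \<in> space M. (x, \<lambda>t. W t \<omega> - W 0 \<omega>) \<in> X}" for x
    using B sets_Pair1[OF X, of x] by (subst emeasure_distr) (auto intro!: arg_cong[of _ _ "emeasure M"])
  moreover have "(\<lambda>x. emeasure (distr M ?P (\<lambda>\<omega> t. W t \<omega> - W 0 \<omega>)) (Pair x -` X)) \<in> borel_measurable borel"
    using X by (intro E.measurable_emeasure_Pair) simp
  ultimately show ?thesis by simp
qed

lemma rmod_mem_periodic:
  assumes "L > 0" "\<And>x. x + L \<in> G \<longleftrightarrow> x \<in> G"
  shows "x rmod L \<in> G \<longleftrightarrow> x \<in> G"
proof -
  have *: "x rmod L = x + of_int (- \<lfloor>x / L\<rfloor>) * L"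
    using assms(1) by (simp add: rmod_def algebra_simps)
  show ?thesis
    unfolding * by (rule periodic_shift_int[where P = "\<lambda>x. x \<in> G", OF assms(2)])
qed

lemma stationary_path_law:
  assumes L: "L > 0" and Z: "\<And>t \<omega>. \<omega> \<in> space M \<Longrightarrow> Z t \<omega> = W t \<omega> rmod L"
    and stat: "stationary M L Z"
  shows "path_law M L Z = unif_law L M (\<lambda>t \<omega>. W t \<omega> - W 0 \<omega>)"
proof -
  note [measurable] = random_variable_W
  let ?P = "\<Pi>\<^sub>M t\<in>(UNIV :: real set). (borel :: real measure)"
  let ?V = "\<lambda>t \<omega>. W t \<omega> - W 0 \<omega>"
  have V: "wiener M ?V" using wiener_of_brownian_motion[OF two_sided_brownian_motion_axioms, of 0] by simp
  have "periodic_brownian_motion M L Z"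
    unfolding periodic_brownian_motion_def using L Z two_sided_brownian_motion_axioms by blast
  note Zm = measurable_periodic_brownian_motion[OF this]
  have cyl: "emeasure (path_law M L Z) {f \<in> circle_paths L. \<forall>j\<in>J. f j \<in> A j} =
      emeasure M {\<omega> \<in> space M. \<forall>j\<in>J. W j \<omega> rmod L \<in> A j}"
    if "finite J" "\<And>j. A j \<in> sets borel" for A J
  proof -
    have "(\<lambda>\<omega> t. Z t \<omega>) -` {f \<in> circle_paths L. \<forall>j\<in>J. f j \<in> A j} \<inter> space M =
        {\<omega> \<in> space M. \<forall>j\<in>J. W j \<omega> rmod L \<in> A j}"
      using measurable_space[OF Zm] by (auto simp: space_path_algebra Z)
    then show ?thesis
      unfolding path_law_def using sets_cylinder[OF L V that] Zm by (simp add: emeasure_distr)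
  qed
  have one: "emeasure (path_law M L Z) {f \<in> circle_paths L. f t \<in> G} = emeasure M {\<omega> \<in> space M. W t \<omega> \<in> G}"
    if "G \<in> sets borel" "\<And>x. x + L \<in> G \<longleftrightarrow> x \<in> G" for t G
    using cyl[of "{t}" "\<lambda>_. G"] that rmod_mem_periodic[OF L that(2)] by simp
  have pt: "emeasure M {\<omega> \<in> space M. W t \<omega> \<in> G} = emeasure M {\<omega> \<in> space M. W 0 \<omega> \<in> G}"
    if G: "G \<in> sets borel" and per: "\<And>x. x + L \<in> G \<longleftrightarrow> x \<in> G" for t G
  proof -
    let ?X = "{f \<in> circle_paths L. f 0 \<in> G}"
    have X: "?X \<in> sets (path_algebra L)" using sets_cylinder[OF L V, of "{0}" "\<lambda>_. G"] G by simp
    have T: "translate (- t) \<in> path_law M L Z \<rightarrow>\<^sub>M path_algebra L"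
      using measurable_translate[of "- t" L] by (simp add: path_law_def cong: measurable_cong_sets)
    have "emeasure (path_law M L Z) ?X = emeasure (distr (path_law M L Z) (path_algebra L) (translate (- t))) ?X"
      using stat by (simp add: stationary_def)
    also have "\<dots> = emeasure (path_law M L Z) (translate (- t) -` ?X \<inter> circle_paths L)"
      using T X by (simp add: emeasure_distr path_law_def space_path_algebra)
    also have "translate (- t) -` ?X \<inter> circle_paths L = {f \<in> circle_paths L. f t \<in> G}"
      using measurable_space[OF measurable_translate[of "- t" L]]
      by (auto simp: translate_def space_path_algebra)
    finally show ?thesis using one[OF G per] by simp
  qed
  have start: "emeasure M {\<omega> \<in> space M. W 0 \<omega> \<in> G} = emeasure (unif L) G"
    if "G \<in> sets borel" "\<And>x. x + L \<in> G \<longleftrightarrow> x \<in> G" for G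
    by (rule stationary_start_uniform[OF L _ that]) (rule pt)
  have wrapped: "distr (distr M borel (W 0)) borel (\<lambda>x. x rmod L) = unif L"
  proof (rule measure_eqI)
    fix G assume "G \<in> sets (distr (distr M borel (W 0)) borel (\<lambda>x. x rmod L))"
    then have G: "G \<in> sets borel" by simp
    let ?G = "{x. x rmod L \<in> G}"
    have G': "?G \<in> sets borel" using G by measurable
    have "emeasure (distr (distr M borel (W 0)) borel (\<lambda>x. x rmod L)) G = emeasure M {\<omega> \<in> space M. W 0 \<omega> \<in> ?G}"
      using G G' by (simp add: emeasure_distr vimage_def Int_def conj_commute)
    also have "\<dots> = emeasure (unif L) ?G"
      by (rule start[OF G']) (simp add: rmod_periodic[OF L])
    also have "\<dots> = emeasure (unif L) G"
    proof -
      have "{0..<L} \<inter> ?G = {0..<L} \<inter> G" by auto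
      then show ?thesis using L G G' by (simp add: emeasure_unif)
    qed
    finally show "emeasure (distr (distr M borel (W 0)) borel (\<lambda>x. x rmod L)) G = emeasure (unif L) G" .
  qed simp
  show ?thesis
  proof (rule path_measure_eqI[where L = L])
    show "finite_measure (path_law M L Z)"
      unfolding path_law_def using Zm by (rule finite_measure_distr)
    fix A :: "real \<Rightarrow> real set" and J :: "real set"
    assume J: "finite J" and A: "\<And>i. A i \<in> sets borel"
    let ?X = "{p :: real \<times> (real \<Rightarrow> real). \<forall>j\<in>J. (fst p + snd p j) rmod L \<in> A j}"
    have X0: "{p \<in> space (borel \<Otimes>\<^sub>M ?P). \<forall>j\<in>J. (fst p + snd p j) rmod L \<in> A j} \<in> sets (borel \<Otimes>\<^sub>M ?P)"
      using A J by measurable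
    have sp: "space (borel \<Otimes>\<^sub>M ?P) = UNIV" by (auto simp: space_pair_measure space_PiM)
    have X: "?X \<in> sets (borel \<Otimes>\<^sub>M ?P)" using X0 unfolding sp by (simp only: UNIV_I simp_thms)
    define h where "h x = emeasure M {\<omega> \<in> space M. (x, \<lambda>t. ?V t \<omega>) \<in> ?X}" for x
    have h: "h \<in> borel_measurable borel" unfolding h_def by (rule measurable_start_section[OF X])
    have hper: "h (x rmod L) = h x" for x
    proof -
      have "(x rmod L + y) rmod L = (x + y) rmod L" for y
        by (intro rmod_cong_eq rcong_add) simp_all
      then show ?thesis by (simp add: h_def)
    qed
    have "emeasure (path_law M L Z) {f \<in> circle_paths L. \<forall>j\<in>J. f j \<in> A j} =
        emeasure M {\<omega> \<in> space M. (W 0 \<omega>, \<lambda>t. ?V t \<omega>) \<in> ?X}"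
      using cyl[OF J A] by simp
    also have "\<dots> = (\<integral>\<^sup>+x. h x \<partial>distr M borel (W 0))"
      unfolding h_def by (rule start_fubini[OF X])
    also have "\<dots> = (\<integral>\<^sup>+x. h x \<partial>distr (distr M borel (W 0)) borel (\<lambda>x. x rmod L))"
      using h by (subst nn_integral_distr) (auto simp: hper)
    also have "\<dots> = emeasure (unif_law L M ?V) {f \<in> circle_paths L. \<forall>j\<in>J. f j \<in> A j}"
      unfolding wrapped unif_law_cylinder(1)[OF L V J A] h_def by simp
    finally show "emeasure (path_law M L Z) {f \<in> circle_paths L. \<forall>j\<in>J. f j \<in> A j} =
        emeasure (unif_law L M ?V) {f \<in> circle_paths L. \<forall>j\<in>J. f j \<in> A j}" .
  qed (simp_all add: path_law_def)
qed

end

lemma nn_integral_unif: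
  assumes "L > 0" "F \<in> borel_measurable borel"
  shows "(\<integral>\<^sup>+x. F x \<partial>unif L) = (\<integral>\<^sup>+x. F x * indicator {0..<L} x \<partial>lborel) / ennreal L"
  using assms unfolding unif_def by (subst nn_integral_uniform_measure) auto

text \<open>
  A uniform point on a circle \<open>m\<close> times as long is a uniform point on the short circle
  together with an independent uniform sheet.
\<close>

lemma nn_integral_unif_multiple:
  assumes L: "L > 0" and m: "m > 0" and F: "F \<in> borel_measurable borel"
    and K: "\<And>c. c < m \<Longrightarrow> (\<integral>\<^sup>+x. F (x + real c * L) \<partial>unif L) = K"
  shows "(\<integral>\<^sup>+x. F x \<partial>unif (real m * L)) = K"
proof -
  have piece: "(\<integral>\<^sup>+x. F x * indicator {real c * L..<real (Suc c) * L} x \<partial>lborel) = ennreal L * K" if "c < m" for c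
  proof -
    have "(\<integral>\<^sup>+x. F x * indicator {real c * L..<real (Suc c) * L} x \<partial>lborel) =
      ennreal \<bar>1\<bar> * (\<integral>\<^sup>+x. F (real c * L + 1 * x) * indicator {real c * L..<real (Suc c) * L} (real c * L + 1 * x) \<partial>lborel)"
      using F by (intro nn_integral_real_affine) auto
    also have "\<dots> = (\<integral>\<^sup>+x. F (x + real c * L) * indicator {0..<L} x \<partial>lborel)"
      by (simp, intro nn_integral_cong) (auto simp: indicator_def algebra_simps)
    also have "\<dots> = ennreal L * (\<integral>\<^sup>+x. F (x + real c * L) \<partial>unif L)"
    proof -
      have "(\<lambda>x. F (x + real c * L)) \<in> borel_measurable borel" using F by measurable
      then show ?thesis
        using L by (simp add: nn_integral_unif ennreal_times_divide mult.commute[of "ennreal L"] mult_divide_eq_ennreal)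
    qed
    finally show ?thesis using K[OF that] by simp
  qed
  have ind: "(indicator {0..<real n * L} x :: ennreal) = (\<Sum>c<n. indicator {real c * L..<real (Suc c) * L} x)" for n x
  proof (induction n)
    case (Suc n)
    have "{0..<real (Suc n) * L} = {0..<real n * L} \<union> {real n * L..<real (Suc n) * L}"
      using L by (auto simp: algebra_simps) (smt (verit) mult_nonneg_nonneg of_nat_0_le_iff)
    then have "(indicator {0..<real (Suc n) * L} x :: ennreal) =
        indicator {0..<real n * L} x + indicator {real n * L..<real (Suc n) * L} x"
      by (auto simp: indicator_def)
    then show ?case using Suc by simp
  qed simp
  have "(\<integral>\<^sup>+x. F x * indicator {0..<real m * L} x \<partial>lborel) =
      (\<integral>\<^sup>+x. (\<Sum>c<m. F x * indicator {real c * L..<real (Suc c) * L} x) \<partial>lborel)"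
    by (simp only: ind sum_distrib_left)
  also have "\<dots> = (\<Sum>c<m. \<integral>\<^sup>+x. F x * indicator {real c * L..<real (Suc c) * L} x \<partial>lborel)"
    using F by (intro nn_integral_sum) auto
  also have "\<dots> = (\<Sum>c<m. ennreal L * K)" using piece by simp
  also have "\<dots> = ennreal (real m * L) * K"
    using L by (simp add: ennreal_mult ennreal_of_nat_eq_real_of_nat mult.assoc)
  finally have "(\<integral>\<^sup>+x. F x \<partial>unif (real m * L)) = ennreal (real m * L) * K / ennreal (real m * L)"
    using L m F by (simp add: nn_integral_unif)
  then show ?thesis
    using L m by (simp add: mult.commute[of _ K] ennreal_mult_divide_eq)
qed

section \<open>Measure preserving maps by pieces and by limits\<close>

text \<open>
  Applying different law-preserving maps on the pieces of a countable partition preserves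
  the law if each map preserves its own piece.
\<close>

lemma distr_piecewise:
  fixes idx :: "'a \<Rightarrow> nat"
  assumes sets: "sets \<mu> = sets N" and idx: "idx \<in> N \<rightarrow>\<^sub>M count_space UNIV"
    and T: "\<And>k. T k \<in> N \<rightarrow>\<^sub>M N" "\<And>k. distr \<mu> N (T k) = \<mu>"
    and inv: "\<And>k x. x \<in> space N \<Longrightarrow> idx (T k x) = k \<longleftrightarrow> idx x = k"
  shows "(\<lambda>x. T (idx x) x) \<in> N \<rightarrow>\<^sub>M N" "distr \<mu> N (\<lambda>x. T (idx x) x) = \<mu>"
proof -
  show F: "(\<lambda>x. T (idx x) x) \<in> N \<rightarrow>\<^sub>M N"
    by (rule measurable_compose_countable[OF T(1) idx])
  have sp: "space \<mu> = space N" using sets by (rule sets_eq_imp_space_eq)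
  have F': "(\<lambda>x. T (idx x) x) \<in> \<mu> \<rightarrow>\<^sub>M N" and T': "T k \<in> \<mu> \<rightarrow>\<^sub>M N" for k
    using F T(1) measurable_cong_sets[OF sets refl] by auto
  have piece: "{x \<in> space N. idx x = k} \<in> sets N" for k
    using measurable_sets[OF idx, of "{k}"] by (simp add: vimage_def Int_def conj_commute)
  show "distr \<mu> N (\<lambda>x. T (idx x) x) = \<mu>"
  proof (rule measure_eqI)
    fix X assume "X \<in> sets (distr \<mu> N (\<lambda>x. T (idx x) x))"
    then have X: "X \<in> sets N" by simp
    let ?A = "\<lambda>k. {x \<in> space N. idx x = k}"
    have TX: "T k -` X \<inter> space N \<in> sets N" for k using measurable_sets[OF T(1) X] .
    have "(\<lambda>x. T (idx x) x) -` X \<inter> space \<mu> = (\<Union>k. ?A k \<inter> (T k -` X \<inter> space N))"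
      by (auto simp: sp)
    then have "emeasure (distr \<mu> N (\<lambda>x. T (idx x) x)) X = emeasure \<mu> (\<Union>k. ?A k \<inter> (T k -` X \<inter> space N))"
      using F' X by (simp add: emeasure_distr)
    also have "\<dots> = (\<Sum>k. emeasure \<mu> (?A k \<inter> (T k -` X \<inter> space N)))"
      by (rule suminf_emeasure[symmetric]) (use piece TX sets in \<open>auto simp: disjoint_family_on_def\<close>)
    also have "\<dots> = (\<Sum>k. emeasure \<mu> (?A k \<inter> X))"
    proof (rule suminf_cong)
      fix k
      have "?A k \<inter> (T k -` X \<inter> space N) = T k -` (?A k \<inter> X) \<inter> space \<mu>"
        using inv measurable_space[OF T(1)] by (auto simp: sp)
      also have "emeasure \<mu> \<dots> = emeasure (distr \<mu> N (T k)) (?A k \<inter> X)"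
        using T' piece X by (subst emeasure_distr) auto
      finally show "emeasure \<mu> (?A k \<inter> (T k -` X \<inter> space N)) = emeasure \<mu> (?A k \<inter> X)"
        by (simp add: T(2))
    qed
    also have "\<dots> = emeasure \<mu> (\<Union>k. ?A k \<inter> X)"
      by (rule suminf_emeasure) (use piece X sets in \<open>auto simp: disjoint_family_on_def\<close>)
    also have "(\<Union>k. ?A k \<inter> X) = X" using sets.sets_into_space[OF X] by auto
    finally show "emeasure (distr \<mu> N (\<lambda>x. T (idx x) x)) X = emeasure \<mu> X" .
  qed (simp add: sets)
qed

text \<open>
  Finite-dimensional distributions are determined by closed sets, one coordinate at a time.
\<close>

lemma closed_boxes_determine:
  fixes Y :: "'i \<Rightarrow> 'a \<Rightarrow> complex" and Y' :: "'i \<Rightarrow> 'b \<Rightarrow> complex"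
  assumes N: "finite_measure N" and N': "finite_measure N'"
    and Y: "\<And>j. Y j \<in> borel_measurable N" and Y': "\<And>j. Y' j \<in> borel_measurable N'"
    and J: "finite J"
    and cl: "\<And>C. (\<And>j. closed (C j)) \<Longrightarrow>
      emeasure N {x \<in> space N. \<forall>j\<in>J. Y j x \<in> C j} = emeasure N' {x \<in> space N'. \<forall>j\<in>J. Y' j x \<in> C j}"
    and A: "\<And>j. A j \<in> sets borel"
  shows "emeasure N {x \<in> space N. \<forall>j\<in>J. Y j x \<in> A j} = emeasure N' {x \<in> space N'. \<forall>j\<in>J. Y' j x \<in> A j}"
proof -
  have "\<forall>A :: 'i \<Rightarrow> complex set. (\<forall>j. A j \<in> sets borel) \<longrightarrow> (\<forall>j\<in>J - S. closed (A j)) \<longrightarrow>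
      emeasure N {x \<in> space N. \<forall>j\<in>J. Y j x \<in> A j} = emeasure N' {x \<in> space N'. \<forall>j\<in>J. Y' j x \<in> A j}"
    if "finite S" "S \<subseteq> J" for S
    using that
  proof (induction S)
    case empty
    show ?case
    proof (intro allI impI)
      fix A :: "'i \<Rightarrow> complex set" assume "\<forall>j\<in>J - {}. closed (A j)"
      then show "emeasure N {x \<in> space N. \<forall>j\<in>J. Y j x \<in> A j} = emeasure N' {x \<in> space N'. \<forall>j\<in>J. Y' j x \<in> A j}"
        using cl[of "\<lambda>j. if j \<in> J then A j else UNIV"] by simp
    qed
  next
    case (insert i S)
    then have i: "i \<in> J" and IH: "\<And>A :: 'i \<Rightarrow> complex set. (\<forall>j. A j \<in> sets borel) \<Longrightarrow> (\<forall>j\<in>J - S. closed (A j)) \<Longrightarrow>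
      emeasure N {x \<in> space N. \<forall>j\<in>J. Y j x \<in> A j} = emeasure N' {x \<in> space N'. \<forall>j\<in>J. Y' j x \<in> A j}"
      by auto
    show ?case
    proof (intro allI impI)
      fix A :: "'i \<Rightarrow> complex set" assume A: "\<forall>j. A j \<in> sets borel" and Ac: "\<forall>j\<in>J - insert i S. closed (A j)"
      define R where "R = {x \<in> space N. \<forall>j\<in>J - {i}. Y j x \<in> A j}"
      define R' where "R' = {x \<in> space N'. \<forall>j\<in>J - {i}. Y' j x \<in> A j}"
      have R: "R \<in> sets N" "R' \<in> sets N'"
      proof -
        note [measurable] = Y Y'
        have [measurable]: "A j \<in> sets borel" for j using A by simp
        have fin: "finite (J - {i})" using J by simp
        show "R \<in> sets N" "R' \<in> sets N'"
          unfolding R_def R'_def using fin by measurable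
      qed
      define \<nu> where "\<nu> = distr (density N (indicator R)) borel (Y i)"
      define \<nu>' where "\<nu>' = distr (density N' (indicator R')) borel (Y' i)"
      have e: "emeasure \<nu> B = emeasure N {x \<in> space N. \<forall>j\<in>J. Y j x \<in> (A(i := B)) j}"
        if B: "B \<in> sets borel" for B
      proof -
        have "emeasure \<nu> B = emeasure N (R \<inter> (Y i -` B \<inter> space N))"
          unfolding \<nu>_def using B Y[of i] R
          by (subst emeasure_distr) (auto simp: emeasure_density indicator_inter_arith[symmetric] measurable_sets)
        also have "R \<inter> (Y i -` B \<inter> space N) = {x \<in> space N. \<forall>j\<in>J. Y j x \<in> (A(i := B)) j}"
          using i by (auto simp: R_def)
        finally show ?thesis .
      qed
      have e': "emeasure \<nu>' B = emeasure N' {x \<in> space N'. \<forall>j\<in>J. Y' j x \<in> (A(i := B)) j}"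
        if B: "B \<in> sets borel" for B
      proof -
        have "emeasure \<nu>' B = emeasure N' (R' \<inter> (Y' i -` B \<inter> space N'))"
          unfolding \<nu>'_def using B Y'[of i] R
          by (subst emeasure_distr) (auto simp: emeasure_density indicator_inter_arith[symmetric] measurable_sets)
        also have "R' \<inter> (Y' i -` B \<inter> space N') = {x \<in> space N'. \<forall>j\<in>J. Y' j x \<in> (A(i := B)) j}"
          using i by (auto simp: R'_def)
        finally show ?thesis .
      qed
      have "\<nu> = \<nu>'"
      proof (rule measure_eqI_generator_eq[where E = "Collect closed" and \<Omega> = UNIV and A = "\<lambda>_. UNIV"])
        show "Int_stable (Collect closed :: complex set set)" by (auto simp: Int_stable_def)
        show "sets \<nu> = sigma_sets UNIV (Collect closed)" "sets \<nu>' = sigma_sets UNIV (Collect closed)"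
          by (simp_all add: \<nu>_def \<nu>'_def borel_eq_closed)
        show "emeasure \<nu> C = emeasure \<nu>' C" if "C \<in> Collect closed" for C
          using that e[of C] e'[of C] IH[of "A(i := C)"] A Ac insert.hyps by auto
        show "emeasure \<nu> UNIV \<noteq> \<infinity>"
          using e[of UNIV] finite_measure.emeasure_finite[OF N] by simp
      qed auto
      then show "emeasure N {x \<in> space N. \<forall>j\<in>J. Y j x \<in> A j} = emeasure N' {x \<in> space N'. \<forall>j\<in>J. Y' j x \<in> A j}"
        using e[of "A i"] e'[of "A i"] A by simp
    qed
  qed
  from this[OF J order_refl] A show ?thesis by simp
qed

lemma borel_via_circ:
  assumes L: "L > 0" and A: "A \<in> sets borel"
  shows "\<exists>C\<in>sets borel. \<forall>x. 0 \<le> x \<longrightarrow> x < L \<longrightarrow> (x \<in> A \<longleftrightarrow> circ L x \<in> C)"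
proof -
  have inj: "x = y" if "circ L x = circ L y" "0 \<le> x" "x < L" "0 \<le> y" "y < L" for x y
    using that circ_eq_iff[OF L] by (auto simp: rcong_def)
  have "A \<in> sigma_sets UNIV (range atMost)" using A unfolding borel_eq_atMost by simp
  then show ?thesis
  proof induction
    case (Basic A)
    then obtain a where a: "A = {..a}" by auto
    show ?case
    proof (cases "a < L")
      case True
      have "compact (circ L ` {0..a})"
        by (intro compact_continuous_image continuous_on_circ continuous_on_id) auto
      then have "circ L ` {0..a} \<in> sets borel" by (intro borel_closed compact_imp_closed)
      then show ?thesis
        by (rule bexI[rotated]) (use inj True a in force)
    qed (use a in \<open>auto intro!: bexI[of _ UNIV]\<close>)
  next
    case Empty
    show ?case by (intro bexI[of _ "{}"]) auto
  next
    case (Compl A)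
    then obtain C where "C \<in> sets borel" "\<forall>x. 0 \<le> x \<longrightarrow> x < L \<longrightarrow> (x \<in> A \<longleftrightarrow> circ L x \<in> C)" by blast
    then show ?case by (intro bexI[of _ "- C"]) auto
  next
    case (Union A)
    then have "\<forall>i. \<exists>C\<in>sets borel. \<forall>x. 0 \<le> x \<longrightarrow> x < L \<longrightarrow> (x \<in> A i \<longleftrightarrow> circ L x \<in> C)" by blast
    then obtain C where "\<And>i. C i \<in> sets borel" "\<And>i x. 0 \<le> x \<Longrightarrow> x < L \<Longrightarrow> (x \<in> A i \<longleftrightarrow> circ L x \<in> C i)"
      by metis
    then show ?case by (intro bexI[of _ "\<Union>i. C i"]) auto
  qed
qed

text \<open>
  Lipschitz approximations from above of the indicator function of a closed set.
\<close>

definition bump :: "complex set \<Rightarrow> nat \<Rightarrow> complex \<Rightarrow> real" where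
  "bump C k z = (if C = {} then 0 else max 0 (1 - real k * infdist z C))"

lemma bump_bounds: "0 \<le> bump C k z" "bump C k z \<le> 1"
  by (auto simp: bump_def infdist_nonneg)

lemma continuous_bump: "continuous_on UNIV (bump C k)"
  unfolding bump_def by (cases "C = {}") (auto intro!: continuous_intros)

lemma bump_tendsto:
  assumes "closed C" shows "(\<lambda>k. bump C k z) \<longlonglongrightarrow> indicator C z"
proof (cases "C = {} \<or> z \<in> C")
  case True
  then consider "C = {}" | "C \<noteq> {}" "z \<in> C" by blast
  then show ?thesis by cases (simp_all add: bump_def)
next
  case False
  then have d: "infdist z C > 0"
    using in_closed_iff_infdist_zero[OF assms] infdist_nonneg[of z C] by (auto simp: less_le)
  obtain K :: nat where K: "1 / infdist z C < K" using reals_Archimedean2 by blast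
  have "bump C k z = 0" if "k \<ge> K" for k
  proof -
    have "1 \<le> real K * infdist z C" using K d by (simp add: field_simps)
    also have "\<dots> \<le> real k * infdist z C" using that d by (intro mult_right_mono) auto
    finally show ?thesis by (simp add: bump_def)
  qed
  then have "eventually (\<lambda>k. bump C k z = indicator C z) sequentially"
    unfolding eventually_sequentially using False by auto
  then show ?thesis by (rule tendsto_eventually)
qed

lemma (in prob_space) closed_box_limit:
  fixes Y :: "'i \<Rightarrow> 'a \<Rightarrow> complex"
  assumes Y [measurable]: "\<And>j. Y j \<in> borel_measurable M" and J: "finite J" and C: "\<And>j. closed (C j)"
  shows "(\<lambda>k. \<integral>x. (\<Prod>j\<in>J. bump (C j) k (Y j x)) \<partial>M) \<longlonglongrightarrow> prob {x \<in> space M. \<forall>j\<in>J. Y j x \<in> C j}"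
proof -
  have [measurable]: "bump (C j) k \<in> borel_measurable borel" for j k
    by (intro borel_measurable_continuous_onI continuous_bump)
  have [measurable]: "C j \<in> sets borel" for j using C by (rule borel_closed)
  have S: "{x \<in> space M. \<forall>j\<in>J. Y j x \<in> C j} \<in> sets M" using J by measurable
  have "(\<lambda>k. \<integral>x. (\<Prod>j\<in>J. bump (C j) k (Y j x)) \<partial>M) \<longlonglongrightarrow>
      (\<integral>x. indicator {x \<in> space M. \<forall>j\<in>J. Y j x \<in> C j} x \<partial>M)"
  proof (rule integral_dominated_convergence[where w = "\<lambda>_. 1"])
    show "AE x in M. (\<lambda>k. \<Prod>j\<in>J. bump (C j) k (Y j x)) \<longlonglongrightarrow> indicator {x \<in> space M. \<forall>j\<in>J. Y j x \<in> C j} x"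
    proof (rule AE_I2)
      fix x assume x: "x \<in> space M"
      have "(\<lambda>k. \<Prod>j\<in>J. bump (C j) k (Y j x)) \<longlonglongrightarrow> (\<Prod>j\<in>J. indicator (C j) (Y j x))"
        by (intro tendsto_prod bump_tendsto C)
      moreover have "(\<Prod>j\<in>J. indicator (C j) (Y j x) :: real) = indicator {x \<in> space M. \<forall>j\<in>J. Y j x \<in> C j} x"
        using x J by (auto simp: indicator_def prod_zero_iff)
      ultimately show "(\<lambda>k. \<Prod>j\<in>J. bump (C j) k (Y j x)) \<longlonglongrightarrow> indicator {x \<in> space M. \<forall>j\<in>J. Y j x \<in> C j} x"
        by simp
    qed
    show "AE x in M. norm (\<Prod>j\<in>J. bump (C j) k (Y j x)) \<le> 1" for k
      by (intro AE_I2) (auto simp: abs_prod intro!: prod_le_1 simp: bump_bounds)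
  qed (use S in auto)
  then show ?thesis using S by simp
qed

text \<open>
  Laws are compared through circle values, since representatives in \<open>{0..<L}\<close> jump at the
  gluing point. Pointwise convergence there suffices for finite-dimensional distributions.
\<close>

lemma distr_limit:
  assumes L: "L > 0" and N: "prob_space N"
    and F: "\<And>n. F n \<in> N \<rightarrow>\<^sub>M path_algebra L" and G: "G \<in> N \<rightarrow>\<^sub>M path_algebra L"
    and law: "\<And>n::nat. distr N (path_algebra L) (F n) = \<mu>"
    and lim: "AE x in N. \<forall>t. (\<lambda>n. circ L (F n x t)) \<longlonglongrightarrow> circ L (G x t)"
  shows "distr N (path_algebra L) G = \<mu>"
proof (rule path_measure_eqI[where L = L])
  interpret N: prob_space N by fact
  have sm: "sets \<mu> = sets (path_algebra L)" using law[of 0] by auto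
  then show "sets \<mu> = sets (path_algebra L)" .
  interpret \<mu>: prob_space \<mu> using N.prob_space_distr[OF F, of 0] by (simp add: law)
  show "finite_measure (distr N (path_algebra L) G)" using G by (rule N.finite_measure_distr)
  note ev[measurable] = measurable_path_eval[of _ L]
  have ev'[measurable]: "(\<lambda>f. f t) \<in> borel_measurable \<mu>" for t
    using ev by (simp cong: measurable_cong_sets add: sm)
  have [measurable]: "(\<lambda>x. F n x t) \<in> borel_measurable N" "(\<lambda>x. G x t) \<in> borel_measurable N" for n t
    using F G by (auto intro: measurable_path_apply)
  have sp: "space \<mu> = circle_paths L" using sets_eq_imp_space_eq[OF sm] by (simp add: space_path_algebra)
  fix A :: "real \<Rightarrow> real set" and J :: "real set"
  assume J: "finite J" and A: "\<And>i. A i \<in> sets borel"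
  have "\<forall>j. \<exists>C\<in>sets borel. \<forall>x. 0 \<le> x \<longrightarrow> x < L \<longrightarrow> (x \<in> A j \<longleftrightarrow> circ L x \<in> C)"
    using borel_via_circ[OF L A] by blast
  then obtain C where C: "\<And>j. C j \<in> sets borel" "\<And>j x. 0 \<le> x \<Longrightarrow> x < L \<Longrightarrow> (x \<in> A j \<longleftrightarrow> circ L x \<in> C j)"
    by metis
  have cp: "f j \<in> A j \<longleftrightarrow> circ L (f j) \<in> C j" if "f \<in> circle_paths L" for f j
    using C(2) circle_path_imp(1,2)[OF L that] by blast
  have "emeasure (distr N (path_algebra L) G) {f \<in> circle_paths L. \<forall>j\<in>J. f j \<in> A j} =
      emeasure N {x \<in> space N. \<forall>j\<in>J. circ L (G x j) \<in> C j}"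
  proof -
    have X: "{f \<in> space (path_algebra L). \<forall>j\<in>J. f j \<in> A j} \<in> sets (path_algebra L)"
      using J A by measurable
    have "G -` {f \<in> circle_paths L. \<forall>j\<in>J. f j \<in> A j} \<inter> space N =
        {x \<in> space N. \<forall>j\<in>J. circ L (G x j) \<in> C j}"
      using cp measurable_path_space[OF G] by auto
    then show ?thesis using X G by (simp add: emeasure_distr space_path_algebra)
  qed
  also have "\<dots> = emeasure \<mu> {f \<in> space \<mu>. \<forall>j\<in>J. circ L (f j) \<in> C j}"
  proof (rule closed_boxes_determine[OF _ _ _ _ J _ C(1)])
    fix D :: "real \<Rightarrow> complex set" assume D: "\<And>j. closed (D j)"
    have [measurable]: "bump (D j) k \<in> borel_measurable borel" for j k
      by (intro borel_measurable_continuous_onI continuous_bump)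
    have int: "(\<integral>x. (\<Prod>j\<in>J. bump (D j) k (circ L (G x j))) \<partial>N) = (\<integral>f. (\<Prod>j\<in>J. bump (D j) k (circ L (f j))) \<partial>\<mu>)" for k
    proof (rule LIMSEQ_unique)
      show "(\<lambda>n. \<integral>x. (\<Prod>j\<in>J. bump (D j) k (circ L (F n x j))) \<partial>N) \<longlonglongrightarrow>
          (\<integral>x. (\<Prod>j\<in>J. bump (D j) k (circ L (G x j))) \<partial>N)"
      proof (rule integral_dominated_convergence[where w = "\<lambda>_. 1"])
        show "AE x in N. (\<lambda>n. \<Prod>j\<in>J. bump (D j) k (circ L (F n x j))) \<longlonglongrightarrow> (\<Prod>j\<in>J. bump (D j) k (circ L (G x j)))"
          using lim
        proof eventually_elim
          case (elim x)
          show ?case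
          proof (rule tendsto_prod)
            fix j
            have "isCont (bump (D j) k) (circ L (G x j))"
              using continuous_bump by (simp add: continuous_on_eq_continuous_at)
            then show "(\<lambda>n. bump (D j) k (circ L (F n x j))) \<longlonglongrightarrow> bump (D j) k (circ L (G x j))"
              using elim by (intro isCont_tendsto_compose[of _ "bump (D j) k"]) auto
          qed
        qed
        show "AE x in N. norm (\<Prod>j\<in>J. bump (D j) k (circ L (F n x j))) \<le> 1" for n
          by (intro AE_I2) (auto simp: abs_prod intro!: prod_le_1 simp: bump_bounds)
      qed auto
      have "(\<integral>x. (\<Prod>j\<in>J. bump (D j) k (circ L (F n x j))) \<partial>N) = (\<integral>f. (\<Prod>j\<in>J. bump (D j) k (circ L (f j))) \<partial>\<mu>)" for n
        unfolding law[of n, symmetric] using F by (subst integral_distr) auto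
      then show "(\<lambda>n. \<integral>x. (\<Prod>j\<in>J. bump (D j) k (circ L (F n x j))) \<partial>N) \<longlonglongrightarrow>
          (\<integral>f. (\<Prod>j\<in>J. bump (D j) k (circ L (f j))) \<partial>\<mu>)"
        by simp
    qed
    have "N.prob {x \<in> space N. \<forall>j\<in>J. circ L (G x j) \<in> D j} = \<mu>.prob {f \<in> space \<mu>. \<forall>j\<in>J. circ L (f j) \<in> D j}"
    proof (rule LIMSEQ_unique)
      show "(\<lambda>k. \<integral>x. (\<Prod>j\<in>J. bump (D j) k (circ L (G x j))) \<partial>N) \<longlonglongrightarrow> N.prob {x \<in> space N. \<forall>j\<in>J. circ L (G x j) \<in> D j}"
        by (rule N.closed_box_limit[OF _ J D]) measurable
      show "(\<lambda>k. \<integral>x. (\<Prod>j\<in>J. bump (D j) k (circ L (G x j))) \<partial>N) \<longlonglongrightarrow> \<mu>.prob {f \<in> space \<mu>. \<forall>j\<in>J. circ L (f j) \<in> D j}"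
        unfolding int by (rule \<mu>.closed_box_limit[OF _ J D]) measurable
    qed
    then show "emeasure N {x \<in> space N. \<forall>j\<in>J. circ L (G x j) \<in> D j} = emeasure \<mu> {f \<in> space \<mu>. \<forall>j\<in>J. circ L (f j) \<in> D j}"
      by (simp add: N.emeasure_eq_measure \<mu>.emeasure_eq_measure)
  qed (measurable, unfold_locales)
  also have "{f \<in> space \<mu>. \<forall>j\<in>J. circ L (f j) \<in> C j} = {f \<in> circle_paths L. \<forall>j\<in>J. f j \<in> A j}"
    using cp by (auto simp: sp)
  finally show "emeasure (distr N (path_algebra L) G) {f \<in> circle_paths L. \<forall>j\<in>J. f j \<in> A j} =
      emeasure \<mu> {f \<in> circle_paths L. \<forall>j\<in>J. f j \<in> A j}" .
qed simp

section \<open>Vertex times and quiet intervals\<close>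

definition quiet :: "real \<Rightarrow> (real \<Rightarrow> real) \<Rightarrow> real \<Rightarrow> real \<Rightarrow> bool" where
  "quiet H f s t \<longleftrightarrow> (\<forall>w\<in>{min s t..max s t}. Im (circ (2 * H) (f w)) \<noteq> 0)"

lemma vertex_iff:
  assumes "H > 0" "[f t = H * g t] (rmod (2 * H))"
  shows "Im (circ (2 * H) (f t)) = 0 \<longleftrightarrow> g t \<in> \<int>"
proof -
  have "circ (2 * H) (f t) = circ (2 * H) (H * g t)" using assms by (simp add: circ_eq_iff)
  also have "\<dots> = cis (g t * pi)" using assms(1) by (simp add: circ_def mult.commute)
  finally show ?thesis by (simp add: sin_times_pi_eq_0)
qed

lemma quiet_iff:
  assumes "H > 0" "\<And>t. [f t = H * g t] (rmod (2 * H))"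
  shows "quiet H f s t \<longleftrightarrow> (\<forall>w\<in>{min s t..max s t}. g w \<notin> \<int>)"
  using vertex_iff[of H f _ g, OF assms] by (simp add: quiet_def)

lemma vertex_flip:
  assumes "H > 0"
  shows "Im (circ (2 * H) (flip_path H S f t)) = 0 \<longleftrightarrow> Im (circ (2 * H) (f t)) = 0"
  using assms by (simp add: flip_path_def circ_minus)

lemma quiet_flip: "H > 0 \<Longrightarrow> quiet H (flip_path H S f) s t \<longleftrightarrow> quiet H f s t"
  by (simp add: quiet_def vertex_flip)

lemma vertex_uminus:
  assumes "H > 0" "Im (circ (2 * H) (f t)) = 0"
  shows "(- f t) rmod (2 * H) = f t rmod (2 * H)"
proof -
  have "cnj (circ (2 * H) (f t)) = circ (2 * H) (f t)" using assms(2) by (simp add: complex_eq_iff)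
  then have "circ (2 * H) (- f t) = circ (2 * H) (f t)" by (simp add: circ_minus)
  then show ?thesis using assms(1) by (simp add: circ_eq_iff rcong_def)
qed

lemma path_unit_lift:
  assumes "H > 0" "f \<in> circle_paths (2 * H)"
  shows "continuous_on UNIV (unit_lift H 1 f)" "[f t = H * unit_lift H 1 f t] (rmod (2 * H))"
    "(H * unit_lift H 1 f t) rmod (2 * H) = f t"
proof -
  show "continuous_on UNIV (unit_lift H 1 f)"
    using continuous_unit_lift[of H 1 f] assms by simp
  show *: "(H * unit_lift H 1 f t) rmod (2 * H) = f t"
    using unit_lift_rmod[of H 1 f t] assms by simp
  show "[f t = H * unit_lift H 1 f t] (rmod (2 * H))"
    unfolding *[symmetric] by simp
qed

lemma continuous_process_path: "H > 0 \<Longrightarrow> continuous_process (path_algebra (2 * H)) (unit_lift H 1)"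
  using continuous_process_unit_lift[of H 1] by simp

lemma quiet_near:
  assumes H: "H > 0" and f: "f \<in> circle_paths (2 * H)" and x: "Im (circ (2 * H) (f x)) \<noteq> 0"
  shows "\<exists>d>0. \<forall>w. \<bar>w - x\<bar> < d \<longrightarrow> quiet H f w x \<and> (\<forall>r. quiet H f r w = quiet H f r x)"
proof -
  let ?g = "unit_lift H 1 f"
  note g = path_unit_lift[OF H f]
  have "?g x \<notin> \<int>" using x vertex_iff[of H f x ?g] H g(2) by blast
  then obtain d where d: "d > 0" "\<And>w. \<bar>w - x\<bar> < d \<Longrightarrow> ?g w \<notin> \<int>"
    using nonint_neighbourhood[OF g(1)] by blast
  have nz: "Im (circ (2 * H) (f w)) \<noteq> 0" if "\<bar>w - x\<bar> < d" for w
    using d(2)[OF that] vertex_iff[of H f w ?g] H g(2) by blast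
  have "quiet H f r w = quiet H f r x" if w: "\<bar>w - x\<bar> < d" for r w
  proof
    assume q: "quiet H f r w"
    show "quiet H f r x" unfolding quiet_def
    proof
      fix v assume v: "v \<in> {min r x..max r x}"
      show "Im (circ (2 * H) (f v)) \<noteq> 0"
        using q nz[of v] v w unfolding quiet_def by (cases "v \<in> {min r w..max r w}") (auto simp: min_def max_def split: if_splits)
    qed
  next
    assume q: "quiet H f r x"
    show "quiet H f r w" unfolding quiet_def
    proof
      fix v assume v: "v \<in> {min r w..max r w}"
      show "Im (circ (2 * H) (f v)) \<noteq> 0"
        using q nz[of v] v w unfolding quiet_def by (cases "v \<in> {min r x..max r x}") (auto simp: min_def max_def split: if_splits)
    qed
  qed
  moreover have "quiet H f w x" if w: "\<bar>w - x\<bar> < d" for w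
    unfolding quiet_def using nz w by (auto simp: min_def max_def split: if_splits)
  ultimately show ?thesis using d(1) by blast
qed

lemma measurable_quiet:
  assumes H: "H > 0" shows "Measurable.pred (path_algebra (2 * H)) (\<lambda>f. quiet H f s t)"
proof -
  let ?N = "path_algebra (2 * H)"
  have [measurable]: "Measurable.pred ?N (\<lambda>f. \<exists>v\<in>{min s t..max s t}. unit_lift H 1 f v = of_int k)" for k :: int
    by (rule measurable_hits[OF continuous_process_path[OF H]]) auto
  have "Measurable.pred ?N (\<lambda>f. \<forall>k::int. \<not> (\<exists>v\<in>{min s t..max s t}. unit_lift H 1 f v = of_int k))"
    by measurable
  then show ?thesis
  proof (rule measurable_cong[THEN iffD1, rotated])
    fix f assume "f \<in> space ?N"
    then have "f \<in> circle_paths (2 * H)" by (simp add: space_path_algebra)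
    then have q: "quiet H f s t \<longleftrightarrow> (\<forall>w\<in>{min s t..max s t}. unit_lift H 1 f w \<notin> \<int>)"
      by (intro quiet_iff[OF H] path_unit_lift(2)[OF H])
    show "(\<forall>k::int. \<not> (\<exists>v\<in>{min s t..max s t}. unit_lift H 1 f v = of_int k)) = quiet H f s t"
      unfolding q by (auto elim!: Ints_cases)
  qed
qed

lemma flip_path_measurable:
  assumes H: "H > 0"
    and S: "\<And>t. Measurable.pred (path_algebra (2 * H)) (\<lambda>f. S f t)"
    and loc: "\<And>f x. f \<in> circle_paths (2 * H) \<Longrightarrow> Im (circ (2 * H) (f x)) \<noteq> 0 \<Longrightarrow>
      \<exists>d>0. \<forall>w. \<bar>w - x\<bar> < d \<longrightarrow> S f w = S f x"
  shows "(\<lambda>f. flip_path H (S f) f) \<in> path_algebra (2 * H) \<rightarrow>\<^sub>M path_algebra (2 * H)"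
proof (rule measurable_path_algebraI)
  fix f assume "f \<in> space (path_algebra (2 * H))"
  then have f: "f \<in> circle_paths (2 * H)" by (simp add: space_path_algebra)
  show "flip_path H (S f) f \<in> circle_paths (2 * H)"
  proof (rule flip_path_in_circle_paths[OF H path_unit_lift(1)[OF H f] path_unit_lift(2)[OF H f]])
    fix x assume "unit_lift H 1 f x \<notin> \<int>"
    then have "Im (circ (2 * H) (f x)) \<noteq> 0"
      using vertex_iff[of H f x "unit_lift H 1 f"] H path_unit_lift(2)[OF H f] by blast
    then show "\<exists>d>0. \<forall>w. \<bar>w - x\<bar> < d \<longrightarrow> S f w = S f x" by (rule loc[OF f])
  qed
next
  fix t
  note [measurable] = S[of t] measurable_path_eval[of t]
  show "(\<lambda>f. flip_path H (S f) f t) \<in> borel_measurable (path_algebra (2 * H))"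
    unfolding flip_path_def by measurable
qed

section \<open>Flipping one excursion\<close>

text \<open>Negation after the first vertex time on the side \<open>e\<close> of the origin.\<close>

definition negate_beyond :: "real \<Rightarrow> real \<Rightarrow> (real \<Rightarrow> real) \<Rightarrow> real \<Rightarrow> real" where
  "negate_beyond H e f = flip_path H (\<lambda>t. 0 \<le> e * t \<and> \<not> quiet H f 0 t) f"

text \<open>
  Reversal of the excursion that is under way at time \<open>r\<close>, if \<open>r\<close> is not a vertex time.
\<close>

definition flip_excursion :: "real \<Rightarrow> real \<Rightarrow> (real \<Rightarrow> real) \<Rightarrow> real \<Rightarrow> real" where
  "flip_excursion H r f = flip_path H (quiet H f r) f"

text \<open>
  The symmetries of the uniform circle law from which the invariance under flips is derived: translations,
  negation, and reflection of one side of time \<open>0\<close> at the position at time \<open>0\<close>.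
\<close>

locale circle_law =
  fixes H :: real and \<mu> :: "(real \<Rightarrow> real) measure"
  assumes H: "H > 0"
    and prob_law: "prob_space \<mu>"
    and sets_law: "sets \<mu> = sets (path_algebra (2 * H))"
    and translate_inv: "\<And>s. distr \<mu> (path_algebra (2 * H)) (translate s) = \<mu>"
    and negate_inv: "distr \<mu> (path_algebra (2 * H)) (negate (2 * H)) = \<mu>"
    and reflect_inv: "\<And>e. e = 1 \<or> e = - 1 \<Longrightarrow> distr \<mu> (path_algebra (2 * H)) (reflect_side (2 * H) e) = \<mu>"
begin

abbreviation "PA \<equiv> path_algebra (2 * H)"

definition preserves :: "((real \<Rightarrow> real) \<Rightarrow> real \<Rightarrow> real) \<Rightarrow> bool" where
  "preserves T \<longleftrightarrow> T \<in> PA \<rightarrow>\<^sub>M PA \<and> distr \<mu> PA T = \<mu>"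

lemma space_law: "space \<mu> = circle_paths (2 * H)"
  using sets_eq_imp_space_eq[OF sets_law] by (simp add: space_path_algebra)

lemma measurable_law: "T \<in> PA \<rightarrow>\<^sub>M N \<Longrightarrow> T \<in> \<mu> \<rightarrow>\<^sub>M N"
  using measurable_cong_sets[OF sets_law refl] by blast

lemma preserves_comp:
  assumes "preserves S" "preserves T" shows "preserves (\<lambda>f. S (T f))"
proof -
  have S: "S \<in> PA \<rightarrow>\<^sub>M PA" and T: "T \<in> PA \<rightarrow>\<^sub>M PA" using assms by (auto simp: preserves_def)
  have "distr \<mu> PA (\<lambda>f. S (T f)) = distr (distr \<mu> PA T) PA S"
    using distr_distr[OF S measurable_law[OF T]] by (simp add: o_def)
  then show ?thesis
    using assms measurable_compose[OF T S] by (simp add: preserves_def)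
qed

lemma preserves_translate: "preserves (translate s)"
  using measurable_translate translate_inv by (simp add: preserves_def)

lemma preserves_negate: "preserves (negate (2 * H))"
  using measurable_negate[of "2 * H"] negate_inv H by (simp add: preserves_def)

lemma distr_law_id: "distr \<mu> PA (\<lambda>f. f) = \<mu>"
  using distr_id2[of PA \<mu>] sets_law by simp

lemma path_rmod: "f \<in> circle_paths (2 * H) \<Longrightarrow> f t rmod (2 * H) = f t"
  using circle_path_imp(1,2)[of "2 * H" f t] H by simp

definition reflect_at :: "real \<Rightarrow> real \<Rightarrow> (real \<Rightarrow> real) \<Rightarrow> real \<Rightarrow> real" where
  "reflect_at e s f = translate s (reflect_side (2 * H) e (translate (- s) f))"

lemma reflect_at_eq: "reflect_at e s f t = (if e * (t - s) \<le> 0 then f t else 2 * f s - f t) rmod (2 * H)"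
  by (simp add: reflect_at_def translate_def reflect_side_def)

text \<open>
  At a fixed time the reflection principle is the symmetry at time \<open>0\<close>, moved by
  stationarity.
\<close>

lemma preserves_reflect_at:
  assumes "e = 1 \<or> e = - 1" shows "preserves (reflect_at e s)"
proof -
  have "preserves (reflect_side (2 * H) e)"
    using measurable_reflect_side[of "2 * H" e] reflect_inv H assms by (simp add: preserves_def)
  from preserves_comp[OF preserves_translate[of s] preserves_comp[OF this preserves_translate[of "- s"]]]
  have "preserves (\<lambda>f. translate s (reflect_side (2 * H) e (translate (- s) f)))" .
  then show ?thesis by (simp add: reflect_at_def[abs_def])
qed

lemma negate_beyond_local:
  assumes f: "f \<in> circle_paths (2 * H)" and x: "Im (circ (2 * H) (f x)) \<noteq> 0"
  shows "\<exists>d>0. \<forall>w. \<bar>w - x\<bar> < d \<longrightarrow>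
    (0 \<le> e * w \<and> \<not> quiet H f 0 w) = (0 \<le> e * x \<and> \<not> quiet H f 0 x)"
proof -
  obtain d where d: "d > 0" "\<And>w r. \<bar>w - x\<bar> < d \<Longrightarrow> quiet H f r w = quiet H f r x"
    using quiet_near[OF H f x] by blast
  show ?thesis
  proof (cases "quiet H f 0 x")
    case True
    have "quiet H f 0 w" if "\<bar>w - x\<bar> < d" for w
      using d(2)[OF that, of 0] True by simp
    with True d(1) show ?thesis by (intro exI[of _ d]) simp
  next
    case False
    then have "x \<noteq> 0" using x by (auto simp: quiet_def)
    show ?thesis
    proof (intro exI[of _ "min d \<bar>x\<bar>"] conjI allI impI)
      fix w assume w: "\<bar>w - x\<bar> < min d \<bar>x\<bar>"
      then have "quiet H f 0 w = quiet H f 0 x" using d(2)[of w 0] by simp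
      moreover have "0 \<le> e * w \<longleftrightarrow> 0 \<le> e * x"
        using w by (cases "x > 0") (auto simp: zero_le_mult_iff abs_if split: if_splits)
      ultimately show "(0 \<le> e * w \<and> \<not> quiet H f 0 w) = (0 \<le> e * x \<and> \<not> quiet H f 0 x)" by simp
    qed (use d(1) \<open>x \<noteq> 0\<close> in simp)
  qed
qed

lemma measurable_negate_beyond: "negate_beyond H e \<in> PA \<rightarrow>\<^sub>M PA"
proof -
  have "(\<lambda>f. flip_path H ((\<lambda>f t. 0 \<le> e * t \<and> \<not> quiet H f 0 t) f) f) \<in> PA \<rightarrow>\<^sub>M PA"
  proof (rule flip_path_measurable[OF H])
    note [measurable] = measurable_quiet[OF H]
    show "Measurable.pred PA (\<lambda>f. 0 \<le> e * t \<and> \<not> quiet H f 0 t)" for t by measurable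
  qed (rule negate_beyond_local)
  then show ?thesis by (simp add: negate_beyond_def[abs_def])
qed

text \<open>
  The reflection principle: the first vertex time is approximated by the next dyadic time, where
  the reflection preserves the law because it does so at every fixed time.
\<close>

lemma preserves_negate_beyond:
  assumes e: "e = 1 \<or> e = - 1"
  shows "preserves (negate_beyond H e)"
proof -
  interpret prob_space \<mu> by (rule prob_law)
  define s where "s N j = e * (real j / 2 ^ N)" for N j :: nat
  define T where "T N k = (case k of 0 \<Rightarrow> (\<lambda>f. f) | Suc j \<Rightarrow> reflect_at e (s N j))" for N k :: nat
  define idx where "idx N f = (if \<exists>j. \<not> quiet H f 0 (s N j) then Suc (LEAST j. \<not> quiet H f 0 (s N j)) else 0)" for N f
  have idx_Suc: "idx N f = Suc j \<longleftrightarrow> \<not> quiet H f 0 (s N j) \<and> (\<forall>i<j. quiet H f 0 (s N i))" for N f j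
  proof
    assume "idx N f = Suc j"
    then have ex: "\<exists>j. \<not> quiet H f 0 (s N j)" and j: "j = (LEAST j. \<not> quiet H f 0 (s N j))"
      by (auto simp: idx_def split: if_splits)
    have "\<not> quiet H f 0 (s N j)" unfolding j by (rule LeastI_ex[OF ex])
    moreover have "quiet H f 0 (s N i)" if "i < j" for i
      using not_less_Least[OF that[unfolded j]] by simp
    ultimately show "\<not> quiet H f 0 (s N j) \<and> (\<forall>i<j. quiet H f 0 (s N i))" by blast
  next
    assume *: "\<not> quiet H f 0 (s N j) \<and> (\<forall>i<j. quiet H f 0 (s N i))"
    have "(LEAST j. \<not> quiet H f 0 (s N j)) = j"
    proof (rule Least_equality)
      fix y assume "\<not> quiet H f 0 (s N y)"
      then show "j \<le> y" using * by (metis not_le)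
    qed (use * in simp)
    then show "idx N f = Suc j" using * by (auto simp: idx_def)
  qed
  have idx_meas: "idx N \<in> PA \<rightarrow>\<^sub>M count_space UNIV" for N
  proof -
    note [measurable] = measurable_quiet[OF H]
    show ?thesis unfolding idx_def[abs_def] by measurable
  qed
  have T: "preserves (T N k)" for N k
    using preserves_reflect_at[OF e] distr_law_id by (cases k) (auto simp: T_def preserves_def)
  have inv: "idx N (T N k f) = k \<longleftrightarrow> idx N f = k" if f: "f \<in> circle_paths (2 * H)" for N k f
  proof (cases k)
    case 0
    then show ?thesis by (simp add: T_def)
  next
    case (Suc j)
    have "circ (2 * H) (reflect_at e (s N j) f w) = circ (2 * H) (f w)"
      if "i \<le> j" "w \<in> {min 0 (s N i)..max 0 (s N i)}" for i w
    proof -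
      define a c where "a = real i / 2 ^ N" and "c = real j / 2 ^ N"
      have ac: "0 \<le> a" "a \<le> c" using that(1) by (auto simp: a_def c_def divide_right_mono)
      have "s N i = e * a" "s N j = e * c" by (simp_all add: s_def a_def c_def)
      then have "e * (w - s N j) \<le> 0"
        using that(2) e ac by (auto simp: min_def max_def split: if_splits)
      then show ?thesis using H by (simp add: reflect_at_eq)
    qed
    then have "quiet H (reflect_at e (s N j) f) 0 (s N i) = quiet H f 0 (s N i)" if "i \<le> j" for i
      using that unfolding quiet_def by auto
    then show ?thesis
      unfolding Suc idx_Suc by (auto simp: T_def)
  qed
  have step: "(\<lambda>f. T N (idx N f) f) \<in> PA \<rightarrow>\<^sub>M PA \<and> distr \<mu> PA (\<lambda>f. T N (idx N f) f) = \<mu>" for N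
  proof
    have 1: "T N k \<in> PA \<rightarrow>\<^sub>M PA" and 2: "distr \<mu> PA (T N k) = \<mu>" for k
      using T by (simp_all add: preserves_def)
    have 3: "idx N (T N k f) = k \<longleftrightarrow> idx N f = k" if "f \<in> space PA" for k f
      using inv that by (simp add: space_path_algebra)
    show "(\<lambda>f. T N (idx N f) f) \<in> PA \<rightarrow>\<^sub>M PA"
      by (rule distr_piecewise(1)[where T = "T N", OF sets_law idx_meas[of N] 1 2 3])
    show "distr \<mu> PA (\<lambda>f. T N (idx N f) f) = \<mu>"
      by (rule distr_piecewise(2)[where T = "T N", OF sets_law idx_meas[of N] 1 2 3])
  qed
  have lim: "(\<lambda>N. circ (2 * H) (T N (idx N f) f t)) \<longlonglongrightarrow> circ (2 * H) (negate_beyond H e f t)"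
    if f: "f \<in> circle_paths (2 * H)" for f t
  proof (cases "0 \<le> e * t \<and> \<not> quiet H f 0 t")
    case False
    have "T N (idx N f) f t = f t" for N
    proof (cases "idx N f")
      case 0
      then show ?thesis by (simp add: T_def)
    next
      case (Suc j)
      then have nq: "\<not> quiet H f 0 (s N j)" using idx_Suc by blast
      have "e * (t - s N j) \<le> 0"
      proof (rule ccontr)
        assume *: "\<not> e * (t - s N j) \<le> 0"
        have "e * s N j = real j / 2 ^ N" using e by (auto simp: s_def)
        then have "0 \<le> e * s N j" by simp
        then have "0 \<le> e * t" using * by (simp add: algebra_simps)
        then have qt: "quiet H f 0 t" using False by simp
        have sub: "{min 0 (s N j)..max 0 (s N j)} \<subseteq> {min 0 t..max 0 t}"
          using e * \<open>0 \<le> e * s N j\<close> by (auto simp: min_def max_def)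
        from qt sub have "quiet H f 0 (s N j)" unfolding quiet_def by (meson subsetD)
        then show False using nq by simp
      qed
      then show ?thesis using Suc path_rmod[OF f] by (simp add: T_def reflect_at_eq)
    qed
    moreover have "negate_beyond H e f t = f t"
      using False path_rmod[OF f] by (auto simp: negate_beyond_def flip_path_def)
    ultimately show ?thesis by simp
  next
    case True
    let ?g = "unit_lift H 1 f"
    note g = path_unit_lift[OF H f]
    have ee: "e * (e * x) = x" for x using e by auto
    define g' where "g' w = ?g (e * w)" for w
    have g': "continuous_on UNIV g'"
      unfolding g'_def by (rule continuous_on_compose2[OF g(1)]) (auto intro!: continuous_intros)
    have vx: "Im (circ (2 * H) (f w)) = 0 \<longleftrightarrow> g' (e * w) \<in> \<int>" for w
    proof -
      have "e * (e * w) = w" using e by auto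
      then show ?thesis using vertex_iff[of H f w ?g, OF H g(2)] by (simp only: g'_def)
    qed
    obtain w0 where w0: "w0 \<in> {min 0 t..max 0 t}" "Im (circ (2 * H) (f w0)) = 0"
      using True by (auto simp: quiet_def)
    have ew0: "0 \<le> e * w0" "e * w0 \<le> e * t" using w0(1) True e by (auto simp: min_def max_def split: if_splits)
    have "g' (e * w0) \<in> \<int>" using vx w0(2) by simp
    from first_int[OF g' ew0(1) this]
    obtain b where b: "0 \<le> b" "b \<le> e * w0" "g' b \<in> \<int>" "\<And>w. 0 \<le> w \<Longrightarrow> w < b \<Longrightarrow> g' w \<notin> \<int>"
      by blast
    have q: "quiet H f 0 (s N j) \<longleftrightarrow> real j / 2 ^ N < b" for N j
    proof
      assume "quiet H f 0 (s N j)"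
      moreover have "Im (circ (2 * H) (f (e * b))) = 0" using vx[of "e * b"] b(3) by (simp only: ee)
      ultimately have "e * b \<notin> {min 0 (s N j)..max 0 (s N j)}" unfolding quiet_def by blast
      then show "real j / 2 ^ N < b"
        using e b(1) by (auto simp: s_def min_def max_def split: if_splits)
    next
      assume lt: "real j / 2 ^ N < b"
      show "quiet H f 0 (s N j)" unfolding quiet_def
      proof
        fix w assume "w \<in> {min 0 (s N j)..max 0 (s N j)}"
        moreover define a where "a = real j / 2 ^ N"
        moreover have "0 \<le> a" by (simp add: a_def)
        moreover have "s N j = e * a" by (simp add: s_def a_def)
        ultimately have "0 \<le> e * w" "e * w \<le> real j / 2 ^ N"
          using e unfolding a_def[symmetric] by (auto simp: min_def max_def split: if_splits)
        then show "Im (circ (2 * H) (f w)) \<noteq> 0" using vx b(4) lt by simp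
      qed
    qed
    define jj where "jj N = nat \<lceil>b * 2 ^ N\<rceil>" for N
    have jj: "idx N f = Suc (jj N)" for N
      unfolding idx_Suc q
    proof (intro conjI allI impI)
      have "b * 2 ^ N \<le> real (jj N)" unfolding jj_def by linarith
      then show "\<not> real (jj N) / 2 ^ N < b" by (simp add: field_simps)
      fix i assume "i < jj N"
      then have "real i < b * 2 ^ N" unfolding jj_def by linarith
      then show "real i / 2 ^ N < b" by (simp add: field_simps)
    qed
    have ss: "b \<le> e * s N (jj N)" "e * s N (jj N) \<le> b + 1 / 2 ^ N" for N
    proof -
      have A: "e * s N (jj N) = real (jj N) / 2 ^ N" using e by (auto simp: s_def)
      have "b * 2 ^ N \<le> real (jj N)" "real (jj N) \<le> b * 2 ^ N + 1"
      proof -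
        have "0 \<le> b * 2 ^ N" using b(1) by simp
        then have "0 \<le> \<lceil>b * 2 ^ N\<rceil>" by linarith
        then have "real (jj N) = of_int \<lceil>b * 2 ^ N\<rceil>" by (simp add: jj_def)
        then show "b * 2 ^ N \<le> real (jj N)" "real (jj N) \<le> b * 2 ^ N + 1" by linarith+
      qed
      then show "b \<le> e * s N (jj N)" "e * s N (jj N) \<le> b + 1 / 2 ^ N"
        unfolding A by (simp_all add: field_simps)
    qed
    have "(\<lambda>N. e * s N (jj N)) \<longlonglongrightarrow> b"
    proof (rule tendsto_sandwich[of "\<lambda>_. b" _ _ "\<lambda>N. b + 1 / 2 ^ N"])
      have "(\<lambda>N. b + (1 / 2) ^ N) \<longlonglongrightarrow> b + 0" by (intro tendsto_intros LIMSEQ_power_zero) simp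
      then show "(\<lambda>N. b + 1 / 2 ^ N) \<longlonglongrightarrow> b" by (simp add: power_one_over)
    qed (use ss in auto)
    then have sb: "(\<lambda>N. g' (e * s N (jj N))) \<longlonglongrightarrow> g' b"
      using g' by (intro isCont_tendsto_compose[of _ g']) (auto simp: continuous_on_eq_continuous_at)
    have neg: "negate_beyond H e f t = (- f t) rmod (2 * H)"
      using True by (simp add: negate_beyond_def flip_path_def)
    show ?thesis
    proof (cases "e * t = b")
      case eq: True
      have "T N (idx N f) f t = f t rmod (2 * H)" for N
        unfolding jj T_def using ss[of N] eq by (simp add: reflect_at_eq right_diff_distrib)
      moreover have "Im (circ (2 * H) (f t)) = 0" using vx[of t] b(3) eq by simp
      ultimately show ?thesis using vertex_uminus[of H f t, OF H] neg by simp
    next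
      case False
      then have lt: "b < e * t" using b(2) ew0(2) by simp
      have "(\<lambda>N. circ (2 * H) (H * (2 * g' (e * s N (jj N)) - ?g t))) \<longlonglongrightarrow> circ (2 * H) (H * (2 * g' b - ?g t))"
        by (intro isCont_tendsto_compose[OF isCont_circ] tendsto_intros sb)
      also have "circ (2 * H) (H * (2 * g' b - ?g t)) = circ (2 * H) (negate_beyond H e f t)"
      proof -
        obtain k where k: "g' b = of_int k" using b(3) by (auto elim: Ints_cases)
        have "[- (H * ?g t) = H * (2 * g' b - ?g t)] (rmod (2 * H))"
          unfolding rcong_altdef k by (intro exI[of _ k]) (simp add: algebra_simps)
        moreover have "[- f t = - (H * ?g t)] (rmod (2 * H))" using rcong_uminus[OF g(2)] .
        ultimately have "[- f t = H * (2 * g' b - ?g t)] (rmod (2 * H))" by (rule rcong_trans[rotated])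
        then show ?thesis using H neg by (simp add: circ_eq_iff rcong_sym_iff)
      qed
      finally have lim: "(\<lambda>N. circ (2 * H) (H * (2 * g' (e * s N (jj N)) - ?g t))) \<longlonglongrightarrow> circ (2 * H) (negate_beyond H e f t)" .
      have "eventually (\<lambda>N. e * s N (jj N) < e * t) sequentially"
        by (rule order_tendstoD(2)[OF \<open>(\<lambda>N. e * s N (jj N)) \<longlonglongrightarrow> b\<close> lt])
      then have "eventually (\<lambda>N. circ (2 * H) (H * (2 * g' (e * s N (jj N)) - ?g t)) = circ (2 * H) (T N (idx N f) f t)) sequentially"
      proof eventually_elim
        case (elim N)
        let ?s = "s N (jj N)"
        have "T N (idx N f) f t = (2 * f ?s - f t) rmod (2 * H)"
          unfolding jj T_def using elim by (simp add: reflect_at_eq right_diff_distrib)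
        moreover have "[f ?s + f ?s - f t = H * ?g ?s + H * ?g ?s - H * ?g t] (rmod (2 * H))"
          by (intro rcong_diff rcong_add g(2))
        moreover have "H * ?g ?s + H * ?g ?s - H * ?g t = H * (2 * g' (e * ?s) - ?g t)"
          unfolding g'_def ee by (simp add: algebra_simps)
        ultimately have "[2 * f ?s - f t = H * (2 * g' (e * ?s) - ?g t)] (rmod (2 * H))" by simp
        then show ?case using H \<open>T N (idx N f) f t = (2 * f ?s - f t) rmod (2 * H)\<close>
          by (simp add: circ_eq_iff rcong_sym_iff)
      qed
      with lim show ?thesis by (rule Lim_transform_eventually)
    qed
  qed
  have "distr \<mu> PA (negate_beyond H e) = \<mu>"
  proof (rule distr_limit[where F = "\<lambda>N f. T N (idx N f) f"])
    show "AE f in \<mu>. \<forall>t. (\<lambda>N. circ (2 * H) (T N (idx N f) f t)) \<longlonglongrightarrow> circ (2 * H) (negate_beyond H e f t)"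
      by (intro AE_I2) (auto simp: space_law lim)
  qed (use H prob_law step measurable_negate_beyond measurable_law in auto)
  then show ?thesis using measurable_negate_beyond by (simp add: preserves_def)
qed

lemma quiet_negate_beyond: "quiet H (negate_beyond H e f) s t = quiet H f s t"
  unfolding negate_beyond_def by (rule quiet_flip[OF H])

text \<open>
  Negating everything, and then negating back what lies beyond the excursion on either
  side.
\<close>

lemma flip_excursion_origin:
  assumes f: "f \<in> circle_paths (2 * H)"
  shows "flip_excursion H 0 f = negate (2 * H) (negate_beyond H 1 (negate_beyond H (- 1) f))"
proof
  fix t
  let ?L = "2 * H"
  have b: "f t rmod ?L = f t" by (rule path_rmod[OF f])
  have neg: "(- ((- x) rmod ?L)) rmod ?L = x rmod ?L" for x
    by (intro rmod_cong_eq) (simp add: rcong_uminus_left_iff)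
  have idem: "(- (x rmod ?L)) rmod ?L = (- x) rmod ?L" for x
    by (intro rmod_cong_eq) (simp add: rcong_uminus_left_iff)
  have n1: "negate_beyond H (- 1) f t = (if t \<le> 0 \<and> \<not> quiet H f 0 t then (- f t) rmod ?L else f t)"
    using b by (simp add: negate_beyond_def flip_path_def)
  have n2: "negate_beyond H 1 (negate_beyond H (- 1) f) t =
      (if 0 \<le> t \<and> \<not> quiet H f 0 t then (- negate_beyond H (- 1) f t) rmod ?L else negate_beyond H (- 1) f t rmod ?L)"
    by (simp add: negate_beyond_def[of H 1] flip_path_def quiet_negate_beyond)
  have n3: "flip_excursion H 0 f t = (if quiet H f 0 t then - f t else f t) rmod ?L"
    by (simp add: flip_excursion_def flip_path_def)
  show "flip_excursion H 0 f t = negate ?L (negate_beyond H 1 (negate_beyond H (- 1) f)) t"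
  proof (cases "quiet H f 0 t")
    case True
    then show ?thesis by (simp add: negate_def n1 n2 n3 b)
  next
    case nq: False
    consider (pos) "t > 0" | (neg) "t < 0" | (zero) "t = 0" by linarith
    then show ?thesis
    proof cases
      case zero
      then have "Im (circ ?L (f t)) = 0" using nq by (simp add: quiet_def)
      from vertex_uminus[of H f t, OF H this] have v: "(- f t) rmod ?L = f t" by (simp add: b)
      show ?thesis
        using nq v n1 n2 n3 b zero by (simp add: negate_def)
    qed (use nq in \<open>simp_all add: negate_def n1 n2 n3 neg b\<close>)
  qed
qed

lemma flip_excursion_translate:
  "flip_excursion H r f = translate r (flip_excursion H 0 (translate (- r) f))"
proof
  fix t
  have "quiet H (translate (- r) f) 0 (t - r) \<longleftrightarrow> quiet H f r t"
  proof
    assume q: "quiet H (translate (- r) f) 0 (t - r)"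
    show "quiet H f r t" unfolding quiet_def
    proof
      fix w assume "w \<in> {min r t..max r t}"
      then have "w - r \<in> {min 0 (t - r)..max 0 (t - r)}" by (auto simp: min_def max_def split: if_splits)
      then show "Im (circ (2 * H) (f w)) \<noteq> 0"
        using q[unfolded quiet_def translate_def, rule_format, of "w - r"] by simp
    qed
  next
    assume q: "quiet H f r t"
    show "quiet H (translate (- r) f) 0 (t - r)" unfolding quiet_def
    proof
      fix w assume "w \<in> {min 0 (t - r)..max 0 (t - r)}"
      then have "w + r \<in> {min r t..max r t}" by (auto simp: min_def max_def split: if_splits)
      with q show "Im (circ (2 * H) (translate (- r) f w)) \<noteq> 0" by (simp add: quiet_def translate_def)
    qed
  qed
  then show "flip_excursion H r f t = translate r (flip_excursion H 0 (translate (- r) f)) t"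
    by (simp add: flip_excursion_def flip_path_def translate_def)
qed

lemma preserves_cong:
  assumes "preserves T" "\<And>f. f \<in> circle_paths (2 * H) \<Longrightarrow> S f = T f"
  shows "preserves S"
proof -
  have "S \<in> PA \<rightarrow>\<^sub>M PA"
    using assms by (subst measurable_cong[of _ _ T]) (auto simp: preserves_def space_path_algebra)
  moreover have "distr \<mu> PA S = distr \<mu> PA T"
    using assms by (intro distr_cong) (auto simp: space_law)
  ultimately show ?thesis using assms(1) by (simp add: preserves_def)
qed

lemma preserves_flip_excursion: "preserves (flip_excursion H r)"
proof -
  have nb: "preserves (negate_beyond H 1)" "preserves (negate_beyond H (- 1))"
    by (rule preserves_negate_beyond; simp)+
  have "preserves (flip_excursion H 0)"
    by (rule preserves_cong[OF preserves_comp[OF preserves_negate preserves_comp[OF nb]] flip_excursion_origin])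
  from preserves_comp[OF preserves_translate[of r] preserves_comp[OF this preserves_translate[of "- r"]]]
  have "preserves (\<lambda>f. translate r (flip_excursion H 0 (translate (- r) f)))" .
  then show ?thesis by (rule preserves_cong) (rule flip_excursion_translate)
qed

end

section \<open>Flipping rules that preserve the law\<close>

lemma lift_move:
  fixes g g' :: "real \<Rightarrow> real"
  assumes g: "continuous_on UNIV g" "continuous_on UNIV g'" and bc: "b \<le> c"
    and n: "\<And>w. b \<le> w \<Longrightarrow> w \<le> c \<Longrightarrow> [g' w = \<sigma> * g w] (rmod 2)"
  shows "g' c - g' b = \<sigma> * (g c - g b)"
proof -
  have "continuous_on {b..c} g'" "continuous_on {b..c} (\<lambda>w. \<sigma> * g w)"
    using g cont_sub by (auto intro!: continuous_intros)
  from lifts_differ_by_constant[of 2 "{b..c}", OF _ _ this] n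
  obtain k :: int where "\<forall>w\<in>{b..c}. g' w = \<sigma> * g w + of_int k * 2" by auto
  then show ?thesis using bc by (simp add: algebra_simps)
qed

lemma rcong_scale:
  assumes "H > 0" shows "[H * x = H * y] (rmod (2 * H)) \<longleftrightarrow> [x = y] (rmod 2)"
proof
  assume "[x = y] (rmod 2)"
  then obtain n :: int where "y = x + of_int n * 2" by (auto simp: rcong_altdef)
  then have "H * y = H * x + of_int n * (2 * H)" by (simp add: algebra_simps)
  then show "[H * x = H * y] (rmod (2 * H))" unfolding rcong_altdef by blast
next
  assume "[H * x = H * y] (rmod (2 * H))"
  then obtain n :: int where "H * y = H * x + of_int n * (2 * H)" unfolding rcong_altdef by blast
  then have "H * y = H * (x + of_int n * 2)" by (simp add: algebra_simps)
  then have "y = x + of_int n * 2" using assms by simp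
  then show "[x = y] (rmod 2)" unfolding rcong_altdef by blast
qed

text \<open>
  The decision to flip the excursion at time \<open>r\<close> depends on the vertex at its start and on whether it
  crosses. It is the same for two paths that agree up to the start \<open>a\<close> of this excursion and are equal
  or opposite during it: the lifts coincide up to \<open>a\<close> and then move in parallel or oppositely from the
  same vertex, so either both or none of them reach a new vertex.
\<close>

lemma vertex_crossing_same:
  fixes g g' :: "real \<Rightarrow> real"
  assumes g: "continuous_on UNIV g" and g': "continuous_on UNIV g'"
    and rel: "\<And>w. [g' w = (if S w then - 1 else 1) * g w] (rmod 2)"
    and vx': "\<And>w. g' w \<in> \<int> \<longleftrightarrow> g w \<in> \<int>"
    and zero: "g' 0 = g 0" and a: "0 \<le> a" "a \<le> r" "g a \<in> \<int>" "\<And>w. a < w \<Longrightarrow> w \<le> r \<Longrightarrow> g w \<notin> \<int>"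
    and S0: "\<And>w. 0 \<le> w \<Longrightarrow> w \<le> a \<Longrightarrow> \<not> S w"
    and exc: "\<And>w. a < w \<Longrightarrow> (\<And>v. r \<le> v \<Longrightarrow> v \<le> w \<Longrightarrow> g v \<notin> \<int>) \<Longrightarrow> S w = F"
  shows "vtx g' r = vtx g r" "crs g' r = crs g r"
proof -
  have vrel: "[g' w = \<sigma> * g w] (rmod 2)" if wi: "g w \<in> \<int>" and si: "\<sigma> = 1 \<or> \<sigma> = - 1" for w \<sigma>
  proof -
    obtain k where k: "g w = of_int k" using wi by (rule Ints_cases)
    have *: "[- real_of_int k = of_int k] (rmod 2)" unfolding rcong_altdef by (intro exI[of _ k]) simp
    have "[(if S w then - 1 else 1) * g w = \<sigma> * g w] (rmod 2)"
      using si * rcong_sym[OF *] by (auto simp: k)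
    with rel[of w] show ?thesis by (rule rcong_trans)
  qed
  obtain k where k: "g a = of_int k" using a(3) by (rule Ints_cases)
  have "g' a - g' 0 = 1 * (g a - g 0)"
  proof (rule lift_move[OF g g' a(1)])
    fix w assume "0 \<le> w" "w \<le> a"
    then show "[g' w = 1 * g w] (rmod 2)" using rel[of w] S0[of w] by simp
  qed
  then have g'a: "g' a = of_int k" using k zero by simp
  have v: "vtx g r = k" by (rule vtx_after_last_int[OF g a(2) k a(4)])
  have v': "vtx g' r = k"
  proof (rule vtx_after_last_int[OF g' a(2) g'a])
    show "g' w \<notin> \<int>" if "a < w" "w \<le> r" for w using a(4)[OF that] vx'[of w] by simp
  qed
  show "vtx g' r = vtx g r" by (simp add: v v')
  show "crs g' r = crs g r"
  proof (cases "\<exists>x\<ge>r. g x \<in> \<int>")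
    case False
    then show ?thesis using crs_imp_next_int[of g r] crs_imp_next_int[of g' r] vx' by blast
  next
    case True
    then obtain x where "r \<le> x" "g x \<in> \<int>" by blast
    from first_int[OF g this]
    obtain b where b: "r \<le> b" "g b \<in> \<int>" "\<And>w. r \<le> w \<Longrightarrow> w < b \<Longrightarrow> g w \<notin> \<int>" by blast
    obtain j where j: "g b = of_int j" using b(2) by (rule Ints_cases)
    have "g' b \<in> \<int>" using vx'[of b] b(2) by simp
    then obtain j' where j': "g' b = of_int j'" by (rule Ints_cases)
    let ?\<sigma> = "(if F then - 1 else 1) :: real"
    have "g' b - g' a = ?\<sigma> * (g b - g a)"
    proof (rule lift_move[OF g g'])
      fix w assume w: "a \<le> w" "w \<le> b"
      show "[g' w = ?\<sigma> * g w] (rmod 2)"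
      proof (cases "g w \<in> \<int>")
        case True
        then show ?thesis by (rule vrel) simp
      next
        case False
        then have aw: "a < w" and wb: "w < b" using w a(3) b(2) by (auto simp: less_le)
        have "S w = F"
        proof (rule exc[OF aw])
          show "g v \<notin> \<int>" if "r \<le> v" "v \<le> w" for v using b(3)[of v] that wb by simp
        qed
        then show ?thesis using rel[of w] by simp
      qed
    qed (use a(2) b(1) in simp)
    then have "real_of_int (j' - k) = of_int ((if F then - 1 else 1) * (j - k))"
      by (simp add: j j' k g'a)
    then have "j' - k = (if F then - 1 else 1) * (j - k)" by (simp only: of_int_eq_iff)
    then have "j' \<noteq> k \<longleftrightarrow> j \<noteq> k" by (auto split: if_splits)
    moreover have "crs g r \<longleftrightarrow> vtx g r \<noteq> j" by (rule next_int_vtx(2)[OF g b(1) j b(3)])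
    moreover have "crs g' r \<longleftrightarrow> vtx g' r \<noteq> j'"
    proof (rule next_int_vtx(2)[OF g' b(1) j'])
      show "g' w \<notin> \<int>" if "r \<le> w" "w < b" for w using b(3)[OF that] vx'[of w] by simp
    qed
    ultimately show ?thesis by (auto simp: v v')
  qed
qed

lemma flipped_same:
  assumes H: "H > 0" and f: "f \<in> circle_paths (2 * H)" and f': "flip_path H S f \<in> circle_paths (2 * H)"
    and u: "0 \<le> u" "u \<le> r" "Im (circ (2 * H) (f u)) = 0"
    and early: "\<And>w. 0 \<le> w \<Longrightarrow> w \<le> r \<Longrightarrow> \<not> quiet H f r w \<Longrightarrow> \<not> S w"
    and exc: "\<And>w. quiet H f r w \<Longrightarrow> S w = F"
  shows "flipped m (\<lambda>t. unit_lift H 1 (flip_path H S f) t + of_int n) r =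
    flipped m (\<lambda>t. unit_lift H 1 f t + of_int n) r"
proof -
  define g g' where "g = unit_lift H 1 f" and "g' = unit_lift H 1 (flip_path H S f)"
  note lg = path_unit_lift[OF H f, folded g_def] and lg' = path_unit_lift[OF H f', folded g'_def]
  have vx: "Im (circ (2 * H) (f w)) = 0 \<longleftrightarrow> g w \<in> \<int>" for w
    by (rule vertex_iff[of H f w g, OF H lg(2)])
  have vx': "g' w \<in> \<int> \<longleftrightarrow> g w \<in> \<int>" for w
    using vertex_iff[of H "flip_path H S f" w g', OF H lg'(2)] vertex_flip[OF H, of S f w] vx by simp
  have rel: "[g' w = (if S w then - 1 else 1) * g w] (rmod 2)" for w
  proof -
    have "flip_path H S f w = (if S w then - (H * g w) else H * g w) rmod (2 * H)"
      by (rule flip_path_cong[of f w "H * g w" H S, OF lg(2)])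
    also have "(if S w then - (H * g w) else H * g w) = H * ((if S w then - 1 else 1) * g w)" by simp
    finally have "[H * g' w = H * ((if S w then - 1 else 1) * g w)] (rmod (2 * H))"
      using lg'(3)[of w] by (simp add: rcong_def)
    then show ?thesis by (simp only: rcong_scale[OF H])
  qed
  have "g u \<in> \<int>" using u(3) vx by simp
  from last_int[OF lg(1) u(2) this]
  obtain a where a: "u \<le> a" "a \<le> r" "g a \<in> \<int>" "\<And>w. a < w \<Longrightarrow> w \<le> r \<Longrightarrow> g w \<notin> \<int>" by blast
  have nq: "\<not> quiet H f r w" if "w \<le> a" for w
  proof
    assume "quiet H f r w"
    moreover have "a \<in> {min r w..max r w}" using that a(2) by simp
    ultimately show False using vx[of a] a(3) by (simp add: quiet_def)
  qed
  have S0: "\<not> S w" if "0 \<le> w" "w \<le> a" for w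
    using early[OF that(1) _ nq[OF that(2)]] that(2) a(2) by simp
  have quiet_exc: "S w = F" if aw: "a < w" and ni: "\<And>v. r \<le> v \<Longrightarrow> v \<le> w \<Longrightarrow> g v \<notin> \<int>" for w
  proof (rule exc)
    show "quiet H f r w" unfolding quiet_def
    proof
      fix v assume v: "v \<in> {min r w..max r w}"
      have "g v \<notin> \<int>"
      proof (cases "v \<le> r")
        case True
        then have "a < v" using v aw a(2,3) ni[of r] a(4)[of v] by (cases "a = r") auto
        then show ?thesis using a(4) True by blast
      next
        case False
        then have "r \<le> v" "v \<le> w" using v by (auto simp: max_def split: if_splits)
        then show ?thesis by (rule ni)
      qed
      then show "Im (circ (2 * H) (f v)) \<noteq> 0" using vx by simp
    qed
  qed
  have zero: "g' 0 = g 0"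
  proof -
    have "flip_path H S f 0 = f 0"
      using S0[of 0] a(1) u(1) circle_path_imp(1,2)[of "2 * H" f 0] f H by (simp add: flip_path_def)
    then show ?thesis
      using lift_0[of "2 * H" f] lift_0[of "2 * H" "flip_path H S f"] f f' H
      by (simp add: unit_lift_def g_def g'_def)
  qed
  have a0: "0 \<le> a" using a(1) u(1) by simp
  have "vtx g' r = vtx g r"
    by (rule vertex_crossing_same(1)[where S = S and F = F, OF lg(1) lg'(1) rel vx' zero a0 a(2,3,4) S0 quiet_exc])
  moreover have "crs g' r = crs g r"
    by (rule vertex_crossing_same(2)[where S = S and F = F, OF lg(1) lg'(1) rel vx' zero a0 a(2,3,4) S0 quiet_exc])
  ultimately show ?thesis unfolding g_def[symmetric] g'_def[symmetric]
    by (simp only: flipped_def vtx_space_shift crs_space_shift)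
qed

context circle_law
begin

context
  fixes m :: nat and c :: int
begin

text \<open>
  The number \<open>2 * c\<close> is the position of the sheet on the long circle, in units of \<open>H\<close>.
\<close>

definition flip_from :: "(real \<Rightarrow> real) \<Rightarrow> real \<Rightarrow> bool" where
  "flip_from f t = flipped m (\<lambda>t. unit_lift H 1 f t + of_int (2 * c)) t"

text \<open>
  Each excursion that follows a vertex time after \<open>0\<close> and meets the grid
  \<open>d, 2 * d, \<dots>\<close> is considered exactly once, at the first grid time that it contains.
\<close>

definition grid_flip :: "real \<Rightarrow> nat \<Rightarrow> (real \<Rightarrow> real) \<Rightarrow> bool" where
  "grid_flip d k f \<longleftrightarrow> \<not> quiet H f (real (k - 1) * d) (real k * d) \<and> flip_from f (real k * d)"

definition flip_step :: "real \<Rightarrow> nat \<Rightarrow> (real \<Rightarrow> real) \<Rightarrow> real \<Rightarrow> real" where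
  "flip_step d k f = (if grid_flip d k f then flip_excursion H (real k * d) f else f)"

lemma measurable_flip_from: "Measurable.pred PA (\<lambda>f. flip_from f t)"
proof -
  have p: "continuous_process PA (unit_lift H 1)" by (rule continuous_process_path[OF H])
  have "continuous_process PA (\<lambda>f t. unit_lift H 1 f t + of_int (2 * c))"
    unfolding continuous_process_def
  proof (intro conjI ballI allI)
    show "continuous_on UNIV (\<lambda>t. unit_lift H 1 f t + of_int (2 * c))" if "f \<in> space PA" for f
      using p that by (intro continuous_intros) (simp add: continuous_process_def)
    show "(\<lambda>f. unit_lift H 1 f t + of_int (2 * c)) \<in> borel_measurable PA" for t
      using p by (intro borel_measurable_add) (simp_all add: continuous_process_def)
  qed
  from measurable_flipped[OF this] show ?thesis by (simp add: flip_from_def)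
qed

lemma measurable_grid_flip: "Measurable.pred PA (\<lambda>f. grid_flip d k f)"
  unfolding grid_flip_def using measurable_flip_from measurable_quiet[OF H] by measurable

lemma flip_excursion_path: "f \<in> circle_paths (2 * H) \<Longrightarrow> flip_excursion H r f \<in> circle_paths (2 * H)"
  using measurable_space[of "flip_excursion H r" PA PA f] preserves_flip_excursion[of r]
  by (simp add: preserves_def space_path_algebra)

lemma grid_flip_invariant:
  assumes f: "f \<in> circle_paths (2 * H)" and d: "d > 0"
  shows "grid_flip d k (flip_excursion H (real k * d) f) = grid_flip d k f"
proof -
  let ?r = "real k * d"
  have "flip_from (flip_excursion H ?r f) ?r = flip_from f ?r" if nq: "\<not> quiet H f (real (k - 1) * d) ?r"
  proof -
    obtain u where u: "u \<in> {min (real (k - 1) * d) ?r..max (real (k - 1) * d) ?r}" "Im (circ (2 * H) (f u)) = 0"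
      using nq by (auto simp: quiet_def)
    have "real (k - 1) * d \<le> ?r" "0 \<le> real (k - 1) * d" using d by (auto intro!: mult_right_mono)
    then have "0 \<le> u" "u \<le> ?r" using u(1) by auto
    then show ?thesis
      unfolding flip_from_def flip_excursion_def
      using flip_excursion_path[OF f, of ?r, unfolded flip_excursion_def] u(2)
      by (intro flipped_same[OF H f, where F = True and u = u]) auto
  qed
  then show ?thesis
    using quiet_flip[OF H, of "quiet H f ?r" f] by (auto simp: grid_flip_def flip_excursion_def)
qed

lemma preserves_flip_step:
  assumes d: "d > 0" shows "preserves (flip_step d k)"
proof -
  define idx where "idx f = (if grid_flip d k f then 1 else 0 :: nat)" for f
  define T where "T i = (if i = 1 then flip_excursion H (real k * d) else (\<lambda>f. f))" for i :: nat
  have idx: "idx \<in> PA \<rightarrow>\<^sub>M count_space UNIV"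
    unfolding idx_def[abs_def] using measurable_grid_flip by measurable
  have "preserves (T i)" for i
    using preserves_flip_excursion distr_law_id by (auto simp: T_def preserves_def)
  then have 1: "T i \<in> PA \<rightarrow>\<^sub>M PA" and 2: "distr \<mu> PA (T i) = \<mu>" for i
    by (auto simp: preserves_def)
  have 3: "idx (T i f) = i \<longleftrightarrow> idx f = i" if "f \<in> space PA" for i f
    using grid_flip_invariant[OF _ d, of f k] that by (auto simp: T_def idx_def space_path_algebra)
  have "(\<lambda>f. T (idx f) f) = flip_step d k"
    by (auto simp: T_def idx_def flip_step_def)
  then show ?thesis
    using distr_piecewise[where T = T, OF sets_law idx 1 2 3] by (simp add: preserves_def)
qed

definition late_flips :: "real \<Rightarrow> nat \<Rightarrow> nat \<Rightarrow> (real \<Rightarrow> real) \<Rightarrow> real \<Rightarrow> bool" where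
  "late_flips d K j f t \<longleftrightarrow> (\<exists>k\<in>{j..K}. quiet H f (real k * d) t \<and> grid_flip d k f)"

lemma quiet_trans: "quiet H f r s \<Longrightarrow> quiet H f r t \<Longrightarrow> quiet H f s t"
  unfolding quiet_def
proof
  fix w assume q: "\<forall>w\<in>{min r s..max r s}. Im (circ (2 * H) (f w)) \<noteq> 0"
      "\<forall>w\<in>{min r t..max r t}. Im (circ (2 * H) (f w)) \<noteq> 0"
    and w: "w \<in> {min s t..max s t}"
  have "w \<in> {min r s..max r s} \<or> w \<in> {min r t..max r t}"
    using w by (auto simp: min_def max_def split: if_splits)
  then show "Im (circ (2 * H) (f w)) \<noteq> 0" using q by blast
qed

lemma quiet_sub: "quiet H f r s \<Longrightarrow> min r s \<le> a \<Longrightarrow> b \<le> max r s \<Longrightarrow> a \<le> b \<Longrightarrow> quiet H f a b"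
  unfolding quiet_def by auto

lemma late_flips_disjoint:
  assumes d: "d > 0" and q: "quiet H f (real j * d) t" shows "\<not> late_flips d K (Suc j) f t"
proof
  assume "late_flips d K (Suc j) f t"
  then obtain k where k: "Suc j \<le> k" "quiet H f (real k * d) t" "grid_flip d k f"
    by (auto simp: late_flips_def)
  have "quiet H f t (real j * d)" "quiet H f t (real k * d)"
    using q k(2) by (simp_all add: quiet_def min.commute max.commute)
  then have q': "quiet H f (real j * d) (real k * d)" by (rule quiet_trans)
  have le: "j \<le> k - 1" "k - 1 \<le> k" using k(1) by simp_all
  have jk: "real j * d \<le> real (k - 1) * d" "real (k - 1) * d \<le> real k * d"
    by (rule mult_right_mono[OF of_nat_mono[OF le(1)] less_imp_le[OF d]], rule mult_right_mono[OF of_nat_mono[OF le(2)] less_imp_le[OF d]])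
  have "quiet H f (real (k - 1) * d) (real k * d)"
    by (rule quiet_sub[OF q' min.coboundedI1[OF jk(1)] max.coboundedI2[OF order_refl] jk(2)])
  then show False using k(3) by (simp add: grid_flip_def)
qed

lemma late_flips_late:
  assumes d: "d > 0" and t: "t \<le> real j * d" shows "\<not> late_flips d K (Suc j) f t"
proof
  assume "late_flips d K (Suc j) f t"
  then obtain k where k: "Suc j \<le> k" "quiet H f (real k * d) t" "grid_flip d k f"
    by (auto simp: late_flips_def)
  have le: "j \<le> k - 1" "k - 1 \<le> k" using k(1) by simp_all
  have jk: "real j * d \<le> real (k - 1) * d" "real (k - 1) * d \<le> real k * d"
    by (rule mult_right_mono[OF of_nat_mono[OF le(1)] less_imp_le[OF d]], rule mult_right_mono[OF of_nat_mono[OF le(2)] less_imp_le[OF d]])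
  have "quiet H f (real (k - 1) * d) (real k * d)"
    by (rule quiet_sub[OF k(2) min.coboundedI2[OF order_trans[OF t jk(1)]] max.coboundedI1[OF order_refl] jk(2)])
  then show False using k(3) by (simp add: grid_flip_def)
qed

lemma late_flips_path:
  assumes f: "f \<in> circle_paths (2 * H)" shows "flip_path H (late_flips d K j f) f \<in> circle_paths (2 * H)"
proof (rule flip_path_in_circle_paths[OF H path_unit_lift(1)[OF H f] path_unit_lift(2)[OF H f]])
  fix x assume "unit_lift H 1 f x \<notin> \<int>"
  then have "Im (circ (2 * H) (f x)) \<noteq> 0"
    using vertex_iff[of H f x "unit_lift H 1 f"] H path_unit_lift(2)[OF H f] by blast
  from quiet_near[OF H f this]
  obtain e where e: "e > 0" "\<And>w r. \<bar>w - x\<bar> < e \<Longrightarrow> quiet H f r w = quiet H f r x" by blast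
  have "late_flips d K j f w = late_flips d K j f x" if "\<bar>w - x\<bar> < e" for w
    unfolding late_flips_def using e(2)[OF that] by blast
  with e(1) show "\<exists>d'>0. \<forall>w. \<bar>w - x\<bar> < d' \<longrightarrow> late_flips d K j f w = late_flips d K j f x" by blast
qed

text \<open>
  The excursions are treated from the last to the first, so each decision still sees the original
  path.
\<close>

lemma preserves_late_flips:
  assumes d: "d > 0" and j: "j \<le> Suc K"
  shows "preserves (\<lambda>f. flip_path H (late_flips d K j f) f)"
  using j
proof (induction j rule: inc_induct)
  case base
  have "preserves (\<lambda>f. f)"
    using distr_law_id by (auto simp: preserves_def)
  then show ?case
    by (rule preserves_cong) (simp add: late_flips_def flip_path_def[abs_def] path_rmod)
next
  case (step j)
  show ?case
  proof (rule preserves_cong[OF preserves_comp[OF preserves_flip_step[OF d, of j] step.IH]])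
    fix f assume f: "f \<in> circle_paths (2 * H)"
    let ?S = "late_flips d K (Suc j) f"
    let ?Y = "flip_path H ?S f"
    have Yp: "?Y \<in> circle_paths (2 * H)" by (rule late_flips_path[OF f])
    have qY: "quiet H ?Y s t = quiet H f s t" for s t by (rule quiet_flip[OF H])
    have cond: "grid_flip d j ?Y = grid_flip d j f"
    proof -
      let ?r = "real j * d"
      have "flip_from ?Y ?r = flip_from f ?r" if nq: "\<not> quiet H f (real (j - 1) * d) ?r"
      proof -
        obtain u where u: "u \<in> {min (real (j - 1) * d) ?r..max (real (j - 1) * d) ?r}" "Im (circ (2 * H) (f u)) = 0"
          using nq by (auto simp: quiet_def)
        have "real (j - 1) * d \<le> ?r" "0 \<le> real (j - 1) * d" using d by (auto intro!: mult_right_mono)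
        then have "0 \<le> u" "u \<le> ?r" using u(1) by auto
        then show ?thesis
          unfolding flip_from_def using u(2) late_flips_late[OF d] late_flips_disjoint[OF d]
          by (intro flipped_same[OF H f Yp, where F = False and u = u]) auto
      qed
      then show ?thesis by (auto simp: grid_flip_def qY)
    qed
    show "flip_path H (late_flips d K j f) f = flip_step d j ?Y"
    proof
      fix t
      have split: "late_flips d K j f t \<longleftrightarrow> ?S t \<or> (quiet H f (real j * d) t \<and> grid_flip d j f)"
      proof -
        have "{j..K} = insert j {Suc j..K}" using step.hyps by auto
        then show ?thesis unfolding late_flips_def by auto
      qed
      have Yt: "?Y t rmod (2 * H) = ?Y t" by (rule path_rmod[OF Yp])
      show "flip_path H (late_flips d K j f) f t = flip_step d j ?Y t"
      proof (cases "grid_flip d j f \<and> quiet H f (real j * d) t")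
        case True
        then have "\<not> ?S t" using late_flips_disjoint[OF d] by blast
        then have "?Y t = f t" by (simp add: flip_path_def path_rmod[OF f])
        then show ?thesis
          using True cond by (simp add: flip_path_def[of H "late_flips d K j f"] split flip_step_def
            flip_excursion_def flip_path_def[of H "quiet H ?Y (real j * d)"] qY)
      next
        case False
        then have "late_flips d K j f t = ?S t" using split by blast
        then have "flip_path H (late_flips d K j f) f t = ?Y t" by (simp add: flip_path_def)
        also have "\<dots> = flip_step d j ?Y t"
          using False cond Yt by (auto simp: flip_step_def flip_excursion_def
            flip_path_def[of H "quiet H ?Y (real j * d)"] qY)
        finally show ?thesis .
      qed
    qed
  qed
qed

text \<open>
  The condition \<open>\<not> quiet H f 0 t\<close> excludes the excursion that is under way at time
  \<open>0\<close>, whose start is not seen.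
\<close>

definition start_flips :: "(real \<Rightarrow> real) \<Rightarrow> real \<Rightarrow> bool" where
  "start_flips f t \<longleftrightarrow> flip_from f t \<and> 0 \<le> t \<and> \<not> quiet H f 0 t"

lemma flip_from_quiet:
  assumes f: "f \<in> circle_paths (2 * H)" and q: "quiet H f s t"
  shows "flip_from f s = flip_from f t"
proof -
  let ?g = "\<lambda>t. unit_lift H 1 f t + of_int (2 * c)"
  note g = path_unit_lift[OF H f]
  have c: "continuous_on UNIV ?g" using g(1) by (intro continuous_intros)
  have ni: "?g w \<notin> \<int>" if "w \<in> {min s t..max s t}" for w
  proof -
    have "Im (circ (2 * H) (f w)) \<noteq> 0" using q that by (simp add: quiet_def)
    then have "unit_lift H 1 f w \<notin> \<int>" using vertex_iff[of H f w "unit_lift H 1 f", OF H g(2)] by blast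
    then show ?thesis using Ints_diff[of "?g w" "of_int (2 * c)"] by auto
  qed
  show ?thesis
  proof (cases "s \<le> t")
    case True
    then show ?thesis
      unfolding flip_from_def using ni by (intro flipped_excursion_const[OF c]) auto
  next
    case False
    have "flipped m ?g t = flipped m ?g s"
      using False ni by (intro flipped_excursion_const[OF c]) auto
    then show ?thesis by (simp add: flip_from_def)
  qed
qed

lemma start_flips_path_measurable: "(\<lambda>f. flip_path H (start_flips f) f) \<in> PA \<rightarrow>\<^sub>M PA"
proof (rule flip_path_measurable[OF H])
  show "Measurable.pred PA (\<lambda>f. start_flips f t)" for t
    unfolding start_flips_def using measurable_flip_from measurable_quiet[OF H] by measurable
  fix f x assume f: "f \<in> circle_paths (2 * H)" and x: "Im (circ (2 * H) (f x)) \<noteq> 0"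
  obtain d where d: "d > 0" "\<And>w. \<bar>w - x\<bar> < d \<Longrightarrow>
      (0 \<le> 1 * w \<and> \<not> quiet H f 0 w) = (0 \<le> 1 * x \<and> \<not> quiet H f 0 x)"
    using negate_beyond_local[OF f x, of 1] by (elim exE conjE) blast
  obtain d' where d': "d' > 0" "\<And>w. \<bar>w - x\<bar> < d' \<Longrightarrow> quiet H f w x"
    using quiet_near[OF H f x] by blast
  have "start_flips f w = start_flips f x" if "\<bar>w - x\<bar> < min d d'" for w
  proof -
    have "\<bar>w - x\<bar> < d" "\<bar>w - x\<bar> < d'" using that by simp_all
    note 1 = d(2)[OF this(1), unfolded mult_1] and 2 = flip_from_quiet[OF f d'(2)[OF this(2)]]
    show ?thesis unfolding start_flips_def 1 2 by (rule refl)
  qed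
  then show "\<exists>d>0. \<forall>w. \<bar>w - x\<bar> < d \<longrightarrow> start_flips f w = start_flips f x"
    using d(1) d'(1) by (intro exI[of _ "min d d'"] conjI allI impI) (simp only: min_less_iff_conj, blast)
qed

text \<open>
  Each excursion that starts after time \<open>0\<close> contains a point of every sufficiently fine
  and sufficiently long grid.
\<close>

lemma late_flips_eventually:
  assumes f: "f \<in> circle_paths (2 * H)" and t: "Im (circ (2 * H) (f t)) \<noteq> 0"
  shows "eventually (\<lambda>n. late_flips (1 / real n) (n * n) 1 f t = start_flips f t) sequentially"
proof -
  let ?g = "unit_lift H 1 f"
  note g = path_unit_lift[OF H f]
  have vx: "Im (circ (2 * H) (f w)) = 0 \<longleftrightarrow> ?g w \<in> \<int>" for w
    by (rule vertex_iff[of H f w ?g, OF H g(2)])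
  have imp: "start_flips f t" if n: "n > 0" and lf: "late_flips (1 / real n) (n * n) 1 f t" for n
  proof -
    obtain k where k: "1 \<le> k" "quiet H f (real k * (1 / real n)) t" "grid_flip (1 / real n) k f"
      using lf by (auto simp: late_flips_def)
    let ?r = "real k * (1 / real n)" and ?s = "real (k - 1) * (1 / real n)"
    have "0 \<le> 1 / real n" by simp
    then have sr: "0 \<le> ?s" "?s \<le> ?r" by (intro mult_nonneg_nonneg mult_right_mono; simp)+
    obtain v where v: "?s \<le> v" "v \<le> ?r" "Im (circ (2 * H) (f v)) = 0"
    proof -
      have "\<not> quiet H f ?s ?r" using k(3) unfolding grid_flip_def by (rule conjunct1)
      then obtain v where "v \<in> {min ?s ?r..max ?s ?r}" "Im (circ (2 * H) (f v)) = 0"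
        unfolding quiet_def by blast
      then show ?thesis using that[of v] sr(2) by (simp only: min_absorb1 max_absorb2 atLeastAtMost_iff)
    qed
    have "v < t"
    proof (rule ccontr)
      assume "\<not> v < t"
      then have "v \<in> {min ?r t..max ?r t}" using v(2) by simp
      then show False using k(2) v(3) by (simp add: quiet_def)
    qed
    moreover have "0 \<le> v" using v(1) sr(1) by (rule order_trans[rotated])
    ultimately have "v \<in> {min 0 t..max 0 t}" "0 \<le> t" by simp_all
    then have "\<not> quiet H f 0 t" "0 \<le> t"
      using v(3) by (auto simp: quiet_def)
    moreover have "flip_from f t" using k(3) flip_from_quiet[OF f k(2)] by (simp add: grid_flip_def)
    ultimately show ?thesis by (simp add: start_flips_def)
  qed
  show ?thesis
  proof (cases "start_flips f t")
    case False
    then have "late_flips (1 / real n) (n * n) 1 f t = start_flips f t" if "n > 0" for n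
      using imp[OF that] by blast
    then show ?thesis by (intro eventually_sequentiallyI[of 1]) simp
  next
    case True
    then obtain w where w: "0 \<le> w" "w \<le> t" "?g w \<in> \<int>" using vx by (auto simp: start_flips_def quiet_def)
    from last_int[OF g(1) w(2,3)]
    obtain a where a: "w \<le> a" "a \<le> t" "?g a \<in> \<int>" "\<And>w. a < w \<Longrightarrow> w \<le> t \<Longrightarrow> ?g w \<notin> \<int>" by blast
    have "a \<noteq> t" using t vx a(3) by auto
    then have at: "a < t" using a(2) by simp
    obtain N :: nat where N: "1 / (t - a) < N" "t < N"
      using reals_Archimedean2[of "max (1 / (t - a)) t"] by auto
    have "late_flips (1 / real n) (n * n) 1 f t" if n: "n \<ge> N" for n
    proof -
      have nN: "real N \<le> real n" using n by simp
      have "0 < 1 / (t - a)" using at by simp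
      then have n0: "real n > 0" using N(1) nN by linarith
      have "1 / (t - a) < real n" "t < real n" using N nN by linarith+
      then have n1: "1 / real n < t - a" "t < real n" using at n0 by (simp_all add: field_simps)
      \<comment> \<open>the index of the first grid time after the start \<open>a\<close> of the excursion\<close>
      define k where "k = nat \<lfloor>a * n\<rfloor> + 1"
      have a0: "0 \<le> a" using w(1) a(1) by simp
      then have "0 \<le> a * n" by simp
      then have k: "real (k - 1) \<le> a * n" "a * n < real k" "real k \<le> a * n + 1" unfolding k_def by linarith+
      have r: "real (k - 1) * (1 / real n) \<le> a" "a < real k * (1 / real n)" "real k * (1 / real n) \<le> a + 1 / real n"
        using k n0 by (simp_all add: field_simps)
      have rt: "real k * (1 / real n) < t" using r(3) n1(1) by simp
      then have "real k / real n < real n" using n1(2) by simp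
      then have "real k < real n * real n" using n0 by (simp add: pos_divide_less_eq)
      then have kn: "k \<le> n * n" by (simp flip: of_nat_mult)
      have q: "quiet H f (real k * (1 / real n)) t"
        unfolding quiet_def
      proof
        fix w assume "w \<in> {min (real k * (1 / real n)) t..max (real k * (1 / real n)) t}"
        then have "a < w" "w \<le> t" using r(2) rt by simp_all
        then show "Im (circ (2 * H) (f w)) \<noteq> 0" using a(4)[of w] vx[of w] by simp
      qed
      have "Im (circ (2 * H) (f a)) = 0" using vx a(3) by simp
      moreover have "a \<in> {min (real (k - 1) * (1 / real n)) (real k * (1 / real n))..
          max (real (k - 1) * (1 / real n)) (real k * (1 / real n))}" using r(1,2) by simp
      ultimately have "\<not> quiet H f (real (k - 1) * (1 / real n)) (real k * (1 / real n))"
        unfolding quiet_def by blast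
      then have "grid_flip (1 / real n) k f"
        using flip_from_quiet[OF f q] True by (simp add: grid_flip_def start_flips_def)
      moreover have "k \<in> {1..n * n}" using kn by (simp add: k_def)
      ultimately show ?thesis using q unfolding late_flips_def by blast
    qed
    then show ?thesis using True by (intro eventually_sequentiallyI[of N]) simp
  qed
qed

text \<open>
  Flipping the finitely many excursions met by a grid preserves the law. Refining the grid
  to step \<open>1 / n\<close> and extending it to length \<open>n\<close> reaches all excursions.
\<close>

lemma preserves_start_flips: "preserves (\<lambda>f. flip_path H (start_flips f) f)"
proof -
  have "distr \<mu> PA (\<lambda>f. flip_path H (start_flips f) f) = \<mu>"
  proof (rule distr_limit[where F = "\<lambda>n f. flip_path H (late_flips (1 / real (Suc n)) (Suc n * Suc n) 1 f) f"])
    have p: "preserves (\<lambda>f. flip_path H (late_flips (1 / real (Suc n)) (Suc n * Suc n) 1 f) f)" for n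
      by (rule preserves_late_flips) auto
    show "(\<lambda>f. flip_path H (late_flips (1 / real (Suc n)) (Suc n * Suc n) 1 f) f) \<in> \<mu> \<rightarrow>\<^sub>M PA" for n
      using p[of n] by (intro measurable_law) (simp add: preserves_def)
    show "distr \<mu> PA (\<lambda>f. flip_path H (late_flips (1 / real (Suc n)) (Suc n * Suc n) 1 f) f) = \<mu>" for n
      using p[of n] by (simp add: preserves_def)
    show "AE f in \<mu>. \<forall>t. (\<lambda>n. circ (2 * H) (flip_path H (late_flips (1 / real (Suc n)) (Suc n * Suc n) 1 f) f t))
        \<longlonglongrightarrow> circ (2 * H) (flip_path H (start_flips f) f t)"
    proof (intro AE_I2 allI)
      fix f t assume "f \<in> space \<mu>"
      then have f: "f \<in> circle_paths (2 * H)" by (simp add: space_law)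
      have "eventually (\<lambda>n. flip_path H (late_flips (1 / real n) (n * n) 1 f) f t = flip_path H (start_flips f) f t) sequentially"
      proof (cases "Im (circ (2 * H) (f t)) = 0")
        case True
        then have "flip_path H S f t = f t rmod (2 * H)" for S
          using vertex_uminus[of H f t, OF H] by (simp add: flip_path_def)
        then show ?thesis by simp
      next
        case False
        from late_flips_eventually[OF f this] show ?thesis
          by eventually_elim (simp add: flip_path_def)
      qed
      then have "eventually (\<lambda>n. flip_path H (late_flips (1 / real (Suc n)) (Suc n * Suc n) 1 f) f t = flip_path H (start_flips f) f t) sequentially"
        by (rule eventually_sequentially_Suc[THEN iffD2])
      then have "eventually (\<lambda>n. circ (2 * H) (flip_path H (late_flips (1 / real (Suc n)) (Suc n * Suc n) 1 f) f t) = circ (2 * H) (flip_path H (start_flips f) f t)) sequentially"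
        by eventually_elim simp
      then show "(\<lambda>n. circ (2 * H) (flip_path H (late_flips (1 / real (Suc n)) (Suc n * Suc n) 1 f) f t))
        \<longlonglongrightarrow> circ (2 * H) (flip_path H (start_flips f) f t)"
        by (rule tendsto_eventually)
    qed
  qed (use H prob_law start_flips_path_measurable measurable_law in auto)
  then show ?thesis using start_flips_path_measurable by (simp add: preserves_def)
qed

end

end

section \<open>Equivariance and locality of the codings\<close>

lemma flipped_time_shift: "flipped m (\<lambda>t. g (t - s)) t = flipped m g (t - s)"
  by (simp add: flipped_def vtx_time_shift crs_time_shift)

lemma flipped_space_shift: "flipped m (\<lambda>t. g t + of_int (n * (2 * int m))) t = flipped m g t"
  by (simp only: flipped_def vtx_space_shift crs_space_shift) simp

lemma decode_time_shift: "decode m (\<lambda>t. g (t - s)) t = decode m g (t - s)"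
  by (simp add: decode_def place_def level_def vtx_time_shift crs_time_shift before_time_shift)

lemma level_space_shift: "level m (\<lambda>t. g t + of_int n) t = level m g t"
proof -
  have "before (\<lambda>t. g t + of_int n) t (of_int (vtx g t + n - \<theta>)) (of_int (vtx g t + n - \<theta> + int m)) =
     before g t (of_int (vtx g t - \<theta>)) (of_int (vtx g t - \<theta> + int m))" for \<theta>
  proof -
    have "real_of_int (vtx g t + n - \<theta>) = of_int (vtx g t - \<theta>) + of_int n"
      "real_of_int (vtx g t + n - \<theta> + int m) = of_int (vtx g t - \<theta> + int m) + of_int n" by simp_all
    then show ?thesis by (simp only: before_space_shift)
  qed
  then show ?thesis unfolding level_def vtx_space_shift by simp
qed

lemma decode_space_shift: "decode m (\<lambda>t. g t + of_int (2 * n)) t = decode m g t"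
proof -
  have "place m (\<lambda>t. g t + of_int (2 * n)) t = place m g t"
    unfolding place_def level_space_shift vtx_space_shift unfold_level_def by simp
  then show ?thesis unfolding decode_def crs_space_shift vtx_space_shift by simp
qed

text \<open>
  Both quantities depend only on the path between the last vertex time before \<open>t\<close> and the
  next one after it.
\<close>

lemma vtx_crs_window:
  fixes g h :: "real \<Rightarrow> real"
  assumes g: "continuous_on UNIV g" and h: "continuous_on UNIV h"
    and eq: "\<And>w. a \<le> w \<Longrightarrow> w \<le> b \<Longrightarrow> h w = g w"
    and v: "a \<le> v" "v \<le> t" "g v \<in> \<int>" and w: "t \<le> w" "w \<le> b" "g w \<in> \<int>"
  shows "vtx h t = vtx g t" "crs h t = crs g t"
proof -
  from last_int[OF g v(2,3)]
  obtain c where c: "v \<le> c" "c \<le> t" "g c \<in> \<int>" "\<And>w. c < w \<Longrightarrow> w \<le> t \<Longrightarrow> g w \<notin> \<int>" by blast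
  from first_int[OF g w(1,3)]
  obtain d where d: "t \<le> d" "d \<le> w" "g d \<in> \<int>" "\<And>w. t \<le> w \<Longrightarrow> w < d \<Longrightarrow> g w \<notin> \<int>" by blast
  obtain k where k: "g c = of_int k" using c(3) by (rule Ints_cases)
  obtain j where j: "g d = of_int j" using d(3) by (rule Ints_cases)
  have hc: "h c = of_int k" using eq[of c] k c(1,2) v(1) w(1,2) by simp
  have hd: "h d = of_int j" using eq[of d] j d(1,2) v(1,2) w(2) by simp
  have "vtx g t = k" by (rule vtx_after_last_int[OF g c(2) k c(4)])
  moreover have "vtx h t = k"
  proof (rule vtx_after_last_int[OF h c(2) hc])
    show "h u \<notin> \<int>" if "c < u" "u \<le> t" for u
      using c(4)[OF that] eq[of u] that c(1) v(1) w(1,2) by simp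
  qed
  ultimately show *: "vtx h t = vtx g t" by simp
  have "crs g t \<longleftrightarrow> vtx g t \<noteq> j" by (rule next_int_vtx(2)[OF g d(1) j d(4)])
  moreover have "crs h t \<longleftrightarrow> vtx h t \<noteq> j"
  proof (rule next_int_vtx(2)[OF h d(1) hd])
    show "h u \<notin> \<int>" if "t \<le> u" "u < d" for u
      using d(4)[OF that] eq[of u] that d(2) v(1,2) w(2) by simp
  qed
  ultimately show "crs h t = crs g t" by (simp only: *)
qed

text \<open>
  A past of range \<open>m\<close> inside the window contains a visit that decides each of the comparisons
  counted by the level; what happened before the window no longer matters.
\<close>

lemma level_window:
  fixes g h :: "real \<Rightarrow> real"
  assumes g: "continuous_on UNIV g" and eq: "\<And>w. a \<le> w \<Longrightarrow> w \<le> t \<Longrightarrow> h w = g w"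
    and vtx: "vtx h t = vtx g t"
    and wide: "a \<le> u" "a \<le> v" "u \<le> t" "v \<le> t" "real m \<le> g u - g v"
  shows "level m h t = level m g t"
proof -
  have "before h t (of_int (vtx g t - \<theta>)) (of_int (vtx g t - \<theta> + int m)) =
      before g t (of_int (vtx g t - \<theta>)) (of_int (vtx g t - \<theta> + int m))" if \<theta>: "1 \<le> \<theta>" "\<theta> < int m" for \<theta>
  proof -
    let ?A = "real_of_int (vtx g t - \<theta>)" and ?B = "real_of_int (vtx g t - \<theta> + int m)"
    from wide_past_exit[OF g wide(3,4,5) \<theta>]
    obtain w where w: "min u v \<le> w" "w \<le> t"
      and alt: "(g w = ?A \<and> (\<forall>x\<in>{w..t}. g x \<noteq> ?B)) \<or> (g w = ?B \<and> (\<forall>x\<in>{w..t}. g x \<noteq> ?A))" by blast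
    have aw: "a \<le> w" using w(1) wide(1,2) by linarith
    have alt': "(h w = ?A \<and> (\<forall>x\<in>{w..t}. h x \<noteq> ?B)) \<or> (h w = ?B \<and> (\<forall>x\<in>{w..t}. h x \<noteq> ?A))"
      using alt eq aw w(2) by auto
    have decide: "before p t ?A ?B \<longleftrightarrow> p w = ?A"
      if alt: "(p w = ?A \<and> (\<forall>x\<in>{w..t}. p x \<noteq> ?B)) \<or> (p w = ?B \<and> (\<forall>x\<in>{w..t}. p x \<noteq> ?A))" for p :: "real \<Rightarrow> real"
    proof
      assume "p w = ?A"
      then show "before p t ?A ?B" using alt w(2) unfolding before_def by auto
    next
      assume "before p t ?A ?B"
      then obtain x where x: "x \<le> t" "p x = ?A" "\<forall>y\<in>{x..t}. p y \<noteq> ?B" unfolding before_def by blast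
      show "p w = ?A"
      proof (rule ccontr)
        assume "p w \<noteq> ?A"
        then have "p w = ?B" "\<forall>x\<in>{w..t}. p x \<noteq> ?A" using alt by blast+
        then show False using x w(2) by (cases "x \<le> w") auto
      qed
    qed
    show ?thesis using decide[OF alt] decide[OF alt'] eq[OF aw w(2)] by simp
  qed
  then show ?thesis unfolding level_def vtx by (intro arg_cong[of _ _ int] arg_cong[of _ _ card]) auto
qed

lemma decode_window:
  fixes g h :: "real \<Rightarrow> real"
  assumes g: "continuous_on UNIV g" and h: "continuous_on UNIV h"
    and eq: "\<And>w. a \<le> w \<Longrightarrow> w \<le> b \<Longrightarrow> h w = g w"
    and v: "a \<le> v" "v \<le> t" "g v \<in> \<int>" and w: "t \<le> w" "w \<le> b" "g w \<in> \<int>"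
    and wide: "a \<le> x" "a \<le> y" "x \<le> t" "y \<le> t" "real m \<le> g x - g y"
  shows "decode m h t = decode m g t"
proof -
  note vc = vtx_crs_window[OF g h eq v w]
  have "level m h t = level m g t"
    by (rule level_window[OF g _ vc(1) wide]) (use eq w in auto)
  moreover have "h t = g t" using eq v w by auto
  ultimately show ?thesis by (simp add: decode_def place_def vc)
qed

text \<open>
  What a time window must contain to determine the codings on the unit interval: vertices on both sides of it and,
  for decoding, two integer times in the past that witness a range of \<open>m\<close>.
\<close>

definition vertex_window :: "nat \<Rightarrow> (real \<Rightarrow> real) \<Rightarrow> bool" where
  "vertex_window N g \<longleftrightarrow> (\<exists>k::int. \<exists>v\<in>{- (real N - 1)..0}. g v = of_int k) \<and>
     (\<exists>k::int. \<exists>v\<in>{1..real N - 1}. g v = of_int k)"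

definition wide_window :: "nat \<Rightarrow> nat \<Rightarrow> (real \<Rightarrow> real) \<Rightarrow> bool" where
  "wide_window m N g \<longleftrightarrow> (\<exists>i<N. \<exists>j<N. real m \<le> \<bar>g (- real i) - g (- real j)\<bar>)"

lemma measurable_vertex_window:
  assumes g: "continuous_process N' g" shows "Measurable.pred N' (\<lambda>x. vertex_window N (g x))"
proof -
  have *: "Measurable.pred N' (\<lambda>x. \<exists>k::int. \<exists>v\<in>{s..t}. g x v = of_int k)" for s t
  proof (cases "s \<le> t")
    case True
    note [measurable] = measurable_hits[OF g True]
    show ?thesis by measurable
  qed simp
  note [measurable] = *
  show ?thesis unfolding vertex_window_def by measurable
qed

lemma measurable_wide_window:
  assumes g: "continuous_process N' g" shows "Measurable.pred N' (\<lambda>x. wide_window m N (g x))"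
proof -
  have [measurable]: "(\<lambda>x. g x t) \<in> borel_measurable N'" for t using g by (simp add: continuous_process_def)
  show ?thesis unfolding wide_window_def by measurable
qed

text \<open>\<open>wild\<close> is a measurable way to say that a path has unbounded oscillation at both ends of time.\<close>

definition wild :: "(real \<Rightarrow> real) \<Rightarrow> bool" where
  "wild g \<longleftrightarrow> (\<forall>k::nat. (\<exists>n::nat. real k \<le> \<bar>g (- real k - real n) - g (- real k)\<bar>) \<and>
     (\<exists>n::nat. real k \<le> \<bar>g (real k + real n) - g (real k)\<bar>))"

lemma integer_between:
  fixes g :: "real \<Rightarrow> real"
  assumes g: "continuous_on UNIV g" and "s \<le> t" and w: "1 \<le> \<bar>g t - g s\<bar>"
  shows "\<exists>v. s \<le> v \<and> v \<le> t \<and> g v \<in> \<int>"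
proof (cases "g s \<le> g t")
  case True
  then have "g s \<le> of_int \<lceil>g s\<rceil>" "of_int \<lceil>g s\<rceil> \<le> g t" using w by linarith+
  from IVT_up[OF g \<open>s \<le> t\<close> this] show ?thesis by fastforce
next
  case False
  then have "g t \<le> of_int \<lceil>g t\<rceil>" "of_int \<lceil>g t\<rceil> \<le> g s" using w by linarith+
  from IVT_down[OF g \<open>s \<le> t\<close> this] show ?thesis by fastforce
qed

lemma wild_vertices:
  fixes g :: "real \<Rightarrow> real"
  assumes g: "continuous_on UNIV g" and w: "wild g"
  shows "\<exists>v\<le>T. g v \<in> \<int>" "\<exists>v\<ge>T. g v \<in> \<int>"
proof -
  obtain k :: nat where k: "max 1 \<bar>T\<bar> < real k" using reals_Archimedean2 by blast
  obtain n n' :: nat where n: "real k \<le> \<bar>g (- real k - real n) - g (- real k)\<bar>"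
    "real k \<le> \<bar>g (real k + real n') - g (real k)\<bar>" using w unfolding wild_def by blast
  have "1 \<le> \<bar>g (- real k) - g (- real k - real n)\<bar>" "1 \<le> \<bar>g (real k + real n') - g (real k)\<bar>"
    using n k by linarith+
  then obtain v v' where v: "v \<le> - real k" "g v \<in> \<int>" "real k \<le> v'" "g v' \<in> \<int>"
    using integer_between[OF g, of "- real k - real n" "- real k"] integer_between[OF g, of "real k" "real k + real n'"] by auto
  have "v \<le> T" "T \<le> v'" using v k by linarith+
  then show "\<exists>v\<le>T. g v \<in> \<int>" "\<exists>v\<ge>T. g v \<in> \<int>" using v by blast+
qed

lemma wild_wide:
  assumes w: "wild g" shows "\<exists>u v. u \<le> T \<and> v \<le> T \<and> C \<le> g u - g v"
proof -
  obtain k :: nat where k: "max C \<bar>T\<bar> < real k" using reals_Archimedean2 by blast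
  obtain n :: nat where n: "real k \<le> \<bar>g (- real k - real n) - g (- real k)\<bar>" using w unfolding wild_def by blast
  show ?thesis
  proof (cases "g (- real k - real n) \<ge> g (- real k)")
    case True
    then show ?thesis using n k by (intro exI[of _ "- real k - real n"] exI[of _ "- real k"]) auto
  next
    case False
    then show ?thesis using n k by (intro exI[of _ "- real k"] exI[of _ "- real k - real n"]) auto
  qed
qed

text \<open>
  Vertices on both sides and a wide past occur at finite distance.
\<close>

lemma wild_windows:
  fixes g :: "real \<Rightarrow> real"
  assumes g: "continuous_on UNIV g" and w: "wild g"
  shows "\<exists>N. vertex_window N g \<and> wide_window m N g"
proof -
  obtain v v' where v: "v \<le> 0" "g v \<in> \<int>" "1 \<le> v'" "g v' \<in> \<int>" using wild_vertices[OF g w] by blast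
  obtain n :: nat where n: "real m \<le> \<bar>g (- real m - real n) - g (- real m)\<bar>" using w unfolding wild_def by blast
  obtain N0 :: nat where N0: "max (- v) v' < real N0" using reals_Archimedean2 by blast
  define N where "N = N0 + m + n + 1"
  have "vertex_window N g"
    unfolding vertex_window_def
  proof
    obtain k k' where k: "g v = of_int k" "g v' = of_int k'" using v(2,4) by (auto elim!: Ints_cases)
    have "v \<in> {- (real N - 1)..0}" "v' \<in> {1..real N - 1}" using N0 v by (auto simp: N_def)
    then show "\<exists>k::int. \<exists>v\<in>{- (real N - 1)..0}. g v = of_int k" "\<exists>k::int. \<exists>v\<in>{1..real N - 1}. g v = of_int k"
      using k by blast+
  qed
  moreover have "- real (m + n) = - real m - real n" by simp
  then have "wide_window m N g"
    unfolding wide_window_def using n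
    by (intro exI[of _ "m + n"] exI[of _ m] conjI) (simp_all add: N_def)
  ultimately show ?thesis by blast
qed

context
  fixes H :: real and m :: nat
  assumes H: "H > 0" and m: "m > 0"
begin

abbreviation "CL \<equiv> 2 * real m * H"

private lemma long_pos: "CL > 0" using H m by simp

lemma lift_reduced:
  assumes f: "f \<in> circle_paths CL"
  shows "[f t = H * unit_lift H m f t] (rmod (2 * H))"
proof -
  have "f t rmod (2 * H) = (H * unit_lift H m f t) rmod (2 * H)"
    using unit_lift_rmod[OF H m f, of t] rmod_rmod_multiple[OF H m, of "H * unit_lift H m f t"] by simp
  then show ?thesis by (simp only: rcong_def)
qed

lemma fold_path_in: 
  assumes f: "f \<in> circle_paths CL"
  shows "fold_path H m f \<in> circle_paths (2 * H)"
  unfolding fold_path_def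
proof (rule flip_path_in_circle_paths[OF H continuous_unit_lift[OF H m f] lift_reduced[OF f]])
  fix x assume "unit_lift H m f x \<notin> \<int>"
  from near_const[OF continuous_unit_lift[OF H m f] this]
  obtain d where d: "d > 0" "\<And>w. \<bar>w - x\<bar> < d \<Longrightarrow> vtx (unit_lift H m f) w = vtx (unit_lift H m f) x"
    "\<And>w. \<bar>w - x\<bar> < d \<Longrightarrow> crs (unit_lift H m f) w = crs (unit_lift H m f) x" by blast
  have "flipped m (unit_lift H m f) w = flipped m (unit_lift H m f) x" if "\<bar>w - x\<bar> < d" for w
    unfolding flipped_def d(2)[OF that] d(3)[OF that] by (rule refl)
  with d(1) show "\<exists>d>0. \<forall>w. \<bar>w - x\<bar> < d \<longrightarrow> flipped m (unit_lift H m f) w = flipped m (unit_lift H m f) x"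
    by blast
qed

lemma measurable_fold_path: "fold_path H m \<in> path_algebra CL \<rightarrow>\<^sub>M path_algebra (2 * H)"
proof (rule measurable_path_algebraI)
  show "fold_path H m f \<in> circle_paths (2 * H)" if "f \<in> space (path_algebra CL)" for f
    using that by (intro fold_path_in) (simp add: space_path_algebra)
  fix t
  note [measurable] = measurable_flipped[OF continuous_process_unit_lift[OF H m], of m t] measurable_path_eval[of t]
  show "(\<lambda>f. fold_path H m f t) \<in> borel_measurable (path_algebra CL)"
    unfolding fold_path_def flip_path_def by measurable
qed

lemma unfold_path_in:
  assumes f: "f \<in> circle_paths (2 * H)"
  shows "unfold_path H m f \<in> circle_paths CL"
proof -
  have "(\<lambda>t. (H * decode m (unit_lift H 1 f) t) rmod CL) \<in> circle_paths CL"
  proof (rule continuous_circleI[OF H long_pos path_unit_lift(1)[OF H f]])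
    fix x
    have "CL / H = 2 * real m" using H by simp
    then show "\<exists>d>0. \<forall>t. \<bar>t - x\<bar> < d \<longrightarrow> (\<exists>n::int. \<bar>decode m (unit_lift H 1 f) t - decode m (unit_lift H 1 f) x
        - of_int n * (CL / H)\<bar> \<le> \<bar>unit_lift H 1 f t - unit_lift H 1 f x\<bar>)"
      using decode_local[OF path_unit_lift(1)[OF H f] m, of x] by (simp only:)
  qed
  then show ?thesis by (simp only: unfold_path_def[abs_def])
qed

lemma measurable_unfold_path: "unfold_path H m \<in> path_algebra (2 * H) \<rightarrow>\<^sub>M path_algebra CL"
proof (rule measurable_path_algebraI)
  show "unfold_path H m f \<in> circle_paths CL" if "f \<in> space (path_algebra (2 * H))" for f
    using that by (intro unfold_path_in) (simp add: space_path_algebra)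
  fix t
  note [measurable] = measurable_decode[OF continuous_process_path[OF H], of m t]
  show "(\<lambda>f. unfold_path H m f t) \<in> borel_measurable (path_algebra (2 * H))"
    unfolding unfold_path_def by measurable
qed

lemma flipped_translate:
  assumes f: "f \<in> circle_paths CL"
  shows "flipped m (unit_lift H m (translate s f)) t = flipped m (unit_lift H m f) (t - s)"
proof -
  let ?g = "unit_lift H m f"
  have g: "continuous_on UNIV (\<lambda>t. ?g (t - s))"
    by (rule continuous_on_compose2[OF continuous_unit_lift[OF H m f]]) (auto intro!: continuous_intros)
  have "translate s f t = (H * ?g (t - s)) rmod CL" for t
    by (simp only: translate_def unit_lift_rmod[OF H m f])
  from flipped_unit_lift[OF H m g this, of t]
  show ?thesis by (simp only: flipped_time_shift)
qed

lemma fold_path_translate: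
  assumes f: "f \<in> circle_paths CL"
  shows "fold_path H m (translate s f) = translate s (fold_path H m f)"
proof
  show "fold_path H m (translate s f) t = translate s (fold_path H m f) t" for t
    using flipped_translate[OF f, of s t] by (simp add: fold_path_def flip_path_def translate_def)
qed

lemma unfold_path_translate:
  assumes f: "f \<in> circle_paths (2 * H)"
  shows "unfold_path H m (translate s f) = translate s (unfold_path H m f)"
proof
  fix t
  let ?g = "unit_lift H 1 f"
  have one: "(1::nat) > 0" by simp
  have g: "continuous_on UNIV (\<lambda>t. ?g (t - s))"
    by (rule continuous_on_compose2[OF path_unit_lift(1)[OF H f]]) (auto intro!: continuous_intros)
  have "translate s f t = (H * ?g (t - s)) rmod (2 * real 1 * H)" for t
    using path_unit_lift(3)[OF H f, of "t - s"] by (simp add: translate_def)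
  from unit_lift_shift[OF H one g this]
  obtain n :: int where n: "\<And>t. unit_lift H 1 (translate s f) t = ?g (t - s) + of_int (n * (2 * int 1))" by blast
  have "unit_lift H 1 (translate s f) = (\<lambda>t. ?g (t - s) + of_int (2 * n))"
  proof
    fix t
    have *: "n * (2 * int 1) = 2 * n" by simp
    show "unit_lift H 1 (translate s f) t = ?g (t - s) + of_int (2 * n)" by (rule n[unfolded *])
  qed
  then have "decode m (unit_lift H 1 (translate s f)) t = decode m ?g (t - s)"
    by (simp only: decode_space_shift[of m "\<lambda>t. ?g (t - s)" n t] decode_time_shift[of m ?g s t])
  then show "unfold_path H m (translate s f) t = translate s (unfold_path H m f) t"
    by (simp only: unfold_path_def translate_def)
qed

text \<open>
  Equal paths on a window may have wound differently before it, so that their lifts agree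
  only up to full turns.
\<close>

lemma lifts_agree:
  assumes K: "K > 0" and f: "f \<in> circle_paths (2 * real K * H)" and f': "f' \<in> circle_paths (2 * real K * H)"
    and eq: "\<And>t. t \<in> {- real N<..<real N} \<Longrightarrow> f t = f' t"
  shows "\<exists>n::int. \<forall>t\<in>{- (real N - 1)..real N - 1}. unit_lift H K f' t + of_int (n * (2 * int K)) = unit_lift H K f t"
proof -
  have "\<exists>n::int. \<forall>t\<in>{- real N<..<real N}. H * unit_lift H K f t = H * unit_lift H K f' t + of_int n * (2 * real K * H)"
  proof (rule lifts_differ_by_constant)
    show "continuous_on {- real N<..<real N} (\<lambda>t. H * unit_lift H K f t)"
      "continuous_on {- real N<..<real N} (\<lambda>t. H * unit_lift H K f' t)"
      using cont_sub[OF continuous_unit_lift[OF H K f]] cont_sub[OF continuous_unit_lift[OF H K f']]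
      by (intro continuous_intros; simp)+
    show "[H * unit_lift H K f t = H * unit_lift H K f' t] (rmod (2 * real K * H))" if "t \<in> {- real N<..<real N}" for t
      unfolding rcong_def unit_lift_rmod[OF H K f] unit_lift_rmod[OF H K f'] by (rule eq[OF that])
  qed (use H K in auto)
  then obtain n :: int where n: "\<And>t. t \<in> {- real N<..<real N} \<Longrightarrow> H * unit_lift H K f t = H * unit_lift H K f' t + of_int n * (2 * real K * H)"
    by blast
  have "unit_lift H K f' t + of_int (n * (2 * int K)) = unit_lift H K f t" if "t \<in> {- (real N - 1)..real N - 1}" for t
  proof -
    have "t \<in> {- real N<..<real N}" using that by auto
    from n[OF this] have "H * unit_lift H K f t = H * (unit_lift H K f' t + of_int (n * (2 * int K)))"
      by (simp add: algebra_simps)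
    then show ?thesis using H by simp
  qed
  then show ?thesis by blast
qed

lemma fold_path_window:
  assumes f: "f \<in> circle_paths CL" and f': "f' \<in> circle_paths CL"
    and win: "vertex_window N (unit_lift H m f)"
    and eq: "\<And>t. t \<in> {- real N<..<real N} \<Longrightarrow> f t = f' t" and t: "t \<in> {0..1}"
  shows "fold_path H m f t = fold_path H m f' t"
proof -
  let ?g = "unit_lift H m f" and ?g' = "unit_lift H m f'"
  obtain n :: int where n: "\<forall>t\<in>{- (real N - 1)..real N - 1}. ?g' t + of_int (n * (2 * int m)) = ?g t"
    using lifts_agree[OF m f f' eq] by blast
  obtain v w where v: "- (real N - 1) \<le> v" "v \<le> 0" "?g v \<in> \<int>" and w: "1 \<le> w" "w \<le> real N - 1" "?g w \<in> \<int>"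
    using win unfolding vertex_window_def by auto
  have "continuous_on UNIV (\<lambda>t. ?g' t + of_int (n * (2 * int m)))"
    using continuous_unit_lift[OF H m f'] by (intro continuous_intros)
  note vc = vtx_crs_window[OF continuous_unit_lift[OF H m f] this, of "- (real N - 1)" "real N - 1" v t w]
  have "flipped m (\<lambda>t. ?g' t + of_int (n * (2 * int m))) t = flipped m ?g t"
    unfolding flipped_def using vc n v w t by simp
  then have "flipped m ?g' t = flipped m ?g t" by (simp only: flipped_space_shift)
  moreover have "f t = f' t" using t w by (intro eq) auto
  ultimately show ?thesis by (simp add: fold_path_def flip_path_def)
qed

lemma unfold_path_window:
  assumes f: "f \<in> circle_paths (2 * H)" and f': "f' \<in> circle_paths (2 * H)"
    and win: "vertex_window N (unit_lift H 1 f)" "wide_window m N (unit_lift H 1 f)"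
    and eq: "\<And>t. t \<in> {- real N<..<real N} \<Longrightarrow> f t = f' t" and t: "t \<in> {0..1}"
  shows "unfold_path H m f t = unfold_path H m f' t"
proof -
  define g g' where "g = unit_lift H 1 f" and "g' = unit_lift H 1 f'"
  note cg = path_unit_lift(1)[OF H f, folded g_def] and cg' = path_unit_lift(1)[OF H f', folded g'_def]
  have one: "(1::nat) > 0" "2 * real 1 * H = 2 * H" by simp_all
  obtain n :: int where n: "\<forall>t\<in>{- (real N - 1)..real N - 1}. g' t + of_int (n * (2 * int 1)) = g t"
    using lifts_agree[OF one(1), unfolded one(2), OF f f' eq] unfolding g_def g'_def by blast
  obtain v w where v: "- (real N - 1) \<le> v" "v \<le> 0" "g v \<in> \<int>" and w: "1 \<le> w" "w \<le> real N - 1" "g w \<in> \<int>"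
    using win(1) unfolding vertex_window_def g_def[symmetric] by auto
  obtain i j :: nat where ij: "i < N" "j < N" "real m \<le> \<bar>g (- real i) - g (- real j)\<bar>"
    using win(2) unfolding wide_window_def g_def[symmetric] by blast
  have c: "continuous_on UNIV (\<lambda>t. g' t + of_int (2 * n))" using cg' by (intro continuous_intros)
  have e: "g' x + of_int (2 * n) = g x" if "- (real N - 1) \<le> x" "x \<le> real N - 1" for x
    using n that by (simp add: mult.commute)
  have vt: "v \<le> t" "t \<le> w" using v w t by auto
  have inx: "- (real N - 1) \<le> - real k" "- real k \<le> t" if "k < N" for k using that t by auto
  have "decode m (\<lambda>t. g' t + of_int (2 * n)) t = decode m g t"
  proof (cases "g (- real i) \<ge> g (- real j)")
    case True
    then show ?thesis using ij(3)
      by (intro decode_window[OF cg c e v(1) vt(1) v(3) vt(2) w(2,3) inx(1)[OF ij(1)] inx(1)[OF ij(2)]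
          inx(2)[OF ij(1)] inx(2)[OF ij(2)]]) auto
  next
    case False
    then show ?thesis using ij(3)
      by (intro decode_window[OF cg c e v(1) vt(1) v(3) vt(2) w(2,3) inx(1)[OF ij(2)] inx(1)[OF ij(1)]
          inx(2)[OF ij(2)] inx(2)[OF ij(1)]]) auto
  qed
  then have "decode m g' t = decode m g t" by (simp only: decode_space_shift)
  then show ?thesis unfolding unfold_path_def g_def g'_def by (rule arg_cong[of _ _ "\<lambda>x. (H * x) rmod CL", OF sym])
qed

end

section \<open>The law of the folded path\<close>

lemma AE_unif_lawI:
  assumes L: "L > 0" and V: "wiener M V"
    and P: "{f \<in> circle_paths L. P f} \<in> sets (path_algebra L)"
    and ae: "\<And>x. AE \<omega> in M. P (\<lambda>t. (x + V t \<omega>) rmod L)"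
  shows "AE f in unif_law L M V. P f"
proof -
  let ?N = "space (path_algebra L) - {f \<in> circle_paths L. P f}"
  have N: "?N \<in> sets (path_algebra L)" using P by (rule sets.compl_sets)
  have "emeasure M {\<omega> \<in> space M. (\<lambda>t. (x + V t \<omega>) rmod L) \<in> ?N} = 0" for x
  proof -
    obtain E where E: "{\<omega> \<in> space M. \<not> P (\<lambda>t. (x + V t \<omega>) rmod L)} \<subseteq> E" "emeasure M E = 0" "E \<in> sets M"
      using ae[of x] by (rule AE_E)
    have "emeasure M {\<omega> \<in> space M. (\<lambda>t. (x + V t \<omega>) rmod L) \<in> ?N} \<le> emeasure M E"
      using E(1,3) by (intro emeasure_mono) (auto simp: space_path_algebra)
    then show ?thesis using E(2) by simp
  qed
  then have "emeasure (unif_law L M V) ?N = 0"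
    using emeasure_unif_law(1)[OF L V N] by simp
  then have "AE f in unif_law L M V. f \<notin> ?N"
    using N by (intro AE_not_in) (simp add: null_sets_def)
  moreover have "space (unif_law L M V) = circle_paths L"
    by (simp add: unif_law_def space_path_algebra)
  ultimately show ?thesis
    by (auto simp: space_path_algebra elim: AE_mp)
qed

context two_sided_brownian_motion
begin

abbreviation "inc \<equiv> (\<lambda>t \<omega>. W t \<omega> - W 0 \<omega>)"

lemma wiener_inc: "wiener M inc"
  using wiener_of_brownian_motion[OF two_sided_brownian_motion_axioms, of 0] by simp

text \<open>
  A Gaussian variable with variance \<open>n\<close> has density at most \<open>1 / sqrt n\<close>, so it lies in a
  fixed bounded interval with a probability that tends to \<open>0\<close>. One sufficiently long
  increment is thus large.
\<close>

lemma AE_large_increment: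
  assumes e: "e = 1 \<or> e = - 1"
  shows "AE \<omega> in M. \<exists>n::nat. C \<le> \<bar>W (T + e * real n) \<omega> - W T \<omega>\<bar>"
proof (cases "C > 0")
  case False
  then show ?thesis by (intro AE_I2 exI[of _ 0]) simp
next
  case C: True
  have [measurable]: "W t \<in> borel_measurable M" for t by (rule random_variable_W)
  let ?B = "{\<omega> \<in> space M. \<forall>n::nat. \<not> C \<le> \<bar>W (T + e * real n) \<omega> - W T \<omega>\<bar>}"
  have B: "?B \<in> sets M" by measurable
  have bound: "prob ?B \<le> 2 * C / sqrt (real n)" if n: "n \<ge> 1" for n
  proof -
    obtain s t where st: "s < t" "t - s = real n"
      and same: "\<And>\<omega>. \<bar>W (T + e * real n) \<omega> - W T \<omega>\<bar> = \<bar>W t \<omega> - W s \<omega>\<bar>"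
    proof (cases "e = 1")
      case True
      then show ?thesis using n by (intro that[of T "T + real n"]) auto
    next
      case False
      then show ?thesis using n e by (intro that[of "T - real n" T]) auto
    qed
    have D: "distributed M lborel (\<lambda>\<omega>. W t \<omega> - W s \<omega>) (normal_density 0 (sqrt (real n)))"
      using gaussian_increments[OF st(1)] st(2) by simp
    have dens: "normal_density 0 (sqrt (real n)) x \<le> 1 / sqrt (real n)" for x
    proof -
      have p1: "1 \<le> 2 * pi" using pi_ge_two by simp
      have "1 / sqrt (2 * pi * real n) \<le> 1 / sqrt (real n)"
        using n mult_right_mono[OF p1, of "real n"] by (intro divide_left_mono) auto
      moreover have "exp (- (x\<^sup>2 / (2 * real n))) \<le> 1" by simp
      ultimately have "1 / sqrt (2 * pi * real n) * exp (- (x\<^sup>2 / (2 * real n))) \<le> 1 / sqrt (real n) * 1"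
        by (intro mult_mono) auto
      then show ?thesis by (simp add: normal_density_def)
    qed
    have "emeasure M ?B \<le> emeasure M ((\<lambda>\<omega>. W t \<omega> - W s \<omega>) -` {- C<..<C} \<inter> space M)"
    proof (rule emeasure_mono)
      show "?B \<subseteq> (\<lambda>\<omega>. W t \<omega> - W s \<omega>) -` {- C<..<C} \<inter> space M"
      proof
        fix \<omega> assume "\<omega> \<in> ?B"
        then have "\<omega> \<in> space M" "\<not> C \<le> \<bar>W (T + e * real n) \<omega> - W T \<omega>\<bar>" by blast+
        then show "\<omega> \<in> (\<lambda>\<omega>. W t \<omega> - W s \<omega>) -` {- C<..<C} \<inter> space M" unfolding same by auto
      qed
    qed measurable
    also have "\<dots> = (\<integral>\<^sup>+x. ennreal (normal_density 0 (sqrt (real n)) x) * indicator {- C<..<C} x \<partial>lborel)"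
      by (rule distributed_emeasure[OF D]) simp
    also have "\<dots> \<le> (\<integral>\<^sup>+x. ennreal (1 / sqrt (real n)) * indicator {- C<..<C} x \<partial>lborel)"
      by (intro nn_integral_mono mult_right_mono ennreal_leI dens) simp
    also have "\<dots> = ennreal (1 / sqrt (real n)) * ennreal (2 * C)"
      using C by (subst nn_integral_cmult_indicator) auto
    also have "\<dots> = ennreal (2 * C / sqrt (real n))"
      using C by (simp flip: ennreal_mult)
    finally show ?thesis
      using C by (simp add: emeasure_eq_measure)
  qed
  have "filterlim (\<lambda>n::nat. sqrt (real n)) at_top sequentially"
    by (rule filterlim_compose[OF sqrt_at_top filterlim_real_sequentially])
  then have lim: "(\<lambda>n::nat. 2 * C / sqrt (real n)) \<longlonglongrightarrow> 0"
    by (intro tendsto_divide_0[OF tendsto_const] filterlim_at_top_imp_at_infinity)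
  have "prob ?B \<le> 0"
    by (rule LIMSEQ_le_const[OF lim]) (use bound in blast)
  then have "emeasure M ?B = 0" using measure_nonneg[of M ?B] by (simp add: emeasure_eq_measure)
  then show ?thesis by (intro AE_I[OF _ _ B]) auto
qed

lemma AE_wild:
  assumes H: "H > 0" and m: "m > 0"
  shows "AE f in unif_law (2 * real m * H) M inc. wild (unit_lift H m f)"
proof (rule AE_unif_lawI[OF _ wiener_inc])
  let ?L = "2 * real m * H"
  show L: "?L > 0" using H m by simp
  have [measurable]: "(\<lambda>f. unit_lift H m f t) \<in> borel_measurable (path_algebra ?L)" for t
    using continuous_process_unit_lift[OF H m] by (simp add: continuous_process_def)
  have "Measurable.pred (path_algebra ?L) (\<lambda>f. wild (unit_lift H m f))"
    unfolding wild_def by measurable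
  then show "{f \<in> circle_paths ?L. wild (unit_lift H m f)} \<in> sets (path_algebra ?L)"
    by (simp add: pred_def space_path_algebra)
  fix x
  have "AE \<omega> in M. \<forall>k::nat. (\<exists>n::nat. real k * H \<le> \<bar>W (- real k + (- 1) * real n) \<omega> - W (- real k) \<omega>\<bar>) \<and>
      (\<exists>n::nat. real k * H \<le> \<bar>W (real k + 1 * real n) \<omega> - W (real k) \<omega>\<bar>)"
    unfolding AE_all_countable by (intro allI AE_conjI AE_large_increment) simp_all
  then show "AE \<omega> in M. wild (unit_lift H m (\<lambda>t. (x + (W t \<omega> - W 0 \<omega>)) rmod ?L))"
  proof (rule AE_mp[OF _ AE_I2], intro impI)
    fix \<omega> assume \<omega>: "\<omega> \<in> space M"
      and big: "\<forall>k::nat. (\<exists>n::nat. real k * H \<le> \<bar>W (- real k + (- 1) * real n) \<omega> - W (- real k) \<omega>\<bar>) \<and>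
      (\<exists>n::nat. real k * H \<le> \<bar>W (real k + 1 * real n) \<omega> - W (real k) \<omega>\<bar>)"
    define g where "g t = (x + (W t \<omega> - W 0 \<omega>)) / H" for t
    have g: "continuous_on UNIV g"
      unfolding g_def using H continuous_paths[OF \<omega>] by (intro continuous_intros) auto
    have "(x + (W t \<omega> - W 0 \<omega>)) rmod ?L = (H * g t) rmod ?L" for t using H by (simp add: g_def)
    from unit_lift_shift[OF H m g this]
    obtain n :: int where n: "\<And>t. unit_lift H m (\<lambda>t. (x + (W t \<omega> - W 0 \<omega>)) rmod ?L) t = g t + of_int (n * (2 * int m))"
      by blast
    have d: "real k \<le> \<bar>g s - g t\<bar> \<longleftrightarrow> real k * H \<le> \<bar>W s \<omega> - W t \<omega>\<bar>" for s t k
    proof -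
      have "g s - g t = (W s \<omega> - W t \<omega>) / H" by (simp add: g_def diff_divide_distrib add_divide_distrib)
      then show ?thesis using H by (simp add: abs_div pos_le_divide_eq)
    qed
    show "wild (unit_lift H m (\<lambda>t. (x + (W t \<omega> - W 0 \<omega>)) rmod ?L))"
      unfolding wild_def n add_diff_cancel_right d using big by simp
  qed
qed

lemma circle_law_unif:
  assumes H: "H > 0" shows "circle_law H (unif_law (2 * H) M inc)"
proof (rule circle_law.intro)
  have L: "2 * H > 0" using H by simp
  show "prob_space (unif_law (2 * H) M inc)" by (rule prob_space_unif_law[OF L wiener_inc])
  show "H > 0" by (rule H)
  show "sets (unif_law (2 * H) M inc) = sets (path_algebra (2 * H))" by simp
  show "distr (unif_law (2 * H) M inc) (path_algebra (2 * H)) (translate s) = unif_law (2 * H) M inc" for s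
    by (rule unif_law_translate[OF L two_sided_brownian_motion_axioms])
  show "distr (unif_law (2 * H) M inc) (path_algebra (2 * H)) (negate (2 * H)) = unif_law (2 * H) M inc"
    by (rule unif_law_negate[OF L wiener_inc])
  show "distr (unif_law (2 * H) M inc) (path_algebra (2 * H)) (reflect_side (2 * H) e) = unif_law (2 * H) M inc"
    if "e = 1 \<or> e = - 1" for e
    by (rule unif_law_reflect_side[OF L wiener_inc that])
qed

context
  fixes H :: real and m :: nat
  assumes H: "H > 0" and m: "m > 0"
begin

interpretation C: circle_law H "unif_law (2 * H) M inc" by (rule circle_law_unif[OF H])

private lemma L: "2 * real m * H > 0" using H m by simp

text \<open>
  Folding of all excursions that start after time \<open>0\<close>. Unlike the full folding map it can
  be described by the path of the short circle from time \<open>0\<close> on and the sheet at time \<open>0\<close>.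
\<close>

definition half_fold :: "(real \<Rightarrow> real) \<Rightarrow> real \<Rightarrow> real" where
  "half_fold f = flip_path H (\<lambda>t. flipped m (unit_lift H m f) t \<and> 0 \<le> t \<and> \<not> quiet H f 0 t) f"

lemma reduce_in:
  assumes f: "f \<in> circle_paths (2 * real m * H)"
  shows "(\<lambda>t. f t rmod (2 * H)) \<in> circle_paths (2 * H)"
proof -
  have "continuous_on UNIV (\<lambda>t. H * unit_lift H m f t)"
    using continuous_unit_lift[OF H m f] by (intro continuous_intros)
  from rmod_in_circle_paths[OF _ this, of "2 * H"] H lift_reduced[OF H m f]
  show ?thesis by (simp add: rcong_def)
qed

lemma quiet_reduce: "quiet H (\<lambda>t. f t rmod (2 * H)) s t = quiet H f s t"
  using H by (simp add: quiet_def)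

lemma measurable_half_fold: "half_fold \<in> path_algebra (2 * real m * H) \<rightarrow>\<^sub>M path_algebra (2 * H)"
proof (rule measurable_path_algebraI)
  fix f assume "f \<in> space (path_algebra (2 * real m * H))"
  then have f: "f \<in> circle_paths (2 * real m * H)" by (simp add: space_path_algebra)
  let ?g = "unit_lift H m f" and ?r = "\<lambda>t. f t rmod (2 * H)"
  show "half_fold f \<in> circle_paths (2 * H)"
    unfolding half_fold_def
  proof (rule flip_path_in_circle_paths[OF H continuous_unit_lift[OF H m f] lift_reduced[OF H m f]])
    fix x assume x: "?g x \<notin> \<int>"
    from near_const[OF continuous_unit_lift[OF H m f] this]
    obtain d where d: "d > 0" "\<And>w. \<bar>w - x\<bar> < d \<Longrightarrow> vtx ?g w = vtx ?g x"
      "\<And>w. \<bar>w - x\<bar> < d \<Longrightarrow> crs ?g w = crs ?g x" by blast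
    have "Im (circ (2 * H) (f x)) \<noteq> 0"
      using x vertex_iff[of H f x ?g, OF H lift_reduced[OF H m f]] by simp
    then have "Im (circ (2 * H) (?r x)) \<noteq> 0" using H by simp
    from C.negate_beyond_local[OF reduce_in[OF f] this, of 1]
    obtain d' where d': "d' > 0" "\<And>w. \<bar>w - x\<bar> < d' \<Longrightarrow>
      (0 \<le> w \<and> \<not> quiet H f 0 w) = (0 \<le> x \<and> \<not> quiet H f 0 x)"
      unfolding quiet_reduce mult_1 by blast
    have "(flipped m ?g w \<and> 0 \<le> w \<and> \<not> quiet H f 0 w) = (flipped m ?g x \<and> 0 \<le> x \<and> \<not> quiet H f 0 x)"
      if "\<bar>w - x\<bar> < min d d'" for w
    proof -
      have a: "\<bar>w - x\<bar> < d" "\<bar>w - x\<bar> < d'" using that by simp_all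
      show ?thesis unfolding flipped_def d(2)[OF a(1)] d(3)[OF a(1)] d'(2)[OF a(2)] by (rule refl)
    qed
    moreover have "min d d' > 0" using d(1) d'(1) by simp
    ultimately show "\<exists>d>0. \<forall>w. \<bar>w - x\<bar> < d \<longrightarrow>
      (flipped m ?g w \<and> 0 \<le> w \<and> \<not> quiet H f 0 w) = (flipped m ?g x \<and> 0 \<le> x \<and> \<not> quiet H f 0 x)" by blast
  qed
next
  fix t
  let ?P = "path_algebra (2 * real m * H)"
  have r: "(\<lambda>f t. f t rmod (2 * H)) \<in> ?P \<rightarrow>\<^sub>M path_algebra (2 * H)"
  proof (rule measurable_path_algebraI)
    show "(\<lambda>t. f t rmod (2 * H)) \<in> circle_paths (2 * H)" if "f \<in> space ?P" for f
      using reduce_in that by (simp add: space_path_algebra)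
    show "(\<lambda>f. f t rmod (2 * H)) \<in> borel_measurable ?P" for t
      using measurable_path_eval[of t] by measurable
  qed
  have q: "Measurable.pred ?P (\<lambda>f. quiet H f 0 t)"
    using measurable_compose[OF r measurable_quiet[OF H, of 0 t]] unfolding quiet_reduce .
  note [measurable] = q measurable_flipped[OF continuous_process_unit_lift[OF H m], of m t] measurable_path_eval[of t]
  show "(\<lambda>f. half_fold f t) \<in> borel_measurable ?P"
    unfolding half_fold_def flip_path_def by measurable
qed

text \<open>
  A point of the long circle is a point \<open>x\<close> of the short one together with the number \<open>c\<close> of the sheet
  above it. Given \<open>c\<close>, folding from time \<open>0\<close> on is a rule for flipping excursions of the short loop.
\<close>

lemma half_fold_loop:
  assumes x: "0 \<le> x" "x < 2 * H" and \<omega>: "\<omega> \<in> space M"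
  defines "X \<equiv> \<lambda>t. (x + (W t \<omega> - W 0 \<omega>)) rmod (2 * H)"
  shows "half_fold (\<lambda>t. (x + real c * (2 * H) + (W t \<omega> - W 0 \<omega>)) rmod (2 * real m * H)) =
    flip_path H (C.start_flips m (int c) X) X"
proof
  fix t
  let ?Z = "\<lambda>t. (x + real c * (2 * H) + (W t \<omega> - W 0 \<omega>)) rmod (2 * real m * H)"
  define g where "g t = (x + (W t \<omega> - W 0 \<omega>)) / H" for t
  have gc: "continuous_on UNIV (\<lambda>t. x + (W t \<omega> - W 0 \<omega>))"
    using continuous_paths[OF \<omega>] by (intro continuous_intros)
  have g: "continuous_on UNIV g"
    unfolding g_def using H by (intro continuous_on_divide[OF gc] continuous_on_const) auto
  have L2: "2 * H > 0" using H by simp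
  have "lift (2 * H) X = (\<lambda>t. x + (W t \<omega> - W 0 \<omega>))"
    by (rule lift_unique[OF L2 gc]) (use x H rmod_idem[of x "2 * H"] in \<open>simp_all add: X_def\<close>)
  then have uX: "unit_lift H 1 X = g" by (simp add: unit_lift_def g_def fun_eq_iff)
  have Z: "?Z t = (H * (g t + of_int (2 * int c))) rmod (2 * real m * H)" for t
  proof -
    have "H * g t = x + (W t \<omega> - W 0 \<omega>)" using H by (simp add: g_def)
    then have "H * (g t + of_int (2 * int c)) = x + real c * (2 * H) + (W t \<omega> - W 0 \<omega>)"
      by (simp add: distrib_left)
    then show ?thesis by (simp only:)
  qed
  have "continuous_on UNIV (\<lambda>t. g t + of_int (2 * int c))" using g by (intro continuous_intros)
  from flipped_unit_lift[OF H m this Z, of t]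
  have fl: "flipped m (unit_lift H m ?Z) t = C.flip_from m (int c) X t"
    by (simp only: C.flip_from_def uX)
  have ZX: "?Z t rmod (2 * H) = X t" for t
  proof -
    have "[x + (W t \<omega> - W 0 \<omega>) = x + real c * (2 * H) + (W t \<omega> - W 0 \<omega>)] (rmod (2 * H))"
      unfolding rcong_altdef by (intro exI[of _ "int c"]) simp
    then show ?thesis unfolding rmod_rmod_multiple[OF H m] X_def by (simp add: rcong_def)
  qed
  have q: "quiet H ?Z 0 t = quiet H X 0 t"
    using quiet_reduce[of ?Z 0 t] unfolding ZX by simp
  have zx: "[?Z t = X t] (rmod (2 * H))" unfolding rcong_def ZX by (simp add: X_def)
  have cong: "flip_path H S ?Z t = (if S t then - X t else X t) rmod (2 * H)" for S
    by (rule flip_path_cong[of ?Z t "X t" H, OF zx])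
  show "half_fold ?Z t = flip_path H (C.start_flips m (int c) X) X t"
    unfolding half_fold_def cong by (simp only: flip_path_def C.start_flips_def fl q)
qed

text \<open>
  Conditionally on the sheet, the flipping rule preserves the law of the short loop, and
  the answer does not depend on the sheet.
\<close>

lemma law_half_fold:
  "distr (unif_law (2 * real m * H) M inc) (path_algebra (2 * H)) half_fold = unif_law (2 * H) M inc"
proof (rule measure_eqI)
  let ?L = "2 * real m * H" and ?l = "2 * H"
  have l: "?l > 0" using H by simp
  show "sets (distr (unif_law ?L M inc) (path_algebra ?l) half_fold) = sets (unif_law ?l M inc)" by simp
  fix A assume "A \<in> sets (distr (unif_law ?L M inc) (path_algebra ?l) half_fold)"
  then have A: "A \<in> sets (path_algebra ?l)" by simp
  let ?B = "half_fold -` A \<inter> space (path_algebra ?L)"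
  have B: "?B \<in> sets (path_algebra ?L)" using measurable_half_fold A by (rule measurable_sets)
  have sp: "space (unif_law ?L M inc) = space (path_algebra ?L)" by (simp add: unif_law_def)
  define F where "F x = emeasure M {\<omega> \<in> space M. (\<lambda>t. (x + (W t \<omega> - W 0 \<omega>)) rmod ?L) \<in> ?B}" for x
  have F: "F \<in> borel_measurable borel"
  proof -
    let ?Y = "(\<lambda>(x, \<omega>) t. (x + (W t \<omega> - W 0 \<omega>)) rmod ?L) -` ?B \<inter> space (unif ?L \<Otimes>\<^sub>M M)"
    have "?Y \<in> sets (unif ?L \<Otimes>\<^sub>M M)"
      using measurable_loop[OF L wiener_inc] B by (rule measurable_sets)
    then have "(\<lambda>x. emeasure M (Pair x -` ?Y)) \<in> borel_measurable (unif ?L)"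
      by (rule measurable_emeasure_Pair)
    also have "(\<lambda>x. emeasure M (Pair x -` ?Y)) = F"
      unfolding F_def by (intro ext arg_cong[of _ _ "emeasure M"]) (auto simp: space_pair_measure)
    finally show ?thesis by simp
  qed
  have step: "(\<integral>\<^sup>+x. F (x + real c * ?l) \<partial>unif ?l) = emeasure (unif_law ?l M inc) A" if "c < m" for c
  proof -
    let ?T = "\<lambda>f. flip_path H (C.start_flips m (int c) f) f"
    have T: "?T \<in> path_algebra ?l \<rightarrow>\<^sub>M path_algebra ?l" "distr (unif_law ?l M inc) (path_algebra ?l) ?T = unif_law ?l M inc"
      using C.preserves_start_flips[of m "int c"] by (simp_all add: C.preserves_def)
    let ?B' = "?T -` A \<inter> space (path_algebra ?l)"
    have B': "?B' \<in> sets (path_algebra ?l)" using T(1) A by (rule measurable_sets)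
    have spl: "space (unif_law ?l M inc) = space (path_algebra ?l)" by (simp add: unif_law_def)
    have "(\<integral>\<^sup>+x. F (x + real c * ?l) \<partial>unif ?l) =
        (\<integral>\<^sup>+x. emeasure M {\<omega> \<in> space M. (\<lambda>t. (x + (W t \<omega> - W 0 \<omega>)) rmod ?l) \<in> ?B'} \<partial>unif ?l)"
    proof (rule nn_integral_cong_AE)
      have "F (x + real c * ?l) = emeasure M {\<omega> \<in> space M. (\<lambda>t. (x + (W t \<omega> - W 0 \<omega>)) rmod ?l) \<in> ?B'}"
        if x: "x \<in> {0..<?l}" for x
        unfolding F_def
      proof (intro arg_cong[of _ _ "emeasure M"] Collect_cong conj_cong refl)
        fix \<omega> assume \<omega>: "\<omega> \<in> space M"
        have "(\<lambda>t. (x + real c * ?l + (W t \<omega> - W 0 \<omega>)) rmod ?L) \<in> circle_paths ?L"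
          "(\<lambda>t. (x + (W t \<omega> - W 0 \<omega>)) rmod ?l) \<in> circle_paths ?l"
          using continuous_paths[OF \<omega>] L l by (auto intro!: rmod_in_circle_paths continuous_intros)
        then show "(\<lambda>t. (x + real c * ?l + (W t \<omega> - W 0 \<omega>)) rmod ?L) \<in> ?B \<longleftrightarrow>
            (\<lambda>t. (x + (W t \<omega> - W 0 \<omega>)) rmod ?l) \<in> ?B'"
          using half_fold_loop[of x \<omega> c] x \<omega> by (simp add: space_path_algebra)
      qed
      then show "AE x in unif ?l. F (x + real c * ?l) =
          emeasure M {\<omega> \<in> space M. (\<lambda>t. (x + (W t \<omega> - W 0 \<omega>)) rmod ?l) \<in> ?B'}"
        unfolding unif_def by (intro AE_uniform_measureI) auto
    qed
    also have "\<dots> = emeasure (unif_law ?l M inc) ?B'"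
      by (rule emeasure_unif_law(1)[OF l wiener_inc B', symmetric])
    also have "\<dots> = emeasure (distr (unif_law ?l M inc) (path_algebra ?l) ?T) A"
      using T(1) A spl by (subst emeasure_distr) (simp_all cong: measurable_cong_sets)
    finally show ?thesis unfolding T(2) .
  qed
  have "emeasure (distr (unif_law ?L M inc) (path_algebra ?l) half_fold) A = emeasure (unif_law ?L M inc) ?B"
    using measurable_half_fold A sp by (subst emeasure_distr) (simp_all cong: measurable_cong_sets)
  also have "\<dots> = (\<integral>\<^sup>+x. F x \<partial>unif ?L)"
    unfolding F_def by (rule emeasure_unif_law(1)[OF L wiener_inc B])
  also have "\<dots> = emeasure (unif_law ?l M inc) A"
  proof -
    have e: "?L = real m * ?l" by simp
    show ?thesis unfolding e by (rule nn_integral_unif_multiple[OF l m F step])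
  qed
  finally show "emeasure (distr (unif_law ?L M inc) (path_algebra ?l) half_fold) A = emeasure (unif_law ?l M inc) A" .
qed

text \<open>
  By stationarity folding may start at time \<open>- n\<close> instead of \<open>0\<close>. As \<open>n\<close> grows this
  reaches every excursion.
\<close>

lemma law_fold_path:
  "distr (unif_law (2 * real m * H) M inc) (path_algebra (2 * H)) (fold_path H m) = unif_law (2 * H) M inc"
proof -
  let ?L = "2 * real m * H" and ?l = "2 * H"
  let ?F = "\<lambda>(n::nat) f. translate (- real n) (half_fold (translate (real n) f))"
  have eqL: "measurable (unif_law ?L M inc) N = measurable (path_algebra ?L) N" for N :: "(real \<Rightarrow> real) measure"
    by (rule measurable_cong_sets) simp_all
  have hF: "(\<lambda>f. half_fold (translate (real n) f)) \<in> path_algebra ?L \<rightarrow>\<^sub>M path_algebra ?l" for n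
    by (rule measurable_compose[OF measurable_translate measurable_half_fold])
  have F: "?F n \<in> path_algebra ?L \<rightarrow>\<^sub>M path_algebra ?l" for n
    by (rule measurable_compose[OF hF measurable_translate])
  show ?thesis
  proof (rule distr_limit[where F = ?F])
    show "?l > 0" using H by simp
    show "prob_space (unif_law ?L M inc)" by (rule prob_space_unif_law[OF L wiener_inc])
    show "?F n \<in> unif_law ?L M inc \<rightarrow>\<^sub>M path_algebra ?l" for n unfolding eqL by (rule F)
    show "fold_path H m \<in> unif_law ?L M inc \<rightarrow>\<^sub>M path_algebra ?l"
      unfolding eqL by (rule measurable_fold_path[OF H m])
    show "distr (unif_law ?L M inc) (path_algebra ?l) (?F n) = unif_law ?l M inc" for n
    proof -
      have "distr (unif_law ?L M inc) (path_algebra ?l) (?F n) =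
          distr (distr (distr (unif_law ?L M inc) (path_algebra ?L) (translate (real n))) (path_algebra ?l) half_fold)
            (path_algebra ?l) (translate (- real n))"
        using measurable_translate[of "real n" ?L] measurable_half_fold
        by (simp add: distr_distr[OF measurable_half_fold] distr_distr[OF measurable_translate] eqL hF comp_def)
      also have "distr (unif_law ?L M inc) (path_algebra ?L) (translate (real n)) = unif_law ?L M inc"
        by (rule unif_law_translate[OF L two_sided_brownian_motion_axioms])
      also have "distr (unif_law ?L M inc) (path_algebra ?l) half_fold = unif_law ?l M inc"
        by (rule law_half_fold)
      also have "distr (unif_law ?l M inc) (path_algebra ?l) (translate (- real n)) = unif_law ?l M inc"
        by (rule C.translate_inv)
      finally show ?thesis .
    qed
    have pt: "\<forall>t. (\<lambda>n. circ ?l (?F n f t)) \<longlonglongrightarrow> circ ?l (fold_path H m f t)"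
      if f: "f \<in> circle_paths ?L" and w: "wild (unit_lift H m f)" for f
    proof
      fix t
      obtain v where v: "v \<le> t" "unit_lift H m f v \<in> \<int>"
        using wild_vertices(1)[OF continuous_unit_lift[OF H m f] w] by blast
      have vz: "Im (circ ?l (f v)) = 0"
        using v(2) vertex_iff[of H f v "unit_lift H m f", OF H lift_reduced[OF H m f]] by simp
      obtain N :: nat where N: "- v < real N" using reals_Archimedean2 by blast
      have "?F n f t = fold_path H m f t" if "n \<ge> N" for n
      proof -
        have vn: "0 \<le> v + real n" using N that by simp
        have "\<not> quiet H (translate (real n) f) 0 (t + real n)"
        proof
          assume "quiet H (translate (real n) f) 0 (t + real n)"
          moreover have "v + real n \<in> {min 0 (t + real n)..max 0 (t + real n)}" using vn v(1) by simp
          ultimately have "Im (circ ?l (translate (real n) f (v + real n))) \<noteq> 0" unfolding quiet_def by blast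
          then show False using vz by (simp add: translate_def)
        qed
        moreover have "0 \<le> t + real n" using vn v(1) by simp
        moreover have "flipped m (unit_lift H m (translate (real n) f)) (t + real n) = flipped m (unit_lift H m f) t"
          using flipped_translate[OF H m f, of "real n" "t + real n"] by simp
        ultimately show ?thesis
          by (simp add: translate_def[of "- real n"] half_fold_def fold_path_def flip_path_def)
             (simp add: translate_def)
      qed
      then have "eventually (\<lambda>n. ?F n f t = fold_path H m f t) sequentially"
        unfolding eventually_sequentially by blast
      then have "eventually (\<lambda>n. circ ?l (?F n f t) = circ ?l (fold_path H m f t)) sequentially"
        by eventually_elim simp
      then show "(\<lambda>n. circ ?l (?F n f t)) \<longlonglongrightarrow> circ ?l (fold_path H m f t)" by (rule tendsto_eventually)
    qed
    have sp: "space (unif_law ?L M inc) = circle_paths ?L" by (simp add: unif_law_def space_path_algebra)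
    show "AE f in unif_law ?L M inc. \<forall>t. (\<lambda>n. circ ?l (?F n f t)) \<longlonglongrightarrow> circ ?l (fold_path H m f t)"
      by (rule AE_mp[OF AE_wild[OF H m] AE_I2]) (use pt sp in blast)
  qed
qed

end

end

section \<open>The codings are inverse to each other\<close>

lemma unfold_fold_path:
  assumes H: "H > 0" and m: "m > 0" and f: "f \<in> circle_paths (2 * real m * H)"
    and w: "wild (unit_lift H m f)" "wild (unit_lift H 1 (fold_path H m f))"
  shows "unfold_path H m (fold_path H m f) = f"
proof
  fix t
  define g g' where "g = unit_lift H m f" and "g' = unit_lift H 1 (fold_path H m f)"
  note cg = continuous_unit_lift[OF H m f, folded g_def]
  note lg' = path_unit_lift[OF H fold_path_in[OF H m f], folded g'_def]
  have rel: "\<exists>n::int. g' t = (if flipped m g t then - g t else g t) + 2 * of_int n" for t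
  proof -
    let ?y = "if flipped m g t then - g t else g t"
    have "fold_path H m f t = (if flipped m g t then - (H * g t) else H * g t) rmod (2 * H)"
      unfolding fold_path_def g_def
      by (rule flip_path_cong[of f t "H * unit_lift H m f t" H, OF lift_reduced[OF H m f]])
    also have "(if flipped m g t then - (H * g t) else H * g t) = H * ?y" by simp
    finally have "[H * ?y = H * g' t] (rmod (2 * H))" unfolding rcong_def lg'(3) by (rule sym)
    then have "[?y = g' t] (rmod 2)" by (simp only: rcong_scale[OF H])
    then obtain n :: int where "g' t = ?y + of_int n * 2" unfolding rcong_altdef by blast
    then show ?thesis by (intro exI[of _ n]) (simp only: mult.commute)
  qed
  have c: "coupled m g g'" unfolding coupled_def using cg lg'(1) rel by blast
  obtain u v where uv: "u \<le> t" "v \<le> t" "real m \<le> g' u - g' v"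
    using wild_wide[OF w(2)[folded g'_def], of t "real m"] by blast
  have past: "\<exists>x\<le>T. g x \<in> \<int>" for T by (rule wild_vertices(1)[OF cg w(1)[folded g_def]])
  obtain n :: int where n: "decode m g' t = g t + real_of_int n * (2 * real m)"
    using decode_coupled[OF c past m uv] by blast
  have "[H * g t = H * decode m g' t] (rmod (2 * real m * H))"
    unfolding rcong_altdef n by (intro exI[of _ n]) (simp add: algebra_simps)
  then have "(H * decode m g' t) rmod (2 * real m * H) = (H * g t) rmod (2 * real m * H)"
    unfolding rcong_def by (rule sym)
  also have "\<dots> = f t" unfolding g_def by (rule unit_lift_rmod[OF H m f])
  finally show "unfold_path H m (fold_path H m f) t = f t" unfolding unfold_path_def g'_def .
qed

lemma measurable_unif_law: "measurable (unif_law L M V) N = measurable (path_algebra L) N"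
  by (rule measurable_cong_sets) simp_all

lemma space_unif_law: "space (unif_law L M V) = circle_paths L"
  by (simp add: unif_law_def space_path_algebra)

context two_sided_brownian_motion
begin

context
  fixes H :: real and m :: nat
  assumes H: "H > 0" and m: "m > 0"
begin

lemma AE_wild_short: "AE f in unif_law (2 * H) M inc. wild (unit_lift H 1 f)"
proof -
  have "(1::nat) > 0" "2 * real 1 * H = 2 * H" by simp_all
  then show ?thesis using AE_wild[OF H, of 1] by metis
qed

lemma AE_unfold_fold:
  "AE f in unif_law (2 * real m * H) M inc. unfold_path H m (fold_path H m f) = f"
proof -
  let ?K = "unif_law (2 * real m * H) M inc"
  have fm: "fold_path H m \<in> ?K \<rightarrow>\<^sub>M path_algebra (2 * H)"
    unfolding measurable_unif_law by (rule measurable_fold_path[OF H m])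
  have "AE X in distr ?K (path_algebra (2 * H)) (fold_path H m). wild (unit_lift H 1 X)"
    unfolding law_fold_path[OF H m] by (rule AE_wild_short)
  then have "AE f in ?K. wild (unit_lift H 1 (fold_path H m f))" by (rule AE_distrD[OF fm])
  moreover have "AE f in ?K. f \<in> circle_paths (2 * real m * H)" by (rule AE_I2) (simp add: space_unif_law)
  moreover note AE_wild[OF H m]
  ultimately show ?thesis
  proof eventually_elim
    case (elim f)
    then show ?case by (intro unfold_fold_path[OF H m]) 
  qed
qed

text \<open>
  The law of the folded path is known and unfolding inverts folding, so nothing about the
  law of decoded paths has to be computed.
\<close>

lemma law_unfold_path:
  "distr (unif_law (2 * H) M inc) (path_algebra (2 * real m * H)) (unfold_path H m) =
    unif_law (2 * real m * H) M inc"
proof -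
  let ?K = "unif_law (2 * real m * H) M inc" and ?P = "path_algebra (2 * real m * H)"
  have fm: "fold_path H m \<in> ?K \<rightarrow>\<^sub>M path_algebra (2 * H)"
    unfolding measurable_unif_law by (rule measurable_fold_path[OF H m])
  have "distr (unif_law (2 * H) M inc) ?P (unfold_path H m) =
      distr (distr ?K (path_algebra (2 * H)) (fold_path H m)) ?P (unfold_path H m)"
    unfolding law_fold_path[OF H m] ..
  also have "\<dots> = distr ?K ?P (unfold_path H m \<circ> fold_path H m)"
    by (rule distr_distr[OF measurable_unfold_path[OF H m] fm])
  also have "\<dots> = distr ?K ?P (\<lambda>f. f)"
  proof (rule distr_cong_AE)
    show "AE f in ?K. (unfold_path H m \<circ> fold_path H m) f = f" using AE_unfold_fold by simp
    show "unfold_path H m \<circ> fold_path H m \<in> ?K \<rightarrow>\<^sub>M ?P"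
      by (rule measurable_comp[OF fm measurable_unfold_path[OF H m]])
    show "(\<lambda>f. f) \<in> ?K \<rightarrow>\<^sub>M ?P" unfolding measurable_unif_law by simp
  qed simp_all
  also have "\<dots> = ?K" by (rule distr_id2) simp
  finally show ?thesis .
qed

text \<open>
  Almost every path of the short circle is a folded path.
\<close>

lemma AE_fold_unfold:
  "AE f in unif_law (2 * H) M inc. fold_path H m (unfold_path H m f) = f"
proof -
  let ?K = "unif_law (2 * real m * H) M inc" and ?p = "path_algebra (2 * H)"
  have H2: "2 * H > 0" using H by simp
  have fm: "fold_path H m \<in> ?K \<rightarrow>\<^sub>M ?p"
    unfolding measurable_unif_law by (rule measurable_fold_path[OF H m])
  have "(\<lambda>f. fold_path H m (unfold_path H m f)) \<in> ?p \<rightarrow>\<^sub>M ?p"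
    by (rule measurable_compose[OF measurable_unfold_path[OF H m] measurable_fold_path[OF H m]])
  from sets_path_eq[OF H2 this measurable_ident]
  have S: "{x \<in> space ?p. fold_path H m (unfold_path H m x) = x} \<in> sets ?p" by simp
  have "AE f in ?K. fold_path H m (unfold_path H m (fold_path H m f)) = fold_path H m f"
    using AE_unfold_fold by eventually_elim simp
  then have "AE f in distr ?K ?p (fold_path H m). fold_path H m (unfold_path H m f) = f"
    by (subst AE_distr_iff[OF fm S])
  then show ?thesis unfolding law_fold_path[OF H m] .
qed

end

end

section \<open>Finitary factors from windows\<close>

text \<open>
  \<open>C N\<close> is a set of paths whose restriction to \<open>(- N, N)\<close> determines the image on the unit interval.
\<close>

definition window_code ::
  "(real \<Rightarrow> real) measure \<Rightarrow> ((real \<Rightarrow> real) \<Rightarrow> real \<Rightarrow> real) \<Rightarrow> (nat \<Rightarrow> (real \<Rightarrow> real) set) \<Rightarrow> bool" where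
  "window_code \<kappa> \<phi> C \<longleftrightarrow> (\<forall>N. C N \<in> sets \<kappa>) \<and> (AE f in \<kappa>. \<exists>N. f \<in> C N) \<and>
     (\<forall>N. \<forall>f\<in>C N. \<forall>f'\<in>space \<kappa>. (\<forall>t\<in>{- real N<..<real N}. f t = f' t) \<longrightarrow>
       (\<forall>t\<in>{0..1}. \<phi> f t = \<phi> f' t))"

lemma window_codeD:
  assumes "window_code \<kappa> \<phi> C"
  shows "C N \<in> sets \<kappa>" "AE f in \<kappa>. \<exists>N. f \<in> C N"
    "\<lbrakk>f \<in> C N; f' \<in> space \<kappa>; \<And>t. - real N < t \<Longrightarrow> t < real N \<Longrightarrow> f t = f' t; 0 \<le> t; t \<le> 1\<rbrakk> \<Longrightarrow> \<phi> f t = \<phi> f' t"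
  using assms unfolding window_code_def by auto

lemma finitary_factorI:
  assumes fac: "flow_factor \<kappa> translate \<kappa>' translate \<phi>" and C: "window_code \<kappa> \<phi> C"
  shows "finitary_factor \<kappa> \<kappa>' \<phi>"
  unfolding finitary_factor_def
proof (intro conjI exI ballI impI fac)
  define w where "w f = (if \<exists>N. f \<in> C N then enat (LEAST N. f \<in> C N) else \<infinity>)" for f
  have [measurable]: "Measurable.pred \<kappa> (\<lambda>f. f \<in> C N)" for N
    using window_codeD(1)[OF C, of N] by measurable
  have L: "(\<lambda>f. LEAST N. f \<in> C N) \<in> \<kappa> \<rightarrow>\<^sub>M count_space UNIV" by measurable
  have "(\<lambda>f. enat (LEAST N. f \<in> C N)) \<in> \<kappa> \<rightarrow>\<^sub>M count_space UNIV"
    by (rule measurable_compose[OF L]) simp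
  moreover have "Measurable.pred \<kappa> (\<lambda>f. \<exists>N. f \<in> C N)" by measurable
  ultimately show "w \<in> \<kappa> \<rightarrow>\<^sub>M count_space UNIV"
    unfolding w_def[abs_def] by (intro measurable_If) (auto simp: pred_def)
  show "AE f in \<kappa>. w f \<noteq> \<infinity>"
    using window_codeD(2)[OF C] by eventually_elim (simp add: w_def)
  fix f f' and t :: real
  assume f': "f' \<in> space \<kappa>" and eq: "\<forall>t. ereal \<bar>t\<bar> < ereal_of_enat (w f) \<longrightarrow> f t = f' t"
    and t: "t \<in> {0<..<1}"
  show "\<phi> f t = \<phi> f' t"
  proof (cases "\<exists>N. f \<in> C N")
    case True
    let ?N = "LEAST N. f \<in> C N"
    have "f \<in> C ?N" using True by (rule LeastI_ex)
    moreover have "f s = f' s" if "- real ?N < s" "s < real ?N" for s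
      using eq[rule_format, of s] that True by (simp add: w_def abs_less_iff)
    ultimately show ?thesis using f' t by (intro window_codeD(3)[OF C]) auto
  next
    case False
    then have "f = f'" using eq by (simp add: w_def fun_eq_iff)
    then show ?thesis by simp
  qed
qed

text \<open>
  To know the second image on the unit interval, the first image must be known on a window of random
  length \<open>n\<close>, that is on \<open>2 n\<close> unit intervals; stationarity gives a finite window for each of them.
\<close>

lemma window_code_comp:
  assumes C: "window_code \<kappa> \<phi> C" and D: "window_code \<kappa>' \<psi> D"
    and \<phi>: "\<phi> \<in> \<kappa> \<rightarrow>\<^sub>M \<kappa>'" and law: "distr \<kappa> \<kappa>' \<phi> = \<kappa>'"
    and tm: "\<And>s. translate s \<in> \<kappa> \<rightarrow>\<^sub>M \<kappa>" and tl: "\<And>s. distr \<kappa> \<kappa> (translate s) = \<kappa>"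
    and equi: "\<And>s f. f \<in> space \<kappa> \<Longrightarrow> \<phi> (translate s f) = translate s (\<phi> f)"
  shows "window_code \<kappa> (\<lambda>f. \<psi> (\<phi> f)) (\<lambda>N. {f \<in> space \<kappa>. \<exists>n\<le>N. \<phi> f \<in> D n \<and>
    (\<forall>k::int. - int n \<le> k \<and> k < int n \<longrightarrow> (\<exists>j. j + nat \<bar>k\<bar> \<le> N \<and> translate (- of_int k) f \<in> C j))})"
  (is "window_code _ _ ?E")
  unfolding window_code_def
proof (intro conjI allI ballI impI)
  have [measurable]: "Measurable.pred \<kappa> (\<lambda>f. \<phi> f \<in> D n)" for n
    using measurable_sets[OF \<phi> window_codeD(1)[OF D, of n]] by (simp add: pred_def vimage_def Int_def conj_commute)
  have [measurable]: "Measurable.pred \<kappa> (\<lambda>f. translate s f \<in> C j)" for s j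
    using measurable_sets[OF tm window_codeD(1)[OF C, of j]] by (simp add: pred_def vimage_def Int_def conj_commute)
  show "?E N \<in> sets \<kappa>" for N by measurable
  have 1: "AE f in \<kappa>. \<exists>n. \<phi> f \<in> D n"
    by (rule AE_distrD[OF \<phi>]) (simp only: law window_codeD(2)[OF D])
  have 2: "AE f in \<kappa>. \<forall>k::int. \<exists>j. translate (- of_int k) f \<in> C j"
    unfolding AE_all_countable
  proof
    fix k :: int
    show "AE f in \<kappa>. \<exists>j. translate (- of_int k) f \<in> C j"
      by (rule AE_distrD[OF tm]) (simp only: tl window_codeD(2)[OF C])
  qed
  have "AE f in \<kappa>. f \<in> space \<kappa>" by (rule AE_I2)
  with 1 2 show "AE f in \<kappa>. \<exists>N. f \<in> ?E N"
  proof eventually_elim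
    case (elim f)
    obtain n where n: "\<phi> f \<in> D n" using elim(1) by blast
    obtain j where j: "\<And>k::int. translate (- of_int k) f \<in> C (j k)" using elim(2) by metis
    \<comment> \<open>a bound for the windows of the \<open>2 * n\<close> unit intervals, moved back to the origin\<close>
    define N where "N = n + (\<Sum>k\<in>{- int n..<int n}. j k + nat \<bar>k\<bar>)"
    have "j k + nat \<bar>k\<bar> \<le> N" if "- int n \<le> k" "k < int n" for k
    proof -
      have "j k + nat \<bar>k\<bar> \<le> (\<Sum>k\<in>{- int n..<int n}. j k + nat \<bar>k\<bar>)"
        using that by (intro member_le_sum[of k _ "\<lambda>k. j k + nat \<bar>k\<bar>"]) auto
      then show ?thesis by (simp add: N_def)
    qed
    moreover have "n \<le> N" by (simp add: N_def)
    ultimately have "f \<in> ?E N" using elim(3) n j by blast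
    then show ?case by blast
  qed
  fix N f f' and t :: real
  assume f: "f \<in> ?E N" and f': "f' \<in> space \<kappa>" and eq: "\<forall>t\<in>{- real N<..<real N}. f t = f' t"
    and t: "t \<in> {0..1}"
  obtain n where n: "n \<le> N" "\<phi> f \<in> D n"
    and j: "\<And>k::int. - int n \<le> k \<Longrightarrow> k < int n \<Longrightarrow> \<exists>j. j + nat \<bar>k\<bar> \<le> N \<and> translate (- of_int k) f \<in> C j"
    using f by blast
  have sf: "f \<in> space \<kappa>" using f by blast
  have "\<phi> f s = \<phi> f' s" if s: "- real n < s" "s < real n" for s
  proof -
    let ?k = "\<lfloor>s\<rfloor>"
    have "- int n \<le> ?k" "?k < int n" using s by linarith+
    from j[OF this] obtain i where i: "i + nat \<bar>?k\<bar> \<le> N" "translate (- of_int ?k) f \<in> C i" by blast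
    have "translate (- of_int ?k) f u = translate (- of_int ?k) f' u" if "- real i < u" "u < real i" for u
    proof -
      have "real i + \<bar>of_int ?k\<bar> \<le> real N"
        using i(1) by (metis of_int_abs of_nat_add of_nat_le_iff of_nat_nat abs_ge_zero)
      then have "- real N < u + of_int ?k" "u + of_int ?k < real N" using that by linarith+
      then have "u + of_int ?k \<in> {- real N<..<real N}" by simp
      then show ?thesis using eq by (simp add: translate_def)
    qed
    then have "\<phi> (translate (- of_int ?k) f) (s - of_int ?k) = \<phi> (translate (- of_int ?k) f') (s - of_int ?k)"
      using measurable_space[OF tm f'] by (intro window_codeD(3)[OF C i(2)]) (auto, linarith+)
    then show ?thesis unfolding equi[OF sf] equi[OF f'] by (simp add: translate_def)
  qed
  then show "\<psi> (\<phi> f) t = \<psi> (\<phi> f') t"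
    using measurable_space[OF \<phi> f'] t by (intro window_codeD(3)[OF D n(2)]) auto
qed

context two_sided_brownian_motion
begin

context
  fixes H :: real
  assumes H: "H > 0"
begin

lemma window_code_fold:
  assumes m: "m > 0"
  shows "window_code (unif_law (2 * real m * H) M inc) (fold_path H m)
    (\<lambda>N. {f \<in> circle_paths (2 * real m * H). vertex_window N (unit_lift H m f)})"
  unfolding window_code_def
proof (intro conjI allI ballI impI)
  let ?P = "path_algebra (2 * real m * H)"
  show "{f \<in> circle_paths (2 * real m * H). vertex_window N (unit_lift H m f)} \<in> sets (unif_law (2 * real m * H) M inc)" for N
    using measurable_vertex_window[OF continuous_process_unit_lift[OF H m]]
    by (simp add: pred_def space_path_algebra)
  have "AE f in unif_law (2 * real m * H) M inc. f \<in> circle_paths (2 * real m * H)"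
    by (rule AE_I2) (simp add: space_unif_law)
  with AE_wild[OF H m]
  show "AE f in unif_law (2 * real m * H) M inc. \<exists>N. f \<in> {f \<in> circle_paths (2 * real m * H). vertex_window N (unit_lift H m f)}"
  proof eventually_elim
    case (elim f)
    show ?case using wild_windows[OF continuous_unit_lift[OF H m elim(2)] elim(1), of m] elim(2) by blast
  qed
next
  fix N f f' and t :: real
  assume "f \<in> {f \<in> circle_paths (2 * real m * H). vertex_window N (unit_lift H m f)}"
    "f' \<in> space (unif_law (2 * real m * H) M inc)" "\<forall>t\<in>{- real N<..<real N}. f t = f' t" "t \<in> {0..1}"
  then show "fold_path H m f t = fold_path H m f' t"
    by (intro fold_path_window[OF H m]) (auto simp: space_unif_law)
qed

lemma window_code_unfold:
  assumes m: "m > 0"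
  shows "window_code (unif_law (2 * H) M inc) (unfold_path H m)
    (\<lambda>N. {f \<in> circle_paths (2 * H). vertex_window N (unit_lift H 1 f) \<and> wide_window m N (unit_lift H 1 f)})"
  unfolding window_code_def
proof (intro conjI allI ballI impI)
  have "Measurable.pred (path_algebra (2 * H)) (\<lambda>f. vertex_window N (unit_lift H 1 f) \<and> wide_window m N (unit_lift H 1 f))" for N
    using measurable_vertex_window[OF continuous_process_path[OF H]] measurable_wide_window[OF continuous_process_path[OF H]]
    by (intro pred_intros_logic)
  then show "{f \<in> circle_paths (2 * H). vertex_window N (unit_lift H 1 f) \<and> wide_window m N (unit_lift H 1 f)} \<in>
      sets (unif_law (2 * H) M inc)" for N
    unfolding pred_def space_path_algebra sets_unif_law .
  have "AE f in unif_law (2 * H) M inc. f \<in> circle_paths (2 * H)"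
    by (rule AE_I2) (simp add: space_unif_law)
  with AE_wild_short[OF H m]
  show "AE f in unif_law (2 * H) M inc. \<exists>N. f \<in> {f \<in> circle_paths (2 * H).
      vertex_window N (unit_lift H 1 f) \<and> wide_window m N (unit_lift H 1 f)}"
  proof eventually_elim
    case (elim f)
    show ?case using wild_windows[OF path_unit_lift(1)[OF H elim(2)] elim(1), of m] elim(2) by blast
  qed
next
  fix N f f' and t :: real
  assume f: "f \<in> {f \<in> circle_paths (2 * H). vertex_window N (unit_lift H 1 f) \<and> wide_window m N (unit_lift H 1 f)}"
    and f': "f' \<in> space (unif_law (2 * H) M inc)" and eq: "\<forall>t\<in>{- real N<..<real N}. f t = f' t" and t: "t \<in> {0..1}"
  show "unfold_path H m f t = unfold_path H m f' t"
  proof (rule unfold_path_window[OF H m])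
    show "f' \<in> circle_paths (2 * H)" using f' by (simp add: space_unif_law)
  qed (use f eq t in blast)+
qed

text \<open>Through the short circle, every long circle is coded into every other one.\<close>

definition recode :: "nat \<Rightarrow> nat \<Rightarrow> (real \<Rightarrow> real) \<Rightarrow> real \<Rightarrow> real" where
  "recode a b f = unfold_path H b (fold_path H a f)"

lemma recode_factor:
  assumes a: "a > 0" and b: "b > 0"
  defines "\<kappa> \<equiv> unif_law (2 * real a * H) M inc" and "\<kappa>' \<equiv> unif_law (2 * real b * H) M inc"
  shows "flow_factor \<kappa> translate \<kappa>' translate (recode a b)"
  unfolding flow_factor_def
proof (intro conjI)
  let ?P = "path_algebra (2 * real a * H)" and ?P' = "path_algebra (2 * real b * H)" and ?p = "path_algebra (2 * H)"
  have m: "recode a b \<in> ?P \<rightarrow>\<^sub>M ?P'"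
    unfolding recode_def[abs_def] by (rule measurable_compose[OF measurable_fold_path[OF H a] measurable_unfold_path[OF H b]])
  then show "recode a b \<in> \<kappa> \<rightarrow>\<^sub>M \<kappa>'"
    by (subst measurable_cong_sets[of \<kappa> ?P \<kappa>' ?P']) (simp_all add: \<kappa>_def \<kappa>'_def)
  show "AE x in \<kappa>. \<forall>s. recode a b (translate s x) = translate s (recode a b x)"
  proof (intro AE_I2 allI)
    fix x s assume "x \<in> space \<kappa>"
    then have x: "x \<in> circle_paths (2 * real a * H)" by (simp add: \<kappa>_def space_unif_law)
    show "recode a b (translate s x) = translate s (recode a b x)"
      unfolding recode_def fold_path_translate[OF H a x] by (rule unfold_path_translate[OF H b fold_path_in[OF H a x]])
  qed
  have fm: "fold_path H a \<in> \<kappa> \<rightarrow>\<^sub>M ?p"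
    unfolding \<kappa>_def measurable_unif_law by (rule measurable_fold_path[OF H a])
  have "distr \<kappa> \<kappa>' (recode a b) = distr \<kappa> ?P' (unfold_path H b \<circ> fold_path H a)"
    by (rule distr_cong) (simp_all add: \<kappa>'_def recode_def)
  also have "\<dots> = distr (distr \<kappa> ?p (fold_path H a)) ?P' (unfold_path H b)"
    by (rule distr_distr[OF measurable_unfold_path[OF H b] fm, symmetric])
  also have "\<dots> = \<kappa>'" unfolding \<kappa>_def \<kappa>'_def law_fold_path[OF H a] by (rule law_unfold_path[OF H b])
  finally show "distr \<kappa> \<kappa>' (recode a b) = \<kappa>'" .
qed

lemma recode_finitary:
  assumes a: "a > 0" and b: "b > 0"
  shows "finitary_factor (unif_law (2 * real a * H) M inc) (unif_law (2 * real b * H) M inc) (recode a b)"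
proof -
  let ?K = "unif_law (2 * real a * H) M inc" and ?k = "unif_law (2 * H) M inc"
  have L: "2 * real a * H > 0" using H a by simp
  have e: "measurable ?K ?k = measurable (path_algebra (2 * real a * H)) (path_algebra (2 * H))"
    "measurable ?K ?K = measurable (path_algebra (2 * real a * H)) (path_algebra (2 * real a * H))"
    by (rule measurable_cong_sets; simp)+
  have d: "distr ?K ?k f = distr ?K (path_algebra (2 * H)) f"
    "distr ?K ?K f = distr ?K (path_algebra (2 * real a * H)) f" for f
    by (rule distr_cong; simp)+
  show ?thesis
    unfolding recode_def[abs_def]
  proof (rule finitary_factorI[OF recode_factor[OF a b, unfolded recode_def[abs_def]]
        window_code_comp[OF window_code_fold[OF a] window_code_unfold[OF b]]])
    show "fold_path H a \<in> ?K \<rightarrow>\<^sub>M ?k" unfolding e by (rule measurable_fold_path[OF H a])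
    show "distr ?K ?k (fold_path H a) = ?k" unfolding d by (rule law_fold_path[OF H a])
    show "translate s \<in> ?K \<rightarrow>\<^sub>M ?K" for s unfolding e by (rule measurable_translate)
    show "distr ?K ?K (translate s) = ?K" for s
      unfolding d by (rule unif_law_translate[OF L two_sided_brownian_motion_axioms])
    show "fold_path H a (translate s f) = translate s (fold_path H a f)" if "f \<in> space ?K" for s f
      using that by (intro fold_path_translate[OF H a]) (simp add: space_unif_law)
  qed
qed

lemma AE_recode_recode:
  assumes a: "a > 0" and b: "b > 0"
  shows "AE f in unif_law (2 * real a * H) M inc. recode b a (recode a b f) = f"
proof -
  let ?K = "unif_law (2 * real a * H) M inc"
  have fm: "fold_path H a \<in> ?K \<rightarrow>\<^sub>M path_algebra (2 * H)"
    unfolding measurable_unif_law by (rule measurable_fold_path[OF H a])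
  have "AE X in distr ?K (path_algebra (2 * H)) (fold_path H a). fold_path H b (unfold_path H b X) = X"
    unfolding law_fold_path[OF H a] by (rule AE_fold_unfold[OF H b])
  then have "AE f in ?K. fold_path H b (unfold_path H b (fold_path H a f)) = fold_path H a f"
    by (rule AE_distrD[OF fm])
  with AE_unfold_fold[OF H a] show ?thesis
    by eventually_elim (simp add: recode_def)
qed

end

end

lemma positive_rat_quotient:
  fixes q :: rat
  assumes "q > 0"
  obtains a b :: nat where "a > 0" "b > 0" "(of_rat q :: real) = real a / real b"
proof -
  obtain n d where nd: "quotient_of q = (n, d)" by (cases "quotient_of q")
  have d: "d > 0" using quotient_of_denom_pos[OF nd] .
  have q: "q = of_int n / of_int d" using quotient_of_div[OF nd] .
  then have n: "n > 0" using assms d by (simp add: zero_less_divide_iff)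
  have "(of_rat q :: real) = of_int n / of_int d" by (simp add: q of_rat_divide)
  then show ?thesis using n d by (intro that[of "nat n" "nat d"]) simp_all
qed

section \<open>The isomorphism\<close>

text \<open>
  Clearing the denominator of \<open>q = a / b\<close> makes both lengths even multiples of \<open>H = h / (2 * b)\<close>.
\<close>

theorem theorem3:
  fixes h :: real and q :: rat
    and M :: "'a measure" and Z :: "real \<Rightarrow> 'a \<Rightarrow> real"
    and M' :: "'b measure" and Z' :: "real \<Rightarrow> 'b \<Rightarrow> real"
  assumes "h > 0" and "q > 0"
    and "periodic_brownian_motion M (of_rat q * h) Z" and "stationary M (of_rat q * h) Z"
    and "periodic_brownian_motion M' h Z'" and "stationary M' h Z'"
  shows "\<exists>\<phi> \<psi>.
    flow_isomorphism (path_law M (of_rat q * h) Z) translate (path_law M' h Z') translate \<phi> \<and>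
    ae_inverse (path_law M (of_rat q * h) Z) (path_law M' h Z') \<phi> \<psi> \<and>
    finitary_factor (path_law M (of_rat q * h) Z) (path_law M' h Z') \<phi> \<and>
    finitary_factor (path_law M' h Z') (path_law M (of_rat q * h) Z) \<psi>"
proof -
  obtain a b where a: "a > 0" and b: "b > 0" and q: "(of_rat q :: real) = real a / real b"
    using positive_rat_quotient[OF assms(2)] .
  define H where "H = h / (2 * real b)"
  have H: "H > 0" using assms(1) b by (simp add: H_def)
  have La: "of_rat q * h = 2 * real a * H" and Lb: "h = 2 * real b * H"
    using b by (simp_all add: q H_def)
  have L: "2 * real a * H > 0" "2 * real b * H > 0" using a b H by simp_all
  obtain W where W: "two_sided_brownian_motion M W" and Z: "\<And>t \<omega>. \<omega> \<in> space M \<Longrightarrow> Z t \<omega> = W t \<omega> rmod (of_rat q * h)"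
    using assms(3) by (auto simp: periodic_brownian_motion_def)
  obtain W' where W': "two_sided_brownian_motion M' W'" and Z': "\<And>t \<omega>. \<omega> \<in> space M' \<Longrightarrow> Z' t \<omega> = W' t \<omega> rmod h"
    using assms(5) by (auto simp: periodic_brownian_motion_def)
  interpret B: two_sided_brownian_motion M W by (rule W)
  interpret B': two_sided_brownian_motion M' W' by (rule W')
  let ?K = "unif_law (2 * real a * H) M B.inc" and ?K' = "unif_law (2 * real b * H) M B.inc"
  have K: "path_law M (of_rat q * h) Z = ?K"
    using B.stationary_path_law[of "of_rat q * h" Z] Z assms(4) L(1) unfolding La by blast
  have "path_law M' h Z' = unif_law h M' B'.inc"
    by (rule B'.stationary_path_law[OF assms(1) Z' assms(6)])
  also have "\<dots> = unif_law h M B.inc"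
    by (rule unif_law_unique[OF assms(1) B'.wiener_inc B.wiener_inc])
  finally have K': "path_law M' h Z' = ?K'" unfolding Lb[symmetric] .
  let ?\<phi> = "B.recode H a b" and ?\<psi> = "B.recode H b a"
  have inv: "AE x in ?K. ?\<psi> (?\<phi> x) = x" "AE y in ?K'. ?\<phi> (?\<psi> y) = y"
    using B.AE_recode_recode[OF H a b] B.AE_recode_recode[OF H b a] .
  have fac: "flow_factor ?K translate ?K' translate ?\<phi>" "flow_factor ?K' translate ?K translate ?\<psi>"
    using B.recode_factor[OF H a b] B.recode_factor[OF H b a] .
  have "flow_isomorphism ?K translate ?K' translate ?\<phi>"
    unfolding flow_isomorphism_def
  proof (intro conjI fac(1) bexI)
    let ?X = "{x \<in> space ?K. ?\<psi> (?\<phi> x) = x}"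
    have "AE x in ?K. x \<in> space ?K" by (rule AE_I2)
    with inv(1) show "AE x in ?K. x \<in> ?X" by eventually_elim simp
    show "inj_on ?\<phi> ?X" by (rule inj_on_inverseI[where g = ?\<psi>]) simp
    have "(\<lambda>x. ?\<psi> (?\<phi> x)) \<in> ?K \<rightarrow>\<^sub>M ?K"
      using fac by (intro measurable_compose[of ?\<phi> ?K ?K' ?\<psi> ?K]) (simp_all add: flow_factor_def)
    then have m: "(\<lambda>x. ?\<psi> (?\<phi> x)) \<in> ?K \<rightarrow>\<^sub>M path_algebra (2 * real a * H)"
      by (simp cong: measurable_cong_sets)
    have i: "(\<lambda>x. x) \<in> ?K \<rightarrow>\<^sub>M path_algebra (2 * real a * H)" unfolding measurable_unif_law by simp
    show "?X \<in> sets ?K" by (rule sets_path_eq[OF L(1) m i])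
  qed
  moreover have "ae_inverse ?K ?K' ?\<phi> ?\<psi>" unfolding ae_inverse_def using inv by blast
  moreover have "finitary_factor ?K ?K' ?\<phi>" "finitary_factor ?K' ?K ?\<psi>"
    using B.recode_finitary[OF H a b] B.recode_finitary[OF H b a] .
  ultimately show ?thesis unfolding K K' by blast
qed

end
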